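(* The Petersen graph is orientably realizable.
   Context: A surface is a complete, compact, connected 2-dimensional Riemannian manifold without boundary. The cut locus $C(x)$ of a point $x$ in a surface is the set of all extremities (different from $x$) of maximal (with respect to inclusion) shortest paths starting at $x$. A graph is orientably realizable if there exists at least one orientable surface $S$ and a point $x\in S$ whose cut locus $C(x)$ is (isometric to) the graph. *)

theory Defs
  imports "HOL-Analysis.Analysis"
begin

section \<open>Smooth maps between Euclidean spaces\<close>

primrec Ck_on :: "nat \<Rightarrow> 'a::real_normed_vector set \<Rightarrow> ('a \<Rightarrow> 'b::real_normed_vector) \<Rightarrow> bool" where
  "Ck_on 0 U f \<longleftrightarrow> continuous_on U f"
| "Ck_on (Suc k) U f \<longleftrightarrow>
     (\<forall>x\<in>U. f differentiable at x) \<and> (\<forall>v. Ck_on k U (\<lambda>x. frechet_derivative f (at x) v))"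

text \<open>This is meant for open \<open>U\<close>; all uses below are of that form.\<close>
definition smooth_on :: "'a::real_normed_vector set \<Rightarrow> ('a \<Rightarrow> 'b::real_normed_vector) \<Rightarrow> bool" where
  "smooth_on U f \<longleftrightarrow> (\<forall>k. Ck_on k U f)"


section \<open>Smooth surfaces\<close>

text \<open>A chart is a pair of its domain and its coordinate map.\<close>
type_synonym 'p chart = "'p set \<times> ('p \<Rightarrow> real^2)"

text \<open>Since charts map onto open subsets of the whole plane, there is no boundary.\<close>
definition is_chart :: "'p topology \<Rightarrow> 'p chart \<Rightarrow> bool" where
  "is_chart X c \<longleftrightarrow> (case c of (U, \<phi>) \<Rightarrow>
     openin X U \<and> open (\<phi> ` U) \<and>
     homeomorphic_map (subtopology X U) (subtopology euclidean (\<phi> ` U)) \<phi>)"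

definition transition :: "'p chart \<Rightarrow> 'p chart \<Rightarrow> real^2 \<Rightarrow> real^2" where
  "transition c d = snd d \<circ> inv_into (fst c) (snd c)"

definition smooth_atlas :: "'p topology \<Rightarrow> 'p chart set \<Rightarrow> bool" where
  "smooth_atlas X A \<longleftrightarrow>
     (\<forall>c\<in>A. is_chart X c) \<and>
     (\<Union>c\<in>A. fst c) = topspace X \<and>
     (\<forall>c\<in>A. \<forall>d\<in>A. smooth_on (snd c ` (fst c \<inter> fst d)) (transition c d))"

definition oriented_atlas :: "'p chart set \<Rightarrow> bool" where
  "oriented_atlas A \<longleftrightarrow>
     (\<forall>c\<in>A. \<forall>d\<in>A. \<forall>p \<in> fst c \<inter> fst d.
        det (matrix (frechet_derivative (transition c d) (at (snd c p)))) > 0)"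

text \<open>The charts of the oriented atlas need not belong to the given atlas \<open>A\<close>, but
  they have to define the same smooth structure.\<close>
definition orientable_atlas :: "'p topology \<Rightarrow> 'p chart set \<Rightarrow> bool" where
  "orientable_atlas X A \<longleftrightarrow>
     (\<exists>B. smooth_atlas X B \<and> smooth_atlas X (A \<union> B) \<and> oriented_atlas B)"


section \<open>Length of curves in a metric space\<close>

text \<open>The total variation of a curve parametrised by the unit interval.\<close>
definition curve_length :: "('a \<Rightarrow> 'a \<Rightarrow> real) \<Rightarrow> (real \<Rightarrow> 'a) \<Rightarrow> ereal" where
  "curve_length d \<gamma> =
     (SUP ts \<in> {ts. sorted ts \<and> set ts \<subseteq> {0..1}}.
        ereal (\<Sum>i < length ts - 1. d (\<gamma> (ts ! i)) (\<gamma> (ts ! Suc i))))"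

definition shortest_path :: "'a set \<Rightarrow> ('a \<Rightarrow> 'a \<Rightarrow> real) \<Rightarrow> (real \<Rightarrow> 'a) \<Rightarrow> bool" where
  "shortest_path M d \<gamma> \<longleftrightarrow>
     pathin (Metric_space.mtopology M d) \<gamma> \<and> curve_length d \<gamma> = ereal (d (\<gamma> 0) (\<gamma> 1))"

definition cut_locus :: "'a set \<Rightarrow> ('a \<Rightarrow> 'a \<Rightarrow> real) \<Rightarrow> 'a \<Rightarrow> 'a set" where
  "cut_locus M d x =
     {y. y \<noteq> x \<and>
         (\<exists>\<gamma>. shortest_path M d \<gamma> \<and> \<gamma> 0 = x \<and> \<gamma> 1 = y \<and>
              \<not> (\<exists>\<delta>. shortest_path M d \<delta> \<and> \<delta> 0 = x \<and> \<gamma> ` {0..1} \<subset> \<delta> ` {0..1}))}"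

text \<open>The distance between points of \<open>A\<close> measured along curves inside \<open>A\<close>
  (infinite if there is no such curve of finite length).\<close>
definition intrinsic_dist :: "'a set \<Rightarrow> ('a \<Rightarrow> 'a \<Rightarrow> real) \<Rightarrow> 'a \<Rightarrow> 'a \<Rightarrow> ereal" where
  "intrinsic_dist A d p q =
     (INF \<gamma> \<in> {\<gamma>. pathin (Metric_space.mtopology A d) \<gamma> \<and> \<gamma> 0 = p \<and> \<gamma> 1 = q}. curve_length d \<gamma>)"

definition isometric :: "'a set \<Rightarrow> ('a \<Rightarrow> 'a \<Rightarrow> ereal) \<Rightarrow> 'b set \<Rightarrow> ('b \<Rightarrow> 'b \<Rightarrow> ereal) \<Rightarrow> bool" where
  "isometric A dA B dB \<longleftrightarrow>
     (\<exists>f. bij_betw f A B \<and> (\<forall>p\<in>A. \<forall>q\<in>A. dB (f p) (f q) = dA p q))"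


section \<open>Riemannian surfaces\<close>

text \<open>\<open>metric S c p\<close> is the inner product on the tangent space at \<open>p\<close>, expressed in the
  coordinates of the chart \<open>c\<close> (whose domain contains \<open>p\<close>).\<close>
record 'p riem_surface =
  topo :: "'p topology"
  atlas :: "'p chart set"
  metric :: "'p chart \<Rightarrow> 'p \<Rightarrow> real^2 \<Rightarrow> real^2 \<Rightarrow> real"

definition riemannian_metric ::
  "'p chart set \<Rightarrow> ('p chart \<Rightarrow> 'p \<Rightarrow> real^2 \<Rightarrow> real^2 \<Rightarrow> real) \<Rightarrow> bool" where
  "riemannian_metric A g \<longleftrightarrow>
     (\<forall>c\<in>A. \<forall>p\<in>fst c.
        bilinear (g c p) \<and>
        (\<forall>u v. g c p u v = g c p v u) \<and>
        (\<forall>u. u \<noteq> 0 \<longrightarrow> g c p u u > 0)) \<and>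
     (\<forall>c\<in>A. \<forall>u v. smooth_on (snd c ` fst c) (\<lambda>x. g c (inv_into (fst c) (snd c) x) u v)) \<and>
     (\<forall>c\<in>A. \<forall>d\<in>A. \<forall>p \<in> fst c \<inter> fst d. \<forall>u v.
        g c p u v =
        g d p (frechet_derivative (transition c d) (at (snd c p)) u)
              (frechet_derivative (transition c d) (at (snd c p)) v))"

text \<open>At the endpoints of the interval the derivatives are one-sided.\<close>
definition C1_curve_on :: "'p riem_surface \<Rightarrow> real \<Rightarrow> real \<Rightarrow> (real \<Rightarrow> 'p) \<Rightarrow> bool" where
  "C1_curve_on S a b \<gamma> \<longleftrightarrow>
     continuous_map (subtopology euclideanreal {a..b}) (topo S) \<gamma> \<and>
     (\<forall>(U, \<phi>) \<in> atlas S. \<exists>\<gamma>'.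
        (\<forall>t \<in> {t\<in>{a..b}. \<gamma> t \<in> U}.
           ((\<phi> \<circ> \<gamma>) has_vector_derivative \<gamma>' t) (at t within {a..b})) \<and>
        continuous_on {t\<in>{a..b}. \<gamma> t \<in> U} \<gamma>')"

definition piecewise_C1_curve :: "'p riem_surface \<Rightarrow> (real \<Rightarrow> 'p) \<Rightarrow> bool" where
  "piecewise_C1_curve S \<gamma> \<longleftrightarrow>
     (\<exists>n (t :: nat \<Rightarrow> real). t 0 = 0 \<and> t n = 1 \<and>
        (\<forall>i<n. t i < t (Suc i) \<and> C1_curve_on S (t i) (t (Suc i)) \<gamma>))"

text \<open>By the transformation rule of the metric, the value does not depend on the selected
  chart wherever \<open>\<gamma>\<close> is differentiable, that is, for piecewise continuously differentiable curves at all
  but finitely many parameters in the unit interval.\<close>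
definition speed :: "'p riem_surface \<Rightarrow> (real \<Rightarrow> 'p) \<Rightarrow> real \<Rightarrow> real" where
  "speed S \<gamma> t =
     (let c = (SOME c. c \<in> atlas S \<and> \<gamma> t \<in> fst c);
          v = vector_derivative (snd c \<circ> \<gamma>) (at t)
      in sqrt (metric S c (\<gamma> t) v v))"

definition riem_dist :: "'p riem_surface \<Rightarrow> 'p \<Rightarrow> 'p \<Rightarrow> real" where
  "riem_dist S p q =
     (INF \<gamma> \<in> {\<gamma>. piecewise_C1_curve S \<gamma> \<and> \<gamma> 0 = p \<and> \<gamma> 1 = q}. integral {0..1} (speed S \<gamma>))"

definition surface :: "'p riem_surface \<Rightarrow> bool" where
  "surface S \<longleftrightarrow>
     topspace (topo S) \<noteq> {} \<and>
     Hausdorff_space (topo S) \<and> second_countable (topo S) \<and>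
     smooth_atlas (topo S) (atlas S) \<and>
     riemannian_metric (atlas S) (metric S) \<and>
     compact_space (topo S) \<and> connected_space (topo S) \<and>
     Metric_space.mcomplete (topspace (topo S)) (riem_dist S)"

definition orientable :: "'p riem_surface \<Rightarrow> bool" where
  "orientable S \<longleftrightarrow> orientable_atlas (topo S) (atlas S)"


section \<open>Graphs\<close>

text \<open>The geometric realization of the finite simple graph with vertex set \<open>V\<close> and edge set
  \<open>E\<close> (whose elements are two-element subsets of \<open>V\<close>): points are given by their barycentric
  coordinates.\<close>
definition graph_points :: "'v set \<Rightarrow> 'v set set \<Rightarrow> ('v \<Rightarrow> real) set" where
  "graph_points V E =
     {f. (\<forall>v. f v \<ge> 0) \<and> (\<Sum>v\<in>V. f v) = 1 \<and>
         ((\<exists>v\<in>V. {v. f v \<noteq> 0} = {v}) \<or> (\<exists>e\<in>E. {v. f v \<noteq> 0} \<subseteq> e))}"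

text \<open>With this normalization, two points \<open>(1 - s) u + s v\<close> and \<open>(1 - t) u + t v\<close> of
  an edge \<open>{u, v}\<close> have distance \<open>\<bar>s - t\<bar>\<close>. The induced intrinsic distance is therefore the path metric of
  the graph in which all edges have length 1.\<close>
definition bary_dist :: "'v set \<Rightarrow> ('v \<Rightarrow> real) \<Rightarrow> ('v \<Rightarrow> real) \<Rightarrow> real" where
  "bary_dist V f g = (\<Sum>v\<in>V. \<bar>f v - g v\<bar>) / 2"

definition graph_dist :: "'v set \<Rightarrow> 'v set set \<Rightarrow> ('v \<Rightarrow> real) \<Rightarrow> ('v \<Rightarrow> real) \<Rightarrow> ereal" where
  "graph_dist V E = intrinsic_dist (graph_points V E) (bary_dist V)"

text \<open>Taking the points of the surface from the type \<^typ>\<open>complex\<close> is no restriction: the topology is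
  arbitrary, and every surface has the cardinality of the continuum.\<close>
definition orientably_realizable :: "'v set \<Rightarrow> 'v set set \<Rightarrow> bool" where
  "orientably_realizable V E \<longleftrightarrow>
     (\<exists>S :: complex riem_surface. surface S \<and> orientable S \<and>
        (\<exists>x \<in> topspace (topo S).
           let C = cut_locus (topspace (topo S)) (riem_dist S) x in
           isometric C (intrinsic_dist C (riem_dist S)) (graph_points V E) (graph_dist V E)))"

text \<open>The Petersen graph as the Kneser graph of the two-element subsets of a five-element set.\<close>
definition petersen_vertices :: "nat set set" where
  "petersen_vertices = {a. a \<subseteq> {0..<5} \<and> card a = 2}"

definition petersen_edges :: "nat set set set" where
  "petersen_edges =
     {{a, b} | a b. a \<in> petersen_vertices \<and> b \<in> petersen_vertices \<and> a \<inter> b = {}}"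

end

theory Submission
  imports Defs "HOL-Complex_Analysis.Complex_Analysis"
begin

text \<open>The Petersen graph is cubic, and it has a closed walk of length 30 that runs through each of
  its 15 edges once in each direction and never turns back at a vertex. Take the regular hyperbolic
  polygon with 30 sides and angles of 120 degrees, read the walk along its boundary, and glue the two
  sides that belong to the same edge, against their direction. The walk is chosen such that the three
  corners at a vertex follow each other cyclically under the gluing. Since three angles of 120 degrees
  fill a full turn, every vertex has a neighbourhood isometric to a piece of the hyperbolic disc
  (\<open>glued_compatible\<close>), so the quotient is a hyperbolic surface, and all coordinate changes are
  holomorphic, so it is orientable. Its genus is 3, because 10 - 15 + 1 = -4. The distance is
  scaled such that the sides have length 1, as in the graph.

  The claim is that the cut locus of the centre of the polygon is the image of the boundary of the
  polygon (\<open>cut_locus_of_centre\<close>), which is the Petersen graph as a set. The essential point is that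
  the distance from the centre is the hyperbolic distance within the polygon (\<open>dist_from_centre\<close>).
  The radial segments give an upper bound. For the lower bound no covering space is used: the function
  \<open>centre_dist\<close>, which is the candidate for the distance, has Lipschitz constant 1 infinitesimally,
  hence its increments are bounded by the lengths of curves (\<open>increment_le_length\<close>). The infinitesimal
  bound holds because near a vertex the function is the minimum of the distances from the centres of
  the three copies of the polygon that meet there. These copies are nearest to their own points
  because their sectors are bounded by the bisectors of the three centres (\<open>star_centre_nearest\<close>).

  Inside the polygon every shortest path from the centre is a proper part of a longer one: it can be
  prolonged along the radius. At a boundary point, two copies of the polygon meet and the distances
  from their centres agree. A longer shortest path would realize both distances, and
  hyperbolic geodesics do not branch (\<open>hyp_dist_no_branching\<close>), so there is none.

  The cut locus and the graph carry intrinsic distances that come from the surface and from the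
  barycentric coordinates, and these ambient distances differ. Both agree with the
  length of the parameter interval for points close together on a side, and a bijection that
  preserves distances locally preserves lengths of curves, hence the intrinsic distances
  (\<open>isometric_intrinsic_if_locally_isometric\<close>, \<open>isometric_if_unit_sides\<close>).\<close>

section \<open>Smooth maps\<close>

lemma frechet_derivative_cong_open:
  assumes "open U" "x \<in> U" "\<And>y. y \<in> U \<Longrightarrow> f y = g y"
  shows "frechet_derivative f (at x) = frechet_derivative g (at x)"
    and "f differentiable at x \<longleftrightarrow> g differentiable at x"
proof -
  have *: "(f has_derivative D) (at x) \<longleftrightarrow> (g has_derivative D) (at x)" for D
    using has_derivative_transform_within_open[OF _ assms(1,2)] assms(3) by metis
  show "frechet_derivative f (at x) = frechet_derivative g (at x)"
    unfolding frechet_derivative_def * ..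
  show "f differentiable at x \<longleftrightarrow> g differentiable at x"
    unfolding differentiable_def * ..
qed

lemma Ck_on_cong_open:
  assumes "open U" "\<And>y. y \<in> U \<Longrightarrow> f y = g y" "Ck_on k U f"
  shows "Ck_on k U g"
  using assms(2,3)
proof (induction k arbitrary: f g)
  case 0
  then show ?case using continuous_on_cong by fastforce
next
  case (Suc k)
  have "Ck_on k U (\<lambda>x. frechet_derivative g (at x) v)" for v
    by (rule Suc.IH[of "\<lambda>x. frechet_derivative f (at x) v"])
      (use Suc.prems frechet_derivative_cong_open(1)[OF assms(1), of _ f g] in auto)
  then show ?case
    using Suc.prems frechet_derivative_cong_open(2)[OF assms(1), of _ f g] by auto
qed

lemma Ck_on_Suc_imp_Ck_on: "Ck_on (Suc k) U f \<Longrightarrow> Ck_on k U f"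
proof (induction k arbitrary: f)
  case 0
  then show ?case
    by (auto intro!: continuous_at_imp_continuous_on differentiable_imp_continuous_within)
next
  case (Suc k)
  from Suc.prems have "Ck_on (Suc k) U (\<lambda>x. frechet_derivative f (at x) v)" for v
    unfolding Ck_on.simps(2)[of "Suc k"] by blast
  then have "Ck_on k U (\<lambda>x. frechet_derivative f (at x) v)" for v
    by (rule Suc.IH)
  with Suc.prems show ?case by auto
qed

lemma Ck_on_add:
  assumes "open U" "Ck_on k U f" "Ck_on k U g"
  shows "Ck_on k U (\<lambda>x. f x + g x)"
  using assms(2,3)
proof (induction k arbitrary: f g)
  case 0
  then show ?case by (auto intro: continuous_intros)
next
  case (Suc k)
  have d: "((\<lambda>x. f x + g x) has_derivative
      (\<lambda>v. frechet_derivative f (at x) v + frechet_derivative g (at x) v)) (at x)" if "x \<in> U" for x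
    using Suc.prems that by (auto intro!: derivative_intros simp: frechet_derivative_works[symmetric])
  have "Ck_on k U (\<lambda>x. frechet_derivative (\<lambda>x. f x + g x) (at x) v)" for v
  proof (rule Ck_on_cong_open[OF \<open>open U\<close>])
    show "Ck_on k U (\<lambda>x. frechet_derivative f (at x) v + frechet_derivative g (at x) v)"
      by (rule Suc.IH) (use Suc.prems in auto)
  qed (simp add: frechet_derivative_at[OF d, symmetric])
  then show ?case using d by (auto simp: differentiable_def)
qed

lemma Ck_on_mult:
  fixes f g :: "'a::real_normed_vector \<Rightarrow> real"
  assumes "open U" "Ck_on k U f" "Ck_on k U g"
  shows "Ck_on k U (\<lambda>x. f x * g x)"
  using assms(2,3)
proof (induction k arbitrary: f g)
  case 0
  then show ?case by (auto intro: continuous_intros)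
next
  case (Suc k)
  have d: "((\<lambda>x. f x * g x) has_derivative
      (\<lambda>v. f x * frechet_derivative g (at x) v + frechet_derivative f (at x) v * g x)) (at x)"
    if "x \<in> U" for x
    using Suc.prems that by (auto intro!: derivative_eq_intros simp: frechet_derivative_works[symmetric])
  have "Ck_on k U (\<lambda>x. frechet_derivative (\<lambda>x. f x * g x) (at x) v)" for v
  proof (rule Ck_on_cong_open[OF \<open>open U\<close>])
    show "Ck_on k U (\<lambda>x. f x * frechet_derivative g (at x) v + frechet_derivative f (at x) v * g x)"
      by (intro Ck_on_add \<open>open U\<close> Suc.IH) (use Suc.prems Ck_on_Suc_imp_Ck_on in auto)
  qed (simp add: frechet_derivative_at[OF d, symmetric])
  then show ?case using d by (auto simp: differentiable_def)
qed

lemma Ck_on_const: "Ck_on k U (\<lambda>x. c)"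
  by (induction k arbitrary: c) (auto simp: frechet_derivative_const)

lemma Ck_on_inverse:
  fixes f :: "'a::real_normed_vector \<Rightarrow> real"
  assumes "open U" "Ck_on k U f" "\<And>x. x \<in> U \<Longrightarrow> f x \<noteq> 0"
  shows "Ck_on k U (\<lambda>x. inverse (f x))"
  using assms(2)
proof (induction k)
  case 0
  then show ?case using assms(3) by (auto intro: continuous_intros)
next
  case (Suc k)
  have d: "((\<lambda>x. inverse (f x)) has_derivative
      (\<lambda>v. (-1) * (inverse (f x) * frechet_derivative f (at x) v * inverse (f x)))) (at x)"
    if "x \<in> U" for x
    using Suc.prems that assms(3)
    by (auto intro!: derivative_eq_intros simp: frechet_derivative_works[symmetric])
  have i: "Ck_on k U (\<lambda>x. inverse (f x))"
    using Suc Ck_on_Suc_imp_Ck_on by blast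
  have "Ck_on k U (\<lambda>x. frechet_derivative (\<lambda>x. inverse (f x)) (at x) v)" for v
  proof (rule Ck_on_cong_open[OF \<open>open U\<close>])
    show "Ck_on k U (\<lambda>x. (-1) * (inverse (f x) * frechet_derivative f (at x) v * inverse (f x)))"
      by (intro Ck_on_mult Ck_on_const \<open>open U\<close> i) (use Suc.prems in auto)
  qed (simp add: frechet_derivative_at[OF d, symmetric])
  then show ?case using d by (auto simp: differentiable_def)
qed

lemma Ck_on_bounded_linear:
  assumes "bounded_linear f"
  shows "Ck_on k U f"
proof (cases k)
  case 0
  then show ?thesis by (simp add: assms linear_continuous_on)
next
  case (Suc n)
  then show ?thesis using bounded_linear_imp_differentiable[OF assms]
    by (auto simp: frechet_derivative_at[OF bounded_linear_imp_has_derivative[OF assms], symmetric] Ck_on_const)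
qed

lemma Ck_on_norm_square: "open U \<Longrightarrow> Ck_on k U (\<lambda>x::real^2. (norm x)\<^sup>2)"
  unfolding power2_norm_eq_inner inner_vec_def sum_2 inner_real_def
  by (intro Ck_on_add Ck_on_mult Ck_on_bounded_linear bounded_linear_vec_nth)

section \<open>The plane as complex numbers and as coordinate space\<close>

definition vec_of_complex :: "complex \<Rightarrow> real^2" where
  "vec_of_complex z = vector [Re z, Im z]"

definition complex_of_vec :: "real^2 \<Rightarrow> complex" where
  "complex_of_vec x = Complex (x $ 1) (x $ 2)"

lemma vec_of_complex_inverse [simp]: "complex_of_vec (vec_of_complex z) = z"
  by (simp add: vec_of_complex_def complex_of_vec_def)

lemma complex_of_vec_inverse [simp]: "vec_of_complex (complex_of_vec x) = x"
  by (simp add: vec_of_complex_def complex_of_vec_def vec_eq_iff forall_2)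

lemma norm_complex_of_vec [simp]: "norm (complex_of_vec x) = norm x"
  by (simp add: complex_of_vec_def cmod_def norm_vec_def L2_set_def sum_2)

lemma norm_vec_of_complex [simp]: "norm (vec_of_complex z) = norm z"
  by (metis norm_complex_of_vec vec_of_complex_inverse)

lemma bounded_linear_complex_of_vec: "bounded_linear complex_of_vec"
  by (rule bounded_linear_intro[where K = 1]) (simp_all add: complex_eq_iff, simp_all add: complex_of_vec_def)

lemma bounded_linear_vec_of_complex: "bounded_linear vec_of_complex"
  by (rule bounded_linear_intro[where K = 1])
    (simp_all add: vec_eq_iff forall_2, simp_all add: vec_of_complex_def)

lemmas continuous_on_vec_of_complex [continuous_intros] =
  bounded_linear.continuous_on[OF bounded_linear_vec_of_complex]
lemmas continuous_on_complex_of_vec [continuous_intros] =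
  bounded_linear.continuous_on[OF bounded_linear_complex_of_vec]

lemma vec_of_complex_image: "vec_of_complex ` U = complex_of_vec -` U"
  by (force simp: image_iff)

lemma open_vec_of_complex_image [simp]: "open (vec_of_complex ` U) \<longleftrightarrow> open U"
proof
  assume "open (vec_of_complex ` U)"
  then have "open (vec_of_complex -` (vec_of_complex ` U))"
    by (intro open_vimage continuous_intros)
  moreover have "vec_of_complex -` (vec_of_complex ` U) = U"
    by (metis inj_on_inverseI inj_vimage_image_eq vec_of_complex_inverse)
  ultimately show "open U" by simp
next
  assume "open U"
  then show "open (vec_of_complex ` U)"
    unfolding vec_of_complex_image by (intro open_vimage continuous_intros)
qed

lemma holomorphic_has_derivative_vec:
  assumes "F field_differentiable at (complex_of_vec x)"
  shows "((\<lambda>y. vec_of_complex (F (complex_of_vec y))) has_derivative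
          (\<lambda>v. vec_of_complex (deriv F (complex_of_vec x) * complex_of_vec v))) (at x)"
proof -
  have "(F has_derivative (*) (deriv F (complex_of_vec x))) (at (complex_of_vec x))"
    using assms DERIV_deriv_iff_field_differentiable has_field_derivative_def by blast
  then have "((\<lambda>y. F (complex_of_vec y)) has_derivative (\<lambda>v. deriv F (complex_of_vec x) * complex_of_vec v)) (at x)"
    using has_derivative_compose[OF bounded_linear_imp_has_derivative[OF bounded_linear_complex_of_vec]]
    by blast
  then show ?thesis
    by (rule bounded_linear.has_derivative[OF bounded_linear_vec_of_complex])
qed

text \<open>The derivative of a holomorphic map, applied to a fixed vector, is again holomorphic up to a
  factor; hence the induction needs no bound on the order.\<close>
lemma Ck_on_holomorphic:
  assumes "open U" "F holomorphic_on U"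
  shows "Ck_on k (vec_of_complex ` U) (\<lambda>x. vec_of_complex (F (complex_of_vec x)))"
  using assms(2)
proof (induction k arbitrary: F)
  case 0
  then have "continuous_on U F" by (rule holomorphic_on_imp_continuous_on)
  then show ?case
    by (auto intro!: continuous_intros continuous_on_compose2[of U F])
next
  case (Suc k)
  let ?D = "\<lambda>v z. deriv F z * complex_of_vec v"
  have d: "((\<lambda>y. vec_of_complex (F (complex_of_vec y))) has_derivative
      (\<lambda>v. vec_of_complex (?D v (complex_of_vec x)))) (at x)" if "x \<in> vec_of_complex ` U" for x
    using that Suc.prems assms(1)
    by (intro holomorphic_has_derivative_vec) (auto simp: holomorphic_on_imp_differentiable_at)
  have "Ck_on k (vec_of_complex ` U)
          (\<lambda>x. frechet_derivative (\<lambda>y. vec_of_complex (F (complex_of_vec y))) (at x) v)" for v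
  proof (rule Ck_on_cong_open)
    show "Ck_on k (vec_of_complex ` U) (\<lambda>x. vec_of_complex (?D v (complex_of_vec x)))"
      by (rule Suc.IH) (use Suc.prems assms(1) in \<open>auto intro!: holomorphic_intros\<close>)
  qed (use assms(1) in \<open>simp_all add: frechet_derivative_at[OF d, symmetric]\<close>)
  then show ?case using d by (auto simp: differentiable_def)
qed

text \<open>Coordinate changes are holomorphic, so this determinant decides orientability.\<close>
lemma det_multiplication_matrix:
  "det (matrix (\<lambda>v. vec_of_complex (c * complex_of_vec v))) = (cmod c)\<^sup>2"
  by (simp add: det_2 matrix_def vec_of_complex_def complex_of_vec_def axis_def
      cmod_power2 flip: power2_eq_square)

section \<open>Lengths of curves\<close>

text \<open>The sums whose supremum is the length, on lists; their recursion replaces reasoning about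
  indices.\<close>
definition path_sum :: "('a \<Rightarrow> 'a \<Rightarrow> real) \<Rightarrow> (real \<Rightarrow> 'a) \<Rightarrow> real list \<Rightarrow> real" where
  "path_sum d \<gamma> ts = (\<Sum>i < length ts - 1. d (\<gamma> (ts ! i)) (\<gamma> (ts ! Suc i)))"

lemma path_sum_simps [simp]:
  "path_sum d \<gamma> [] = 0"
  "path_sum d \<gamma> [a] = 0"
  "path_sum d \<gamma> (a # b # ts) = d (\<gamma> a) (\<gamma> b) + path_sum d \<gamma> (b # ts)"
  by (simp_all add: path_sum_def sum.lessThan_Suc_shift del: sum.lessThan_Suc)

lemma path_sum_append:
  "path_sum d \<gamma> ((a # xs) @ ys) = path_sum d \<gamma> (a # xs) + path_sum d \<gamma> (last (a # xs) # ys)"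
  by (induction xs arbitrary: a) auto

lemma path_sum_le_curve_length:
  "sorted ts \<Longrightarrow> set ts \<subseteq> {0..1} \<Longrightarrow> ereal (path_sum d \<gamma> ts) \<le> curve_length d \<gamma>"
  unfolding curve_length_def path_sum_def by (rule SUP_upper) auto

lemma curve_length_leI:
  assumes "\<And>ts. sorted ts \<Longrightarrow> set ts \<subseteq> {0..1} \<Longrightarrow> ereal (path_sum d \<gamma> ts) \<le> L"
  shows "curve_length d \<gamma> \<le> L"
  unfolding curve_length_def path_sum_def[symmetric] using assms by (auto intro: SUP_least)

lemma sorted_chain_append:
  assumes "sorted (a # xs)" "last (a # xs) = b" "sorted (b # ys)"
  shows "sorted (a # xs @ ys)"
proof -
  have "x \<le> b" if "x \<in> set (a # xs)" for x
    using assms(1,2) that by (metis in_set_conv_nth last_conv_nth length_pos_if_in_set list.distinct(1)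
        sorted_nth_mono Suc_pred' less_Suc_eq_le diff_less zero_less_one)
  then show ?thesis using assms by (fastforce simp: sorted_append)
qed

lemma chain_subset:
  assumes "sorted (a # xs)" "last (a # xs) = b"
  shows "set (a # xs) \<subseteq> {a..b::real}"
proof -
  have "x \<le> b" if "x \<in> set (a # xs)" for x
    using assms(1,2) that by (metis in_set_conv_nth last_conv_nth length_pos_if_in_set list.distinct(1)
        sorted_nth_mono Suc_pred' less_Suc_eq_le diff_less zero_less_one)
  then show ?thesis using assms by auto
qed

text \<open>Every subdivision can be refined until all pairs of neighbouring points are close enough for
  the local comparison. The subdivision of a single interval is found by bisection
  (\<open>Bolzano\<close>); the closeness of a subinterval to a point is all that the hypothesis offers,
  hence the two equations with \<open>t\<close> at either end.\<close>
lemma curve_length_le_if_locally_equal: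
  assumes "Metric_space A d" "\<gamma> ` {0..1} \<subseteq> A"
    and loc: "\<And>t. t \<in> {0..1} \<Longrightarrow> \<exists>\<delta>>0. \<forall>s\<in>{0..1}. \<bar>s - t\<bar> < \<delta> \<longrightarrow>
      d (\<gamma> t) (\<gamma> s) = d' (\<gamma>' t) (\<gamma>' s) \<and> d' (\<gamma>' s) (\<gamma>' t) = d' (\<gamma>' t) (\<gamma>' s)"
  shows "curve_length d \<gamma> \<le> curve_length d' \<gamma>'"
proof -
  interpret Metric_space A d by fact
  define P where "P a b \<longleftrightarrow> (\<exists>xs. sorted (a # xs) \<and> last (a # xs) = b \<and>
     d (\<gamma> a) (\<gamma> b) \<le> path_sum d' \<gamma>' (a # xs))" for a b
  have P: "P a0 b0" if ab0: "0 \<le> a0" "a0 \<le> b0" "b0 \<le> 1" for a0 b0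
  proof -
    have "a0 \<le> a0 \<and> b0 \<le> b0 \<longrightarrow> P a0 b0"
    proof (rule Bolzano[of a0 b0 "\<lambda>a b. a0 \<le> a \<and> b \<le> b0 \<longrightarrow> P a b"])
      show "a0 \<le> b0" using ab0 by simp
    next
      fix a b c assume IH: "a0 \<le> a \<and> b \<le> b0 \<longrightarrow> P a b" "a0 \<le> b \<and> c \<le> b0 \<longrightarrow> P b c"
        and abc: "a \<le> b" "b \<le> c"
      show "a0 \<le> a \<and> c \<le> b0 \<longrightarrow> P a c"
      proof
        assume ac: "a0 \<le> a \<and> c \<le> b0"
        obtain xs where xs: "sorted (a # xs)" "last (a # xs) = b"
          "d (\<gamma> a) (\<gamma> b) \<le> path_sum d' \<gamma>' (a # xs)"
          using IH(1) ac abc unfolding P_def by auto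
        obtain ys where ys: "sorted (b # ys)" "last (b # ys) = c"
          "d (\<gamma> b) (\<gamma> c) \<le> path_sum d' \<gamma>' (b # ys)"
          using IH(2) ac abc unfolding P_def by auto
        have "d (\<gamma> a) (\<gamma> c) \<le> d (\<gamma> a) (\<gamma> b) + d (\<gamma> b) (\<gamma> c)"
          using assms(2) ac abc ab0 by (intro triangle) (auto simp: image_subset_iff)
        also have "\<dots> \<le> path_sum d' \<gamma>' (a # xs @ ys)"
          using path_sum_append[of d' \<gamma>' a xs ys] xs ys by simp
        finally have "d (\<gamma> a) (\<gamma> c) \<le> path_sum d' \<gamma>' (a # xs @ ys)" .
        moreover have "last (a # xs @ ys) = c"
          using xs(2) ys(2) by (cases ys) auto
        ultimately show "P a c"
          unfolding P_def using sorted_chain_append[OF xs(1,2) ys(1)] by blast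
      qed
    next
      fix t assume t: "a0 \<le> t" "t \<le> b0"
      then obtain \<delta> where \<delta>: "\<delta> > 0" "\<And>s. s \<in> {0..1} \<Longrightarrow> \<bar>s - t\<bar> < \<delta> \<Longrightarrow>
         d (\<gamma> t) (\<gamma> s) = d' (\<gamma>' t) (\<gamma>' s) \<and> d' (\<gamma>' s) (\<gamma>' t) = d' (\<gamma>' t) (\<gamma>' s)"
        using loc[of t] ab0 by auto
      show "\<exists>\<delta>>0. \<forall>a b. a \<le> t \<and> t \<le> b \<and> b - a < \<delta> \<longrightarrow> a0 \<le> a \<and> b \<le> b0 \<longrightarrow> P a b"
      proof (intro exI[of _ \<delta>] conjI allI impI \<delta>(1))
        fix a b assume *: "a \<le> t \<and> t \<le> b \<and> b - a < \<delta>" "a0 \<le> a \<and> b \<le> b0"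
        have "d (\<gamma> a) (\<gamma> b) \<le> d (\<gamma> a) (\<gamma> t) + d (\<gamma> t) (\<gamma> b)"
          using assms(2) * t ab0 by (intro triangle) (auto simp: image_subset_iff)
        also have "\<dots> = path_sum d' \<gamma>' [a, t, b]"
          using \<delta>(2)[of a] \<delta>(2)[of b] * ab0 t by (simp add: commute[of "\<gamma> a"])
        finally show "P a b"
          unfolding P_def using * by (intro exI[of _ "[t, b]"]) auto
      qed
    qed
    then show "P a0 b0" using ab0 by simp
  qed
  have chain: "\<exists>us. sorted (a # us) \<and> last (a # us) = last (a # ts) \<and>
      path_sum d \<gamma> (a # ts) \<le> path_sum d' \<gamma>' (a # us)"
    if "sorted (a # ts)" "set (a # ts) \<subseteq> {0..1}" for a ts
    using that
  proof (induction ts arbitrary: a)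
    case Nil
    then show ?case by (intro exI[of _ "[]"]) auto
  next
    case (Cons b ts)
    obtain us where us: "sorted (b # us)" "last (b # us) = last (b # ts)"
      "path_sum d \<gamma> (b # ts) \<le> path_sum d' \<gamma>' (b # us)"
      using Cons.IH[of b] Cons.prems by force
    obtain xs where xs: "sorted (a # xs)" "last (a # xs) = b"
      "d (\<gamma> a) (\<gamma> b) \<le> path_sum d' \<gamma>' (a # xs)"
      using P[of a b] Cons.prems unfolding P_def by auto
    have "path_sum d \<gamma> (a # b # ts) \<le> path_sum d' \<gamma>' (a # xs @ us)"
      using path_sum_append[of d' \<gamma>' a xs us] xs us by simp
    moreover have "last (a # xs @ us) = last (a # b # ts)"
      using xs(2) us(2) by (cases us) auto
    ultimately show ?case using sorted_chain_append[OF xs(1,2) us(1)] by blast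
  qed
  show ?thesis
  proof (rule curve_length_leI)
    fix ts :: "real list" assume ts: "sorted ts" "set ts \<subseteq> {0..1}"
    show "ereal (path_sum d \<gamma> ts) \<le> curve_length d' \<gamma>'"
    proof (cases ts)
      case Nil
      then show ?thesis using path_sum_le_curve_length[of "[]" d' \<gamma>'] by simp
    next
      case (Cons a ts')
      then obtain us where us: "sorted (a # us)" "last (a # us) = last (a # ts')"
        "path_sum d \<gamma> ts \<le> path_sum d' \<gamma>' (a # us)"
        using chain ts by blast
      have "last (a # us) \<in> set ts" using us(2) Cons by (metis last_in_set list.distinct(1))
      then have "set (a # us) \<subseteq> {0..1}"
        using chain_subset[OF us(1) refl] ts Cons by force
      then have "ereal (path_sum d' \<gamma>' (a # us)) \<le> curve_length d' \<gamma>'"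
        by (intro path_sum_le_curve_length us(1))
      with us(3) show ?thesis by (meson ereal_less_eq(3) order_trans)
    qed
  qed
qed

lemma intrinsic_dist_le_if_locally_isometric:
  assumes "Metric_space A dA" "Metric_space B dB" "f ` A \<subseteq> B" "p \<in> A" "q \<in> A"
    and loc: "\<And>a. a \<in> A \<Longrightarrow> \<exists>\<epsilon>>0. \<forall>b\<in>A. dA a b < \<epsilon> \<longrightarrow> dB (f a) (f b) = dA a b"
  shows "intrinsic_dist B dB (f p) (f q) \<le> intrinsic_dist A dA p q"
  unfolding intrinsic_dist_def
proof (rule INF_greatest)
  interpret A: Metric_space A dA by fact
  interpret B: Metric_space B dB by fact
  fix \<gamma> assume "\<gamma> \<in> {\<gamma>. pathin A.mtopology \<gamma> \<and> \<gamma> 0 = p \<and> \<gamma> 1 = q}"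
  then have \<gamma>: "pathin A.mtopology \<gamma>" "\<gamma> 0 = p" "\<gamma> 1 = q" by auto
  have cont: "continuous_map A.mtopology B.mtopology f"
    unfolding A.metric_continuous_map[OF assms(2)]
  proof (intro conjI ballI allI impI)
    fix a and e :: real assume "a \<in> A" "e > 0"
    then obtain \<epsilon> where "\<epsilon> > 0" "\<forall>b\<in>A. dA a b < \<epsilon> \<longrightarrow> dB (f a) (f b) = dA a b"
      using loc by blast
    then show "\<exists>\<delta>>0. \<forall>x. x \<in> A \<and> dA a x < \<delta> \<longrightarrow> dB (f a) (f x) < e"
      using \<open>e > 0\<close> by (intro exI[of _ "min e \<epsilon>"]) auto
  qed (use assms in auto)
  have \<gamma>A: "\<gamma> t \<in> A" if "t \<in> {0..1}" for t
    using \<gamma>(1) that by (auto simp: pathin_def continuous_map_def)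
  have "curve_length dB (f \<circ> \<gamma>) \<le> curve_length dA \<gamma>"
  proof (rule curve_length_le_if_locally_equal[OF assms(2)])
    show "(f \<circ> \<gamma>) ` {0..1} \<subseteq> B" using \<gamma>A assms(3) by auto
    fix t :: real assume t: "t \<in> {0..1}"
    obtain \<epsilon> where \<epsilon>: "\<epsilon> > 0" "\<forall>b\<in>A. dA (\<gamma> t) b < \<epsilon> \<longrightarrow> dB (f (\<gamma> t)) (f b) = dA (\<gamma> t) b"
      using loc \<gamma>A t by blast
    have "openin (top_of_set {0..1}) {s \<in> {0..1}. \<gamma> s \<in> A.mball (\<gamma> t) \<epsilon>}"
      using openin_continuous_map_preimage[OF \<gamma>(1)[unfolded pathin_def] A.openin_mball] by simp
    moreover have "t \<in> {s \<in> {0..1}. \<gamma> s \<in> A.mball (\<gamma> t) \<epsilon>}" using t \<gamma>A[OF t] \<epsilon>(1) by simp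
    ultimately obtain \<delta> where \<delta>: "\<delta> > 0"
      "\<And>s. s \<in> {0..1} \<Longrightarrow> dist s t < \<delta> \<Longrightarrow> \<gamma> s \<in> A.mball (\<gamma> t) \<epsilon>"
      unfolding openin_euclidean_subtopology_iff by blast
    show "\<exists>\<delta>>0. \<forall>s\<in>{0..1}. \<bar>s - t\<bar> < \<delta> \<longrightarrow>
        dB ((f \<circ> \<gamma>) t) ((f \<circ> \<gamma>) s) = dA (\<gamma> t) (\<gamma> s) \<and> dA (\<gamma> s) (\<gamma> t) = dA (\<gamma> t) (\<gamma> s)"
    proof (intro exI[of _ \<delta>] conjI ballI impI \<delta>(1))
      fix s :: real assume "s \<in> {0..1}" "\<bar>s - t\<bar> < \<delta>"
      then show "dB ((f \<circ> \<gamma>) t) ((f \<circ> \<gamma>) s) = dA (\<gamma> t) (\<gamma> s)"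
        using \<delta>(2)[of s] \<epsilon>(2) by (simp add: dist_real_def)
      show "dA (\<gamma> s) (\<gamma> t) = dA (\<gamma> t) (\<gamma> s)" by (rule A.commute)
    qed
  qed
  moreover have "pathin B.mtopology (f \<circ> \<gamma>)"
    using pathin_compose[OF \<gamma>(1) cont] .
  ultimately show "(INF \<gamma>\<in>{\<gamma>. pathin B.mtopology \<gamma> \<and> \<gamma> 0 = f p \<and> \<gamma> 1 = f q}. curve_length dB \<gamma>)
      \<le> curve_length dA \<gamma>"
    using \<gamma> by (intro INF_lower2[of "f \<circ> \<gamma>"]) auto
qed

text \<open>Since only the inner geometry is compared, it suffices that the bijection preserves small
  distances, where small may refer to either of the two distances: the one makes the bijection
  continuous and the other its inverse.\<close>
lemma isometric_intrinsic_if_locally_isometric: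
  assumes A: "Metric_space A dA" and B: "Metric_space B dB" and f: "bij_betw f A B"
    and loc: "\<And>a. a \<in> A \<Longrightarrow> \<exists>\<epsilon>>0. \<forall>b\<in>A. dA a b < \<epsilon> \<or> dB (f a) (f b) < \<epsilon> \<longrightarrow> dB (f a) (f b) = dA a b"
  shows "isometric A (intrinsic_dist A dA) B (intrinsic_dist B dB)"
  unfolding isometric_def
proof (intro exI conjI ballI)
  show "bij_betw f A B" by fact
  fix p q assume pq: "p \<in> A" "q \<in> A"
  have fA: "f ` A = B" and inj: "inj_on f A" using f by (auto simp: bij_betw_def)
  let ?g = "inv_into A f"
  have gf: "?g (f a) = a" if "a \<in> A" for a using inj that by simp
  show "intrinsic_dist B dB (f p) (f q) = intrinsic_dist A dA p q"
  proof (rule antisym)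
    show "intrinsic_dist B dB (f p) (f q) \<le> intrinsic_dist A dA p q"
      by (rule intrinsic_dist_le_if_locally_isometric[OF A B])
        (use fA pq loc in \<open>auto, metis\<close>)
    have "intrinsic_dist A dA (?g (f p)) (?g (f q)) \<le> intrinsic_dist B dB (f p) (f q)"
    proof (rule intrinsic_dist_le_if_locally_isometric[OF B A])
      fix b assume "b \<in> B"
      then obtain a where a: "a \<in> A" "b = f a" using fA by auto
      then show "\<exists>\<epsilon>>0. \<forall>b'\<in>B. dB b b' < \<epsilon> \<longrightarrow> dA (?g b) (?g b') = dB b b'"
        using loc[OF a(1)] gf fA by (metis (no_types, lifting) imageE)
    qed (use fA pq gf in auto)
    then show "intrinsic_dist A dA p q \<le> intrinsic_dist B dB (f p) (f q)"
      using gf pq by simp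
  qed
qed

text \<open>The function \<open>f\<close> plays the role of arc length. Bounding distances by its
  increments bounds the length by \<open>f 1 - f 0\<close>.\<close>
lemma shortest_pathI:
  fixes f :: "real \<Rightarrow> real"
  assumes M: "Metric_space M d" and \<gamma>: "\<gamma> ` {0..1} \<subseteq> M" and f: "continuous_on {0..1} f"
    and le: "\<And>s t. 0 \<le> s \<Longrightarrow> s \<le> t \<Longrightarrow> t \<le> 1 \<Longrightarrow> d (\<gamma> s) (\<gamma> t) \<le> f t - f s"
    and eq: "d (\<gamma> 0) (\<gamma> 1) = f 1 - f 0"
  shows "shortest_path M d \<gamma>"
proof -
  interpret Metric_space M d by fact
  have "path_sum d \<gamma> (a # ts) \<le> f (last (a # ts)) - f a"
    if "sorted (a # ts)" "set (a # ts) \<subseteq> {0..1}" for a ts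
    using that
  proof (induction ts arbitrary: a)
    case (Cons b ts)
    then show ?case using le[of a b] Cons.IH[of b] by force
  qed simp
  moreover have mono: "f s \<le> f t" if "0 \<le> s" "s \<le> t" "t \<le> 1" for s t
    using le[OF that] nonneg[of "\<gamma> s" "\<gamma> t"] by linarith
  ultimately have *: "path_sum d \<gamma> ts \<le> f 1 - f 0" if "sorted ts" "set ts \<subseteq> {0..1}" for ts
  proof (cases ts)
    case Nil
    then show ?thesis using mono[of 0 1] by simp
  next
    case (Cons a ts')
    have "last ts \<in> {0..1}" "a \<in> {0..1}" using that Cons last_in_set[of ts] by auto
    then show ?thesis
      using mono[of 0 a] mono[of "last ts" 1] Cons that
        \<open>\<And>ts a. sorted (a # ts) \<Longrightarrow> set (a # ts) \<subseteq> {0..1} \<Longrightarrow> path_sum d \<gamma> (a # ts) \<le> f (last (a # ts)) - f a\<close>[of a ts']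
      by simp
  qed
  have "curve_length d \<gamma> \<le> ereal (f 1 - f 0)"
    by (rule curve_length_leI) (simp add: *)
  moreover have "ereal (f 1 - f 0) \<le> curve_length d \<gamma>"
    using path_sum_le_curve_length[of "[0, 1]" d \<gamma>] eq by simp
  moreover have "pathin mtopology \<gamma>"
    unfolding pathin_def
  proof (rule continuous_map_to_metric[THEN iffD2], intro ballI allI impI)
    fix t \<epsilon> :: real assume t: "t \<in> topspace (top_of_set {0..1})" and "\<epsilon> > 0"
    have t01: "t \<in> {0..1}" using t by simp
    let ?U = "{s \<in> {0..1}. f s \<in> ball (f t) \<epsilon>}"
    have "openin (top_of_set {0..1}) ?U"
      using continuous_openin_preimage_gen[OF f open_ball] by (simp add: vimage_def Int_def)
    moreover have "\<gamma> s \<in> mball (\<gamma> t) \<epsilon>" if "s \<in> ?U" for s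
      using that t01 le[of s t] le[of t s] \<gamma> commute[of "\<gamma> s" "\<gamma> t"]
      by (cases "s \<le> t") (auto simp: dist_real_def image_subset_iff)
    ultimately show "\<exists>U. openin (top_of_set {0..1}) U \<and> t \<in> U \<and> (\<forall>s\<in>U. \<gamma> s \<in> mball (\<gamma> t) \<epsilon>)"
      using t01 \<open>\<epsilon> > 0\<close> by (intro exI[of _ ?U]) auto
  qed
  ultimately show ?thesis unfolding shortest_path_def using eq by auto
qed

text \<open>A path that passes through a point and is not longer than the distance of its ends realizes
  the triangle inequality with equality there.\<close>
lemma shortest_path_additive:
  assumes M: "Metric_space M d" and \<gamma>: "shortest_path M d \<gamma>" and st: "0 \<le> s" "s \<le> t" "t \<le> 1"
  shows "d (\<gamma> 0) (\<gamma> t) = d (\<gamma> 0) (\<gamma> s) + d (\<gamma> s) (\<gamma> t)"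
proof -
  interpret Metric_space M d by fact
  have in_M: "\<gamma> u \<in> M" if "u \<in> {0..1}" for u
    using \<gamma> that by (auto simp: shortest_path_def pathin_def continuous_map_def)
  have "ereal (path_sum d \<gamma> [0, s, t, 1]) \<le> ereal (d (\<gamma> 0) (\<gamma> 1))"
    using path_sum_le_curve_length[of "[0,s,t,1]" d \<gamma>] \<gamma> st by (simp add: shortest_path_def)
  then have "d (\<gamma> 0) (\<gamma> s) + d (\<gamma> s) (\<gamma> t) + d (\<gamma> t) (\<gamma> 1) \<le> d (\<gamma> 0) (\<gamma> 1)" by simp
  moreover have "d (\<gamma> 0) (\<gamma> 1) \<le> d (\<gamma> 0) (\<gamma> t) + d (\<gamma> t) (\<gamma> 1)"
    "d (\<gamma> 0) (\<gamma> t) \<le> d (\<gamma> 0) (\<gamma> s) + d (\<gamma> s) (\<gamma> t)"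
    using st in_M by (auto intro!: triangle)
  ultimately show ?thesis by linarith
qed

section \<open>Increments of functions with a pointwise Lipschitz bound\<close>

text \<open>The mean value estimate for a function that need not be differentiable, as is the case for a
  minimum of distances. Bisection reduces the estimate up to \<open>e\<close> to small
  intervals.\<close>
lemma increment_le_integral:
  fixes f g :: "real \<Rightarrow> real"
  assumes ab: "a \<le> b" and g: "continuous_on {a..b} g"
    and lip: "\<And>t e. t \<in> {a..b} \<Longrightarrow> e > 0 \<Longrightarrow>
      \<exists>\<delta>>0. \<forall>s\<in>{a..b}. \<bar>s - t\<bar> < \<delta> \<longrightarrow> \<bar>f s - f t\<bar> \<le> (g t + e) * \<bar>s - t\<bar>"
  shows "\<bar>f b - f a\<bar> \<le> integral {a..b} g"
proof (rule field_le_epsilon)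
  fix e0 :: real assume "e0 > 0"
  define e where "e = e0 / (2 * (b - a + 1))"
  have e: "e > 0" unfolding e_def using \<open>e0 > 0\<close> ab by simp
  have "\<bar>f b - f a\<bar> \<le> integral {a..b} g + 2 * e * (b - a)"
  proof (rule Bolzano[of a b "\<lambda>u v. a \<le> u \<and> v \<le> b \<longrightarrow> \<bar>f v - f u\<bar> \<le> integral {u..v} g + 2 * e * (v - u)", THEN mp])
    fix u v w :: real
    assume IH: "a \<le> u \<and> v \<le> b \<longrightarrow> \<bar>f v - f u\<bar> \<le> integral {u..v} g + 2 * e * (v - u)"
       "a \<le> v \<and> w \<le> b \<longrightarrow> \<bar>f w - f v\<bar> \<le> integral {v..w} g + 2 * e * (w - v)"
       and uvw: "u \<le> v" "v \<le> w"
    show "a \<le> u \<and> w \<le> b \<longrightarrow> \<bar>f w - f u\<bar> \<le> integral {u..w} g + 2 * e * (w - u)"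
    proof
      assume uw: "a \<le> u \<and> w \<le> b"
      have "continuous_on {u..w} g" using g uw by (auto intro: continuous_on_subset)
      then have "integral {u..w} g = integral {u..v} g + integral {v..w} g"
        using Henstock_Kurzweil_Integration.integral_combine[OF uvw] integrable_continuous_interval
        by (metis (no_types))
      then show "\<bar>f w - f u\<bar> \<le> integral {u..w} g + 2 * e * (w - u)"
        using IH uw uvw by (auto simp: algebra_simps)
    qed
  next
    fix t assume t: "a \<le> t" "t \<le> b"
    obtain \<delta>1 where \<delta>1: "\<delta>1 > 0" "\<And>s. s \<in> {a..b} \<Longrightarrow> \<bar>s - t\<bar> < \<delta>1 \<Longrightarrow> \<bar>f s - f t\<bar> \<le> (g t + e) * \<bar>s - t\<bar>"
      using lip[of t e] t e by auto
    obtain \<delta>2 where \<delta>2: "\<delta>2 > 0" "\<And>s. s \<in> {a..b} \<Longrightarrow> \<bar>s - t\<bar> < \<delta>2 \<Longrightarrow> \<bar>g s - g t\<bar> < e"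
      using g t e unfolding continuous_on_iff dist_real_def by (metis atLeastAtMost_iff)
    show "\<exists>\<delta>>0. \<forall>u v. u \<le> t \<and> t \<le> v \<and> v - u < \<delta> \<longrightarrow>
       a \<le> u \<and> v \<le> b \<longrightarrow> \<bar>f v - f u\<bar> \<le> integral {u..v} g + 2 * e * (v - u)"
    proof (intro exI[of _ "min \<delta>1 \<delta>2"] conjI allI impI)
      fix u v assume uv: "u \<le> t \<and> t \<le> v \<and> v - u < min \<delta>1 \<delta>2" "a \<le> u \<and> v \<le> b"
      have "\<bar>f v - f t\<bar> \<le> (g t + e) * (v - t)" "\<bar>f u - f t\<bar> \<le> (g t + e) * (t - u)"
        using \<delta>1(2)[of v] \<delta>1(2)[of u] uv by auto
      then have 1: "\<bar>f v - f u\<bar> \<le> (g t + e) * (v - u)" by (simp add: algebra_simps)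
      have "integral {u..v} (\<lambda>_. g t - e) \<le> integral {u..v} g"
      proof (rule integral_le)
        show "g integrable_on {u..v}"
          using g uv by (auto intro!: integrable_continuous_interval intro: continuous_on_subset)
        show "g t - e \<le> g s" if "s \<in> {u..v}" for s
        proof -
          have "\<bar>s - t\<bar> < \<delta>2" "s \<in> {a..b}" using that uv by auto
          then show ?thesis using \<delta>2(2)[of s] by linarith
        qed
      qed (rule integrable_const_ivl)
      then have "(g t - e) * (v - u) \<le> integral {u..v} g" using uv by (simp add: mult.commute)
      with 1 show "\<bar>f v - f u\<bar> \<le> integral {u..v} g + 2 * e * (v - u)"
        by (simp add: algebra_simps)
    qed (use \<delta>1 \<delta>2 in auto)
  qed (use ab in simp_all)
  also have "2 * e * (b - a) \<le> e0"
    using ab \<open>e0 > 0\<close> unfolding e_def by (simp add: field_simps)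
  finally show "\<bar>f b - f a\<bar> \<le> integral {a..b} g + e0" by simp
qed

section \<open>The hyperbolic disc\<close>

abbreviation disc :: "complex set" where
  "disc \<equiv> ball 0 1"

definition conformal_factor :: "complex \<Rightarrow> real" where
  "conformal_factor z = 2 / (1 - (cmod z)\<^sup>2)"

text \<open>Local isometries of the Poincare metric of curvature -1; being holomorphic, they preserve
  the orientation.\<close>
definition hyp_isometry :: "(complex \<Rightarrow> complex) \<Rightarrow> bool" where
  "hyp_isometry F \<longleftrightarrow> F holomorphic_on disc \<and> F ` disc \<subseteq> disc \<and>
     (\<forall>z\<in>disc. conformal_factor (F z) * cmod (deriv F z) = conformal_factor z)"

text \<open>For \<open>a\<close> in the disc, this is the hyperbolic rotation by 180 degrees that
  exchanges 0 and \<open>a\<close>. Being an involution, it serves in both directions to move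
  \<open>a\<close> to the origin.\<close>
definition half_turn :: "complex \<Rightarrow> complex \<Rightarrow> complex" where
  "half_turn a z = (a - z) / (1 - cnj a * z)"

definition hyp_norm :: "complex \<Rightarrow> real" where
  "hyp_norm z = 2 * artanh (cmod z)"

definition hyp_dist :: "complex \<Rightarrow> complex \<Rightarrow> real" where
  "hyp_dist z w = hyp_norm (half_turn z w)"

lemma conformal_factor_pos: "z \<in> disc \<Longrightarrow> conformal_factor z > 0"
  by (simp add: conformal_factor_def abs_square_less_1)

lemma hyp_isometry_in_disc: "hyp_isometry F \<Longrightarrow> z \<in> disc \<Longrightarrow> F z \<in> disc"
  unfolding hyp_isometry_def by blast

lemma hyp_isometry_DERIV:
  "hyp_isometry F \<Longrightarrow> z \<in> disc \<Longrightarrow> (F has_field_derivative deriv F z) (at z)"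
  using holomorphic_derivI[of F disc z] by (auto simp: hyp_isometry_def)

lemma hyp_isometry_continuous: "hyp_isometry F \<Longrightarrow> continuous_on disc F"
  by (auto simp: hyp_isometry_def holomorphic_on_imp_continuous_on)

lemma hyp_isometry_deriv_nonzero: "hyp_isometry F \<Longrightarrow> z \<in> disc \<Longrightarrow> deriv F z \<noteq> 0"
  using conformal_factor_pos[of z] by (force simp: hyp_isometry_def)

lemma hyp_isometry_ident: "hyp_isometry (\<lambda>z. z)"
  by (auto simp: hyp_isometry_def)

lemma hyp_isometry_rotation: "cmod c = 1 \<Longrightarrow> hyp_isometry (\<lambda>z. c * z)"
  by (auto simp: hyp_isometry_def conformal_factor_def norm_mult intro!: holomorphic_intros)

lemma hyp_isometry_compose:
  assumes F: "hyp_isometry F" and G: "hyp_isometry G"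
  shows "hyp_isometry (\<lambda>z. F (G z))"
proof -
  have d: "deriv (\<lambda>z. F (G z)) z = deriv F (G z) * deriv G z" if "z \<in> disc" for z
    using DERIV_chain2[OF hyp_isometry_DERIV[OF F hyp_isometry_in_disc[OF G that]]
        hyp_isometry_DERIV[OF G that]] by (rule DERIV_imp_deriv)
  have "conformal_factor (F (G z)) * cmod (deriv (\<lambda>z. F (G z)) z) = conformal_factor z" if "z \<in> disc" for z
  proof -
    have "conformal_factor (F (G z)) * cmod (deriv F (G z)) = conformal_factor (G z)"
      using F hyp_isometry_in_disc[OF G that] by (simp add: hyp_isometry_def)
    moreover have "conformal_factor (G z) * cmod (deriv G z) = conformal_factor z"
      using G that by (simp add: hyp_isometry_def)
    ultimately show ?thesis using d[OF that] by (simp add: norm_mult mult.assoc[symmetric])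
  qed
  moreover have "(\<lambda>z. F (G z)) holomorphic_on disc"
    using F G holomorphic_on_compose_gen[of G disc F disc] by (auto simp: hyp_isometry_def o_def)
  ultimately show ?thesis using F G by (auto simp: hyp_isometry_def image_subset_iff)
qed

lemma one_minus_cnj_mult_nonzero:
  assumes "a \<in> disc" "z \<in> disc"
  shows "1 - cnj a * z \<noteq> 0"
proof -
  have "cmod (cnj a * z) < 1" using assms mult_strict_mono'[of "cmod a" 1 "cmod z" 1]
    by (simp add: norm_mult)
  then show ?thesis by (metis eq_iff_diff_eq_0 less_irrefl norm_one)
qed

lemma norm_diff_square_identity:
  "(cmod (1 - cnj a * z))\<^sup>2 - (cmod (a - z))\<^sup>2 = (1 - (cmod a)\<^sup>2) * (1 - (cmod z)\<^sup>2)"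
  unfolding cmod_power2 by (simp add: algebra_simps power2_eq_square)

lemma one_minus_norm_half_turn:
  assumes "a \<in> disc" "z \<in> disc"
  shows "1 - (cmod (half_turn a z))\<^sup>2 = (1 - (cmod a)\<^sup>2) * (1 - (cmod z)\<^sup>2) / (cmod (1 - cnj a * z))\<^sup>2"
  using one_minus_cnj_mult_nonzero[OF assms] norm_diff_square_identity[of a z]
  by (simp add: half_turn_def norm_divide power_divide field_simps)

lemma half_turn_in_disc:
  assumes "a \<in> disc" "z \<in> disc"
  shows "half_turn a z \<in> disc"
proof -
  have "0 < 1 - (cmod (half_turn a z))\<^sup>2"
    unfolding one_minus_norm_half_turn[OF assms]
    using assms one_minus_cnj_mult_nonzero[OF assms] by (simp add: abs_square_less_1)
  then show ?thesis by (simp add: abs_square_less_1)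
qed

lemma half_turn_self [simp]: "half_turn a a = 0"
  and half_turn_0 [simp]: "half_turn a 0 = a"
  and half_turn_0_left [simp]: "half_turn 0 z = - z"
  by (simp_all add: half_turn_def)

lemma half_turn_involution:
  assumes "a \<in> disc" "z \<in> disc"
  shows "half_turn a (half_turn a z) = z"
proof -
  note nz = one_minus_cnj_mult_nonzero[OF assms] one_minus_cnj_mult_nonzero[OF assms(1) assms(1)]
    one_minus_cnj_mult_nonzero[OF assms(1) half_turn_in_disc[OF assms]]
  have "half_turn a (half_turn a z) = (a * (1 - cnj a * z) - (a - z)) / ((1 - cnj a * z) - cnj a * (a - z))"
    using nz unfolding half_turn_def by (simp add: divide_simps)
  also have "\<dots> = (z * (1 - cnj a * a)) / (1 - cnj a * a)" by (simp add: algebra_simps)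
  finally show ?thesis using nz by simp
qed

lemma half_turn_DERIV:
  assumes "a \<in> disc" "z \<in> disc"
  shows "(half_turn a has_field_derivative - (1 - (cmod a)\<^sup>2) / (1 - cnj a * z)\<^sup>2) (at z)"
proof -
  have "(half_turn a has_field_derivative
      ((- 1) * (1 - cnj a * z) - (a - z) * (- cnj a)) / ((1 - cnj a * z) * (1 - cnj a * z))) (at z)"
    unfolding half_turn_def[abs_def] using one_minus_cnj_mult_nonzero[OF assms]
    by (auto intro!: derivative_eq_intros)
  moreover have "(- 1) * (1 - cnj a * z) - (a - z) * (- cnj a) = - (1 - (cmod a)\<^sup>2)"
    by (simp add: algebra_simps complex_norm_square[symmetric] del: of_real_power)
  ultimately show ?thesis unfolding power2_eq_square[of "1 - cnj a * z"] by metis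
qed

lemma hyp_isometry_half_turn:
  assumes a: "a \<in> disc"
  shows "hyp_isometry (half_turn a)"
  unfolding hyp_isometry_def
proof (intro conjI ballI)
  show "half_turn a holomorphic_on disc"
    unfolding holomorphic_on_open[OF open_ball] using half_turn_DERIV[OF a] by blast
  show "half_turn a ` disc \<subseteq> disc" using half_turn_in_disc[OF a] by auto
  fix z assume z: "z \<in> disc"
  have d: "cmod (deriv (half_turn a) z) = (1 - (cmod a)\<^sup>2) / (cmod (1 - cnj a * z))\<^sup>2"
  proof -
    have "cmod (deriv (half_turn a) z) = cmod (1 - of_real ((cmod a)\<^sup>2)) / (cmod (1 - cnj a * z))\<^sup>2"
      using DERIV_imp_deriv[OF half_turn_DERIV[OF a z]] by (simp add: norm_divide norm_power norm_minus_commute)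
    also have "1 - of_real ((cmod a)\<^sup>2) = (of_real (1 - (cmod a)\<^sup>2) :: complex)" by simp
    finally show ?thesis using a by (simp only: norm_of_real) (simp add: abs_square_le_1)
  qed
  have "1 - (cmod a)\<^sup>2 \<noteq> 0" "1 - (cmod z)\<^sup>2 \<noteq> 0"
    using a z by (simp_all add: power2_eq_1_iff) (use norm_ge_zero in \<open>smt (verit)\<close>)+
  then show "conformal_factor (half_turn a z) * cmod (deriv (half_turn a) z) = conformal_factor z"
    unfolding conformal_factor_def d one_minus_norm_half_turn[OF a z]
    using one_minus_cnj_mult_nonzero[OF a z] by simp
qed

lemma hyp_norm_0 [simp]: "hyp_norm 0 = 0"
  by (simp add: hyp_norm_def)

lemma artanh_less_iff:
  assumes "\<bar>x\<bar> < 1" "\<bar>y\<bar> < (1::real)"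
  shows "artanh x < artanh y \<longleftrightarrow> x < y"
proof -
  have "0 < (1 + x) / (1 - x)" "0 < (1 + y) / (1 - y)" using assms by auto
  then show ?thesis using assms unfolding artanh_def by (simp add: field_simps)
qed

lemma artanh_le_iff:
  assumes "\<bar>x\<bar> < 1" "\<bar>y\<bar> < (1::real)"
  shows "artanh x \<le> artanh y \<longleftrightarrow> x \<le> y"
  using artanh_less_iff[OF assms(2,1)] by linarith

lemma artanh_add:
  assumes "0 \<le> x" "x < 1" "0 \<le> y" "y < (1::real)"
  shows "artanh x + artanh y = artanh ((x + y) / (1 + x * y))"
proof -
  have xy: "1 + x * y > 0" using assms by (simp add: add_pos_nonneg)
  have "(1 - x) * (1 - y) > 0" using assms by simp
  then have lt: "x + y < 1 + x * y" by (simp add: algebra_simps)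
  have "(1 + (x + y) / (1 + x * y)) / (1 - (x + y) / (1 + x * y)) =
      ((1 + x * y + (x + y)) / (1 + x * y)) / ((1 + x * y - (x + y)) / (1 + x * y))"
    using xy by (simp add: field_simps)
  also have "\<dots> = (1 + x * y + (x + y)) / (1 + x * y - (x + y))"
    using xy by simp
  also have "\<dots> = ((1 + x) / (1 - x)) * ((1 + y) / (1 - y))"
    by (simp add: algebra_simps)
  finally have "ln ((1 + (x + y) / (1 + x * y)) / (1 - (x + y) / (1 + x * y))) =
      ln ((1 + x) / (1 - x)) + ln ((1 + y) / (1 - y))"
    using assms ln_mult[of "(1 + x) / (1 - x)" "(1 + y) / (1 - y)"] by simp
  then show ?thesis by (simp add: artanh_def)
qed

lemma hyp_norm_le_iff: "z \<in> disc \<Longrightarrow> w \<in> disc \<Longrightarrow> hyp_norm z \<le> hyp_norm w \<longleftrightarrow> cmod z \<le> cmod w"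
  by (simp add: hyp_norm_def artanh_le_iff)

lemma hyp_norm_eq_iff: "z \<in> disc \<Longrightarrow> w \<in> disc \<Longrightarrow> hyp_norm z = hyp_norm w \<longleftrightarrow> cmod z = cmod w"
  using hyp_norm_le_iff[of z w] hyp_norm_le_iff[of w z] by linarith

lemma hyp_norm_less_iff: "z \<in> disc \<Longrightarrow> w \<in> disc \<Longrightarrow> hyp_norm z < hyp_norm w \<longleftrightarrow> cmod z < cmod w"
  using hyp_norm_le_iff[of w z] by linarith

lemma hyp_norm_nonneg: "z \<in> disc \<Longrightarrow> 0 \<le> hyp_norm z"
  using hyp_norm_le_iff[of 0 z] by simp

lemma hyp_norm_eq_0_iff: "z \<in> disc \<Longrightarrow> hyp_norm z = 0 \<longleftrightarrow> z = 0"
  using hyp_norm_eq_iff[of z 0] by simp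

lemma hyp_norm_mult_unit: "cmod c = 1 \<Longrightarrow> hyp_norm (c * z) = hyp_norm z"
  by (simp add: hyp_norm_def norm_mult)

lemma hyp_dist_nonneg: "z \<in> disc \<Longrightarrow> w \<in> disc \<Longrightarrow> 0 \<le> hyp_dist z w"
  unfolding hyp_dist_def by (intro hyp_norm_nonneg half_turn_in_disc)

lemma hyp_dist_self [simp]: "hyp_dist z z = 0"
  by (simp add: hyp_dist_def)

lemma hyp_dist_0_left [simp]: "hyp_dist 0 z = hyp_norm z"
  by (simp add: hyp_dist_def hyp_norm_def)

lemma hyp_dist_0_right [simp]: "hyp_dist z 0 = hyp_norm z"
  by (simp add: hyp_dist_def)

lemma hyp_dist_eq_0_iff: "z \<in> disc \<Longrightarrow> w \<in> disc \<Longrightarrow> hyp_dist z w = 0 \<longleftrightarrow> z = w"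
  using one_minus_cnj_mult_nonzero[of z w]
  unfolding hyp_dist_def by (subst hyp_norm_eq_0_iff[OF half_turn_in_disc]) (auto simp: half_turn_def)

lemma hyp_dist_commute: "hyp_dist z w = hyp_dist w z"
proof -
  have "cmod (1 - cnj z * w) = cmod (1 - cnj w * z)"
    using complex_mod_cnj[of "1 - cnj z * w"] by (simp add: mult.commute)
  then show ?thesis by (simp add: hyp_dist_def hyp_norm_def half_turn_def norm_divide norm_minus_commute)
qed

lemma hyp_dist_rotation: "cmod c = 1 \<Longrightarrow> hyp_dist (c * z) (c * w) = hyp_dist z w"
proof -
  assume c: "cmod c = 1"
  then have "cnj c * c = 1" using complex_norm_square[of c] by (simp add: mult.commute)
  then have "half_turn (c * z) (c * w) = c * half_turn z w"
    unfolding half_turn_def by (simp add: algebra_simps)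
  then show ?thesis by (simp add: hyp_dist_def hyp_norm_mult_unit c)
qed

lemma hyp_dist_half_turn:
  assumes "a \<in> disc" "z \<in> disc" "w \<in> disc"
  shows "hyp_dist (half_turn a z) (half_turn a w) = hyp_dist z w"
proof -
  note nz = one_minus_cnj_mult_nonzero[OF assms(1,2)] one_minus_cnj_mult_nonzero[OF assms(1,3)]
    one_minus_cnj_mult_nonzero[OF assms(1,1)] one_minus_cnj_mult_nonzero[OF assms(2,3)]
  have nz': "1 - a * cnj z \<noteq> 0" using one_minus_cnj_mult_nonzero[OF assms(2,1)] by (simp add: mult.commute)
  have 1: "half_turn a z - half_turn a w = (1 - cnj a * a) * (w - z) / ((1 - cnj a * z) * (1 - cnj a * w))"
    using nz unfolding half_turn_def by (simp add: divide_simps) (simp add: algebra_simps)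
  have 2: "1 - cnj (half_turn a z) * half_turn a w =
      (1 - cnj a * a) * (1 - cnj z * w) / ((1 - a * cnj z) * (1 - cnj a * w))"
    using nz nz' unfolding half_turn_def by (simp add: divide_simps) (simp add: algebra_simps)
  have 3: "cmod (1 - a * cnj z) = cmod (1 - cnj a * z)"
    using complex_mod_cnj[of "1 - cnj a * z"] by simp
  have "cmod (half_turn (half_turn a z) (half_turn a w)) = cmod (half_turn z w)"
    unfolding half_turn_def[of "half_turn a z" "half_turn a w"] 1 2 norm_divide norm_mult 3
    unfolding half_turn_def[of z w] norm_divide
    using nz by (simp add: norm_minus_commute)
  then show ?thesis by (simp add: hyp_dist_def hyp_norm_def)
qed

text \<open>Seen from a point \<open>y\<close> moved to the origin, the triangle inequality with middle vertex \<open>y\<close>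
  compares \<open>|1 - cnj a b|\<close> with \<open>1 + |a| |b|\<close>; hence equality holds only if \<open>a\<close> and
  \<open>b\<close> lie in opposite directions.\<close>
lemma hyp_dist_le_hyp_norms:
  assumes "a \<in> disc" "b \<in> disc"
  shows "hyp_dist a b \<le> hyp_norm a + hyp_norm b"
    and "hyp_dist a b = hyp_norm a + hyp_norm b \<Longrightarrow> cnj a * b = - of_real (cmod a * cmod b)"
proof -
  define x y m where "x = cmod a" "y = cmod b" "m = cmod (1 - cnj a * b)"
  have x: "0 \<le> x" "x < 1" and y: "0 \<le> y" "y < 1" using assms by (auto simp: x_y_m_def)
  have m0: "m > 0" using one_minus_cnj_mult_nonzero[OF assms] by (simp add: x_y_m_def)
  have mle: "m \<le> 1 + x * y"
    using norm_triangle_ineq4[of 1 "cnj a * b"] by (simp add: x_y_m_def norm_mult)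
  have xy: "1 + x * y > 0" using x y by (simp add: add_pos_nonneg)
  have sq: "1 - ((x + y) / (1 + x * y))\<^sup>2 = (1 - x\<^sup>2) * (1 - y\<^sup>2) / (1 + x * y)\<^sup>2"
  proof -
    have "(1 + x * y)\<^sup>2 - (x + y)\<^sup>2 = (1 - x\<^sup>2) * (1 - y\<^sup>2)"
      by (simp add: power2_eq_square algebra_simps)
    then show ?thesis using xy by (simp add: power_divide field_simps)
  qed
  have sq': "1 - (cmod (half_turn a b))\<^sup>2 = (1 - x\<^sup>2) * (1 - y\<^sup>2) / m\<^sup>2"
    using one_minus_norm_half_turn[OF assms] by (simp add: x_y_m_def)
  have pos: "(1 - x\<^sup>2) * (1 - y\<^sup>2) > 0" using x y by (simp add: abs_square_less_1)
  define X where "X = (x + y) / (1 + x * y)"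
  have "(1 - x) * (1 - y) > 0" using x y by simp
  then have X: "0 \<le> X" "X < 1" using x y xy by (simp_all add: X_def algebra_simps)
  have sum: "hyp_norm a + hyp_norm b = 2 * artanh X"
    using artanh_add[of x y] x y by (simp add: hyp_norm_def x_y_m_def X_def)
  have h1: "cmod (half_turn a b) < 1" using half_turn_in_disc[OF assms] by simp
  have "m\<^sup>2 \<le> (1 + x * y)\<^sup>2" using mle less_imp_le[OF m0] by (rule power_mono)
  then have "(1 - x\<^sup>2) * (1 - y\<^sup>2) / (1 + x * y)\<^sup>2 \<le> (1 - x\<^sup>2) * (1 - y\<^sup>2) / m\<^sup>2"
    using less_imp_le[OF pos] mult_pos_pos[OF zero_less_power[OF xy, of 2] zero_less_power[OF m0, of 2]]
    by (rule divide_left_mono)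
  then have "(cmod (half_turn a b))\<^sup>2 \<le> X\<^sup>2"
    using sq sq' unfolding X_def by linarith
  then have "cmod (half_turn a b) \<le> X" using X(1) by (rule power2_le_imp_le)
  then show "hyp_dist a b \<le> hyp_norm a + hyp_norm b"
    unfolding sum unfolding hyp_dist_def hyp_norm_def using X h1 by (simp add: artanh_le_iff)
  assume "hyp_dist a b = hyp_norm a + hyp_norm b"
  then have "artanh (cmod (half_turn a b)) = artanh X" unfolding sum by (simp add: hyp_dist_def hyp_norm_def)
  then have "cmod (half_turn a b) = X"
    using artanh_less_iff[of "cmod (half_turn a b)" X] artanh_less_iff[of X "cmod (half_turn a b)"] X h1
    by simp
  then have "(1 - x\<^sup>2) * (1 - y\<^sup>2) / m\<^sup>2 = (1 - x\<^sup>2) * (1 - y\<^sup>2) / (1 + x * y)\<^sup>2"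
    using sq sq' unfolding X_def by metis
  then have "m\<^sup>2 = (1 + x * y)\<^sup>2" using pos m0 xy by (simp add: field_simps)
  then have meq: "m = 1 + x * y" using m0 xy power2_eq_iff_nonneg[of m "1 + x * y"] by simp
  define c where "c = cnj a * b"
  have c: "cmod c = x * y" by (simp add: c_def x_y_m_def norm_mult)
  have "(cmod (1 - c))\<^sup>2 = (1 + cmod c)\<^sup>2" using meq c by (simp add: c_def x_y_m_def)
  then have "Re c = - cmod c" unfolding cmod_power2 using cmod_power2[of c] by (simp add: power2_eq_square algebra_simps)
  moreover then have "Im c = 0" using cmod_power2[of c] by simp
  ultimately have "c = - of_real (cmod c)" by (simp add: complex_eq_iff)
  then show "cnj a * b = - of_real (cmod a * cmod b)" using c by (simp add: c_def x_y_m_def)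
qed

lemma hyp_dist_triangle:
  assumes "x \<in> disc" "y \<in> disc" "z \<in> disc"
  shows "hyp_dist x z \<le> hyp_dist x y + hyp_dist y z"
  using hyp_dist_le_hyp_norms(1)[OF half_turn_in_disc[OF assms(2,1)] half_turn_in_disc[OF assms(2,3)]]
    hyp_dist_half_turn[OF assms(2,1,3)]
  by (simp add: hyp_dist_def[of y] hyp_dist_commute[of x y])

text \<open>Two geodesics of equal length that end in \<open>y\<close> cannot have a common minimizing extension
  beyond \<open>y\<close>, since hyperbolic geodesics do not branch.\<close>
lemma hyp_dist_no_branching:
  assumes "y \<in> disc" "z \<in> disc" "c \<in> disc" "c' \<in> disc" "z \<noteq> y"
    and "hyp_dist c y = hyp_dist c' y"
    and "hyp_dist c z = hyp_dist c y + hyp_dist y z"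
    and "hyp_dist c' z = hyp_dist c' y + hyp_dist y z"
  shows "c = c'"
proof -
  let ?a = "half_turn y c" and ?a' = "half_turn y c'" and ?b = "half_turn y z"
  have disc: "?a \<in> disc" "?a' \<in> disc" "?b \<in> disc" using assms half_turn_in_disc by auto
  have b0: "?b \<noteq> 0" using assms(1,2,5) one_minus_cnj_mult_nonzero[of y z] by (auto simp: half_turn_def)
  have nrm: "cmod ?a = cmod ?a'"
    using assms(6) hyp_norm_eq_iff[OF disc(1,2)]
    by (metis hyp_dist_commute hyp_dist_def)
  have "hyp_dist ?a ?b = hyp_norm ?a + hyp_norm ?b"
    using assms(7) hyp_dist_half_turn[OF assms(1,3,2)] hyp_dist_commute[of c y] by (simp add: hyp_dist_def[of y])
  then have 1: "cnj ?a * ?b = - of_real (cmod ?a * cmod ?b)"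
    using hyp_dist_le_hyp_norms(2)[OF disc(1,3)] by blast
  have "hyp_dist ?a' ?b = hyp_norm ?a' + hyp_norm ?b"
    using assms(8) hyp_dist_half_turn[OF assms(1,4,2)] hyp_dist_commute[of c' y] by (simp add: hyp_dist_def[of y])
  then have 2: "cnj ?a' * ?b = - of_real (cmod ?a' * cmod ?b)"
    using hyp_dist_le_hyp_norms(2)[OF disc(2,3)] by blast
  have "cnj ?a * ?b = cnj ?a' * ?b" using 1 2 nrm by simp
  then have "?a = ?a'" using b0 by simp
  then show ?thesis using half_turn_involution assms by metis
qed

section \<open>Functions with infinitesimal Lipschitz constant one\<close>

text \<open>The infinitesimal form of \<open>\<bar>h w - h z\<bar> \<le> hyp_dist z w\<close>. Only this
  local form carries over to the glued surface, where there is no global comparison with the disc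
  yet.\<close>
definition hyp_lipschitz_at :: "(complex \<Rightarrow> real) \<Rightarrow> complex \<Rightarrow> bool" where
  "hyp_lipschitz_at h z \<longleftrightarrow>
     (\<forall>e>0. \<forall>\<^sub>F w in nhds z. \<bar>h w - h z\<bar> \<le> (conformal_factor z + e) * cmod (w - z))"

lemma hyp_lipschitz_at_cong:
  assumes "\<forall>\<^sub>F w in nhds z. h w = g w" "hyp_lipschitz_at h z"
  shows "hyp_lipschitz_at g z"
proof -
  have "h z = g z" using assms(1) by (rule eventually_nhds_x_imp_x)
  then show ?thesis
    using assms(2) eventually_elim2[OF assms(1)] unfolding hyp_lipschitz_at_def
    by (smt (verit, best) eventually_elim2 assms(1))
qed

lemma hyp_lipschitz_at_const: "z \<in> disc \<Longrightarrow> hyp_lipschitz_at (\<lambda>w. c) z"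
  using conformal_factor_pos[of z] by (auto simp: hyp_lipschitz_at_def)

lemma hyp_lipschitz_at_min:
  assumes "hyp_lipschitz_at h z" "hyp_lipschitz_at g z"
  shows "hyp_lipschitz_at (\<lambda>w. min (h w) (g w)) z"
  unfolding hyp_lipschitz_at_def
proof (intro allI impI)
  fix e :: real assume "e > 0"
  then have "\<forall>\<^sub>F w in nhds z. \<bar>h w - h z\<bar> \<le> (conformal_factor z + e) * cmod (w - z)"
    "\<forall>\<^sub>F w in nhds z. \<bar>g w - g z\<bar> \<le> (conformal_factor z + e) * cmod (w - z)"
    using assms by (auto simp: hyp_lipschitz_at_def)
  then show "\<forall>\<^sub>F w in nhds z. \<bar>min (h w) (g w) - min (h z) (g z)\<bar> \<le> (conformal_factor z + e) * cmod (w - z)"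
    by eventually_elim linarith
qed

lemma eventually_norm_diff_le:
  assumes "(F has_field_derivative D) (at z)" "e > 0"
  shows "\<forall>\<^sub>F w in nhds z. cmod (F w - F z) \<le> (cmod D + e) * cmod (w - z)"
proof -
  obtain d where d: "d > 0"
    "\<And>y. cmod (y - z) < d \<Longrightarrow> cmod (F y - F z - D * (y - z)) \<le> e * cmod (y - z)"
    using assms unfolding has_field_derivative_def has_derivative_at_alt by blast
  have "cmod (F y - F z) \<le> (cmod D + e) * cmod (y - z)" if "dist y z < d" for y
  proof -
    have "cmod (F y - F z) \<le> cmod (F y - F z - D * (y - z)) + cmod (D * (y - z))"
      using norm_triangle_ineq[of "F y - F z - D * (y - z)" "D * (y - z)"] by simp
    also have "\<dots> \<le> e * cmod (y - z) + cmod D * cmod (y - z)"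
      using d(2)[of y] that by (simp add: norm_mult dist_norm)
    finally show ?thesis by (simp add: algebra_simps)
  qed
  then show ?thesis using d(1) unfolding eventually_nhds_metric by blast
qed

lemma hyp_lipschitz_at_compose:
  assumes F: "hyp_isometry F" and z: "z \<in> disc" and h: "hyp_lipschitz_at h (F z)"
  shows "hyp_lipschitz_at (\<lambda>w. h (F w)) z"
  unfolding hyp_lipschitz_at_def
proof (intro allI impI)
  fix e :: real assume e: "e > 0"
  define D where "D = cmod (deriv F z)"
  define lam where "lam = conformal_factor (F z)"
  have lam: "lam > 0" using conformal_factor_pos hyp_isometry_in_disc[OF F z] by (simp add: lam_def)
  have D: "D > 0" using hyp_isometry_deriv_nonzero[OF F z] by (simp add: D_def)
  have eq: "lam * D = conformal_factor z" using F z by (simp add: hyp_isometry_def lam_def D_def)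
  \<comment> \<open>Chosen such that \<open>(lam + e1) * (D + e2) = conformal_factor z + e\<close>.\<close>
  define e1 where "e1 = e / (2 * D)"
  define e2 where "e2 = e / (2 * (lam + e1))"
  have e1: "e1 > 0" and e2: "e2 > 0" using e D lam by (auto simp: e1_def e2_def add_pos_pos)
  have "isCont F z" using DERIV_isCont[OF hyp_isometry_DERIV[OF F z]] .
  then have "filterlim F (nhds (F z)) (nhds z)" by (simp add: isCont_def tendsto_at_iff_tendsto_nhds)
  moreover have "\<forall>\<^sub>F w in nhds (F z). \<bar>h w - h (F z)\<bar> \<le> (lam + e1) * cmod (w - F z)"
    using h e1 by (simp add: hyp_lipschitz_at_def lam_def)
  ultimately have "\<forall>\<^sub>F w in nhds z. \<bar>h (F w) - h (F z)\<bar> \<le> (lam + e1) * cmod (F w - F z)"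
    by (rule eventually_compose_filterlim[rotated])
  moreover have "\<forall>\<^sub>F w in nhds z. cmod (F w - F z) \<le> (D + e2) * cmod (w - z)"
    unfolding D_def by (rule eventually_norm_diff_le[OF hyp_isometry_DERIV[OF F z] e2])
  ultimately show "\<forall>\<^sub>F w in nhds z. \<bar>h (F w) - h (F z)\<bar> \<le> (conformal_factor z + e) * cmod (w - z)"
  proof eventually_elim
    case (elim w)
    have le: "\<bar>h (F w) - h (F z)\<bar> \<le> (lam + e1) * ((D + e2) * cmod (w - z))"
      using elim lam e1 by (meson add_pos_pos less_imp_le mult_left_mono order_trans)
    have "(lam + e1) * (D + e2) = lam * D + e1 * D + (lam + e1) * e2" by (simp add: algebra_simps)
    also have "e1 * D = e / 2" using D by (simp add: e1_def)
    also have "(lam + e1) * e2 = e / 2" using lam e1 by (simp add: e2_def field_simps)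
    finally have "(lam + e1) * (D + e2) = conformal_factor z + e" using eq by simp
    with le show ?case by (simp add: mult.assoc[symmetric])
  qed
qed

lemma hyp_lipschitz_at_hyp_norm:
  assumes z: "z \<in> disc"
  shows "hyp_lipschitz_at hyp_norm z"
  unfolding hyp_lipschitz_at_def
proof (intro allI impI)
  fix e :: real assume e: "e > 0"
  have "((\<lambda>x. 2 * artanh x) has_real_derivative conformal_factor z) (at (cmod z))"
    using z by (auto intro!: derivative_eq_intros simp: conformal_factor_def)
  then obtain d where d: "d > 0" "\<And>y. \<bar>y - cmod z\<bar> < d \<Longrightarrow>
      \<bar>2 * artanh y - 2 * artanh (cmod z) - conformal_factor z * (y - cmod z)\<bar> \<le> e * \<bar>y - cmod z\<bar>"
    using e unfolding has_field_derivative_def has_derivative_at_alt real_norm_def by blast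
  have "\<bar>hyp_norm w - hyp_norm z\<bar> \<le> (conformal_factor z + e) * cmod (w - z)" if "dist w z < d" for w
  proof -
    have tri: "\<bar>cmod w - cmod z\<bar> \<le> cmod (w - z)" by (rule norm_triangle_ineq3)
    then have "\<bar>hyp_norm w - hyp_norm z - conformal_factor z * (cmod w - cmod z)\<bar> \<le> e * \<bar>cmod w - cmod z\<bar>"
      using d(2)[of "cmod w"] that by (simp add: hyp_norm_def dist_norm)
    moreover have "\<bar>conformal_factor z * (cmod w - cmod z)\<bar> = conformal_factor z * \<bar>cmod w - cmod z\<bar>"
      using conformal_factor_pos[OF z] by (simp add: abs_mult)
    ultimately have "\<bar>hyp_norm w - hyp_norm z\<bar> \<le> (conformal_factor z + e) * \<bar>cmod w - cmod z\<bar>"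
      unfolding distrib_right by linarith
    also have "\<dots> \<le> (conformal_factor z + e) * cmod (w - z)"
      using tri conformal_factor_pos[OF z] e by (intro mult_left_mono) auto
    finally show ?thesis .
  qed
  then show "\<forall>\<^sub>F w in nhds z. \<bar>hyp_norm w - hyp_norm z\<bar> \<le> (conformal_factor z + e) * cmod (w - z)"
    using d(1) unfolding eventually_nhds_metric by blast
qed

lemma hyp_lipschitz_at_hyp_dist:
  "a \<in> disc \<Longrightarrow> z \<in> disc \<Longrightarrow> hyp_lipschitz_at (hyp_dist a) z"
  unfolding hyp_dist_def[abs_def]
  by (rule hyp_lipschitz_at_compose[OF hyp_isometry_half_turn _ hyp_lipschitz_at_hyp_norm[OF half_turn_in_disc]])

section \<open>Geodesics of the disc\<close>

text \<open>The geodesic segment, obtained from a Euclidean radius by moving the start to the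
  origin.\<close>
definition hyp_segment :: "complex \<Rightarrow> complex \<Rightarrow> real \<Rightarrow> complex" where
  "hyp_segment z w t = half_turn z (of_real t * half_turn z w)"

lemma hyp_segment_ends:
  "hyp_segment z w 0 = z" "z \<in> disc \<Longrightarrow> w \<in> disc \<Longrightarrow> hyp_segment z w 1 = w"
  by (simp_all add: hyp_segment_def half_turn_involution)

lemma scaled_in_disc: "z \<in> disc \<Longrightarrow> 0 \<le> t \<Longrightarrow> t \<le> 1 \<Longrightarrow> of_real t * z \<in> disc"
  using mult_left_le_one_le[of "cmod z" t] by (auto simp: norm_mult intro: le_less_trans)

lemma hyp_segment_in_ball:
  assumes "z \<in> disc" "w \<in> disc" "0 \<le> t" "t \<le> 1"
  shows "hyp_segment z w t \<in> disc" "hyp_dist z (hyp_segment z w t) \<le> hyp_dist z w"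
proof -
  have b: "half_turn z w \<in> disc" "of_real t * half_turn z w \<in> disc"
    using assms half_turn_in_disc scaled_in_disc by auto
  show "hyp_segment z w t \<in> disc" unfolding hyp_segment_def by (rule half_turn_in_disc[OF assms(1) b(2)])
  show "hyp_dist z (hyp_segment z w t) \<le> hyp_dist z w"
    unfolding hyp_segment_def hyp_dist_def half_turn_involution[OF assms(1) b(2)] hyp_norm_le_iff[OF b(2,1)]
    using assms mult_left_le_one_le[of "cmod (half_turn z w)" t] by (simp add: norm_mult)
qed

lemma hyp_segment_derivative:
  assumes "z \<in> disc" "w \<in> disc" "0 \<le> t" "t \<le> 1"
  defines "b \<equiv> half_turn z w"
  shows "(hyp_segment z w has_vector_derivative b * deriv (half_turn z) (of_real t * b)) (at t within T)"
    and "conformal_factor (hyp_segment z w t) * cmod (b * deriv (half_turn z) (of_real t * b)) = 2 * cmod b / (1 - (t * cmod b)\<^sup>2)"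
proof -
  have b: "b \<in> disc" "of_real t * b \<in> disc"
    using assms half_turn_in_disc scaled_in_disc by auto
  have "((\<lambda>t. of_real t * b) has_vector_derivative b) (at t within T)"
    by (auto intro!: derivative_eq_intros)
  from field_vector_diff_chain_within[OF this DERIV_subset[OF hyp_isometry_DERIV[OF hyp_isometry_half_turn[OF assms(1)] b(2)] subset_UNIV]]
  show "(hyp_segment z w has_vector_derivative b * deriv (half_turn z) (of_real t * b)) (at t within T)"
    by (simp add: hyp_segment_def[abs_def] o_def b_def)
  have "conformal_factor (half_turn z (of_real t * b)) * cmod (deriv (half_turn z) (of_real t * b)) = conformal_factor (of_real t * b)"
    using hyp_isometry_half_turn[OF assms(1)] b(2) unfolding hyp_isometry_def by blast
  then have "conformal_factor (hyp_segment z w t) * cmod (b * deriv (half_turn z) (of_real t * b)) = cmod b * conformal_factor (of_real t * b)"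
    by (simp add: hyp_segment_def b_def norm_mult)
  then show "conformal_factor (hyp_segment z w t) * cmod (b * deriv (half_turn z) (of_real t * b)) = 2 * cmod b / (1 - (t * cmod b)\<^sup>2)"
    using assms by (simp add: conformal_factor_def norm_mult)
qed

lemma continuous_hyp_segment_derivative:
  assumes "z \<in> disc" "w \<in> disc"
  shows "continuous_on {0..1} (\<lambda>t. half_turn z w * deriv (half_turn z) (of_real t * half_turn z w))"
proof -
  have "deriv (half_turn z) holomorphic_on disc"
    using hyp_isometry_half_turn[OF assms(1)] by (intro holomorphic_deriv) (auto simp: hyp_isometry_def)
  then have "continuous_on disc (deriv (half_turn z))" by (rule holomorphic_on_imp_continuous_on)
  moreover have "continuous_on {0..1} (\<lambda>t. of_real t * half_turn z w)" by (intro continuous_intros)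
  moreover have "(\<lambda>t. of_real t * half_turn z w) ` {0..1} \<subseteq> disc"
    using scaled_in_disc[OF half_turn_in_disc[OF assms]] by auto
  ultimately have "continuous_on {0..1} (\<lambda>t. deriv (half_turn z) (of_real t * half_turn z w))"
    by (rule continuous_on_compose2)
  then show ?thesis by (rule continuous_on_mult_left)
qed

lemma integral_hyp_segment:
  assumes "z \<in> disc" "w \<in> disc"
  shows "((\<lambda>t. 2 * cmod (half_turn z w) / (1 - (t * cmod (half_turn z w))\<^sup>2)) has_integral hyp_dist z w) {0..1}"
proof -
  define r where "r = cmod (half_turn z w)"
  have r: "0 \<le> r" "r < 1" using half_turn_in_disc[OF assms] by (auto simp: r_def)
  have "((\<lambda>t. 2 * r / (1 - (t * r)\<^sup>2)) has_integral (2 * artanh (1 * r) - 2 * artanh (0 * r))) {0..1}"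
  proof (rule fundamental_theorem_of_calculus)
    fix t :: real assume t: "t \<in> {0..1}"
    have "\<bar>t * r\<bar> < 1" using r t mult_left_le_one_le[of r t] by auto
    then show "((\<lambda>t. 2 * artanh (t * r)) has_vector_derivative 2 * r / (1 - (t * r)\<^sup>2)) (at t within {0..1})"
      unfolding has_real_derivative_iff_has_vector_derivative[symmetric]
      by (auto intro!: derivative_eq_intros DERIV_chain2[where f = artanh])
  qed simp
  then show ?thesis by (simp add: hyp_dist_def hyp_norm_def r_def)
qed

lemma openI_eventually: "(\<And>x. x \<in> S \<Longrightarrow> \<forall>\<^sub>F y in nhds x. y \<in> S) \<Longrightarrow> open S"
  unfolding eventually_nhds by (meson openI open_subopen subset_iff)

section \<open>Surfaces glued from pieces of the hyperbolic disc\<close>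

text \<open>Data for a surface that is covered by injective images of open sets of the disc. Near two
  coordinates of the same point, the two parametrizations differ by a hyperbolic isometry. The factor
  \<open>\<mu>\<close> rescales the metric.\<close>
locale isometric_atlas =
  fixes I :: "'i set" and N :: "'i \<Rightarrow> complex set" and \<psi> :: "'i \<Rightarrow> complex \<Rightarrow> 'p" and \<mu> :: real
  assumes finite_I: "finite I"
    and mu_pos: "\<mu> > 0"
    and open_N: "i \<in> I \<Longrightarrow> open (N i)"
    and N_subset_disc: "i \<in> I \<Longrightarrow> N i \<subseteq> disc"
    and inj_\<psi>: "i \<in> I \<Longrightarrow> inj_on (\<psi> i) (N i)"
    and covering: "(\<Union>i\<in>I. \<psi> i ` N i) = UNIV"
    and compatible: "\<lbrakk>i \<in> I; j \<in> I; z \<in> N i; z' \<in> N j; \<psi> i z = \<psi> j z'\<rbrakk> \<Longrightarrow>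
      \<exists>F. hyp_isometry F \<and> F z = z' \<and> (\<forall>\<^sub>F w in nhds z. F w \<in> N j \<and> \<psi> j (F w) = \<psi> i w)"
begin

text \<open>The final topology with respect to all parametrizations.\<close>
definition glued_topology :: "'p topology" where
  "glued_topology = topology (\<lambda>U. \<forall>i\<in>I. open {z \<in> N i. \<psi> i z \<in> U})"

definition patch :: "'i \<Rightarrow> 'p set" where
  "patch i = \<psi> i ` N i"

definition coord :: "'i \<Rightarrow> 'p \<Rightarrow> complex" where
  "coord i = inv_into (N i) (\<psi> i)"

definition overlap :: "'i \<Rightarrow> 'i \<Rightarrow> complex set" where
  "overlap i j = {z \<in> N i. \<psi> i z \<in> patch j}"

definition change :: "'i \<Rightarrow> 'i \<Rightarrow> complex \<Rightarrow> complex" where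
  "change i j z = coord j (\<psi> i z)"

definition glued_chart :: "'i \<Rightarrow> 'p chart" where
  "glued_chart i = (patch i, \<lambda>p. vec_of_complex (coord i p))"

definition glued_surface :: "'p riem_surface" where
  "glued_surface = \<lparr>topo = glued_topology, atlas = glued_chart ` I,
     metric = (\<lambda>c p u v. (2 * \<mu> / (1 - (norm (snd c p))\<^sup>2))\<^sup>2 * (u \<bullet> v))\<rparr>"

lemma openin_glued: "openin glued_topology U \<longleftrightarrow> (\<forall>i\<in>I. open {z \<in> N i. \<psi> i z \<in> U})"
proof -
  have "istopology (\<lambda>U. \<forall>i\<in>I. open {z \<in> N i. \<psi> i z \<in> U})"
    unfolding istopology_def
  proof (intro conjI allI impI ballI)
    fix S T i assume *: "\<forall>i\<in>I. open {z \<in> N i. \<psi> i z \<in> S}" "\<forall>i\<in>I. open {z \<in> N i. \<psi> i z \<in> T}" "i \<in> I"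
    have "{z \<in> N i. \<psi> i z \<in> S \<inter> T} = {z \<in> N i. \<psi> i z \<in> S} \<inter> {z \<in> N i. \<psi> i z \<in> T}" by auto
    then show "open {z \<in> N i. \<psi> i z \<in> S \<inter> T}" using * by auto
  next
    fix \<K> i assume *: "\<forall>K\<in>\<K>. \<forall>i\<in>I. open {z \<in> N i. \<psi> i z \<in> K}" "i \<in> I"
    have "{z \<in> N i. \<psi> i z \<in> \<Union>\<K>} = (\<Union>K\<in>\<K>. {z \<in> N i. \<psi> i z \<in> K})" by auto
    then show "open {z \<in> N i. \<psi> i z \<in> \<Union>\<K>}" using * by auto
  qed
  then show ?thesis by (simp add: glued_topology_def)
qed

lemma topspace_glued [simp]: "topspace glued_topology = UNIV"
proof -
  have "openin glued_topology UNIV" unfolding openin_glued using open_N by simp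
  then show ?thesis using openin_subset by blast
qed

lemma obtain_chart: obtains i z where "i \<in> I" "z \<in> N i" "\<psi> i z = p"
proof -
  have "p \<in> (\<Union>i\<in>I. \<psi> i ` N i)" unfolding covering by simp
  then show ?thesis using that by auto
qed

lemma coord_\<psi> [simp]: "i \<in> I \<Longrightarrow> z \<in> N i \<Longrightarrow> coord i (\<psi> i z) = z"
  using inj_\<psi> by (simp add: coord_def)

lemma \<psi>_coord: "p \<in> patch i \<Longrightarrow> \<psi> i (coord i p) = p" "p \<in> patch i \<Longrightarrow> coord i p \<in> N i"
  by (auto simp: patch_def coord_def f_inv_into_f inv_into_into)

lemma \<psi>_in_patch: "z \<in> N i \<Longrightarrow> \<psi> i z \<in> patch i"
  by (simp add: patch_def)

text \<open>The compatibility condition makes the parametrizations open maps.\<close>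
lemma openin_\<psi>_image:
  assumes i: "i \<in> I" and V: "open V" "V \<subseteq> N i"
  shows "openin glued_topology (\<psi> i ` V)"
  unfolding openin_glued
proof (intro ballI openI_eventually)
  fix j z assume j: "j \<in> I" and "z \<in> {z \<in> N j. \<psi> j z \<in> \<psi> i ` V}"
  then obtain z' where z: "z \<in> N j" "z' \<in> V" "\<psi> j z = \<psi> i z'" by auto
  obtain F where F: "hyp_isometry F" "F z = z'" "\<forall>\<^sub>F w in nhds z. F w \<in> N i \<and> \<psi> i (F w) = \<psi> j w"
    using compatible[OF j i z(1) _ z(3)] z V by auto
  have "isCont F z" using hyp_isometry_DERIV[OF F(1)] N_subset_disc[OF j] z(1) DERIV_isCont by blast
  then have "filterlim F (nhds z') (nhds z)" unfolding F(2)[symmetric] by (simp add: isCont_def tendsto_at_iff_tendsto_nhds)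
  then have "\<forall>\<^sub>F w in nhds z. F w \<in> V"
    using V(1) z(2) by (rule topological_tendstoD)
  moreover have "\<forall>\<^sub>F w in nhds z. w \<in> N j" using open_N[OF j] z(1) by (rule eventually_nhds_in_open)
  ultimately show "\<forall>\<^sub>F w in nhds z. w \<in> {z \<in> N j. \<psi> j z \<in> \<psi> i ` V}"
    using F(3) by eventually_elim force
qed

lemma openin_patch: "i \<in> I \<Longrightarrow> openin glued_topology (patch i)"
  unfolding patch_def by (rule openin_\<psi>_image) (use open_N in auto)

lemma open_overlap: "i \<in> I \<Longrightarrow> j \<in> I \<Longrightarrow> open (overlap i j)"
  using openin_patch[of j] by (simp add: openin_glued overlap_def)

text \<open>Locally every coordinate change is one of the isometries from the compatibility
  condition, so the analytic properties of the coordinate changes can be read off from it.\<close>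
lemma change_local_isometry:
  assumes ij: "i \<in> I" "j \<in> I" and z: "z \<in> overlap i j"
  obtains F where "hyp_isometry F" "\<forall>\<^sub>F w in nhds z. change i j w = F w"
proof -
  have z': "z \<in> N i" "coord j (\<psi> i z) \<in> N j" "\<psi> i z = \<psi> j (coord j (\<psi> i z))"
    using z by (auto simp: overlap_def \<psi>_coord)
  obtain F where F: "hyp_isometry F" "\<forall>\<^sub>F w in nhds z. F w \<in> N j \<and> \<psi> j (F w) = \<psi> i w"
    using compatible[OF ij z'] by auto
  from F(2) have "\<forall>\<^sub>F w in nhds z. change i j w = F w"
    by eventually_elim (use ij in \<open>metis change_def coord_\<psi>\<close>)
  with F(1) show ?thesis by (rule that)
qed

lemma change_DERIV:
  assumes ij: "i \<in> I" "j \<in> I" and z: "z \<in> overlap i j"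
  shows "(change i j has_field_derivative deriv (change i j) z) (at z)"
    and "conformal_factor (change i j z) * cmod (deriv (change i j) z) = conformal_factor z"
proof -
  have zd: "z \<in> disc" using z N_subset_disc[OF ij(1)] by (auto simp: overlap_def)
  obtain F where F: "hyp_isometry F" "\<forall>\<^sub>F w in nhds z. change i j w = F w"
    using change_local_isometry[OF assms] .
  have d: "(change i j has_field_derivative deriv F z) (at z)"
    using DERIV_cong_ev[OF refl F(2) refl] hyp_isometry_DERIV[OF F(1) zd] by blast
  then have eq: "deriv (change i j) z = deriv F z" by (rule DERIV_imp_deriv)
  show "(change i j has_field_derivative deriv (change i j) z) (at z)" using d eq by simp
  have "change i j z = F z" using F(2) by (rule eventually_nhds_x_imp_x)
  then show "conformal_factor (change i j z) * cmod (deriv (change i j) z) = conformal_factor z"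
    using F(1) zd eq unfolding hyp_isometry_def by simp
qed

lemma change_holomorphic: "i \<in> I \<Longrightarrow> j \<in> I \<Longrightarrow> change i j holomorphic_on overlap i j"
  using change_DERIV(1) open_overlap by (auto simp: holomorphic_on_open)

lemma continuous_deriv_change: "i \<in> I \<Longrightarrow> j \<in> I \<Longrightarrow> continuous_on (overlap i j) (deriv (change i j))"
  by (intro holomorphic_on_imp_continuous_on holomorphic_deriv change_holomorphic open_overlap)

lemma conformal_factor_N_pos: "i \<in> I \<Longrightarrow> z \<in> N i \<Longrightarrow> conformal_factor z > 0"
  using N_subset_disc conformal_factor_pos by blast

subsection \<open>The smooth structure\<close>

lemma glued_chart_image: "i \<in> I \<Longrightarrow> V \<subseteq> N i \<Longrightarrow> snd (glued_chart i) ` (\<psi> i ` V) = vec_of_complex ` V"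
  by (auto simp: glued_chart_def image_image subset_iff intro!: image_cong)

lemma is_chart_glued: assumes i: "i \<in> I" shows "is_chart glued_topology (glued_chart i)"
proof -
  let ?\<phi> = "\<lambda>p. vec_of_complex (coord i p)"
  have img: "?\<phi> ` patch i = vec_of_complex ` N i"
    using glued_chart_image[OF i subset_refl] by (simp add: glued_chart_def patch_def)
  have top: "topspace (subtopology glued_topology (patch i)) = patch i" by simp
  have "homeomorphic_map (subtopology glued_topology (patch i)) (top_of_set (?\<phi> ` patch i)) ?\<phi>"
  proof (rule bijective_open_imp_homeomorphic_map)
    show "continuous_map (subtopology glued_topology (patch i)) (top_of_set (?\<phi> ` patch i)) ?\<phi>"
      unfolding continuous_map_in_subtopology
    proof (intro conjI)
      show "continuous_map (subtopology glued_topology (patch i)) euclidean ?\<phi>"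
        unfolding continuous_map
      proof (intro conjI allI impI)
        fix W :: "(real^2) set" assume "openin euclidean W"
        then have "open (complex_of_vec ` W)"
          using open_vec_of_complex_image[of "complex_of_vec ` W"] by (simp add: image_image)
        then have "openin glued_topology (\<psi> i ` (N i \<inter> complex_of_vec ` W))"
          using open_N[OF i] by (intro openin_\<psi>_image[OF i]) auto
        moreover have "{p \<in> patch i. ?\<phi> p \<in> W} = \<psi> i ` (N i \<inter> complex_of_vec ` W)"
          using i by (force simp: patch_def image_iff)
        ultimately show "openin (subtopology glued_topology (patch i))
            {p \<in> topspace (subtopology glued_topology (patch i)). ?\<phi> p \<in> W}"
          unfolding top using openin_patch[OF i] by (simp add: openin_open_subtopology) (auto simp: patch_def)
      qed auto
    qed auto
    show "open_map (subtopology glued_topology (patch i)) (top_of_set (?\<phi> ` patch i)) ?\<phi>"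
      unfolding open_map_def
    proof (intro allI impI)
      fix U assume "openin (subtopology glued_topology (patch i)) U"
      then have U: "openin glued_topology U" "U \<subseteq> patch i"
        using openin_patch[OF i] by (auto simp: openin_open_subtopology)
      have "open {z \<in> N i. \<psi> i z \<in> U}" using U(1) i by (simp add: openin_glued)
      moreover have "?\<phi> ` U = vec_of_complex ` {z \<in> N i. \<psi> i z \<in> U}"
      proof -
        have "U = \<psi> i ` {z \<in> N i. \<psi> i z \<in> U}" using U(2) by (auto simp: patch_def)
        then show ?thesis
          using glued_chart_image[OF i, of "{z \<in> N i. \<psi> i z \<in> U}"] by (simp add: glued_chart_def)
      qed
      ultimately have "open (?\<phi> ` U)" by simp
      then show "openin (top_of_set (?\<phi> ` patch i)) (?\<phi> ` U)"
        by (rule open_subset[OF image_mono[OF U(2)]])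
    qed
    show "?\<phi> ` topspace (subtopology glued_topology (patch i)) = topspace (top_of_set (?\<phi> ` patch i))" by simp
    show "inj_on ?\<phi> (topspace (subtopology glued_topology (patch i)))"
      unfolding top by (rule inj_onI) (metis \<psi>_coord(1) vec_of_complex_inverse)
  qed
  then show ?thesis
    unfolding is_chart_def glued_chart_def using openin_patch[OF i] img open_N[OF i] by simp
qed

lemma overlap_image:
  assumes "i \<in> I"
  shows "snd (glued_chart i) ` (fst (glued_chart i) \<inter> fst (glued_chart j)) = vec_of_complex ` overlap i j"
proof -
  have "patch i \<inter> patch j = \<psi> i ` overlap i j" by (auto simp: patch_def overlap_def)
  then show ?thesis using glued_chart_image[OF assms, of "overlap i j"] by (auto simp: glued_chart_def overlap_def)
qed

lemma inv_glued_chart: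
  assumes "i \<in> I" "z \<in> N i"
  shows "inv_into (fst (glued_chart i)) (snd (glued_chart i)) (vec_of_complex z) = \<psi> i z"
proof -
  have "inj_on (snd (glued_chart i)) (fst (glued_chart i))"
  proof (rule inj_onI)
    fix p q assume pq: "p \<in> fst (glued_chart i)" "q \<in> fst (glued_chart i)"
      and "snd (glued_chart i) p = snd (glued_chart i) q"
    then have "coord i p = coord i q"
      unfolding glued_chart_def snd_conv by (metis vec_of_complex_inverse)
    then have "\<psi> i (coord i p) = \<psi> i (coord i q)" by simp
    moreover have "p \<in> patch i" "q \<in> patch i" using pq by (simp_all add: glued_chart_def)
    ultimately show "p = q" by (simp only: \<psi>_coord(1))
  qed
  moreover have "\<psi> i z \<in> fst (glued_chart i)" using assms by (simp add: glued_chart_def patch_def)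
  moreover have "snd (glued_chart i) (\<psi> i z) = vec_of_complex z" using assms by (simp add: glued_chart_def)
  ultimately show ?thesis by (rule inv_into_f_eq)
qed

lemma transition_glued:
  assumes "i \<in> I" "x \<in> vec_of_complex ` overlap i j"
  shows "transition (glued_chart i) (glued_chart j) x = vec_of_complex (change i j (complex_of_vec x))"
proof -
  obtain z where z: "x = vec_of_complex z" "z \<in> overlap i j" using assms by auto
  then have "z \<in> N i" by (simp add: overlap_def)
  then show ?thesis using inv_glued_chart[OF assms(1)] z(1)
    by (simp add: transition_def change_def) (simp add: glued_chart_def)
qed

lemma transition_glued_derivative:
  assumes ij: "i \<in> I" "j \<in> I" and z: "z \<in> overlap i j"
  shows "frechet_derivative (transition (glued_chart i) (glued_chart j)) (at (vec_of_complex z)) =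
     (\<lambda>v. vec_of_complex (deriv (change i j) z * complex_of_vec v))"
proof -
  have "((\<lambda>x. vec_of_complex (change i j (complex_of_vec x))) has_derivative
     (\<lambda>v. vec_of_complex (deriv (change i j) z * complex_of_vec v))) (at (vec_of_complex z))"
    using holomorphic_has_derivative_vec[of "change i j" "vec_of_complex z"] change_DERIV(1)[OF assms]
    by (auto simp: field_differentiable_def)
  then have "(transition (glued_chart i) (glued_chart j) has_derivative
     (\<lambda>v. vec_of_complex (deriv (change i j) z * complex_of_vec v))) (at (vec_of_complex z))"
  proof (rule has_derivative_transform_within_open)
    show "open (vec_of_complex ` overlap i j)" using open_overlap[OF ij] by simp
    show "vec_of_complex z \<in> vec_of_complex ` overlap i j" using z by simp
  qed (simp add: transition_glued[OF ij(1)])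
  then show ?thesis by (rule frechet_derivative_at[symmetric])
qed

lemma smooth_atlas_glued: "smooth_atlas glued_topology (glued_chart ` I)"
  unfolding smooth_atlas_def
proof (intro conjI ballI)
  show "is_chart glued_topology c" if "c \<in> glued_chart ` I" for c
    using that is_chart_glued by auto
  show "(\<Union>c\<in>glued_chart ` I. fst c) = topspace glued_topology"
    using covering by (simp add: glued_chart_def patch_def)
  fix c d assume "c \<in> glued_chart ` I" "d \<in> glued_chart ` I"
  then obtain i j where ij: "i \<in> I" "j \<in> I" "c = glued_chart i" "d = glued_chart j" by auto
  have "Ck_on k (vec_of_complex ` overlap i j) (transition c d)" for k
  proof (rule Ck_on_cong_open)
    show "Ck_on k (vec_of_complex ` overlap i j) (\<lambda>x. vec_of_complex (change i j (complex_of_vec x)))"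
      by (rule Ck_on_holomorphic[OF open_overlap[OF ij(1,2)] change_holomorphic[OF ij(1,2)]])
    show "open (vec_of_complex ` overlap i j)" using open_overlap[OF ij(1,2)] by simp
  qed (simp add: ij transition_glued[OF ij(1)])
  then show "smooth_on (snd c ` (fst c \<inter> fst d)) (transition c d)"
    using overlap_image[OF ij(1)] ij by (simp add: smooth_on_def)
qed

lemma oriented_atlas_glued: "oriented_atlas (glued_chart ` I)"
  unfolding oriented_atlas_def
proof (intro ballI)
  fix c d p assume "c \<in> glued_chart ` I" "d \<in> glued_chart ` I" and p: "p \<in> fst c \<inter> fst d"
  then obtain i j where ij: "i \<in> I" "j \<in> I" "c = glued_chart i" "d = glued_chart j" by auto
  have z: "coord i p \<in> overlap i j" using p ij by (auto simp: overlap_def glued_chart_def \<psi>_coord)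
  then have "deriv (change i j) (coord i p) \<noteq> 0"
    using change_DERIV(2)[OF ij(1,2) z] conformal_factor_N_pos[OF ij(1), of "coord i p"] by (auto simp: overlap_def)
  then show "det (matrix (frechet_derivative (transition c d) (at (snd c p)))) > 0"
    using transition_glued_derivative[OF ij(1,2) z] ij
    by (simp add: glued_chart_def det_multiplication_matrix)
qed

lemma orientable_glued: "orientable glued_surface"
  unfolding orientable_def orientable_atlas_def glued_surface_def
  using smooth_atlas_glued oriented_atlas_glued by (auto intro!: exI[of _ "glued_chart ` I"])

lemma inner_vec_of_complex: "vec_of_complex z \<bullet> vec_of_complex w = Re z * Re w + Im z * Im w"
  by (simp add: vec_of_complex_def inner_vec_def sum_2)

lemma inner_mult_complex:
  "vec_of_complex (c * z) \<bullet> vec_of_complex (c * w) = (cmod c)\<^sup>2 * (vec_of_complex z \<bullet> vec_of_complex w)"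
  unfolding inner_vec_of_complex cmod_power2 by (simp add: algebra_simps power2_eq_square)

lemma metric_glued: "metric glued_surface c p u v = (2 * \<mu> / (1 - (norm (snd c p))\<^sup>2))\<^sup>2 * (u \<bullet> v)"
  by (simp add: glued_surface_def)

lemma metric_glued_chart:
  "metric glued_surface (glued_chart i) p u v = (\<mu> * conformal_factor (coord i p))\<^sup>2 * (u \<bullet> v)"
  by (simp add: metric_glued glued_chart_def conformal_factor_def mult.commute)

lemma riemannian_metric_glued: "riemannian_metric (atlas glued_surface) (metric glued_surface)"
proof -
  have A: "atlas glued_surface = glued_chart ` I" by (simp add: glued_surface_def)
  have 1: "bilinear (metric glued_surface c p) \<and> (\<forall>u v. metric glued_surface c p u v = metric glued_surface c p v u) \<and>
        (\<forall>u. u \<noteq> 0 \<longrightarrow> metric glued_surface c p u u > 0)"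
    if c: "c \<in> glued_chart ` I" "p \<in> fst c" for c p
  proof -
    obtain i where i: "i \<in> I" "c = glued_chart i" using c by auto
    then have "conformal_factor (coord i p) > 0"
      using c conformal_factor_N_pos[OF i(1), of "coord i p"] by (simp add: glued_chart_def \<psi>_coord)
    then have "\<mu> * conformal_factor (coord i p) > 0" using mu_pos by simp
    then have "metric glued_surface c p u u > 0" if "u \<noteq> 0" for u
      unfolding i(2) metric_glued_chart using that by (intro mult_pos_pos) auto
    moreover have "bilinear (metric glued_surface c p)" "metric glued_surface c p u v = metric glued_surface c p v u" for u v
      unfolding i(2) by (simp_all add: metric_glued_chart bilinear_def inner_commute linear_iff
          inner_add_left inner_add_right algebra_simps)
    ultimately show ?thesis by blast
  qed
  have 2: "smooth_on (snd c ` fst c) (\<lambda>x. metric glued_surface c (inv_into (fst c) (snd c) x) u v)"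
    if c: "c \<in> glued_chart ` I" for c u v
  proof -
    obtain i where i: "i \<in> I" "c = glued_chart i" using c by auto
    let ?U = "vec_of_complex ` N i"
    have U: "snd c ` fst c = ?U"
      using glued_chart_image[OF i(1) subset_refl] i by (simp add: glued_chart_def patch_def)
    have op: "open ?U" using open_N[OF i(1)] by simp
    have nz: "1 + (-1) * (norm x)\<^sup>2 \<noteq> 0" if "x \<in> ?U" for x
    proof -
      obtain z where "z \<in> N i" "x = vec_of_complex z" using \<open>x \<in> ?U\<close> by blast
      then have "cmod z < 1" "norm x = cmod z" using N_subset_disc[OF i(1)] by auto
      then have "(norm x)\<^sup>2 < 1" by (simp add: abs_square_less_1)
      then show ?thesis by simp
    qed
    have "Ck_on k ?U (\<lambda>x. ((2 * \<mu>) * inverse (1 + (-1) * (norm x)\<^sup>2)) * ((2 * \<mu>) * inverse (1 + (-1) * (norm x)\<^sup>2)) * (u \<bullet> v))" for k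
      by (intro Ck_on_mult Ck_on_const Ck_on_inverse Ck_on_add Ck_on_norm_square op nz)
    then have "Ck_on k ?U (\<lambda>x. metric glued_surface c (inv_into (fst c) (snd c) x) u v)" for k
    proof (rule Ck_on_cong_open[OF op, rotated])
      fix x assume x: "x \<in> ?U"
      have "snd c (inv_into (fst c) (snd c) x) = x"
        using x unfolding U[symmetric] by (rule f_inv_into_f)
      then show "((2 * \<mu>) * inverse (1 + (-1) * (norm x)\<^sup>2)) * ((2 * \<mu>) * inverse (1 + (-1) * (norm x)\<^sup>2)) * (u \<bullet> v)
         = metric glued_surface c (inv_into (fst c) (snd c) x) u v"
        by (simp add: metric_glued power2_eq_square divide_inverse)
    qed
    then show ?thesis unfolding U by (simp add: smooth_on_def)
  qed
  have 3: "metric glued_surface c p u v = metric glued_surface d p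
       (frechet_derivative (transition c d) (at (snd c p)) u) (frechet_derivative (transition c d) (at (snd c p)) v)"
    if c: "c \<in> glued_chart ` I" "d \<in> glued_chart ` I" "p \<in> fst c \<inter> fst d" for c d p u v
  proof -
    obtain i j where ij: "i \<in> I" "j \<in> I" "c = glued_chart i" "d = glued_chart j" using c by auto
    have z: "coord i p \<in> overlap i j" using c ij by (auto simp: overlap_def glued_chart_def \<psi>_coord)
    have p: "\<psi> i (coord i p) = p" using c ij by (simp add: glued_chart_def \<psi>_coord)
    have "metric glued_surface c p u v = (\<mu> * conformal_factor (coord i p))\<^sup>2 * (u \<bullet> v)"
      using ij by (simp add: metric_glued_chart)
    also have "\<dots> = (\<mu> * conformal_factor (coord j p))\<^sup>2 * ((cmod (deriv (change i j) (coord i p)))\<^sup>2 * (u \<bullet> v))"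
      using change_DERIV(2)[OF ij(1,2) z, symmetric] p by (simp add: change_def power_mult_distrib)
    also have "\<dots> = metric glued_surface d p
       (frechet_derivative (transition c d) (at (snd c p)) u) (frechet_derivative (transition c d) (at (snd c p)) v)"
      using transition_glued_derivative[OF ij(1,2) z] ij
        inner_mult_complex[of "deriv (change i j) (coord i p)" "complex_of_vec u" "complex_of_vec v"]
      by (simp add: metric_glued_chart) (simp add: glued_chart_def)
    finally show ?thesis .
  qed
  show ?thesis unfolding riemannian_metric_def A
    by (intro conjI ballI allI 2 3) (use 1 in simp_all)
qed

lemma second_countable_glued: "second_countable glued_topology"
proof -
  obtain B :: "complex set set" where B: "countable B" "\<And>V. V \<in> B \<Longrightarrow> open V"
    "\<And>U. open U \<Longrightarrow> \<exists>B'\<subseteq>B. U = \<Union>B'"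
    using univ_second_countable by metis
  let ?\<B> = "\<Union>i\<in>I. (\<lambda>V. \<psi> i ` (V \<inter> N i)) ` B"
  have "countable ?\<B>" using countable_finite[OF finite_I] B(1) by (intro countable_UN countable_image)
  moreover have "\<forall>V\<in>?\<B>. openin glued_topology V"
    using B(2) open_N by (auto intro!: openin_\<psi>_image)
  moreover have "\<exists>V\<in>?\<B>. x \<in> V \<and> V \<subseteq> U" if U: "openin glued_topology U" "x \<in> U" for U x
  proof -
    obtain i z where i: "i \<in> I" "z \<in> N i" "\<psi> i z = x" using obtain_chart .
    have "open {z \<in> N i. \<psi> i z \<in> U}" using U i by (simp add: openin_glued)
    then obtain B' where B': "B' \<subseteq> B" "{z \<in> N i. \<psi> i z \<in> U} = \<Union>B'" using B(3) by blast
    then obtain V where V: "V \<in> B'" "z \<in> V" using i U(2) by blast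
    then have "\<psi> i ` (V \<inter> N i) \<subseteq> U" using B'(2) by blast
    moreover have "x \<in> \<psi> i ` (V \<inter> N i)" using V(2) i by auto
    moreover have "\<psi> i ` (V \<inter> N i) \<in> ?\<B>" using V(1) B'(1) i(1) by auto
    ultimately show ?thesis by (intro bexI[of _ "\<psi> i ` (V \<inter> N i)"] conjI)
  qed
  ultimately have "countable ?\<B> \<and> (\<forall>V\<in>?\<B>. openin glued_topology V) \<and>
      (\<forall>U x. openin glued_topology U \<and> x \<in> U \<longrightarrow> (\<exists>V\<in>?\<B>. x \<in> V \<and> V \<subseteq> U))"
    by (intro conjI allI impI) simp_all
  then show ?thesis unfolding second_countable_def by (rule exI)
qed

end

section \<open>Piecewise smooth curves\<close>

text \<open>An inductive description of piecewise curves, closed under concatenation; it replaces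
  partitions in the proofs.\<close>
inductive piecewise_C1_on :: "'p riem_surface \<Rightarrow> (real \<Rightarrow> 'p) \<Rightarrow> real \<Rightarrow> real \<Rightarrow> bool"
  for S \<gamma> where
  single: "a < b \<Longrightarrow> C1_curve_on S a b \<gamma> \<Longrightarrow> piecewise_C1_on S \<gamma> a b"
| join: "piecewise_C1_on S \<gamma> a b \<Longrightarrow> piecewise_C1_on S \<gamma> b c \<Longrightarrow> piecewise_C1_on S \<gamma> a c"

lemma piecewise_C1_on_less: "piecewise_C1_on S \<gamma> a b \<Longrightarrow> a < b"
  by (induction rule: piecewise_C1_on.induct) auto

lemma piecewise_C1_curve_iff: "piecewise_C1_curve S \<gamma> \<longleftrightarrow> piecewise_C1_on S \<gamma> 0 1"
proof
  assume "piecewise_C1_curve S \<gamma>"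
  then obtain n and t :: "nat \<Rightarrow> real" where t: "t 0 = 0" "t n = 1"
    "\<And>i. i < n \<Longrightarrow> t i < t (Suc i) \<and> C1_curve_on S (t i) (t (Suc i)) \<gamma>"
    unfolding piecewise_C1_curve_def by blast
  have pw: "Suc k \<le> n \<Longrightarrow> piecewise_C1_on S \<gamma> (t 0) (t (Suc k))" for k
  proof (induction k)
    case 0
    then show ?case using t(3)[of 0] by (auto intro: single)
  next
    case (Suc k)
    then show ?case using t(3)[of "Suc k"] by (auto intro: join single)
  qed
  have "n \<noteq> 0" using t by (metis zero_neq_one)
  then show "piecewise_C1_on S \<gamma> 0 1" using pw[of "n - 1"] t(1,2) by simp
next
  have "\<exists>n (t :: nat \<Rightarrow> real). t 0 = a \<and> t n = b \<and>
     (\<forall>i<n. t i < t (Suc i) \<and> C1_curve_on S (t i) (t (Suc i)) \<gamma>)" if "piecewise_C1_on S \<gamma> a b" for a b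
    using that
  proof (induction rule: piecewise_C1_on.induct)
    case (single a b)
    then show ?case by (intro exI[of _ "1::nat"] exI[of _ "\<lambda>i. if i = 0 then a else b"]) auto
  next
    case (join a b c)
    obtain n s where s: "s 0 = a" "s n = b" "\<And>i. i < n \<Longrightarrow> s i < s (Suc i) \<and> C1_curve_on S (s i) (s (Suc i)) \<gamma>"
      using join.IH(1) by blast
    obtain m t where t: "t 0 = b" "t m = c" "\<And>i. i < m \<Longrightarrow> t i < t (Suc i) \<and> C1_curve_on S (t i) (t (Suc i)) \<gamma>"
      using join.IH(2) by blast
    define r where "r i = (if i \<le> n then s i else t (i - n))" for i
    have "r i < r (Suc i) \<and> C1_curve_on S (r i) (r (Suc i)) \<gamma>" if "i < n + m" for i
    proof (cases "i < n")
      case True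
      then show ?thesis using s(3)[OF True] by (simp add: r_def)
    next
      case False
      then have "r i = t (i - n)" "r (Suc i) = t (Suc (i - n))"
        using s(2) t(1) by (auto simp: r_def Suc_diff_le)
      then show ?thesis using t(3)[of "i - n"] False that by simp
    qed
    moreover have "r 0 = a" "r (n + m) = c" using s t by (auto simp: r_def)
    ultimately show ?case by blast
  qed
  then show "piecewise_C1_on S \<gamma> 0 1 \<Longrightarrow> piecewise_C1_curve S \<gamma>"
    unfolding piecewise_C1_curve_def by blast
qed

lemma C1_curve_on_cong:
  assumes "\<And>t. t \<in> {a..b} \<Longrightarrow> \<gamma> t = \<gamma>' t" "C1_curve_on S a b \<gamma>"
  shows "C1_curve_on S a b \<gamma>'"
proof -
  have 1: "continuous_map (top_of_set {a..b}) (topo S) \<gamma>'"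
    using assms by (auto simp: C1_curve_on_def intro: continuous_map_eq)
  have 2: "{t \<in> {a..b}. \<gamma>' t \<in> U} = {t \<in> {a..b}. \<gamma> t \<in> U}" for U using assms(1) by auto
  have 3: "((\<phi> \<circ> \<gamma>') has_vector_derivative D) (at t within {a..b}) \<longleftrightarrow>
       ((\<phi> \<circ> \<gamma>) has_vector_derivative D) (at t within {a..b})" if "t \<in> {a..b}" for \<phi> :: "'a \<Rightarrow> real^2" and D t
    using has_vector_derivative_transform[OF that, of "\<phi> \<circ> \<gamma>" "\<phi> \<circ> \<gamma>'"]
      has_vector_derivative_transform[OF that, of "\<phi> \<circ> \<gamma>'" "\<phi> \<circ> \<gamma>"] assms(1) by auto
  have "\<exists>\<gamma>''. (\<forall>t\<in>{t \<in> {a..b}. \<gamma>' t \<in> U}. ((\<phi> \<circ> \<gamma>') has_vector_derivative \<gamma>'' t) (at t within {a..b})) \<and>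
      continuous_on {t \<in> {a..b}. \<gamma>' t \<in> U} \<gamma>''" if c: "(U, \<phi>) \<in> atlas S" for U \<phi>
  proof -
    obtain g where "\<forall>t\<in>{t \<in> {a..b}. \<gamma> t \<in> U}. ((\<phi> \<circ> \<gamma>) has_vector_derivative g t) (at t within {a..b})"
      "continuous_on {t \<in> {a..b}. \<gamma> t \<in> U} g"
      using c assms(2) unfolding C1_curve_on_def by blast
    then show ?thesis unfolding 2 using 3 by (intro exI[of _ g]) auto
  qed
  with 1 show ?thesis unfolding C1_curve_on_def by blast
qed

lemma speed_cong:
  assumes "\<forall>\<^sub>F s in nhds t. \<gamma> s = \<gamma>' s"
  shows "speed S \<gamma> t = speed S \<gamma>' t"
proof -
  have "\<gamma> t = \<gamma>' t" using assms by (rule eventually_nhds_x_imp_x)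
  moreover have "vector_derivative (\<phi> \<circ> \<gamma>) (at t) = vector_derivative (\<phi> \<circ> \<gamma>') (at t)" for \<phi> :: "'a \<Rightarrow> real^2"
    by (rule vector_derivative_cong_eq) (use assms in \<open>auto elim: eventually_mono\<close>)
  ultimately show ?thesis by (simp add: speed_def)
qed

lemma piecewise_C1_on_cong:
  assumes "piecewise_C1_on S \<gamma> a b" "\<And>t. t \<in> {a..b} \<Longrightarrow> \<gamma> t = \<gamma>' t"
  shows "piecewise_C1_on S \<gamma>' a b"
  using assms
proof (induction rule: piecewise_C1_on.induct)
  case (single a b)
  then show ?case by (meson C1_curve_on_cong piecewise_C1_on.single)
next
  case (join a b c)
  have "a < b" "b < c" using join.hyps piecewise_C1_on_less by blast+
  then show ?case using join by (auto intro!: piecewise_C1_on.join[of _ _ a b c])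
qed

lemma integral_speed_cong:
  assumes "\<And>t. t \<in> {a..b} \<Longrightarrow> \<gamma> t = \<gamma>' t"
  shows "(speed S \<gamma> has_integral L) {a..b} \<longleftrightarrow> (speed S \<gamma>' has_integral L) {a..b}"
proof -
  have "speed S \<gamma>' t = speed S \<gamma> t" if "t \<in> box a b" for t
  proof (rule speed_cong)
    have "\<forall>\<^sub>F s in nhds t. s \<in> box a b" using that by (intro eventually_nhds_in_open) auto
    then show "\<forall>\<^sub>F s in nhds t. \<gamma>' s = \<gamma> s" by eventually_elim (use assms in auto)
  qed
  from has_integral_spike_interior_eq[of a b, OF this] show ?thesis by simp
qed

context isometric_atlas
begin

subsection \<open>Speed and Lipschitz functions along curves\<close>

lemma C1_curve_iff:
  "C1_curve_on glued_surface a b \<gamma> \<longleftrightarrow> continuous_map (top_of_set {a..b}) glued_topology \<gamma> \<and>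
    (\<forall>i\<in>I. \<exists>g. (\<forall>t\<in>{t\<in>{a..b}. \<gamma> t \<in> patch i}. ((\<lambda>s. coord i (\<gamma> s)) has_vector_derivative g t) (at t within {a..b})) \<and>
       continuous_on {t\<in>{a..b}. \<gamma> t \<in> patch i} g)"
proof -
  have eq: "(\<exists>g. (\<forall>t\<in>T. (((\<lambda>p. vec_of_complex (coord i p)) \<circ> \<gamma>) has_vector_derivative g t) (at t within A)) \<and> continuous_on T g) \<longleftrightarrow>
     (\<exists>g. (\<forall>t\<in>T. ((\<lambda>s. coord i (\<gamma> s)) has_vector_derivative g t) (at t within A)) \<and> continuous_on T g)" (is "?L \<longleftrightarrow> ?R") for i T A
  proof
    assume ?L
    then obtain g where g: "\<forall>t\<in>T. (((\<lambda>p. vec_of_complex (coord i p)) \<circ> \<gamma>) has_vector_derivative g t) (at t within A)" "continuous_on T g" by blast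
    have "((\<lambda>s. coord i (\<gamma> s)) has_vector_derivative complex_of_vec (g t)) (at t within A)" if "t \<in> T" for t
      using bounded_linear.has_vector_derivative[OF bounded_linear_complex_of_vec bspec[OF g(1) that]] by (simp add: o_def)
    moreover have "continuous_on T (\<lambda>t. complex_of_vec (g t))" using g(2) by (intro continuous_intros)
    ultimately show ?R by (intro exI[of _ "\<lambda>t. complex_of_vec (g t)"] conjI ballI)
  next
    assume ?R
    then obtain g where g: "\<forall>t\<in>T. ((\<lambda>s. coord i (\<gamma> s)) has_vector_derivative g t) (at t within A)" "continuous_on T g" by blast
    have "(((\<lambda>p. vec_of_complex (coord i p)) \<circ> \<gamma>) has_vector_derivative vec_of_complex (g t)) (at t within A)" if "t \<in> T" for t
      using bounded_linear.has_vector_derivative[OF bounded_linear_vec_of_complex bspec[OF g(1) that]] by (simp add: o_def)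
    moreover have "continuous_on T (\<lambda>t. vec_of_complex (g t))" using g(2) by (intro continuous_intros)
    ultimately show ?L by (intro exI[of _ "\<lambda>t. vec_of_complex (g t)"] conjI ballI)
  qed
  have charts: "(\<forall>(U, \<phi>) \<in> atlas glued_surface. P U \<phi>) \<longleftrightarrow> (\<forall>i\<in>I. P (patch i) (\<lambda>p. vec_of_complex (coord i p)))" for P
    by (simp add: glued_surface_def glued_chart_def)
  have topo: "topo glued_surface = glued_topology" by (simp add: glued_surface_def)
  show ?thesis unfolding C1_curve_on_def charts eq topo ..
qed

lemma eventually_in_patch:
  assumes "continuous_map (top_of_set T) glued_topology \<gamma>" "i \<in> I" "t \<in> T" "\<gamma> t \<in> patch i"
  shows "\<exists>\<delta>>0. \<forall>s\<in>T. dist s t < \<delta> \<longrightarrow> \<gamma> s \<in> patch i"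
proof -
  have "openin (top_of_set T) {s \<in> T. \<gamma> s \<in> patch i}"
    using openin_continuous_map_preimage[OF assms(1) openin_patch[OF assms(2)]] by simp
  moreover have "t \<in> {s \<in> T. \<gamma> s \<in> patch i}" using assms(3,4) by simp
  ultimately show ?thesis unfolding openin_euclidean_subtopology_iff by blast
qed

lemma derivative_in_other_chart:
  assumes ij: "i \<in> I" "j \<in> I" and p: "\<gamma> t \<in> patch i" "\<gamma> t \<in> patch j" and t: "t \<in> T"
    and \<delta>: "\<delta> > 0" "\<And>s. s \<in> T \<Longrightarrow> dist s t < \<delta> \<Longrightarrow> \<gamma> s \<in> patch i"
    and D: "((\<lambda>s. coord i (\<gamma> s)) has_vector_derivative D) (at t within T)"
  shows "((\<lambda>s. coord j (\<gamma> s)) has_vector_derivative D * deriv (change i j) (coord i (\<gamma> t))) (at t within T)"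
    and "conformal_factor (coord j (\<gamma> t)) * cmod (D * deriv (change i j) (coord i (\<gamma> t))) =
         conformal_factor (coord i (\<gamma> t)) * cmod D"
proof -
  have z: "coord i (\<gamma> t) \<in> overlap i j" using p by (simp add: overlap_def \<psi>_coord)
  have ch: "change i j (coord i (\<gamma> s)) = coord j (\<gamma> s)" if "\<gamma> s \<in> patch i" for s
    using that by (simp add: change_def \<psi>_coord)
  have "((change i j \<circ> (\<lambda>s. coord i (\<gamma> s))) has_vector_derivative D * deriv (change i j) (coord i (\<gamma> t))) (at t within T)"
    by (rule field_vector_diff_chain_within[OF D DERIV_subset[OF change_DERIV(1)[OF ij z] subset_UNIV]])
  then show "((\<lambda>s. coord j (\<gamma> s)) has_vector_derivative D * deriv (change i j) (coord i (\<gamma> t))) (at t within T)"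
    by (rule has_vector_derivative_transform_within[OF _ \<delta>(1) t]) (simp add: ch \<delta>(2))
  show "conformal_factor (coord j (\<gamma> t)) * cmod (D * deriv (change i j) (coord i (\<gamma> t))) =
         conformal_factor (coord i (\<gamma> t)) * cmod D"
    using change_DERIV(2)[OF ij z] ch[OF p(1)] by (simp add: norm_mult)
qed

text \<open>The speed is defined with an arbitrarily selected chart; the compatibility makes the choice
  irrelevant.\<close>
lemma speed_eq:
  assumes i: "i \<in> I" "\<gamma> t \<in> patch i" and \<delta>: "\<delta> > 0" "\<And>s. dist s t < \<delta> \<Longrightarrow> \<gamma> s \<in> patch i"
    and D: "((\<lambda>s. coord i (\<gamma> s)) has_vector_derivative D) (at t)"
  shows "speed glued_surface \<gamma> t = \<mu> * (conformal_factor (coord i (\<gamma> t)) * cmod D)"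
proof -
  define c where "c = (SOME c. c \<in> atlas glued_surface \<and> \<gamma> t \<in> fst c)"
  have "\<exists>c. c \<in> atlas glued_surface \<and> \<gamma> t \<in> fst c"
    using i by (auto simp: glued_surface_def glued_chart_def)
  then have "c \<in> atlas glued_surface \<and> \<gamma> t \<in> fst c" unfolding c_def by (rule someI_ex)
  then obtain j where j: "j \<in> I" "c = glued_chart j" "\<gamma> t \<in> patch j"
    by (auto simp: glued_surface_def glued_chart_def)
  define E where "E = D * deriv (change i j) (coord i (\<gamma> t))"
  have E: "((\<lambda>s. coord j (\<gamma> s)) has_vector_derivative E) (at t)"
    "conformal_factor (coord j (\<gamma> t)) * cmod E = conformal_factor (coord i (\<gamma> t)) * cmod D"
    unfolding E_def using derivative_in_other_chart[OF i(1) j(1) i(2) j(3) UNIV_I \<delta>(1) _ D] \<delta>(2) by auto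
  have "((snd c \<circ> \<gamma>) has_vector_derivative vec_of_complex E) (at t)"
    using bounded_linear.has_vector_derivative[OF bounded_linear_vec_of_complex E(1)] j(2)
    by (simp add: glued_chart_def o_def)
  then have v: "vector_derivative (snd c \<circ> \<gamma>) (at t) = vec_of_complex E" by (rule vector_derivative_at)
  have pos: "\<mu> * conformal_factor (coord j (\<gamma> t)) > 0"
    using mu_pos conformal_factor_N_pos[OF j(1), of "coord j (\<gamma> t)"] j(3) by (simp add: \<psi>_coord)
  have "speed glued_surface \<gamma> t = sqrt ((\<mu> * conformal_factor (coord j (\<gamma> t)))\<^sup>2 * (vec_of_complex E \<bullet> vec_of_complex E))"
    unfolding speed_def c_def[symmetric] Let_def v unfolding j(2) metric_glued_chart ..
  also have "\<dots> = (\<mu> * conformal_factor (coord j (\<gamma> t))) * cmod E"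
    unfolding power2_norm_eq_inner[symmetric] real_sqrt_mult real_sqrt_abs using pos by simp
  finally show ?thesis using E(2) by (simp add: mult.assoc)
qed

lemma speed_nonneg: "speed glued_surface \<gamma> t \<ge> 0"
  by (simp add: speed_def Let_def metric_glued)

text \<open>On a closed parameter interval the one-sided derivatives give a continuous version of the
  speed, which differs from it at most at the two ends.\<close>
lemma continuous_one_sided_speed:
  assumes ab: "a < b" and C: "C1_curve_on glued_surface a b \<gamma>"
  obtains \<sigma> where "continuous_on {a..b} \<sigma>"
    "\<And>t. t \<in> {a<..<b} \<Longrightarrow> speed glued_surface \<gamma> t = \<sigma> t"
    "\<And>i t. i \<in> I \<Longrightarrow> t \<in> {a..b} \<Longrightarrow> \<gamma> t \<in> patch i \<Longrightarrow> \<exists>D.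
       ((\<lambda>s. coord i (\<gamma> s)) has_vector_derivative D) (at t within {a..b}) \<and>
       \<sigma> t = \<mu> * (conformal_factor (coord i (\<gamma> t)) * cmod D)"
proof -
  have cont: "continuous_map (top_of_set {a..b}) glued_topology \<gamma>" using C by (simp add: C1_curve_iff)
  have "\<exists>i. i \<in> I \<and> \<gamma> t \<in> patch i" for t using obtain_chart by (metis \<psi>_in_patch)
  then obtain ch where ch: "\<And>t. ch t \<in> I" "\<And>t. \<gamma> t \<in> patch (ch t)" by metis
  define \<sigma> where "\<sigma> t = \<mu> * (conformal_factor (coord (ch t) (\<gamma> t)) *
     cmod (vector_derivative (\<lambda>s. coord (ch t) (\<gamma> s)) (at t within {a..b})))" for t
  have "\<forall>i\<in>I. \<exists>g. (\<forall>t\<in>{t\<in>{a..b}. \<gamma> t \<in> patch i}. ((\<lambda>s. coord i (\<gamma> s)) has_vector_derivative g t) (at t within {a..b})) \<and>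
       continuous_on {t\<in>{a..b}. \<gamma> t \<in> patch i} g" using C by (simp add: C1_curve_iff)
  from bchoice[OF this] obtain g where g0: "\<forall>i\<in>I. (\<forall>t\<in>{t\<in>{a..b}. \<gamma> t \<in> patch i}.
       ((\<lambda>s. coord i (\<gamma> s)) has_vector_derivative g i t) (at t within {a..b})) \<and>
       continuous_on {t\<in>{a..b}. \<gamma> t \<in> patch i} (g i)" by (rule exE)
  have g: "\<And>i t. i \<in> I \<Longrightarrow> t \<in> {a..b} \<Longrightarrow> \<gamma> t \<in> patch i \<Longrightarrow>
      ((\<lambda>s. coord i (\<gamma> s)) has_vector_derivative g i t) (at t within {a..b})"
    "\<And>i. i \<in> I \<Longrightarrow> continuous_on {t\<in>{a..b}. \<gamma> t \<in> patch i} (g i)"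
    using g0 by simp_all
  have \<sigma>: "\<sigma> t = \<mu> * (conformal_factor (coord i (\<gamma> t)) * cmod (g i t))"
    if i: "i \<in> I" and t: "t \<in> {a..b}" and p: "\<gamma> t \<in> patch i" for i t
  proof -
    obtain \<delta> where \<delta>: "\<delta> > 0" "\<And>s. s \<in> {a..b} \<Longrightarrow> dist s t < \<delta> \<Longrightarrow> \<gamma> s \<in> patch i"
      using eventually_in_patch[OF cont i t p] by blast
    note d = derivative_in_other_chart[OF i ch(1) p ch(2) t \<delta> g(1)[OF i t p]]
    have "vector_derivative (\<lambda>s. coord (ch t) (\<gamma> s)) (at t within {a..b}) = g i t * deriv (change i (ch t)) (coord i (\<gamma> t))"
      using vector_derivative_within_cbox[of a b t] ab t d(1) by simp
    then show ?thesis unfolding \<sigma>_def using d(2) by simp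
  qed
  show ?thesis
  proof (rule that[of \<sigma>])
    show "\<exists>D. ((\<lambda>s. coord i (\<gamma> s)) has_vector_derivative D) (at t within {a..b}) \<and>
       \<sigma> t = \<mu> * (conformal_factor (coord i (\<gamma> t)) * cmod D)"
      if "i \<in> I" "t \<in> {a..b}" "\<gamma> t \<in> patch i" for i t
      using g(1)[OF that] \<sigma>[OF that] by blast
    show "speed glued_surface \<gamma> t = \<sigma> t" if t: "t \<in> {a<..<b}" for t
    proof -
      have t': "t \<in> {a..b}" using t by auto
      obtain \<delta> where \<delta>: "\<delta> > 0" "\<And>s. s \<in> {a..b} \<Longrightarrow> dist s t < \<delta> \<Longrightarrow> \<gamma> s \<in> patch (ch t)"
        using eventually_in_patch[OF cont ch(1) t' ch(2)] by blast
      define \<delta>' where "\<delta>' = min \<delta> (min (t - a) (b - t))"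
      have "\<delta>' > 0" using t \<delta>(1) by (simp add: \<delta>'_def)
      moreover have "\<gamma> s \<in> patch (ch t)" if "dist s t < \<delta>'" for s
        using that by (intro \<delta>(2)) (auto simp: \<delta>'_def dist_real_def)
      moreover have "((\<lambda>s. coord (ch t) (\<gamma> s)) has_vector_derivative g (ch t) t) (at t)"
        using g(1)[OF ch(1) t' ch(2)] t by (simp add: at_within_Icc_at)
      ultimately have "speed glued_surface \<gamma> t = \<mu> * (conformal_factor (coord (ch t) (\<gamma> t)) * cmod (g (ch t) t))"
        by (rule speed_eq[OF ch])
      then show ?thesis using \<sigma>[OF ch(1) t' ch(2)] by simp
    qed
    show "continuous_on {a..b} \<sigma>"
      unfolding continuous_on_eq_continuous_within
    proof
      fix t assume t: "t \<in> {a..b}"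
      define T where "T = {s \<in> {a..b}. \<gamma> s \<in> patch (ch t)}"
      have "continuous_on T (\<lambda>s. coord (ch t) (\<gamma> s))"
        unfolding continuous_on_eq_continuous_within
      proof
        fix s assume s: "s \<in> T"
        then have "continuous (at s within {a..b}) (\<lambda>s. coord (ch t) (\<gamma> s))"
          using g(1)[OF ch(1), of s t] by (auto simp: T_def intro: has_vector_derivative_continuous)
        then show "continuous (at s within T) (\<lambda>s. coord (ch t) (\<gamma> s))"
          by (rule continuous_within_subset) (auto simp: T_def)
      qed
      moreover have "1 - (cmod (coord (ch t) (\<gamma> s)))\<^sup>2 \<noteq> 0" if "s \<in> T" for s
      proof -
        have "coord (ch t) (\<gamma> s) \<in> N (ch t)" using that \<psi>_coord(2) by (simp add: T_def)
        then have "coord (ch t) (\<gamma> s) \<in> disc" using N_subset_disc[OF ch(1)] by blast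
        then have "(cmod (coord (ch t) (\<gamma> s)))\<^sup>2 < 1" by (simp add: abs_square_less_1)
        then show ?thesis by simp
      qed
      ultimately have "continuous_on T (\<lambda>s. \<mu> * (conformal_factor (coord (ch t) (\<gamma> s)) * cmod (g (ch t) s)))"
        unfolding conformal_factor_def using g(2)[OF ch(1), of t] by (intro continuous_intros) (auto simp: T_def)
      then have "continuous_on T \<sigma>"
        by (rule continuous_on_eq) (use \<sigma>[OF ch(1), of _ t] in \<open>auto simp: T_def\<close>)
      then have c: "continuous (at t within T) \<sigma>"
        using t ch(2) by (auto simp: continuous_on_eq_continuous_within T_def)
      obtain \<delta> where \<delta>: "\<delta> > 0" "\<And>s. s \<in> {a..b} \<Longrightarrow> dist s t < \<delta> \<Longrightarrow> \<gamma> s \<in> patch (ch t)"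
        using eventually_in_patch[OF cont ch(1) t ch(2)] by blast
      have "{a..b} \<inter> ball t \<delta> - {t} = T \<inter> ball t \<delta> - {t}"
        using \<delta>(2) by (auto simp: T_def dist_commute)
      then have "at t within {a..b} = at t within T"
        using \<delta>(1) by (intro at_within_nhd[of t "ball t \<delta>"]) auto
      then show "continuous (at t within {a..b}) \<sigma>" using c by simp
    qed
  qed
qed

lemma has_integral_speed:
  assumes ab: "a < b" and \<sigma>: "continuous_on {a..b} \<sigma>" "\<And>t. t \<in> {a<..<b} \<Longrightarrow> speed glued_surface \<gamma> t = \<sigma> t"
  shows "(speed glued_surface \<gamma> has_integral integral {a..b} \<sigma>) {a..b}"
proof -
  have "(\<sigma> has_integral integral {a..b} \<sigma>) (cbox a b)"
    using integrable_continuous_interval[OF \<sigma>(1)] by (simp add: integrable_integral)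
  then have "(speed glued_surface \<gamma> has_integral integral {a..b} \<sigma>) (cbox a b)"
    by (rule has_integral_spike_interior) (use \<sigma>(2) in auto)
  then show ?thesis by simp
qed

text \<open>One parametrization for each point suffices, because coordinate changes are
  isometries.\<close>
definition glued_lipschitz :: "('p \<Rightarrow> real) \<Rightarrow> bool" where
  "glued_lipschitz H \<longleftrightarrow>
     (\<forall>p. \<exists>i\<in>I. \<exists>z\<in>N i. \<psi> i z = p \<and> hyp_lipschitz_at (\<lambda>w. H (\<psi> i w)) z)"

lemma increment_le_length_single:
  assumes ab: "a < b" and C: "C1_curve_on glued_surface a b \<gamma>" and H: "glued_lipschitz H"
  shows "\<mu> * \<bar>H (\<gamma> b) - H (\<gamma> a)\<bar> \<le> integral {a..b} (speed glued_surface \<gamma>)"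
proof -
  have cont: "continuous_map (top_of_set {a..b}) glued_topology \<gamma>" using C by (simp add: C1_curve_iff)
  obtain \<sigma> where \<sigma>: "continuous_on {a..b} \<sigma>"
    "\<And>t. t \<in> {a<..<b} \<Longrightarrow> speed glued_surface \<gamma> t = \<sigma> t"
    "\<And>i t. i \<in> I \<Longrightarrow> t \<in> {a..b} \<Longrightarrow> \<gamma> t \<in> patch i \<Longrightarrow> \<exists>D.
       ((\<lambda>s. coord i (\<gamma> s)) has_vector_derivative D) (at t within {a..b}) \<and>
       \<sigma> t = \<mu> * (conformal_factor (coord i (\<gamma> t)) * cmod D)"
    using continuous_one_sided_speed[OF ab C] by blast
  have "\<bar>\<mu> * H (\<gamma> b) - \<mu> * H (\<gamma> a)\<bar> \<le> integral {a..b} \<sigma>"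
  proof (rule increment_le_integral[OF less_imp_le[OF ab] \<sigma>(1)])
    fix t e :: real assume t: "t \<in> {a..b}" and e: "e > 0"
    obtain i z where i: "i \<in> I" "z \<in> N i" "\<psi> i z = \<gamma> t" and hl: "hyp_lipschitz_at (\<lambda>w. H (\<psi> i w)) z"
      using H unfolding glued_lipschitz_def by blast
    have p: "\<gamma> t \<in> patch i" and cz: "coord i (\<gamma> t) = z"
      using i \<psi>_in_patch coord_\<psi> by metis+
    obtain D where D: "((\<lambda>s. coord i (\<gamma> s)) has_vector_derivative D) (at t within {a..b})"
       "\<sigma> t = \<mu> * (conformal_factor z * cmod D)"
      using \<sigma>(3)[OF i(1) t p] cz by blast
    obtain \<delta>1 where \<delta>1: "\<delta>1 > 0" "\<And>s. s \<in> {a..b} \<Longrightarrow> dist s t < \<delta>1 \<Longrightarrow> \<gamma> s \<in> patch i"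
      using eventually_in_patch[OF cont i(1) t p] by blast
    define lam where "lam = conformal_factor z"
    have lam: "lam > 0" using conformal_factor_N_pos[OF i(1,2)] by (simp add: lam_def)
    define e1 where "e1 = e / (2 * \<mu> * (cmod D + 1))"
    have e1: "e1 > 0" using e mu_pos by (simp add: e1_def add_nonneg_pos)
    define e2 where "e2 = min 1 (e / (2 * \<mu> * (lam + e1)))"
    have e2: "e2 > 0" "e2 \<le> 1" "e2 \<le> e / (2 * \<mu> * (lam + e1))"
      using e mu_pos lam e1 by (auto simp: e2_def)
    obtain \<eta> where \<eta>: "\<eta> > 0" "\<And>w. dist w z < \<eta> \<Longrightarrow> \<bar>H (\<psi> i w) - H (\<psi> i z)\<bar> \<le> (lam + e1) * cmod (w - z)"
      using hl e1 unfolding hyp_lipschitz_at_def lam_def eventually_nhds_metric by blast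
    obtain \<delta>2 where \<delta>2: "\<delta>2 > 0" "\<And>s. s \<in> {a..b} \<Longrightarrow> \<bar>s - t\<bar> < \<delta>2 \<Longrightarrow>
         cmod (coord i (\<gamma> s) - z - (s - t) *\<^sub>R D) \<le> e2 * \<bar>s - t\<bar>"
      using D(1) e2(1) unfolding has_vector_derivative_def has_derivative_within_alt real_norm_def cz by blast
    have "continuous (at t within {a..b}) (\<lambda>s. coord i (\<gamma> s))"
      using D(1) by (rule has_vector_derivative_continuous)
    then obtain \<delta>3 where \<delta>3: "\<delta>3 > 0" "\<And>s. s \<in> {a..b} \<Longrightarrow> dist s t < \<delta>3 \<Longrightarrow> dist (coord i (\<gamma> s)) z < \<eta>"
      using \<eta>(1) unfolding continuous_within_eps_delta cz by blast
    show "\<exists>\<delta>>0. \<forall>s\<in>{a..b}. \<bar>s - t\<bar> < \<delta> \<longrightarrow> \<bar>\<mu> * H (\<gamma> s) - \<mu> * H (\<gamma> t)\<bar> \<le> (\<sigma> t + e) * \<bar>s - t\<bar>"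
    proof (intro exI[of _ "min \<delta>1 (min \<delta>2 \<delta>3)"] conjI ballI impI)
      fix s assume s: "s \<in> {a..b}" "\<bar>s - t\<bar> < min \<delta>1 (min \<delta>2 \<delta>3)"
      let ?w = "coord i (\<gamma> s)"
      have ps: "\<psi> i ?w = \<gamma> s" using \<delta>1(2)[of s] s by (simp add: dist_real_def \<psi>_coord)
      have "cmod (?w - z) \<le> cmod (?w - z - (s - t) *\<^sub>R D) + cmod ((s - t) *\<^sub>R D)"
        using norm_triangle_ineq[of "?w - z - (s - t) *\<^sub>R D" "(s - t) *\<^sub>R D"] by simp
      also have "\<dots> \<le> e2 * \<bar>s - t\<bar> + \<bar>s - t\<bar> * cmod D" using \<delta>2(2)[of s] s by simp
      finally have w: "cmod (?w - z) \<le> (cmod D + e2) * \<bar>s - t\<bar>" by (simp add: algebra_simps)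
      have "\<bar>H (\<gamma> s) - H (\<gamma> t)\<bar> \<le> (lam + e1) * cmod (?w - z)"
        using \<eta>(2)[of ?w] \<delta>3(2)[of s] s ps i(3) by (simp add: dist_real_def)
      also have "\<dots> \<le> (lam + e1) * ((cmod D + e2) * \<bar>s - t\<bar>)"
        using w lam e1 by (intro mult_left_mono) auto
      finally have "\<mu> * \<bar>H (\<gamma> s) - H (\<gamma> t)\<bar> \<le> \<mu> * ((lam + e1) * ((cmod D + e2) * \<bar>s - t\<bar>))"
        using mu_pos by (intro mult_left_mono) auto
      also have "\<dots> = (\<mu> * ((lam + e1) * (cmod D + e2))) * \<bar>s - t\<bar>" by (simp add: mult.assoc)
      also have "\<dots> \<le> (\<sigma> t + e) * \<bar>s - t\<bar>"
      proof (rule mult_right_mono)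
        have "\<mu> * e1 * cmod D \<le> \<mu> * e1 * (cmod D + 1)" using mu_pos e1 by (intro mult_left_mono) auto
        also have "\<dots> = e / 2"
        proof -
          have "2 * \<mu> * (cmod D + 1) > 0" using mu_pos by (simp add: add_nonneg_pos)
          then have "2 * \<mu> * (cmod D + 1) \<noteq> 0" by (rule less_imp_neq[symmetric])
          then have "e1 * (2 * \<mu> * (cmod D + 1)) = e"
            unfolding e1_def times_divide_eq_left by (rule nonzero_mult_div_cancel_right)
          then show ?thesis by (simp add: algebra_simps)
        qed
        finally have 1: "\<mu> * e1 * cmod D \<le> e / 2" .
        have "\<mu> * (lam + e1) * e2 \<le> \<mu> * (lam + e1) * (e / (2 * \<mu> * (lam + e1)))"
          using e2(3) mu_pos lam e1 by (intro mult_left_mono) auto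
        also have "\<dots> = e / 2"
        proof -
          have "\<mu> * (lam + e1) > 0" using mu_pos lam e1 by simp
          moreover have "x * (e / (2 * x)) = e / 2" if "x > 0" for x using that by simp
          ultimately show ?thesis unfolding mult.assoc[of 2] by blast
        qed
        finally have 2: "\<mu> * (lam + e1) * e2 \<le> e / 2" .
        have "\<mu> * ((lam + e1) * (cmod D + e2)) = \<mu> * (lam * cmod D) + \<mu> * e1 * cmod D + \<mu> * (lam + e1) * e2"
          by (simp add: algebra_simps)
        then show "\<mu> * ((lam + e1) * (cmod D + e2)) \<le> \<sigma> t + e"
          using 1 2 D(2) unfolding lam_def by linarith
      qed simp
      finally show "\<bar>\<mu> * H (\<gamma> s) - \<mu> * H (\<gamma> t)\<bar> \<le> (\<sigma> t + e) * \<bar>s - t\<bar>"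
        using mu_pos by (simp add: right_diff_distrib[symmetric] abs_mult)
    qed (use \<delta>1 \<delta>2 \<delta>3 in auto)
  qed
  moreover have "integral {a..b} (speed glued_surface \<gamma>) = integral {a..b} \<sigma>"
    using has_integral_speed[OF ab \<sigma>(1,2)] by (rule integral_unique)
  ultimately show ?thesis using mu_pos by (simp add: right_diff_distrib[symmetric] abs_mult)
qed

lemma speed_integrable:
  "piecewise_C1_on glued_surface \<gamma> a b \<Longrightarrow> speed glued_surface \<gamma> integrable_on {a..b}"
proof (induction rule: piecewise_C1_on.induct)
  case (single a b)
  show ?case
    by (rule continuous_one_sided_speed[OF single])
      (rule has_integral_integrable[OF has_integral_speed[OF single(1)]])
next
  case (join a b c)
  then show ?case using piecewise_C1_on_less[OF join.hyps(1)] piecewise_C1_on_less[OF join.hyps(2)]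
    by (intro Henstock_Kurzweil_Integration.integrable_combine[of a b c]) auto
qed

lemma integral_speed_join:
  assumes "piecewise_C1_on glued_surface \<gamma> a b" "piecewise_C1_on glued_surface \<gamma> b c"
  shows "integral {a..c} (speed glued_surface \<gamma>) = integral {a..b} (speed glued_surface \<gamma>) + integral {b..c} (speed glued_surface \<gamma>)"
  using Henstock_Kurzweil_Integration.integral_combine[of a b c "speed glued_surface \<gamma>"]
    speed_integrable[OF piecewise_C1_on.join[OF assms]] piecewise_C1_on_less[OF assms(1)] piecewise_C1_on_less[OF assms(2)]
  by simp

text \<open>All lower bounds for distances on the surface come from here: a curve from \<open>p\<close>
  to \<open>q\<close> is at least as long as the increment of any such function.\<close>
lemma increment_le_length:
  assumes "piecewise_C1_on glued_surface \<gamma> a b" "glued_lipschitz H"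
  shows "\<mu> * \<bar>H (\<gamma> b) - H (\<gamma> a)\<bar> \<le> integral {a..b} (speed glued_surface \<gamma>)"
  using assms(1)
proof (induction rule: piecewise_C1_on.induct)
  case (single a b)
  then show ?case using increment_le_length_single assms(2) by blast
next
  case (join a b c)
  have "\<mu> * \<bar>H (\<gamma> c) - H (\<gamma> a)\<bar> \<le> \<mu> * (\<bar>H (\<gamma> b) - H (\<gamma> a)\<bar> + \<bar>H (\<gamma> c) - H (\<gamma> b)\<bar>)"
    using mu_pos by (intro mult_left_mono) auto
  then show ?case using join.IH integral_speed_join[OF join.hyps] by (simp add: algebra_simps)
qed

end

text \<open>Closed hyperbolic balls are compact and form a basis of neighbourhoods: a half turn moves
  the centre to the origin, where they are Euclidean balls.\<close>
lemma hyp_ball_in_open: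
  assumes zd: "z \<in> disc" and U: "open U" "z \<in> U"
  obtains \<epsilon> where "\<epsilon> > 0" "{w \<in> disc. hyp_dist z w \<le> \<epsilon>} \<subseteq> U" "compact {w \<in> disc. hyp_dist z w \<le> \<epsilon>}"
    "\<forall>\<^sub>F w in nhds z. w \<in> disc \<and> hyp_dist z w < \<epsilon>"
proof -
  have hc: "continuous_on disc (half_turn z)" by (rule hyp_isometry_continuous[OF hyp_isometry_half_turn[OF zd]])
  have "open (disc \<inter> half_turn z -` U)"
    using continuous_open_preimage[OF hc] U(1) by simp
  moreover have "0 \<in> disc \<inter> half_turn z -` U" using U(2) by simp
  ultimately obtain \<rho>0 where \<rho>0: "\<rho>0 > 0" "cball 0 \<rho>0 \<subseteq> disc \<inter> half_turn z -` U"
    using open_contains_cball by blast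
  define \<rho> where "\<rho> = \<rho>0"
  have \<rho>: "\<rho> > 0" "cball 0 \<rho> \<subseteq> disc" "\<And>w. cmod w \<le> \<rho> \<Longrightarrow> half_turn z w \<in> U"
    using \<rho>0 by (auto simp: \<rho>_def subset_iff)
  have \<rho>d: "of_real \<rho> \<in> disc" using \<rho>(1) subsetD[OF \<rho>(2), of "of_real \<rho>"] by simp
  define \<epsilon> where "\<epsilon> = hyp_norm (of_real \<rho>)"
  have le: "hyp_dist z w \<le> \<epsilon> \<longleftrightarrow> cmod (half_turn z w) \<le> \<rho>"
    and less: "hyp_dist z w < \<epsilon> \<longleftrightarrow> cmod (half_turn z w) < \<rho>" if "w \<in> disc" for w
    unfolding hyp_dist_def \<epsilon>_def
    using hyp_norm_le_iff[OF half_turn_in_disc[OF zd that] \<rho>d] hyp_norm_less_iff[OF half_turn_in_disc[OF zd that] \<rho>d] \<rho>(1)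
    by simp_all
  have eq: "{w \<in> disc. hyp_dist z w \<le> \<epsilon>} = half_turn z ` cball 0 \<rho>"
  proof (intro equalityI subsetI)
    fix w assume w: "w \<in> {w \<in> disc. hyp_dist z w \<le> \<epsilon>}"
    then have "half_turn z w \<in> cball 0 \<rho>" "half_turn z (half_turn z w) = w"
      using le half_turn_involution[OF zd] by auto
    then show "w \<in> half_turn z ` cball 0 \<rho>" by (metis imageI)
  next
    fix w assume "w \<in> half_turn z ` cball 0 \<rho>"
    then obtain v where v: "v \<in> cball 0 \<rho>" "w = half_turn z v" by blast
    then have vd: "v \<in> disc" using \<rho>(2) by blast
    then have wd: "w \<in> disc" using half_turn_in_disc[OF zd] v(2) by simp
    moreover have "half_turn z w = v" using half_turn_involution[OF zd vd] v(2) by simp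
    ultimately show "w \<in> {w \<in> disc. hyp_dist z w \<le> \<epsilon>}" using le[OF wd] v(1) by simp
  qed
  show ?thesis
  proof (rule that[of \<epsilon>])
    have "hyp_norm 0 < hyp_norm (of_real \<rho>)" using \<rho>(1) \<rho>d by (subst hyp_norm_less_iff) auto
    then show "\<epsilon> > 0" by (simp add: \<epsilon>_def)
    show "{w \<in> disc. hyp_dist z w \<le> \<epsilon>} \<subseteq> U" unfolding eq using \<rho>(3) by auto
    show "compact {w \<in> disc. hyp_dist z w \<le> \<epsilon>}"
      unfolding eq by (rule compact_continuous_image[OF continuous_on_subset[OF hc \<rho>(2)] compact_cball])
    have "open (disc \<inter> half_turn z -` ball 0 \<rho>)"
      using continuous_open_preimage[OF hc] by simp
    then have "\<forall>\<^sub>F w in nhds z. w \<in> disc \<inter> half_turn z -` ball 0 \<rho>"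
      using zd \<rho>(1) by (intro eventually_nhds_in_open) auto
    then show "\<forall>\<^sub>F w in nhds z. w \<in> disc \<and> hyp_dist z w < \<epsilon>"
      by eventually_elim (use less in auto)
  qed
qed

context isometric_atlas
begin

subsection \<open>Reparametrization and concatenation\<close>

text \<open>Parameters are changed only by affine maps; a negative slope reverses the curve.\<close>
lemma C1_curve_affine:
  assumes m: "m \<noteq> 0" and ab: "a < b" "a' < b'" and C: "C1_curve_on glued_surface a b \<gamma>"
    and img: "(\<lambda>t. m * t + c) ` {a'..b'} = {a..b}"
  shows "C1_curve_on glued_surface a' b' (\<lambda>t. \<gamma> (m * t + c))"
    and "integral {a'..b'} (speed glued_surface (\<lambda>t. \<gamma> (m * t + c))) = integral {a..b} (speed glued_surface \<gamma>)"
proof -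
  let ?\<gamma>' = "\<lambda>t. \<gamma> (m * t + c)"
  have into: "m * t + c \<in> {a..b}" if "t \<in> {a'..b'}" for t using img that by blast
  have C': "continuous_map (top_of_set {a..b}) glued_topology \<gamma>"
    "\<And>i. i \<in> I \<Longrightarrow> \<exists>g. (\<forall>t\<in>{t\<in>{a..b}. \<gamma> t \<in> patch i}. ((\<lambda>s. coord i (\<gamma> s)) has_vector_derivative g t) (at t within {a..b})) \<and>
       continuous_on {t\<in>{a..b}. \<gamma> t \<in> patch i} g"
    using C by (simp_all add: C1_curve_iff)
  have aff: "continuous_map (top_of_set {a'..b'}) (top_of_set {a..b}) (\<lambda>t. m * t + c)"
    using into by (auto simp: continuous_map_in_subtopology intro!: continuous_intros)
  show C1: "C1_curve_on glued_surface a' b' ?\<gamma>'"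
    unfolding C1_curve_iff
  proof (intro conjI ballI)
    show "continuous_map (top_of_set {a'..b'}) glued_topology ?\<gamma>'"
      using continuous_map_compose[OF aff C'(1)] by (simp add: o_def)
    fix i assume i: "i \<in> I"
    obtain g where g: "\<forall>t\<in>{t\<in>{a..b}. \<gamma> t \<in> patch i}. ((\<lambda>s. coord i (\<gamma> s)) has_vector_derivative g t) (at t within {a..b})"
       "continuous_on {t\<in>{a..b}. \<gamma> t \<in> patch i} g" using C'(2)[OF i] by blast
    have "((\<lambda>s. coord i (?\<gamma>' s)) has_vector_derivative m *\<^sub>R g (m * t + c)) (at t within {a'..b'})"
      if t: "t \<in> {t\<in>{a'..b'}. ?\<gamma>' t \<in> patch i}" for t
    proof -
      have "((\<lambda>t. m * t + c) has_vector_derivative m) (at t within {a'..b'})"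
        by (auto intro!: derivative_eq_intros)
      moreover have "((\<lambda>s. coord i (\<gamma> s)) has_vector_derivative g (m * t + c)) (at (m * t + c) within {a..b})"
        using g(1) t into by auto
      ultimately show ?thesis
        using vector_diff_chain_within[of "\<lambda>t. m * t + c" m t "{a'..b'}" "\<lambda>s. coord i (\<gamma> s)"] unfolding img o_def by blast
    qed
    moreover have "continuous_on {t\<in>{a'..b'}. ?\<gamma>' t \<in> patch i} (\<lambda>t. m *\<^sub>R g (m * t + c))"
    proof (intro continuous_on_scaleR continuous_on_const)
      show "continuous_on {t\<in>{a'..b'}. ?\<gamma>' t \<in> patch i} (\<lambda>t. g (m * t + c))"
        by (rule continuous_on_compose2[OF g(2)]) (use into in \<open>auto intro!: continuous_intros\<close>)
    qed
    ultimately show "\<exists>g. (\<forall>t\<in>{t\<in>{a'..b'}. ?\<gamma>' t \<in> patch i}. ((\<lambda>s. coord i (?\<gamma>' s)) has_vector_derivative g t) (at t within {a'..b'})) \<and>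
       continuous_on {t\<in>{a'..b'}. ?\<gamma>' t \<in> patch i} g"
      by (intro exI[of _ "\<lambda>t. m *\<^sub>R g (m * t + c)"] conjI ballI)
  qed
  have sp: "speed glued_surface ?\<gamma>' t = \<bar>m\<bar> * speed glued_surface \<gamma> (m * t + c)" if t: "t \<in> {a'<..<b'}" for t
  proof -
    let ?u = "m * t + c"
    have "?u \<noteq> a" "?u \<noteq> b" "?u \<in> {a..b}"
    proof -
      have ex: "\<exists>s\<in>{a'..b'}. m * s + c < ?u" "\<exists>s\<in>{a'..b'}. ?u < m * s + c"
      proof -
        have "m > 0 \<or> m < 0" using m by auto
        then show "\<exists>s\<in>{a'..b'}. m * s + c < ?u" "\<exists>s\<in>{a'..b'}. ?u < m * s + c"
          using t ab(2) by (auto intro: bexI[of _ a'] bexI[of _ b'])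
      qed
      then show "?u \<noteq> a" "?u \<noteq> b" using into by force+
      show "?u \<in> {a..b}" using into t by auto
    qed
    then have u: "?u \<in> {a<..<b}" "?u \<in> {a..b}" by auto
    obtain i where i: "i \<in> I" "\<gamma> ?u \<in> patch i" using obtain_chart \<psi>_in_patch by metis
    obtain g where g: "((\<lambda>s. coord i (\<gamma> s)) has_vector_derivative g) (at ?u within {a..b})"
      using C'(2)[OF i(1)] u(2) i(2) by blast
    then have d1: "((\<lambda>s. coord i (\<gamma> s)) has_vector_derivative g) (at ?u)"
      using u(1) by (simp add: at_within_Icc_at)
    have "((\<lambda>t. m * t + c) has_vector_derivative m) (at t)"
      by (auto intro!: derivative_eq_intros)
    from vector_diff_chain_at[OF this d1]
    have d2: "((\<lambda>s. coord i (?\<gamma>' s)) has_vector_derivative m *\<^sub>R g) (at t)" by (simp add: o_def)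
    obtain \<delta> where \<delta>: "\<delta> > 0" "\<forall>s\<in>{a..b}. dist s ?u < \<delta> \<longrightarrow> \<gamma> s \<in> patch i"
      using eventually_in_patch[OF C'(1) i(1) u(2) i(2)] by blast
    define \<delta>1 where "\<delta>1 = min \<delta> (min (?u - a) (b - ?u))"
    have \<delta>1: "\<delta>1 > 0" "\<And>s. dist s ?u < \<delta>1 \<Longrightarrow> \<gamma> s \<in> patch i"
    proof -
      show "\<delta>1 > 0" using \<delta>(1) u(1) by (simp add: \<delta>1_def)
      fix s assume s: "dist s ?u < \<delta>1"
      then have "s \<in> {a..b}" unfolding \<delta>1_def dist_real_def atLeastAtMost_iff by linarith
      then show "\<gamma> s \<in> patch i" using \<delta>(2) s by (simp add: \<delta>1_def)
    qed
    have "dist (m * s + c) ?u < \<delta>1" if "dist s t < \<delta>1 / \<bar>m\<bar>" for s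
    proof -
      have "dist (m * s + c) ?u = \<bar>m\<bar> * dist s t"
        by (simp add: dist_real_def abs_mult[symmetric] algebra_simps)
      then show ?thesis using that m by (simp add: field_simps)
    qed
    then have "\<And>s. dist s t < \<delta>1 / \<bar>m\<bar> \<Longrightarrow> ?\<gamma>' s \<in> patch i" using \<delta>1(2) by blast
    from speed_eq[of i ?\<gamma>' t "\<delta>1 / \<bar>m\<bar>", OF i(1) _ _ this d2] speed_eq[OF i \<delta>1 d1]
    show ?thesis using i(2) \<delta>1(1) m by (simp add: algebra_simps)
  qed
  have inv: "(\<lambda>x. (1 / m) *\<^sub>R x + -((1 / m) *\<^sub>R c)) ` cbox a b = cbox a' b'"
  proof -
    have "(\<lambda>x. (1 / m) *\<^sub>R x + -((1 / m) *\<^sub>R c)) ` (\<lambda>t. m * t + c) ` {a'..b'} = {a'..b'}"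
      unfolding image_image using m by (simp add: field_simps)
    then show ?thesis unfolding img by simp
  qed
  have "piecewise_C1_on glued_surface \<gamma> a b" using ab(1) C by (rule piecewise_C1_on.single)
  then have "(speed glued_surface \<gamma> has_integral integral {a..b} (speed glued_surface \<gamma>)) (cbox a b)"
    using speed_integrable by (simp add: integrable_integral)
  from has_integral_affinity[OF this m, of c]
  have "((\<lambda>x. speed glued_surface \<gamma> (m * x + c)) has_integral integral {a..b} (speed glued_surface \<gamma>) / \<bar>m\<bar>) (cbox a' b')"
    unfolding inv by simp
  then have "((\<lambda>x. \<bar>m\<bar> * speed glued_surface \<gamma> (m * x + c)) has_integral \<bar>m\<bar> * (integral {a..b} (speed glued_surface \<gamma>) / \<bar>m\<bar>)) (cbox a' b')"
    by (rule has_integral_mult_right)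
  then have "(speed glued_surface ?\<gamma>' has_integral \<bar>m\<bar> * (integral {a..b} (speed glued_surface \<gamma>) / \<bar>m\<bar>)) (cbox a' b')"
    by (rule has_integral_spike_interior) (use sp in auto)
  then show "integral {a'..b'} (speed glued_surface ?\<gamma>') = integral {a..b} (speed glued_surface \<gamma>)"
    using m by (simp add: integral_unique)
qed

lemma piecewise_C1_scale:
  assumes m: "m > 0" and p: "piecewise_C1_on glued_surface \<gamma> a b"
  shows "piecewise_C1_on glued_surface (\<lambda>t. \<gamma> (m * t + c)) ((a - c) / m) ((b - c) / m) \<and>
    integral {(a - c) / m..(b - c) / m} (speed glued_surface (\<lambda>t. \<gamma> (m * t + c))) = integral {a..b} (speed glued_surface \<gamma>)"
  using p
proof (induction rule: piecewise_C1_on.induct)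
  case (single a b)
  have lt: "(a - c) / m < (b - c) / m" using m single(1) by (simp add: divide_strict_right_mono)
  have "(\<lambda>t. m * t + c) ` {(a - c) / m..(b - c) / m} = {a..b}"
    using m image_affinity_atLeastAtMost[of m c "(a - c) / m" "(b - c) / m"] lt by simp
  from C1_curve_affine[OF _ single(1) lt single(2) this] m lt show ?case
    by (auto intro: piecewise_C1_on.single)
next
  case (join a b c')
  have "piecewise_C1_on glued_surface (\<lambda>t. \<gamma> (m * t + c)) ((a - c) / m) ((b - c) / m)"
    "piecewise_C1_on glued_surface (\<lambda>t. \<gamma> (m * t + c)) ((b - c) / m) ((c' - c) / m)"
    using join.IH by blast+
  from piecewise_C1_on.join[OF this] integral_speed_join[OF this] show ?case
    using join.IH integral_speed_join[OF join.hyps] by (simp only:)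
qed

lemma piecewise_C1_reverse:
  assumes p: "piecewise_C1_on glued_surface \<gamma> a b"
  shows "piecewise_C1_on glued_surface (\<lambda>t. \<gamma> (- 1 * t + c)) (c - b) (c - a) \<and>
    integral {c - b..c - a} (speed glued_surface (\<lambda>t. \<gamma> (- 1 * t + c))) = integral {a..b} (speed glued_surface \<gamma>)"
  using p
proof (induction rule: piecewise_C1_on.induct)
  case (single a b)
  have lt: "c - b < c - a" using single(1) by simp
  have "(\<lambda>t. - 1 * t + c) ` {c - b..c - a} = {a..b}"
    using image_affinity_atLeastAtMost[of "- 1" c "c - b" "c - a"] lt by simp
  from C1_curve_affine[OF _ single(1) lt single(2) this] lt show ?case
    by (auto intro: piecewise_C1_on.single)
next
  case (join a b c')
  have "piecewise_C1_on glued_surface (\<lambda>t. \<gamma> (- 1 * t + c)) (c - c') (c - b)"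
    "piecewise_C1_on glued_surface (\<lambda>t. \<gamma> (- 1 * t + c)) (c - b) (c - a)"
    using join.IH by blast+
  from piecewise_C1_on.join[OF this] integral_speed_join[OF this] show ?case
    using join.IH integral_speed_join[OF join.hyps] by (simp only:) (simp add: add.commute)
qed

lemma piecewise_C1_length_cong:
  assumes "piecewise_C1_on glued_surface \<alpha> a b" "integral {a..b} (speed glued_surface \<alpha>) = L"
    and eq: "\<And>t. t \<in> {a..b} \<Longrightarrow> \<alpha> t = \<gamma> t"
  shows "piecewise_C1_on glued_surface \<gamma> a b" "integral {a..b} (speed glued_surface \<gamma>) = L"
proof -
  show "piecewise_C1_on glued_surface \<gamma> a b" using assms(1) eq by (rule piecewise_C1_on_cong)
  have "(speed glued_surface \<alpha> has_integral L) {a..b}"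
    using speed_integrable[OF assms(1)] assms(2) by (metis integrable_integral)
  then have "(speed glued_surface \<gamma> has_integral L) {a..b}"
    using integral_speed_cong[of a b \<alpha> \<gamma>] eq by blast
  then show "integral {a..b} (speed glued_surface \<gamma>) = L" by (rule integral_unique)
qed

text \<open>\<open>joined p q L\<close> says that some admissible curve from \<open>p\<close> to \<open>q\<close> has length \<open>L\<close>.\<close>
definition joined :: "'p \<Rightarrow> 'p \<Rightarrow> real \<Rightarrow> bool" where
  "joined p q L \<longleftrightarrow> (\<exists>\<gamma>. piecewise_C1_on glued_surface \<gamma> 0 1 \<and> \<gamma> 0 = p \<and> \<gamma> 1 = q \<and>
     integral {0..1} (speed glued_surface \<gamma>) = L)"

lemma riem_dist_joined: "riem_dist glued_surface p q = Inf {L. joined p q L}"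
proof -
  have "(\<lambda>\<gamma>. integral {0..1} (speed glued_surface \<gamma>)) ` {\<gamma>. piecewise_C1_curve glued_surface \<gamma> \<and> \<gamma> 0 = p \<and> \<gamma> 1 = q} = {L. joined p q L}"
    by (auto simp: joined_def piecewise_C1_curve_iff)
  then show ?thesis unfolding riem_dist_def by simp
qed

lemma joined_nonneg: "joined p q L \<Longrightarrow> 0 \<le> L"
  unfolding joined_def using integral_nonneg[OF speed_integrable speed_nonneg] by blast

lemma joined_sym:
  assumes "joined p q L"
  shows "joined q p L"
proof -
  obtain \<gamma> where "piecewise_C1_on glued_surface \<gamma> 0 1" "\<gamma> 0 = p" "\<gamma> 1 = q" "integral {0..1} (speed glued_surface \<gamma>) = L"
    using assms unfolding joined_def by blast
  then show ?thesis using piecewise_C1_reverse[of \<gamma> 0 1 1] unfolding joined_def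
    by (intro exI[of _ "\<lambda>t. \<gamma> (- 1 * t + 1)"]) simp
qed

lemma joined_trans:
  assumes "joined p q L" "joined q r K"
  shows "joined p r (L + K)"
proof -
  obtain \<alpha> where \<alpha>: "piecewise_C1_on glued_surface \<alpha> 0 1" "\<alpha> 0 = p" "\<alpha> 1 = q" "integral {0..1} (speed glued_surface \<alpha>) = L"
    using assms(1) unfolding joined_def by blast
  obtain \<beta> where \<beta>: "piecewise_C1_on glued_surface \<beta> 0 1" "\<beta> 0 = q" "\<beta> 1 = r" "integral {0..1} (speed glued_surface \<beta>) = K"
    using assms(2) unfolding joined_def by blast
  define \<gamma> where "\<gamma> t = (if t \<le> 1/2 then \<alpha> (2 * t) else \<beta> (2 * t - 1))" for t :: real
  have a: "\<alpha> (2 * t + 0) = \<gamma> t" if "t \<in> {0..1/2}" for t using that by (simp add: \<gamma>_def)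
  have b: "\<beta> (2 * t + - 1) = \<gamma> t" if "t \<in> {1/2..1}" for t
  proof (cases "t = 1/2")
    case True
    show ?thesis unfolding True using \<alpha>(3) \<beta>(2) by (simp add: \<gamma>_def)
  next
    case False
    then show ?thesis using that by (simp add: \<gamma>_def)
  qed
  have "piecewise_C1_on glued_surface (\<lambda>t. \<alpha> (2 * t + 0)) 0 (1/2)"
    "integral {0..1/2} (speed glued_surface (\<lambda>t. \<alpha> (2 * t + 0))) = L"
    using piecewise_C1_scale[OF _ \<alpha>(1), of 2 0] \<alpha>(4) by auto
  note 1 = piecewise_C1_length_cong[of _ 0 "1/2" L \<gamma>, OF this a, simplified]
  have "piecewise_C1_on glued_surface (\<lambda>t. \<beta> (2 * t + - 1)) (1/2) 1"
    "integral {1/2..1} (speed glued_surface (\<lambda>t. \<beta> (2 * t + - 1))) = K"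
    using piecewise_C1_scale[OF _ \<beta>(1), of 2 "- 1"] \<beta>(4) by auto
  note 2 = piecewise_C1_length_cong[of _ "1/2" 1 K \<gamma>, OF this b, simplified]
  have "\<gamma> 0 = p" "\<gamma> 1 = r" using \<alpha> \<beta> by (simp_all add: \<gamma>_def)
  moreover have "integral {0..1} (speed glued_surface \<gamma>) = L + K"
    using integral_speed_join[OF 1(1) 2(1)] 1(2) 2(2) by simp
  ultimately show ?thesis
    unfolding joined_def using piecewise_C1_on.join[OF 1(1) 2(1)] by blast
qed

lemma joined_ge: "joined p q L \<Longrightarrow> glued_lipschitz H \<Longrightarrow> \<mu> * \<bar>H q - H p\<bar> \<le> L"
  unfolding joined_def using increment_le_length by blast

lemma riem_dist_le: "joined p q L \<Longrightarrow> riem_dist glued_surface p q \<le> L"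
  unfolding riem_dist_joined by (rule cInf_lower) (auto intro: bdd_belowI joined_nonneg)

lemma chart_curve_joined:
  assumes i: "i \<in> I" and \<zeta>: "\<And>t. t \<in> {0..1} \<Longrightarrow> \<zeta> t \<in> N i"
    and d: "\<And>t. t \<in> {0..1} \<Longrightarrow> (\<zeta> has_vector_derivative \<zeta>' t) (at t within {0..1})"
    and c: "continuous_on {0..1} \<zeta>'"
    and L: "((\<lambda>t. conformal_factor (\<zeta> t) * cmod (\<zeta>' t)) has_integral L) {0..1}"
  shows "joined (\<psi> i (\<zeta> 0)) (\<psi> i (\<zeta> 1)) (\<mu> * L)"
proof -
  let ?\<gamma> = "\<lambda>t. \<psi> i (\<zeta> t)"
  have cont: "continuous_on {0..1} \<zeta>"
    using d has_vector_derivative_continuous continuous_on_eq_continuous_within by blast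
  have C: "C1_curve_on glued_surface 0 1 ?\<gamma>"
    unfolding C1_curve_iff
  proof (intro conjI ballI)
    show "continuous_map (top_of_set {0..1}) glued_topology ?\<gamma>"
      unfolding continuous_map
    proof (intro conjI allI impI)
      fix U assume "openin glued_topology U"
      then have "open {z \<in> N i. \<psi> i z \<in> U}" using i by (simp add: openin_glued)
      then have "openin (top_of_set {0..1}) ({0..1} \<inter> \<zeta> -` {z \<in> N i. \<psi> i z \<in> U})"
        by (rule continuous_openin_preimage_gen[OF cont])
      moreover have "{t \<in> topspace (top_of_set {0..1}). ?\<gamma> t \<in> U} = {0..1} \<inter> \<zeta> -` {z \<in> N i. \<psi> i z \<in> U}"
        using \<zeta> by auto
      ultimately show "openin (top_of_set {0..1}) {t \<in> topspace (top_of_set {0..1}). ?\<gamma> t \<in> U}" by simp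
    qed simp
    fix j assume j: "j \<in> I"
    let ?T = "{t \<in> {0..1}. ?\<gamma> t \<in> patch j}"
    have ov: "\<zeta> t \<in> overlap i j" if "t \<in> ?T" for t using that \<zeta> by (auto simp: overlap_def)
    have "((\<lambda>s. coord j (?\<gamma> s)) has_vector_derivative \<zeta>' t * deriv (change i j) (\<zeta> t)) (at t within {0..1})"
      if t: "t \<in> ?T" for t
      using field_vector_diff_chain_within[OF d DERIV_subset[OF change_DERIV(1)[OF i j ov[OF t]] subset_UNIV]] t
      by (simp add: o_def change_def)
    moreover have "continuous_on ?T (\<lambda>t. \<zeta>' t * deriv (change i j) (\<zeta> t))"
    proof (rule continuous_on_mult)
      show "continuous_on ?T \<zeta>'" by (rule continuous_on_subset[OF c]) auto
      have "continuous_on ?T \<zeta>" by (rule continuous_on_subset[OF cont]) auto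
      then show "continuous_on ?T (\<lambda>t. deriv (change i j) (\<zeta> t))"
        by (rule continuous_on_compose2[OF continuous_deriv_change[OF i j]]) (use ov in auto)
    qed
    ultimately show "\<exists>g. (\<forall>t\<in>?T. ((\<lambda>s. coord j (?\<gamma> s)) has_vector_derivative g t) (at t within {0..1})) \<and> continuous_on ?T g"
      by (intro exI[of _ "\<lambda>t. \<zeta>' t * deriv (change i j) (\<zeta> t)"] conjI ballI)
  qed
  have sp: "speed glued_surface ?\<gamma> t = \<mu> * (conformal_factor (\<zeta> t) * cmod (\<zeta>' t))" if t: "t \<in> {0<..<1}" for t
  proof -
    have t': "t \<in> {0..1}" using t by auto
    have "((\<lambda>s. coord i (?\<gamma> s)) has_vector_derivative \<zeta>' t) (at t within {0..1})"
      using has_vector_derivative_transform[OF t' _ d[OF t'], of "\<lambda>s. coord i (?\<gamma> s)"] i \<zeta> by simp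
    then have "((\<lambda>s. coord i (?\<gamma> s)) has_vector_derivative \<zeta>' t) (at t)" using t by (simp add: at_within_Icc_at)
    moreover have "?\<gamma> s \<in> patch i" if "dist s t < min t (1 - t)" for s
    proof -
      have "s \<in> {0..1}" using that unfolding dist_real_def atLeastAtMost_iff by linarith
      then show ?thesis using \<zeta> \<psi>_in_patch by blast
    qed
    moreover have "min t (1 - t) > 0" using t by auto
    ultimately have "speed glued_surface ?\<gamma> t = \<mu> * (conformal_factor (coord i (?\<gamma> t)) * cmod (\<zeta>' t))"
      using \<psi>_in_patch[OF \<zeta>[OF t']] by (intro speed_eq[OF i, of _ _ "min t (1 - t)"]) auto
    then show ?thesis using i \<zeta>[OF t'] by simp
  qed
  have "((\<lambda>t. \<mu> * (conformal_factor (\<zeta> t) * cmod (\<zeta>' t))) has_integral \<mu> * L) (cbox 0 1)"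
    using has_integral_mult_right[OF L] by simp
  then have "(speed glued_surface ?\<gamma> has_integral \<mu> * L) (cbox 0 1)"
    by (rule has_integral_spike_interior) (use sp in auto)
  then have "integral {0..1} (speed glued_surface ?\<gamma>) = \<mu> * L" by (simp add: integral_unique)
  then show ?thesis unfolding joined_def using piecewise_C1_on.single[OF _ C] by (intro exI[of _ ?\<gamma>]) auto
qed

lemma hyp_segment_joined:
  assumes i: "i \<in> I" and z: "z \<in> disc" "w \<in> disc" and seg: "\<And>t. t \<in> {0..1} \<Longrightarrow> hyp_segment z w t \<in> N i"
  shows "joined (\<psi> i z) (\<psi> i w) (\<mu> * hyp_dist z w)"
proof -
  let ?d = "\<lambda>t. half_turn z w * deriv (half_turn z) (of_real t * half_turn z w)"
  have "joined (\<psi> i (hyp_segment z w 0)) (\<psi> i (hyp_segment z w 1)) (\<mu> * hyp_dist z w)"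
  proof (rule chart_curve_joined[OF i seg, where \<zeta>' = ?d])
    show "(hyp_segment z w has_vector_derivative ?d t) (at t within {0..1})" if "t \<in> {0..1}" for t
      using hyp_segment_derivative(1)[OF z] that by simp
    show "continuous_on {0..1} ?d" by (rule continuous_hyp_segment_derivative[OF z])
    show "((\<lambda>t. conformal_factor (hyp_segment z w t) * cmod (?d t)) has_integral hyp_dist z w) {0..1}"
      by (rule has_integral_eq[OF _ integral_hyp_segment[OF z]]) (use hyp_segment_derivative(2)[OF z] in auto)
  qed
  then show ?thesis using z by (simp add: hyp_segment_ends)
qed

lemma hyp_ball_in_N:
  assumes i: "i \<in> I" and z: "z \<in> N i"
  obtains \<epsilon> where "\<epsilon> > 0" "{w \<in> disc. hyp_dist z w \<le> \<epsilon>} \<subseteq> N i" "compact {w \<in> disc. hyp_dist z w \<le> \<epsilon>}"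
    "\<forall>\<^sub>F w in nhds z. w \<in> disc \<and> hyp_dist z w < \<epsilon>"
proof (rule hyp_ball_in_open)
  show "z \<in> disc" using N_subset_disc[OF i] z by blast
qed (use open_N[OF i] z that in blast)+

lemma joined_in_hyp_ball:
  assumes i: "i \<in> I" and z: "z \<in> N i" and \<epsilon>: "{w \<in> disc. hyp_dist z w \<le> \<epsilon>} \<subseteq> N i"
    and w: "w \<in> disc" "hyp_dist z w \<le> \<epsilon>"
  shows "joined (\<psi> i z) (\<psi> i w) (\<mu> * hyp_dist z w)"
proof (rule hyp_segment_joined[OF i _ w(1)])
  show zd: "z \<in> disc" using N_subset_disc[OF i] z by blast
  show "hyp_segment z w t \<in> N i" if "t \<in> {0..1}" for t
    using hyp_segment_in_ball[OF zd w(1), of t] that w(2) \<epsilon> by auto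
qed

end

section \<open>The distance of a glued surface\<close>

locale isometric_surface = isometric_atlas I N \<psi> \<mu>
  for I :: "'i set" and N :: "'i \<Rightarrow> complex set" and \<psi> :: "'i \<Rightarrow> complex \<Rightarrow> 'p" and \<mu> :: real +
  assumes hausdorff: "Hausdorff_space glued_topology"
    and compact: "compact_space glued_topology"
    and connected: "connected_space glued_topology"
begin

abbreviation d :: "'p \<Rightarrow> 'p \<Rightarrow> real" where
  "d \<equiv> riem_dist glued_surface"

text \<open>The points that can be joined to a given point form a set that is open and closed. Without
  this the infimum that defines the distance would be meaningless.\<close>
lemma ex_joined: "\<exists>L. joined p q L"
proof -
  define R where "R = {q. \<exists>L. joined p q L}"
  have step: "\<forall>\<^sub>F w in nhds z. \<exists>L. joined (\<psi> j z) (\<psi> j w) L" if j: "j \<in> I" "z \<in> N j" for j z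
  proof -
    obtain \<epsilon> where \<epsilon>: "\<epsilon> > 0" "{w \<in> disc. hyp_dist z w \<le> \<epsilon>} \<subseteq> N j"
      "\<forall>\<^sub>F w in nhds z. w \<in> disc \<and> hyp_dist z w < \<epsilon>" using hyp_ball_in_N[OF j] by blast
    from \<epsilon>(3) show ?thesis
      by eventually_elim (use joined_in_hyp_ball[OF j \<epsilon>(2)] in \<open>auto intro: less_imp_le\<close>)
  qed
  have op: "openin glued_topology X" if X: "\<And>q r L. q \<in> X \<Longrightarrow> joined q r L \<Longrightarrow> r \<in> X" for X
    unfolding openin_glued
  proof (intro ballI openI_eventually)
    fix j z assume j: "j \<in> I" and z: "z \<in> {z \<in> N j. \<psi> j z \<in> X}"
    have "\<forall>\<^sub>F w in nhds z. w \<in> N j" using open_N[OF j] z by (intro eventually_nhds_in_open) auto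
    moreover have "\<forall>\<^sub>F w in nhds z. \<exists>L. joined (\<psi> j z) (\<psi> j w) L" using step[OF j] z by simp
    ultimately show "\<forall>\<^sub>F w in nhds z. w \<in> {z \<in> N j. \<psi> j z \<in> X}"
      by eventually_elim (use X z in blast)
  qed
  have "openin glued_topology R" by (rule op) (auto simp: R_def dest: joined_trans)
  moreover have "openin glued_topology (- R)"
    by (rule op) (auto simp: R_def dest: joined_trans joined_sym)
  then have "closedin glued_topology R" by (simp add: closedin_def Compl_eq_Diff_UNIV)
  moreover have "p \<in> R"
  proof -
    obtain i z where i: "i \<in> I" "z \<in> N i" "\<psi> i z = p" using obtain_chart .
    then show ?thesis using eventually_nhds_x_imp_x[OF step[OF i(1,2)]] by (simp add: R_def)
  qed
  ultimately have "R = UNIV"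
    using connected unfolding connected_space_clopen_in by auto
  then show ?thesis by (auto simp: R_def)
qed

lemma le_riem_distI:
  assumes "\<And>L. joined p q L \<Longrightarrow> x \<le> L"
  shows "x \<le> d p q"
  unfolding riem_dist_joined by (rule cInf_greatest) (use ex_joined assms in auto)

lemma lipschitz_le_riem_dist: "glued_lipschitz H \<Longrightarrow> \<mu> * \<bar>H q - H p\<bar> \<le> d p q"
  by (rule le_riem_distI) (rule joined_ge)

lemma riem_dist_nonneg: "0 \<le> d p q"
  by (rule le_riem_distI) (rule joined_nonneg)

lemma riem_dist_commute: "d p q = d q p"
proof -
  have "{L. joined p q L} = {L. joined q p L}" using joined_sym by blast
  then show ?thesis unfolding riem_dist_joined by simp
qed

lemma riem_dist_triangle: "d p r \<le> d p q + d q r"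
proof -
  have "d p r - K \<le> d p q" if K: "joined q r K" for K
  proof (rule le_riem_distI)
    fix L assume "joined p q L"
    then show "d p r - K \<le> L" using riem_dist_le[OF joined_trans[OF _ K]] by (simp add: diff_le_eq)
  qed
  then have "d p r - d p q \<le> d q r" by (intro le_riem_distI) (simp add: algebra_simps)
  then show ?thesis by simp
qed

text \<open>The lower bound compares with the distance from the centre in a chart, cut off at the radius
  of a small compact ball; outside the ball the cut-off function is constant, and it is Lipschitz there
  because the ball is closed in the Hausdorff space.\<close>
lemma chart_locally_isometric:
  assumes i: "i \<in> I" and z: "z \<in> N i"
  obtains \<epsilon> where "\<epsilon> > 0" "\<And>w. w \<in> disc \<Longrightarrow> hyp_dist z w < \<epsilon> \<Longrightarrow> w \<in> N i \<and> d (\<psi> i z) (\<psi> i w) = \<mu> * hyp_dist z w"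
    "\<And>q. d (\<psi> i z) q < \<mu> * \<epsilon> \<Longrightarrow> \<exists>w\<in>disc. hyp_dist z w < \<epsilon> \<and> q = \<psi> i w"
proof -
  have zd: "z \<in> disc" using N_subset_disc[OF i] z by blast
  obtain \<epsilon> where \<epsilon>: "\<epsilon> > 0" "{w \<in> disc. hyp_dist z w \<le> \<epsilon>} \<subseteq> N i" "compact {w \<in> disc. hyp_dist z w \<le> \<epsilon>}"
    using hyp_ball_in_N[OF i z] by blast
  let ?K = "{w \<in> disc. hyp_dist z w \<le> \<epsilon>}"
  have "continuous_map (top_of_set ?K) glued_topology (\<psi> i)"
    unfolding continuous_map
  proof (intro conjI allI impI)
    fix U assume "openin glued_topology U"
    then have "open {w \<in> N i. \<psi> i w \<in> U}" using i by (simp add: openin_glued)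
    moreover have "{w \<in> topspace (top_of_set ?K). \<psi> i w \<in> U} = ?K \<inter> {w \<in> N i. \<psi> i w \<in> U}" using \<epsilon>(2) by auto
    ultimately show "openin (top_of_set ?K) {w \<in> topspace (top_of_set ?K). \<psi> i w \<in> U}"
      by (simp only: openin_open_Int)
  qed simp
  then have "compactin glued_topology (\<psi> i ` ?K)"
    using image_compactin[of "top_of_set ?K" ?K] \<epsilon>(3) by (simp add: compactin_subtopology)
  then have closed: "closedin glued_topology (\<psi> i ` ?K)"
    using compactin_imp_closedin hausdorff by blast
  define G where "G q = (if q \<in> patch i then min \<epsilon> (hyp_dist z (coord i q)) else \<epsilon>)" for q
  have "glued_lipschitz G"
    unfolding glued_lipschitz_def
  proof
    fix p
    show "\<exists>j\<in>I. \<exists>v\<in>N j. \<psi> j v = p \<and> hyp_lipschitz_at (\<lambda>w. G (\<psi> j w)) v"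
    proof (cases "p \<in> patch i")
      case True
      then obtain v where v: "v \<in> N i" "\<psi> i v = p" by (auto simp: patch_def)
      then have vd: "v \<in> disc" using N_subset_disc[OF i] by blast
      have "\<forall>\<^sub>F w in nhds v. w \<in> N i" using open_N[OF i] v(1) by (rule eventually_nhds_in_open)
      then have "\<forall>\<^sub>F w in nhds v. min \<epsilon> (hyp_dist z w) = G (\<psi> i w)"
        by eventually_elim (use i \<psi>_in_patch in \<open>simp add: G_def\<close>)
      then have "hyp_lipschitz_at (\<lambda>w. G (\<psi> i w)) v"
        by (rule hyp_lipschitz_at_cong) (intro hyp_lipschitz_at_min hyp_lipschitz_at_const hyp_lipschitz_at_hyp_dist zd vd)
      then show ?thesis using i v by blast
    next
      case False
      obtain j v where v: "j \<in> I" "v \<in> N j" "\<psi> j v = p" using obtain_chart .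
      have vd: "v \<in> disc" using N_subset_disc[OF v(1)] v(2) by blast
      have "openin glued_topology (- (\<psi> i ` ?K))" using closed by (simp add: closedin_def Compl_eq_Diff_UNIV)
      then have "open {w \<in> N j. \<psi> j w \<in> - (\<psi> i ` ?K)}" using v(1) unfolding openin_glued by blast
      moreover have "v \<in> {w \<in> N j. \<psi> j w \<in> - (\<psi> i ` ?K)}" using v False \<epsilon>(2) by (auto simp: patch_def)
      ultimately have "\<forall>\<^sub>F w in nhds v. w \<in> {w \<in> N j. \<psi> j w \<in> - (\<psi> i ` ?K)}" by (rule eventually_nhds_in_open)
      then have "\<forall>\<^sub>F w in nhds v. \<epsilon> = G (\<psi> j w)"
      proof eventually_elim
        case (elim w)
        have "\<epsilon> < hyp_dist z (coord i (\<psi> j w))" if p: "\<psi> j w \<in> patch i"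
        proof (rule ccontr)
          assume "\<not> \<epsilon> < hyp_dist z (coord i (\<psi> j w))"
          then have "coord i (\<psi> j w) \<in> ?K" using N_subset_disc[OF i] \<psi>_coord(2)[OF p] by auto
          then show False using elim \<psi>_coord(1)[OF p] by (metis (no_types, lifting) ComplD imageI mem_Collect_eq)
        qed
        then show ?case by (auto simp: G_def)
      qed
      then have "hyp_lipschitz_at (\<lambda>w. G (\<psi> j w)) v"
        by (rule hyp_lipschitz_at_cong) (rule hyp_lipschitz_at_const[OF vd])
      then show ?thesis using v by blast
    qed
  qed
  then have lower: "\<mu> * G q \<le> d (\<psi> i z) q" for q
  proof -
    have "\<psi> i z \<in> patch i" using \<psi>_in_patch[OF z] .
    then have "G (\<psi> i z) = 0" using i z \<epsilon>(1) by (simp add: G_def)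
    moreover have "G q \<ge> 0"
      using \<epsilon>(1) N_subset_disc[OF i] \<psi>_coord(2)[of q i] hyp_dist_nonneg[OF zd, of "coord i q"] by (auto simp: G_def)
    ultimately show ?thesis using lipschitz_le_riem_dist[OF \<open>glued_lipschitz G\<close>, of q "\<psi> i z"] by simp
  qed
  show ?thesis
  proof (rule that[of \<epsilon>])
    show "\<epsilon> > 0" by fact
    fix w assume w: "w \<in> disc" "hyp_dist z w < \<epsilon>"
    then have wN: "w \<in> N i" using \<epsilon>(2) by auto
    have "G (\<psi> i w) = hyp_dist z w" using w(2) \<psi>_in_patch[OF wN] i wN by (simp add: G_def)
    then have "\<mu> * hyp_dist z w \<le> d (\<psi> i z) (\<psi> i w)" using lower[of "\<psi> i w"] by simp
    moreover have "d (\<psi> i z) (\<psi> i w) \<le> \<mu> * hyp_dist z w"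
      using riem_dist_le[OF joined_in_hyp_ball[OF i z \<epsilon>(2) w(1)]] w(2) by simp
    ultimately show "w \<in> N i \<and> d (\<psi> i z) (\<psi> i w) = \<mu> * hyp_dist z w" using wN by simp
  next
    fix q assume "d (\<psi> i z) q < \<mu> * \<epsilon>"
    then have "\<mu> * G q < \<mu> * \<epsilon>" using lower[of q] by simp
    then have "G q < \<epsilon>" using mu_pos by simp
    then have "q \<in> patch i" "hyp_dist z (coord i q) < \<epsilon>" by (auto simp: G_def split: if_splits)
    then show "\<exists>w\<in>disc. hyp_dist z w < \<epsilon> \<and> q = \<psi> i w"
      using subsetD[OF N_subset_disc[OF i] \<psi>_coord(2)] \<psi>_coord(1)
      by (intro bexI[of _ "coord i q"]) simp_all
  qed
qed

lemma Metric_space_riem_dist: "Metric_space UNIV d"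
proof
  show "0 \<le> d p q" "d p q = d q p" for p q by (rule riem_dist_nonneg riem_dist_commute)+
  show "d p r \<le> d p q + d q r" for p q r by (rule riem_dist_triangle)
  show "d p q = 0 \<longleftrightarrow> p = q" for p q
  proof -
    obtain i z where i: "i \<in> I" "z \<in> N i" "\<psi> i z = p" using obtain_chart .
    have zd: "z \<in> disc" using N_subset_disc[OF i(1)] i(2) by blast
    obtain \<epsilon> where \<epsilon>: "\<epsilon> > 0" "\<And>w. w \<in> disc \<Longrightarrow> hyp_dist z w < \<epsilon> \<Longrightarrow> d p (\<psi> i w) = \<mu> * hyp_dist z w"
      "\<And>q. d p q < \<mu> * \<epsilon> \<Longrightarrow> \<exists>w\<in>disc. hyp_dist z w < \<epsilon> \<and> q = \<psi> i w"
      using chart_locally_isometric[OF i(1,2)] i(3) by metis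
    show ?thesis
    proof
      assume 0: "d p q = 0"
      then have "d p q < \<mu> * \<epsilon>" using \<epsilon>(1) mu_pos by simp
      then obtain w where w: "w \<in> disc" "hyp_dist z w < \<epsilon>" "q = \<psi> i w" using \<epsilon>(3) by blast
      then have "hyp_dist z w = 0" using \<epsilon>(2)[OF w(1,2)] 0 mu_pos by simp
      then show "p = q" using hyp_dist_eq_0_iff[OF zd w(1)] w(3) i(3) by simp
    next
      assume "p = q"
      then show "d p q = 0" using \<epsilon>(2)[OF zd] \<epsilon>(1) i(3) by simp
    qed
  qed
qed

lemma openin_glued_if_openin_riem_dist:
  assumes "openin (Metric_space.mtopology UNIV d) U"
  shows "openin glued_topology U"
  unfolding openin_glued
proof (intro ballI openI_eventually)
  interpret Metric_space UNIV d by (rule Metric_space_riem_dist)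
  fix i z assume i: "i \<in> I" and "z \<in> {z \<in> N i. \<psi> i z \<in> U}"
  then have z: "z \<in> N i" "\<psi> i z \<in> U" by auto
  then obtain r where r: "r > 0" "mball (\<psi> i z) r \<subseteq> U" using assms by (auto simp: openin_mtopology)
  obtain \<epsilon> where \<epsilon>: "\<epsilon> > 0" "\<And>w. w \<in> disc \<Longrightarrow> hyp_dist z w < \<epsilon> \<Longrightarrow> w \<in> N i \<and> d (\<psi> i z) (\<psi> i w) = \<mu> * hyp_dist z w"
    using chart_locally_isometric[OF i z(1)] by metis
  have zd: "z \<in> disc" using N_subset_disc[OF i] z(1) by blast
  define e where "e = min \<epsilon> (r / \<mu>)"
  have e: "e > 0" using \<epsilon>(1) r(1) mu_pos by (simp add: e_def)
  have "\<forall>\<^sub>F w in nhds z. \<bar>hyp_dist z w - hyp_dist z z\<bar> \<le> (conformal_factor z + 1) * cmod (w - z)"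
    using hyp_lipschitz_at_hyp_dist[OF zd zd] unfolding hyp_lipschitz_at_def by (metis zero_less_one)
  moreover have "\<forall>\<^sub>F w in nhds z. cmod (w - z) < e / (conformal_factor z + 1)"
    using e conformal_factor_pos[OF zd] unfolding eventually_nhds_metric dist_norm
    by (intro exI[of _ "e / (conformal_factor z + 1)"]) auto
  moreover have "\<forall>\<^sub>F w in nhds z. w \<in> disc" using zd by (intro eventually_nhds_in_open) auto
  ultimately show "\<forall>\<^sub>F w in nhds z. w \<in> {z \<in> N i. \<psi> i z \<in> U}"
  proof eventually_elim
    case (elim w)
    have "hyp_dist z w \<le> (conformal_factor z + 1) * cmod (w - z)" using elim(1) by simp
    also have "\<dots> < e" using elim(2) conformal_factor_pos[OF zd] by (simp add: field_simps)
    finally have "hyp_dist z w < \<epsilon>" "hyp_dist z w < r / \<mu>" by (auto simp: e_def)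
    then have "w \<in> N i" "d (\<psi> i z) (\<psi> i w) < r" using \<epsilon>(2)[OF elim(3)] mu_pos by (auto simp: field_simps)
    then show ?case using r(2) by auto
  qed
qed

text \<open>The metric topology is coarser than the topology of the surface, hence compact.\<close>
lemma mcomplete_riem_dist: "Metric_space.mcomplete UNIV d"
proof -
  interpret Metric_space UNIV d by (rule Metric_space_riem_dist)
  have "continuous_map glued_topology mtopology id"
    unfolding continuous_map using openin_glued_if_openin_riem_dist by simp
  then have "compactin mtopology (id ` UNIV)"
    using compact by (intro image_compactin[of glued_topology]) (simp_all add: compact_space_def)
  then have "compact_space mtopology" by (simp add: compact_space_def)
  then show ?thesis by (rule compact_space_imp_mcomplete)
qed

theorem surface_glued: "surface glued_surface"
proof -
  have t: "topo glued_surface = glued_topology" "atlas glued_surface = glued_chart ` I" by (simp_all add: glued_surface_def)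
  show ?thesis
    unfolding surface_def t topspace_glued
    using hausdorff compact connected second_countable_glued smooth_atlas_glued riemannian_metric_glued[unfolded t]
      mcomplete_riem_dist by simp
qed

end

section \<open>The regular hyperbolic polygon with 30 sides and angles of 120 degrees\<close>

definition rot30 :: complex where "rot30 = cis (pi / 15)"
definition rot6 :: complex where "rot6 = cis (pi / 3)"
definition rot3 :: complex where "rot3 = cis (2 * pi / 3)"

text \<open>The distance from the centre to the corners for which the angles become 120 degrees.\<close>
definition corner_radius :: real where
  "corner_radius = sqrt (cos (11 * pi / 30) / cos (3 * pi / 10))"

text \<open>Moves the corner on the positive real axis to the origin and the adjacent corner with
  positive argument to the positive real axis.\<close>
definition to_vertex :: "complex \<Rightarrow> complex" where
  "to_vertex z = rot6 * half_turn (of_real corner_radius) z"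

definition from_vertex :: "complex \<Rightarrow> complex" where
  "from_vertex w = half_turn (of_real corner_radius) (cnj rot6 * w)"

text \<open>The coordinate of the next corner as seen from a corner that has been moved to the
  origin.\<close>
definition side :: real where
  "side = Re (to_vertex (of_real corner_radius * rot30))"

text \<open>The half turn about the midpoint of a side, in coordinates in which the side runs from 0
  along the positive real axis.\<close>
definition flip :: "complex \<Rightarrow> complex" where
  "flip = half_turn (of_real side)"

lemma norm_rots [simp]: "cmod rot30 = 1" "cmod rot6 = 1" "cmod rot3 = 1"
  by (simp_all add: rot30_def rot6_def rot3_def)

lemma rots_nonzero [simp]: "rot30 \<noteq> 0" "rot6 \<noteq> 0" "rot3 \<noteq> 0"
  using norm_rots by (metis norm_zero zero_neq_one)+

lemma cnj_mult_unit: "cmod c = 1 \<Longrightarrow> cnj c * c = 1" "cmod c = 1 \<Longrightarrow> c * cnj c = 1"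
  using complex_norm_square[of c] by (simp_all add: mult.commute)

lemma cnj_unit_cancel [simp]:
  "cnj rot30 * (rot30 * z) = z" "rot30 * (cnj rot30 * z) = z"
  "cnj rot6 * (rot6 * z) = z" "rot6 * (cnj rot6 * z) = z"
  "cnj rot3 * (rot3 * z) = z" "rot3 * (cnj rot3 * z) = z"
  by (simp_all add: mult.assoc[symmetric] cnj_mult_unit)

lemma Im_divide_norm: "Im (a / b) = Im (a * cnj b) / (cmod b)\<^sup>2"
  and Re_divide_norm: "Re (a / b) = Re (a * cnj b) / (cmod b)\<^sup>2"
  unfolding complex_div_cnj[of a b] of_real_power[symmetric]
  by (simp_all only: Im_divide_of_real Re_divide_of_real)

lemma cis_difference:
  "Re (cis a * (cis b - of_real q * cnj (cis b))) = cos (a + b) - q * cos (a - b)"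
  "Re (cis b * (cis a - of_real q * cnj (cis a))) = cos (a + b) - q * cos (a - b)"
  "Im (cis b * (cis a - of_real q * cnj (cis a))) = sin (a + b) + q * sin (a - b)"
  by (simp_all add: cos_add cos_diff sin_add sin_diff algebra_simps)

lemma cnj_rot30_pow: "cnj rot30 ^ k = cis (- (real k * (pi / 15)))"
  using Complex.DeMoivre[of "- (pi / 15)" k] by (simp add: rot30_def cis_cnj)

lemma cnj_mult_cancel: "cmod c = 1 \<Longrightarrow> cnj c * (c * z) = z"
  by (simp add: mult.assoc[symmetric] cnj_mult_unit)

lemma polar_rot30:
  "cnj rot30 * (of_real r * cis a) = of_real r * cis (a - pi / 15)"
  "rot30 * (of_real r * cis a) = of_real r * cis (a + pi / 15)"
  by (simp_all add: rot30_def cis_cnj mult.left_commute cis_mult add.commute)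

lemma Im_polar: "Im (of_real r * cis a) = r * sin a"
  by simp

lemma cis_sum_expand:
  "cis x * (cis y * (of_real a + of_real b * cis w)) = of_real a * cis (x + y) + of_real b * cis (x + (y + w))"
  by (simp add: cis_mult[symmetric] algebra_simps)

lemma rot3_eq: "rot3 = rot6 * rot6"
  by (simp add: rot3_def rot6_def cis_mult)

lemma rot3_cubed: "rot3 ^ 3 = 1"
  by (simp add: rot3_def Complex.DeMoivre)

lemma rot30_pow: "rot30 ^ 30 = 1"
  by (simp add: rot30_def Complex.DeMoivre)

lemma corner_radius_bounds: "0 < corner_radius" "corner_radius < 1"
  and corner_radius_sq: "corner_radius\<^sup>2 * cos (3 * pi / 10) = cos (11 * pi / 30)"
proof -
  have 1: "cos (11 * pi / 30) > 0" "cos (3 * pi / 10) > 0"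
    using pi_gt_zero by (auto intro!: cos_gt_zero simp: field_simps)
  have 2: "cos (11 * pi / 30) < cos (3 * pi / 10)"
    using pi_gt_zero by (intro cos_monotone_0_pi) (auto simp: field_simps)
  show "0 < corner_radius" "corner_radius < 1"
    using 1 2 by (simp_all add: corner_radius_def)
  show "corner_radius\<^sup>2 * cos (3 * pi / 10) = cos (11 * pi / 30)"
    using 1 by (simp add: corner_radius_def)
qed

lemma corner_disc [simp]: "of_real corner_radius \<in> disc"
  using corner_radius_bounds by simp

text \<open>The directions from a corner of the polygon to the preceding and to the next corner differ by
  the angle of the polygon. After common factors have been cancelled, the equation says that this angle
  is 120 degrees. It amounts to the vanishing of a real part, which determines the corner radius.\<close>
lemma angle_condition:
  "rot3 * (1 - of_real (corner_radius\<^sup>2) * cnj rot30) = - cnj rot30 * (1 - of_real (corner_radius\<^sup>2) * rot30)"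
proof -
  define q where "q = corner_radius\<^sup>2"
  define h where "h = cis (pi / 30)"
  have h2: "rot30 = h * h" by (simp add: rot30_def h_def cis_mult)
  have hc: "h * cnj h = 1" by (simp add: h_def cis_cnj cis_mult)
  define X where "X = rot6 * (h - of_real q * cnj h)"
  have ReX: "Re X = cos (pi / 3 + pi / 30) - q * cos (pi / 3 - pi / 30)"
    unfolding X_def rot6_def h_def by (rule cis_difference)
  have e: "pi / 3 + pi / 30 = 11 * pi / 30" "pi / 3 - pi / 30 = 3 * pi / 10" by (simp_all add: field_simps)
  have "Re X = 0" unfolding ReX e using corner_radius_sq by (simp add: q_def)
  then have "X + cnj X = 0" by (simp add: complex_eq_iff)
  then have 0: "rot6 * (h - of_real q * cnj h) + cnj rot6 * (cnj h - of_real q * h) = 0" by (simp add: X_def)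
  have "rot3 * (1 - of_real q * cnj rot30) + cnj rot30 * (1 - of_real q * rot30) =
     rot6 * cnj h * (rot6 * (h - of_real q * cnj h) + cnj rot6 * (cnj h - of_real q * h))"
  proof -
    have r: "rot6 * cnj rot6 = 1" by (simp add: cnj_mult_unit)
    show ?thesis unfolding h2 rot3_eq complex_cnj_mult using hc r by algebra
  qed
  then have "rot3 * (1 - of_real q * cnj rot30) + cnj rot30 * (1 - of_real q * rot30) = 0" unfolding 0 by simp
  then show ?thesis unfolding q_def by (simp add: add_eq_0_iff)
qed

lemma corner_denominators:
  "1 - of_real (corner_radius\<^sup>2) * rot30 \<noteq> 0" "1 - of_real (corner_radius\<^sup>2) * cnj rot30 \<noteq> 0"
proof -
  have "of_real corner_radius * rot30 \<in> disc" "of_real corner_radius * cnj rot30 \<in> disc"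
    using corner_radius_bounds by (simp_all add: norm_mult)
  then show "1 - of_real (corner_radius\<^sup>2) * rot30 \<noteq> 0" "1 - of_real (corner_radius\<^sup>2) * cnj rot30 \<noteq> 0"
    using one_minus_cnj_mult_nonzero[OF corner_disc] by (auto simp: power2_eq_square mult.assoc)
qed

lemma next_corner_complex:
  "to_vertex (of_real corner_radius * rot30) =
     rot6 * of_real corner_radius * (1 - rot30) / (1 - of_real (corner_radius\<^sup>2) * rot30)"
  by (simp add: to_vertex_def half_turn_def power2_eq_square algebra_simps)

lemma to_vertex_next_corner: "to_vertex (of_real corner_radius * rot30) = of_real side"
proof -
  let ?X = "to_vertex (of_real corner_radius * rot30)"
  define q :: complex where "q = of_real (corner_radius\<^sup>2)"
  have c: "cnj q = q" by (simp add: q_def)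
  have D: "1 - q * rot30 \<noteq> 0" "1 - q * cnj rot30 \<noteq> 0" using corner_denominators by (simp_all add: q_def)
  have u: "cnj rot30 * rot30 = 1" "cnj rot6 * rot6 = 1" by (simp_all add: cnj_mult_unit)
  have ac: "rot6 * rot6 * (1 - q * cnj rot30) = - cnj rot30 * (1 - q * rot30)"
    using angle_condition by (simp add: rot3_eq q_def)
  have "cnj ?X = cnj rot6 * of_real corner_radius * (1 - cnj rot30) / (1 - q * cnj rot30)"
    unfolding next_corner_complex q_def by simp
  also have "\<dots> = ?X"
  proof -
    have "cnj rot6 * (1 - cnj rot30) * (1 - q * rot30) = rot6 * (1 - rot30) * (1 - q * cnj rot30)"
      using u ac by algebra
    then show ?thesis unfolding next_corner_complex q_def[symmetric] using D
      by (simp add: frac_eq_eq mult.assoc mult.left_commute)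
  qed
  finally have "Im ?X = 0" by (simp add: complex_eq_iff)
  then show ?thesis by (simp add: side_def complex_eq_iff)
qed

lemma side_pos: "0 < side"
proof -
  let ?q = "corner_radius\<^sup>2"
  have q: "0 < ?q" "?q < 1" using corner_radius_bounds by (simp_all add: abs_square_less_1)
  define D where "D = 1 - of_real ?q * rot30"
  have D0: "D \<noteq> 0" using corner_denominators by (simp add: D_def)
  have "of_real side = rot6 * of_real corner_radius * (1 - rot30) / D"
    unfolding to_vertex_next_corner[symmetric] next_corner_complex D_def[symmetric] ..
  then have "Re (of_real side) = Re (rot6 * of_real corner_radius * (1 - rot30) * cnj D) / (cmod D)\<^sup>2"
    by (simp only: Re_divide_norm)
  moreover have "Re (rot6 * of_real corner_radius * (1 - rot30) * cnj D) =
     corner_radius * (1 / 2 * (1 + ?q) * (1 - cos (pi / 15)) + sqrt 3 / 2 * (1 - ?q) * sin (pi / 15))"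
  proof -
    have "(1 - rot30) * cnj D = Complex ((1 + ?q) * (1 - cos (pi / 15))) (- ((1 - ?q) * sin (pi / 15)))"
      using sin_cos_squared_add[of "pi / 15"]
      by (simp add: complex_eq_iff D_def rot30_def algebra_simps power2_eq_square)
    note eq = this
    have "Re (rot6 * of_real corner_radius * ((1 - rot30) * cnj D)) =
     corner_radius * (1 / 2 * (1 + ?q) * (1 - cos (pi / 15)) + sqrt 3 / 2 * (1 - ?q) * sin (pi / 15))"
      unfolding eq by (simp add: rot6_def cos_60 sin_60 field_simps)
    then show ?thesis by (simp only: mult.assoc)
  qed
  ultimately have side_eq: "side = corner_radius * (1 / 2 * (1 + ?q) * (1 - cos (pi / 15)) + sqrt 3 / 2 * (1 - ?q) * sin (pi / 15)) / (cmod D)\<^sup>2"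
    by simp
  have "sin (pi / 15) > 0" by (intro sin_gt_zero) auto
  then have "0 < 1 / 2 * (1 + ?q) * (1 - cos (pi / 15)) + sqrt 3 / 2 * (1 - ?q) * sin (pi / 15)"
    using q by (intro add_nonneg_pos mult_pos_pos mult_nonneg_nonneg) auto
  then show ?thesis unfolding side_eq using corner_radius_bounds(1) D0 by (intro divide_pos_pos mult_pos_pos) auto
qed

lemma to_vertex_disc: "z \<in> disc \<Longrightarrow> to_vertex z \<in> disc"
  using half_turn_in_disc[OF corner_disc, of z] by (simp add: to_vertex_def norm_mult)

lemma rotate_disc: "cmod c = 1 \<Longrightarrow> z \<in> disc \<Longrightarrow> c * z \<in> disc"
  by (simp add: norm_mult)

lemma from_vertex_disc: "w \<in> disc \<Longrightarrow> from_vertex w \<in> disc"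
  unfolding from_vertex_def by (intro half_turn_in_disc corner_disc rotate_disc) simp_all

lemma side_less_1: "side < 1"
proof -
  have "of_real corner_radius * rot30 \<in> disc" using corner_radius_bounds by (simp add: norm_mult)
  from to_vertex_disc[OF this] show ?thesis by (simp add: to_vertex_next_corner)
qed

lemma side_disc [simp]: "of_real side \<in> disc"
  using side_pos side_less_1 by simp

lemma from_to_vertex: "z \<in> disc \<Longrightarrow> from_vertex (to_vertex z) = z"
  unfolding from_vertex_def to_vertex_def cnj_unit_cancel by (rule half_turn_involution[OF corner_disc])

lemma to_from_vertex: "w \<in> disc \<Longrightarrow> to_vertex (from_vertex w) = w"
  unfolding from_vertex_def to_vertex_def
  by (subst half_turn_involution[OF corner_disc rotate_disc]) simp_all

lemma from_vertex_0: "from_vertex 0 = of_real corner_radius"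
  by (simp add: from_vertex_def)

lemma from_vertex_side: "from_vertex (of_real side) = rot30 * of_real corner_radius"
proof -
  have "of_real corner_radius * rot30 \<in> disc" using corner_radius_bounds by (simp add: norm_mult)
  from from_to_vertex[OF this] show ?thesis unfolding to_vertex_next_corner by (simp add: mult.commute)
qed

lemma flip_disc: "w \<in> disc \<Longrightarrow> flip w \<in> disc"
  unfolding flip_def by (rule half_turn_in_disc[OF side_disc])

lemma flip_flip: "w \<in> disc \<Longrightarrow> flip (flip w) = w"
  unfolding flip_def by (rule half_turn_involution[OF side_disc])

text \<open>This is the relation between the rotation about the centre, the rotation about a corner
  and the half-turn about the midpoint of a side, that is, the relation of the triangle group
  (2,3,30).\<close>
lemma triangle_group_relation:
  assumes z: "z \<in> disc"
  shows "to_vertex (cnj rot30 * z) = rot3 * flip (to_vertex z)"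
proof -
  let ?c = "of_real corner_radius :: complex"
  define y where "y = ?c * rot30"
  have y: "y \<in> disc" using corner_radius_bounds by (simp add: y_def norm_mult)
  have cc: "cnj ?c = ?c" by simp
  have nz: "1 - ?c * z \<noteq> 0" "1 - ?c * y \<noteq> 0" "1 - cnj y * z \<noteq> 0" "1 - ?c * cnj y \<noteq> 0" "1 - ?c * ?c \<noteq> 0"
    using one_minus_cnj_mult_nonzero[OF corner_disc z] one_minus_cnj_mult_nonzero[OF corner_disc y]
      one_minus_cnj_mult_nonzero[OF y z] one_minus_cnj_mult_nonzero[OF y corner_disc]
      one_minus_cnj_mult_nonzero[OF corner_disc corner_disc] by (simp_all add: mult.commute)
  have X: "of_real side = rot6 * half_turn ?c y"
    unfolding to_vertex_next_corner[symmetric] to_vertex_def y_def ..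
  have Xc: "cnj (of_real side) = cnj rot6 * cnj (half_turn ?c y)" unfolding X by simp
  have Xr: "cnj (of_real side) * (rot6 * half_turn ?c z) = cnj (half_turn ?c y) * half_turn ?c z"
    unfolding Xc using cnj_mult_unit(1)[of rot6] by (simp add: mult.assoc mult.left_commute)
  have 1: "half_turn ?c y - half_turn ?c z = (1 - ?c * ?c) * (z - y) / ((1 - ?c * y) * (1 - ?c * z))"
    using nz unfolding half_turn_def cc by (simp add: divide_simps) (simp add: algebra_simps)
  have 2: "1 - cnj (half_turn ?c y) * half_turn ?c z = (1 - ?c * ?c) * (1 - cnj y * z) / ((1 - ?c * cnj y) * (1 - ?c * z))"
    using nz unfolding half_turn_def cc by (simp add: divide_simps) (simp add: algebra_simps)
  have "flip (to_vertex z) = rot6 * (half_turn ?c y - half_turn ?c z) / (1 - cnj (half_turn ?c y) * half_turn ?c z)"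
    unfolding flip_def to_vertex_def half_turn_def[of "of_real side"] Xr unfolding X by (simp add: algebra_simps)
  also have "\<dots> = rot6 * ((z - y) * (1 - ?c * cnj y)) / ((1 - ?c * y) * (1 - cnj y * z))"
    unfolding 1 2 using nz by (simp add: divide_simps)
  finally have F: "rot3 * flip (to_vertex z) = rot6 * ((rot3 * (1 - ?c * cnj y)) * (z - y)) / ((1 - ?c * y) * (1 - cnj y * z))"
    by simp
  have "rot3 * (1 - ?c * cnj y) = - cnj rot30 * (1 - ?c * y)"
    using angle_condition by (simp add: y_def power2_eq_square mult.assoc)
  then have "rot3 * flip (to_vertex z) = rot6 * (- cnj rot30 * (z - y)) / (1 - cnj y * z)"
    unfolding F using nz by (simp add: divide_simps)
  also have "\<dots> = rot6 * ((?c - cnj rot30 * z) / (1 - ?c * (cnj rot30 * z)))"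
    using cnj_mult_unit(1)[of rot30] by (simp add: y_def algebra_simps)
  also have "\<dots> = to_vertex (cnj rot30 * z)" by (simp add: to_vertex_def half_turn_def)
  finally show ?thesis by simp
qed

lemma from_vertex_flip:
  assumes "w \<in> disc"
  shows "from_vertex (rot3 * flip w) = cnj rot30 * from_vertex w"
proof -
  have "to_vertex (cnj rot30 * from_vertex w) = rot3 * flip w"
    using triangle_group_relation[OF from_vertex_disc[OF assms]] to_from_vertex[OF assms] by simp
  moreover have "cnj rot30 * from_vertex w \<in> disc" using from_vertex_disc[OF assms] by (intro rotate_disc) simp_all
  ultimately show ?thesis using from_to_vertex by metis
qed

subsection \<open>Half-planes and sectors\<close>

lemma Im_half_turn_real:
  assumes X: "of_real X \<in> disc" and w: "w \<in> disc"
  shows "Im (half_turn (of_real X) w) = - ((1 - X\<^sup>2) / (cmod (1 - of_real X * w))\<^sup>2) * Im w"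
proof -
  have "Im (half_turn (of_real X) w) = Im ((of_real X - w) * cnj (1 - of_real X * w)) / (cmod (1 - of_real X * w))\<^sup>2"
    unfolding half_turn_def Im_divide_norm by simp
  also have "Im ((of_real X - w) * cnj (1 - of_real X * w)) = - (1 - X\<^sup>2) * Im w"
    by (simp add: algebra_simps power2_eq_square)
  finally show ?thesis
    by (simp only: minus_mult_left[symmetric] minus_divide_left[symmetric] times_divide_eq_left)
qed

lemma sgn_Im_half_turn_real:
  assumes X: "of_real X \<in> disc" and w: "w \<in> disc"
  shows "Im (half_turn (of_real X) w) > 0 \<longleftrightarrow> Im w < 0" "Im (half_turn (of_real X) w) < 0 \<longleftrightarrow> Im w > 0"
proof -
  define K where "K = (1 - X\<^sup>2) / (cmod (1 - of_real X * w))\<^sup>2"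
  have K: "K > 0"
    using X one_minus_cnj_mult_nonzero[OF X w] by (simp add: K_def abs_square_less_1)
  have "Im (half_turn (of_real X) w) = - K * Im w"
    unfolding Im_half_turn_real[OF assms] K_def ..
  then show "Im (half_turn (of_real X) w) > 0 \<longleftrightarrow> Im w < 0" "Im (half_turn (of_real X) w) < 0 \<longleftrightarrow> Im w > 0"
    using K by (simp_all add: zero_less_mult_iff mult_less_0_iff)
qed

text \<open>Up to a positive factor, this is the imaginary part of \<open>z\<close> after the side has
  been moved to the real axis; so its sign tells on which side of the line of the polygon side a point
  lies.\<close>
definition side_form :: "complex \<Rightarrow> real" where
  "side_form z = Im (rot6 * (of_real corner_radius - z) * cnj (1 - of_real corner_radius * z))"

lemma Im_to_vertex:
  assumes "z \<in> disc"
  shows "Im (to_vertex z) = side_form z / (cmod (1 - of_real corner_radius * z))\<^sup>2"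
    "(cmod (1 - of_real corner_radius * z))\<^sup>2 > 0"
proof -
  have nz: "1 - of_real corner_radius * z \<noteq> 0" using one_minus_cnj_mult_nonzero[OF corner_disc assms] by simp
  then show "(cmod (1 - of_real corner_radius * z))\<^sup>2 > 0" by simp
  show "Im (to_vertex z) = side_form z / (cmod (1 - of_real corner_radius * z))\<^sup>2"
    unfolding side_form_def to_vertex_def half_turn_def complex_cnj_complex_of_real times_divide_eq_right
    by (rule Im_divide_norm)
qed

lemma sgn_Im_to_vertex:
  assumes "z \<in> disc"
  shows "Im (to_vertex z) \<ge> 0 \<longleftrightarrow> side_form z \<ge> 0" "Im (to_vertex z) > 0 \<longleftrightarrow> side_form z > 0"
    "Im (to_vertex z) = 0 \<longleftrightarrow> side_form z = 0"
  using Im_to_vertex[OF assms] by (auto simp: zero_le_divide_iff zero_less_divide_iff)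

definition form_quad :: real where "form_quad = sqrt 3 / 2 * corner_radius"
definition form_lin :: real where
  "form_lin = sin (pi / 3 + pi / 30) + corner_radius\<^sup>2 * sin (pi / 3 - pi / 30)"

text \<open>In this form the rotations about the centre affect only the linear term, so that comparing
  different sides is comparing cosines.\<close>
lemma side_form_eq:
  "side_form z = form_quad * (1 + (cmod z)\<^sup>2) - form_lin * Re (cnj (cis (pi / 30)) * z)"
proof -
  let ?q = "corner_radius\<^sup>2"
  define h where "h = cis (pi / 30)"
  have e: "pi / 3 + pi / 30 = 11 * pi / 30" "pi / 3 - pi / 30 = 3 * pi / 10" by (simp_all add: field_simps)
  have "h * (rot6 - of_real ?q * cnj rot6) = \<i> * of_real form_lin"
  proof -
    have "Re (h * (rot6 - of_real ?q * cnj rot6)) = cos (pi / 3 + pi / 30) - ?q * cos (pi / 3 - pi / 30)"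
      unfolding h_def rot6_def by (rule cis_difference)
    also have "\<dots> = 0" unfolding e using corner_radius_sq by simp
    finally have "Re (h * (rot6 - of_real ?q * cnj rot6)) = 0" .
    moreover have "Im (h * (rot6 - of_real ?q * cnj rot6)) = form_lin"
      unfolding h_def rot6_def form_lin_def by (rule cis_difference)
    ultimately show ?thesis by (simp only: complex_eq_iff) simp
  qed
  then have "cnj h * (h * (rot6 - of_real ?q * cnj rot6)) = cnj h * (\<i> * of_real form_lin)" by simp
  then have k: "rot6 - of_real ?q * cnj rot6 = \<i> * of_real form_lin * cnj h"
    using cnj_mult_cancel[of h "rot6 - of_real ?q * cnj rot6"] unfolding h_def by (simp only: norm_cis mult_ac)
  have "rot6 * (of_real corner_radius - z) * cnj (1 - of_real corner_radius * z) =
     rot6 * of_real (corner_radius * (1 + (cmod z)\<^sup>2)) - (rot6 * z + of_real ?q * (rot6 * cnj z))"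
    unfolding of_real_mult of_real_add complex_norm_square by (simp add: power2_eq_square algebra_simps)
  then have "side_form z = Im (rot6 * of_real (corner_radius * (1 + (cmod z)\<^sup>2))) - Im (rot6 * z) - ?q * Im (rot6 * cnj z)"
    unfolding side_form_def by simp
  also have "Im (rot6 * cnj z) = - Im (cnj rot6 * z)" by simp
  also have "Im (rot6 * of_real (corner_radius * (1 + (cmod z)\<^sup>2))) = form_quad * (1 + (cmod z)\<^sup>2)"
    by (simp add: rot6_def sin_60 form_quad_def)
  also have "form_quad * (1 + (cmod z)\<^sup>2) - Im (rot6 * z) - ?q * - Im (cnj rot6 * z) =
     form_quad * (1 + (cmod z)\<^sup>2) - Im ((rot6 - of_real ?q * cnj rot6) * z)"
    by (simp add: algebra_simps)
  also have "Im ((rot6 - of_real ?q * cnj rot6) * z) = form_lin * Re (cnj h * z)"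
    unfolding k by (simp add: algebra_simps)
  finally show ?thesis unfolding h_def .
qed

lemma form_pos: "form_quad > 0" "form_lin > 0"
proof -
  show "form_quad > 0" using corner_radius_bounds by (simp add: form_quad_def)
  have "sin (pi / 3 + pi / 30) > 0" "sin (pi / 3 - pi / 30) > 0"
    using pi_gt_zero by (auto intro!: sin_gt_zero simp: field_simps)
  then show "form_lin > 0" unfolding form_lin_def by (intro add_pos_nonneg) auto
qed

lemma form_at_boundary: "2 * form_quad < form_lin * cos (pi / 30)"
proof -
  have "side_form 1 = 2 * form_quad - form_lin * cos (pi / 30)" by (simp add: side_form_eq)
  moreover have "side_form 1 = - (sqrt 3 / 2 * (1 - corner_radius)\<^sup>2)"
    by (simp add: side_form_def rot6_def sin_60 power2_eq_square algebra_simps)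
  moreover have "sqrt 3 / 2 * (1 - corner_radius)\<^sup>2 > 0" using corner_radius_bounds by simp
  ultimately show ?thesis by linarith
qed

text \<open>The sector of the disc that belongs to one side of the polygon, as seen from the
  centre.\<close>
definition side_sector :: "complex set" where
  "side_sector = {z. 0 \<le> Im z \<and> Im (cnj rot30 * z) \<le> 0}"

text \<open>The double sector that belongs to a corner: both sides at the corner lie in it, apart from
  their other ends.\<close>
definition corner_wedge :: "complex set" where
  "corner_wedge = {z. 0 < Im (rot30 * z) \<and> Im (cnj rot30 * z) < 0}"

text \<open>One third of the plane, the part that a corner of the polygon occupies after it has been
  moved to the origin.\<close>
definition vertex_sector :: "complex set" where
  "vertex_sector = {w. 0 \<le> Im w \<and> Im (cnj rot3 * w) \<le> 0}"

lemma open_corner_wedge: "open corner_wedge"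
  unfolding corner_wedge_def by (intro open_Collect_conj open_Collect_less continuous_intros)

lemma closed_vertex_sector: "closed vertex_sector"
  unfolding vertex_sector_def by (intro closed_Collect_conj closed_Collect_le continuous_intros)

lemma sin_th_pos: "sin (pi / 15) > 0" and cos_th_pos: "cos (pi / 15) > 0"
  by (auto intro!: sin_gt_zero cos_gt_zero)

lemma Im_rot30_mult: "Im (rot30 * z) = 2 * cos (pi / 15) * Im z - Im (cnj rot30 * z)"
  by (simp add: rot30_def)

lemma side_sector_cone:
  assumes "z \<in> side_sector"
  obtains a b where "0 \<le> a" "0 \<le> b" "z = of_real a + of_real b * rot30"
proof -
  define a where "a = - Im (cnj rot30 * z) / sin (pi / 15)"
  define b where "b = Im z / sin (pi / 15)"
  have "z = of_real a + of_real b * rot30"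
    using sin_th_pos by (simp add: complex_eq_iff a_def b_def rot30_def field_simps)
  moreover have "0 \<le> a" "0 \<le> b"
    using assms sin_th_pos by (simp_all add: side_sector_def a_def b_def field_simps)
  ultimately show ?thesis using that by blast
qed

text \<open>The midpoint of a side has argument pi/30 and the corners are 2 * pi/30 apart, so the angle
  between a midpoint and a corner is an odd multiple of pi/30. It is least for the two corners of the
  side.\<close>
lemma cos_odd_multiple_le:
  fixes m :: int
  assumes "odd m"
  shows "cos (of_int m * (pi / 30)) \<le> cos (pi / 30)"
proof -
  define r where "r = m mod 60"
  define q where "q = m div 60"
  have m: "m = 60 * q + r" by (simp add: r_def q_def)
  have r: "0 \<le> r" "r < 60" "odd r" using assms by (auto simp: r_def) presburger
  have "of_int m * (pi / 30) = of_int r * (pi / 30) + 2 * pi * of_int q"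
    unfolding m by (simp add: field_simps)
  then have "cos (of_int m * (pi / 30)) = cos (of_int r * (pi / 30))"
    by (simp only: cos_add cos_int_2pin sin_int_2pin mult_1_right mult_zero_right diff_zero)
  also have "\<dots> \<le> cos (pi / 30)"
  proof (cases "r \<le> 30")
    case True
    have "r \<ge> 1" using r by presburger
    then have "1 \<le> real_of_int r" "real_of_int r \<le> 30" using True by linarith+
    then have "pi / 30 \<le> of_int r * (pi / 30)" "of_int r * (pi / 30) \<le> pi"
      using mult_right_mono[of 1 "real_of_int r" "pi / 30"] mult_right_mono[of "real_of_int r" 30 "pi / 30"] by auto
    then show ?thesis by (intro cos_monotone_0_pi_le) auto
  next
    case False
    have "r \<le> 59" using r by presburger
    then have "1 \<le> 60 - real_of_int r" "60 - real_of_int r \<le> 30" using False by linarith+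
    then have 1: "pi / 30 \<le> (60 - of_int r) * (pi / 30)" "(60 - of_int r) * (pi / 30) \<le> pi"
      using mult_right_mono[of 1 "60 - real_of_int r" "pi / 30"] mult_right_mono[of "60 - real_of_int r" 30 "pi / 30"] by auto
    have "cos (of_int r * (pi / 30)) = cos ((60 - of_int r) * (pi / 30))"
      using cos_diff[of "2 * pi" "of_int r * (pi / 30)"] by (simp add: algebra_simps)
    also have "\<dots> \<le> cos (pi / 30)" using 1 by (intro cos_monotone_0_pi_le) auto
    finally show ?thesis .
  qed
  finally show ?thesis .
qed

text \<open>In a sector only the nearest side matters.\<close>
lemma side_form_le_rotated:
  assumes "z \<in> side_sector"
  shows "side_form z \<le> side_form (cnj rot30 ^ k * z)"
proof -
  obtain a b where ab: "0 \<le> a" "0 \<le> b" "z = of_real a + of_real b * rot30"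
    using side_sector_cone[OF assms] .
  have c: "cnj (cis (pi / 30)) * (cnj rot30 ^ k * z) =
     of_real a * cis (- ((2 * real k + 1) * (pi / 30))) + of_real b * cis (- ((2 * real k - 1) * (pi / 30)))"
  proof -
    have "- (pi / 30) + - (real k * (pi / 15)) = - ((2 * real k + 1) * (pi / 30))"
      "- (pi / 30) + (- (real k * (pi / 15)) + pi / 15) = - ((2 * real k - 1) * (pi / 30))" by (simp_all add: field_simps)
    then show ?thesis unfolding ab(3) cnj_rot30_pow unfolding rot30_def cis_cnj
      by (simp only: cis_sum_expand)
  qed
  have odd: "odd (2 * int k + 1)" "odd (2 * int k - 1)" by presburger+
  have "cos ((2 * real k + 1) * (pi / 30)) \<le> cos (pi / 30)" "cos ((2 * real k - 1) * (pi / 30)) \<le> cos (pi / 30)"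
    using cos_odd_multiple_le[OF odd(1)] cos_odd_multiple_le[OF odd(2)] by simp_all
  then have "a * cos ((2 * real k + 1) * (pi / 30)) + b * cos ((2 * real k - 1) * (pi / 30)) \<le> a * cos (pi / 30) + b * cos (pi / 30)"
    using ab by (intro add_mono mult_left_mono) auto
  then have 1: "Re (cnj (cis (pi / 30)) * (cnj rot30 ^ k * z)) \<le> (a + b) * cos (pi / 30)"
    unfolding c by (simp add: algebra_simps)
  have 2: "Re (cnj (cis (pi / 30)) * z) = (a + b) * cos (pi / 30)"
  proof -
    have "cnj (cis (pi / 30)) * z = of_real a * cis (- (pi / 30)) + of_real b * (cis (- (pi / 30)) * rot30)"
      by (simp add: ab(3) cis_cnj algebra_simps)
    also have "cis (- (pi / 30)) * rot30 = cis (pi / 30)" by (simp add: rot30_def cis_mult)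
    finally show ?thesis by (simp add: algebra_simps)
  qed
  have "form_lin * Re (cnj (cis (pi / 30)) * (cnj rot30 ^ k * z)) \<le> form_lin * Re (cnj (cis (pi / 30)) * z)"
    using 1 2 form_pos by (intro mult_left_mono) auto
  moreover have "cmod (cnj rot30 ^ k * z) = cmod z" by (simp add: norm_mult norm_power)
  ultimately show ?thesis by (simp only: side_form_eq)
qed

lemma ex_side_sector: "\<exists>j<30. cnj rot30 ^ j * z \<in> side_sector"
proof -
  define \<alpha> where "\<alpha> = Arg2pi z"
  have \<alpha>: "0 \<le> \<alpha>" "\<alpha> < 2 * pi" "z = of_real (cmod z) * cis \<alpha>"
    using Arg2pi[of z] by (simp_all add: \<alpha>_def cis_conv_exp is_Arg_def)
  define j where "j = nat \<lfloor>\<alpha> / (pi / 15)\<rfloor>"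
  have "0 \<le> \<alpha> / (pi / 15)" using \<alpha> by simp
  then have j: "real j \<le> \<alpha> / (pi / 15)" "\<alpha> / (pi / 15) < real j + 1" unfolding j_def by linarith+
  then have j': "real j * (pi / 15) \<le> \<alpha>" "\<alpha> < real j * (pi / 15) + pi / 15" by (simp_all add: field_simps)
  have "\<alpha> / (pi / 15) < 30" using \<alpha>(2) by (simp add: field_simps)
  then have "j < 30" using j(1) by linarith
  have "cnj rot30 ^ j * z = of_real (cmod z) * cis (\<alpha> - real j * (pi / 15))"
    by (subst \<alpha>(3)) (simp add: cnj_rot30_pow mult.left_commute cis_mult)
  then have "Im (cnj rot30 ^ j * z) = cmod z * sin (\<alpha> - real j * (pi / 15))"
    "Im (cnj rot30 * (cnj rot30 ^ j * z)) = cmod z * sin (\<alpha> - real j * (pi / 15) - pi / 15)"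
    by (simp_all only: polar_rot30 Im_polar)
  moreover have "0 \<le> sin (\<alpha> - real j * (pi / 15))" using j' by (intro sin_ge_zero) auto
  moreover have "sin (\<alpha> - real j * (pi / 15) - pi / 15) \<le> 0"
  proof -
    have "0 \<le> sin (- (\<alpha> - real j * (pi / 15) - pi / 15))" using j' by (intro sin_ge_zero) auto
    then show ?thesis unfolding sin_minus by linarith
  qed
  ultimately have "cnj rot30 ^ j * z \<in> side_sector"
    unfolding side_sector_def mem_Collect_eq by (simp only: mult_nonneg_nonneg mult_nonneg_nonpos norm_ge_zero simp_thms)
  then show ?thesis using \<open>j < 30\<close> by blast
qed

lemma corner_wedge_polar:
  assumes "z \<in> corner_wedge"
  shows "z \<noteq> 0" "\<exists>\<alpha>. \<bar>\<alpha>\<bar> < pi / 15 \<and> z = of_real (cmod z) * cis \<alpha>"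
proof -
  show z0: "z \<noteq> 0" using assms by (auto simp: corner_wedge_def)
  define \<alpha> where "\<alpha> = Arg z"
  have \<alpha>: "- pi < \<alpha>" "\<alpha> \<le> pi" "z = of_real (cmod z) * cis \<alpha>"
    using mpi_less_Arg[of z] Arg_le_pi[of z] Arg_eq[OF z0] by (simp_all add: \<alpha>_def cis_conv_exp)
  have "Im (rot30 * z) = cmod z * sin (\<alpha> + pi / 15)" "Im (cnj rot30 * z) = cmod z * sin (\<alpha> - pi / 15)"
    by (subst \<alpha>(3), simp only: polar_rot30 Im_polar)+
  then have s: "0 < sin (\<alpha> + pi / 15)" "sin (\<alpha> - pi / 15) < 0"
    using assms z0 unfolding corner_wedge_def mem_Collect_eq by (simp_all add: zero_less_mult_iff mult_less_0_iff)
  have "\<alpha> < pi / 15"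
  proof (rule ccontr)
    assume "\<not> \<alpha> < pi / 15"
    then have "0 \<le> sin (\<alpha> - pi / 15)" using \<alpha> by (intro sin_ge_zero) auto
    then show False using s by simp
  qed
  moreover have "- (pi / 15) < \<alpha>"
  proof (rule ccontr)
    assume "\<not> - (pi / 15) < \<alpha>"
    then have "0 \<le> sin (- (\<alpha> + pi / 15))" using \<alpha> by (intro sin_ge_zero) auto
    then show False using s unfolding sin_minus by linarith
  qed
  ultimately have "\<bar>\<alpha>\<bar> < pi / 15" by linarith
  then show "\<exists>\<alpha>. \<bar>\<alpha>\<bar> < pi / 15 \<and> z = of_real (cmod z) * cis \<alpha>" using \<alpha>(3) by blast
qed

lemma rotated_angle:
  fixes \<alpha> \<beta> :: real
  assumes "z \<noteq> 0" "z = of_real (cmod z) * cis \<alpha>" "cnj rot30 ^ d * z = of_real (cmod z) * cis \<beta>"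
  shows "\<exists>n::int. \<alpha> - \<beta> = (real d + 30 * of_int n) * (pi / 15)"
proof -
  have "of_real (cmod z) * cis (\<alpha> - real d * (pi / 15)) = cnj rot30 ^ d * (of_real (cmod z) * cis \<alpha>)"
    by (simp add: cnj_rot30_pow mult.left_commute cis_mult)
  also have "\<dots> = of_real (cmod z) * cis \<beta>" using assms(2,3) by simp
  finally have "cis (\<alpha> - real d * (pi / 15)) = cis \<beta>" using assms(1) by simp
  then have "cos (\<alpha> - real d * (pi / 15)) = cos \<beta>" "sin (\<alpha> - real d * (pi / 15)) = sin \<beta>"
    by (simp_all add: complex_eq_iff)
  then obtain n :: int where "\<alpha> - real d * (pi / 15) = \<beta> + 2 * pi * of_int n"
    using sin_cos_eq_iff by blast
  then show ?thesis by (intro exI[of _ n]) (simp add: field_simps)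
qed

text \<open>The wedges of two corners meet only if the corners are equal or adjacent.\<close>
lemma corner_wedges_adjacent:
  assumes "z \<in> corner_wedge" "cnj rot30 ^ d * z \<in> corner_wedge"
  shows "d mod 30 \<in> {0, 1, 29}"
proof -
  obtain \<alpha> where \<alpha>: "\<bar>\<alpha>\<bar> < pi / 15" "z = of_real (cmod z) * cis \<alpha>" using corner_wedge_polar(2)[OF assms(1)] by blast
  have "cmod (cnj rot30 ^ d * z) = cmod z" by (simp add: norm_mult norm_power)
  then obtain \<beta> where \<beta>: "\<bar>\<beta>\<bar> < pi / 15" "cnj rot30 ^ d * z = of_real (cmod z) * cis \<beta>"
    using corner_wedge_polar(2)[OF assms(2)] by metis
  obtain n :: int where n: "\<alpha> - \<beta> = (real d + 30 * of_int n) * (pi / 15)"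
    using rotated_angle[OF corner_wedge_polar(1)[OF assms(1)] \<alpha>(2) \<beta>(2)] by blast
  have "\<bar>(real d + 30 * of_int n) * (pi / 15)\<bar> < 2 * (pi / 15)" using \<alpha>(1) \<beta>(1) unfolding n[symmetric] by linarith
  then have "\<bar>real d + 30 * of_int n\<bar> < 2" by (simp add: abs_mult)
  then have cases: "int d + 30 * n = -1 \<or> int d + 30 * n = 0 \<or> int d + 30 * n = 1" by linarith
  have "int d mod 30 = c mod 30" if "int d + 30 * n = c" for c
  proof -
    have "int d = c + (- n) * 30" using that by simp
    then show ?thesis by (metis mod_mult_self1)
  qed
  then have "int d mod 30 \<in> {(-1) mod 30, 0 mod 30, 1 mod 30}" using cases by blast
  moreover have "int (d mod 30) = int d mod 30" by (simp add: zmod_int)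
  ultimately have "int (d mod 30) = 29 \<or> int (d mod 30) = 0 \<or> int (d mod 30) = 1" by simp
  then have "d mod 30 = 0 \<or> d mod 30 = 1 \<or> d mod 30 = 29" by linarith
  then show ?thesis by simp
qed

text \<open>Half-open, so that the rotated copies are disjoint; this makes the position of a boundary
  point unique.\<close>
definition half_open_sector :: "complex set" where
  "half_open_sector = {z. 0 \<le> Im z \<and> Im (cnj rot30 * z) < 0}"

lemma half_open_sector_rotated:
  assumes "z \<in> half_open_sector" "cnj rot30 ^ d * z \<in> half_open_sector"
  shows "d mod 30 = 0"
proof -
  have polar: "z \<noteq> 0 \<and> (\<exists>\<alpha>. 0 \<le> \<alpha> \<and> \<alpha> < pi / 15 \<and> z = of_real (cmod z) * cis \<alpha>)" if z: "z \<in> half_open_sector" for z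
  proof -
    have "0 < Im (rot30 * z)"
    proof -
      have "0 \<le> 2 * cos (pi / 15) * Im z" "Im (cnj rot30 * z) < 0"
        using z cos_th_pos unfolding half_open_sector_def mem_Collect_eq by simp_all
      then show ?thesis using Im_rot30_mult[of z] by linarith
    qed
    then have "z \<in> corner_wedge" using z unfolding half_open_sector_def corner_wedge_def by blast
    then obtain \<alpha> where \<alpha>: "z \<noteq> 0" "\<bar>\<alpha>\<bar> < pi / 15" "z = of_real (cmod z) * cis \<alpha>" using corner_wedge_polar by blast
    have "0 \<le> \<alpha>"
    proof (rule ccontr)
      assume "\<not> 0 \<le> \<alpha>"
      then have "0 < sin (- \<alpha>)" using \<alpha>(2) by (intro sin_gt_zero) auto
      then have "Im (of_real (cmod z) * cis \<alpha>) < 0" using \<alpha>(1) by (simp add: mult_less_0_iff)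
      then show False using z \<alpha>(3) by (simp add: half_open_sector_def)
    qed
    then show ?thesis using \<alpha> by (auto intro!: exI[of _ \<alpha>])
  qed
  obtain \<alpha> where \<alpha>: "z \<noteq> 0" "0 \<le> \<alpha>" "\<alpha> < pi / 15" "z = of_real (cmod z) * cis \<alpha>" using polar[OF assms(1)] by blast
  have "cmod (cnj rot30 ^ d * z) = cmod z" by (simp add: norm_mult norm_power)
  then obtain \<beta> where \<beta>: "0 \<le> \<beta>" "\<beta> < pi / 15" "cnj rot30 ^ d * z = of_real (cmod z) * cis \<beta>"
    using polar[OF assms(2)] by metis
  obtain n :: int where n: "\<alpha> - \<beta> = (real d + 30 * of_int n) * (pi / 15)"
    using rotated_angle[OF \<alpha>(1,4) \<beta>(3)] by blast
  have "\<bar>(real d + 30 * of_int n) * (pi / 15)\<bar> < 1 * (pi / 15)" using \<alpha>(2,3) \<beta>(1,2) unfolding n[symmetric] by linarith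
  then have "\<bar>real d + 30 * of_int n\<bar> < 1" by (simp add: abs_mult)
  then have "int d + 30 * n = 0" by linarith
  then show ?thesis by presburger
qed

subsection \<open>The polygon\<close>

text \<open>Here \<open>k\<close> ranges over all natural numbers instead of the residues modulo 30,
  which makes the rotations symmetries at once.\<close>
definition polygon :: "complex set" where
  "polygon = {z \<in> disc. \<forall>k. 0 \<le> side_form (cnj rot30 ^ k * z)}"

definition polygon_interior :: "complex set" where
  "polygon_interior = {z \<in> disc. \<forall>k. 0 < side_form (cnj rot30 ^ k * z)}"

text \<open>For \<open>0 \<le> y \<le> side\<close> this runs through the side from the corner on the
  positive real axis to the next corner.\<close>
definition edge_point :: "real \<Rightarrow> complex" where
  "edge_point y = from_vertex (of_real y)"

text \<open>The restriction of \<open>flip\<close> to the side: it exchanges the two directions in which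
  a side is run through.\<close>
definition flip_real :: "real \<Rightarrow> real" where
  "flip_real y = (side - y) / (1 - side * y)"

lemma cnj_rot30_pow_30: "cnj rot30 ^ 30 = 1"
  using rot30_pow by (metis complex_cnj_one complex_cnj_power)

lemma cnj_rot30_pow_mod: "cnj rot30 ^ (k mod 30) = cnj rot30 ^ k"
proof -
  have "cnj rot30 ^ k = cnj rot30 ^ (30 * (k div 30) + k mod 30)" by simp
  also have "\<dots> = cnj rot30 ^ (k mod 30)" unfolding power_add power_mult cnj_rot30_pow_30 by simp
  finally show ?thesis by simp
qed

lemma rot30_pow_mod: "rot30 ^ (k mod 30) = rot30 ^ k"
  using arg_cong[OF cnj_rot30_pow_mod[of k], of cnj] by simp

lemma rot30_pow_cancel: "rot30 ^ j * (cnj rot30 ^ j * z) = z" "cnj rot30 ^ j * (rot30 ^ j * z) = z"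
  by (simp_all add: mult.assoc[symmetric] power_mult_distrib[symmetric] cnj_mult_unit)

lemma norm_rot30_pow [simp]: "cmod (rot30 ^ j) = 1" "cmod (cnj rot30 ^ j) = 1"
  by (simp_all add: norm_power)

lemma rot30_pow_eq_cnj: "rot30 ^ j = cnj rot30 ^ (29 * j)"
proof -
  have "rot30 = cnj rot30 ^ 29"
  proof -
    have "rot30 * (cnj rot30 * cnj rot30 ^ 29) = rot30" using cnj_rot30_pow_30 by (simp add: power_Suc[symmetric] del: power_Suc)
    then show ?thesis by (simp only: cnj_unit_cancel)
  qed
  then show ?thesis by (metis power_mult)
qed

lemma polygon_rotate:
  "z \<in> polygon \<Longrightarrow> cnj rot30 ^ m * z \<in> polygon"
  "z \<in> polygon_interior \<Longrightarrow> cnj rot30 ^ m * z \<in> polygon_interior"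
  unfolding polygon_def polygon_interior_def
  by (auto simp: norm_mult norm_power mult.assoc[symmetric] power_add[symmetric])

lemma polygon_rotate_iff:
  "rot30 ^ j * z \<in> polygon \<longleftrightarrow> z \<in> polygon"
  "rot30 ^ j * z \<in> polygon_interior \<longleftrightarrow> z \<in> polygon_interior"
  using polygon_rotate[of "rot30 ^ j * z" j] polygon_rotate[of z "29 * j"]
  by (auto simp: rot30_pow_cancel rot30_pow_eq_cnj[symmetric])

lemma polygon_disc: "z \<in> polygon \<Longrightarrow> z \<in> disc" "z \<in> polygon_interior \<Longrightarrow> z \<in> disc"
  by (simp_all add: polygon_def polygon_interior_def)

lemma polygon_interior_subset: "polygon_interior \<subseteq> polygon"
  by (auto simp: polygon_def polygon_interior_def intro: less_imp_le)

lemma continuous_side_form: "continuous_on A (\<lambda>z. side_form (c * z))"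
  unfolding side_form_def by (intro continuous_intros)

lemma open_polygon_interior: "open polygon_interior"
proof -
  have "polygon_interior = disc \<inter> (\<Inter>k\<in>{..<30}. {z. 0 < side_form (cnj rot30 ^ k * z)})"
  proof -
    have "(\<forall>k<30. 0 < side_form (cnj rot30 ^ k * z)) \<longleftrightarrow> (\<forall>k. 0 < side_form (cnj rot30 ^ k * z))" for z
    proof
      assume *: "\<forall>k<30. 0 < side_form (cnj rot30 ^ k * z)"
      show "\<forall>k. 0 < side_form (cnj rot30 ^ k * z)"
      proof
        fix k
        have "k mod 30 < (30 :: nat)" by simp
        then have "0 < side_form (cnj rot30 ^ (k mod 30) * z)" using * by blast
        then show "0 < side_form (cnj rot30 ^ k * z)" by (simp only: cnj_rot30_pow_mod)
      qed
    qed simp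
    then show ?thesis by (auto simp: polygon_interior_def)
  qed
  moreover have "open {z. 0 < side_form (cnj rot30 ^ k * z)}" for k
    by (intro open_Collect_less continuous_side_form continuous_on_const)
  then have "open (\<Inter>k\<in>{..<30::nat}. {z. 0 < side_form (cnj rot30 ^ k * z)})" by (intro open_INT) auto
  ultimately show ?thesis using open_Int[OF open_ball] by metis
qed

lemma side_form_unit_circle:
  assumes "cmod z = 1" "z \<in> side_sector"
  shows "side_form z < 0"
proof -
  obtain a b where ab: "0 \<le> a" "0 \<le> b" "z = of_real a + of_real b * rot30"
    using side_sector_cone[OF assms(2)] .
  have "cmod z \<le> a + b" unfolding ab(3) using norm_triangle_ineq[of "of_real a" "of_real b * rot30"] ab
    by (simp add: norm_mult)
  then have "1 \<le> a + b" using assms(1) by simp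
  have "cnj (cis (pi / 30)) * z = of_real a * cis (- (pi / 30)) + of_real b * (cis (- (pi / 30)) * rot30)"
    by (simp add: ab(3) cis_cnj algebra_simps)
  also have "cis (- (pi / 30)) * rot30 = cis (pi / 30)" by (simp add: rot30_def cis_mult)
  finally have "Re (cnj (cis (pi / 30)) * z) = (a + b) * cos (pi / 30)" by (simp add: algebra_simps)
  moreover have "cos (pi / 30) > 0" by (intro cos_gt_zero) auto
  ultimately have "cos (pi / 30) \<le> Re (cnj (cis (pi / 30)) * z)" using \<open>1 \<le> a + b\<close> by simp
  then have "form_lin * cos (pi / 30) \<le> form_lin * Re (cnj (cis (pi / 30)) * z)"
    using form_pos by (intro mult_left_mono) auto
  then show ?thesis using form_at_boundary assms(1) by (simp add: side_form_eq)
qed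

lemma compact_polygon: "compact polygon"
proof -
  have "polygon = cball 0 1 \<inter> (\<Inter>k. {z. 0 \<le> side_form (cnj rot30 ^ k * z)})"
  proof -
    have "cmod z < 1" if z: "cmod z \<le> 1" "\<forall>k. 0 \<le> side_form (cnj rot30 ^ k * z)" for z
    proof (rule ccontr)
      assume "\<not> cmod z < 1"
      then have 1: "cmod z = 1" using z by simp
      obtain j where j: "cnj rot30 ^ j * z \<in> side_sector" using ex_side_sector by blast
      have "cmod (cnj rot30 ^ j * z) = 1" using 1 by (simp add: norm_mult norm_power)
      from side_form_unit_circle[OF this j] show False using z(2) by (metis not_le)
    qed
    then show ?thesis by (auto simp: polygon_def)
  qed
  moreover have "closed {z. 0 \<le> side_form (cnj rot30 ^ k * z)}" for k
    by (intro closed_Collect_le continuous_side_form continuous_on_const)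
  then have "closed (\<Inter>k. {z. 0 \<le> side_form (cnj rot30 ^ k * z)})" by blast
  ultimately show ?thesis using compact_Int_closed[OF compact_cball] by metis
qed

text \<open>On a radius the form of a side is a multiple of \<open>1 + t\<^sup>2 * r\<^sup>2\<close>
  minus a term linear in \<open>t\<close>. Bounding the linear term by its value at the end of the
  radius leaves the factor \<open>(1 - t) * (1 - t * r\<^sup>2)\<close>, which is positive since
  \<open>r < 1\<close>.\<close>
lemma polygon_scale:
  assumes z: "z \<in> polygon" and t: "0 \<le> t" "t < 1"
  shows "of_real t * z \<in> polygon_interior"
proof -
  have zd: "cmod z < 1" using polygon_disc(1)[OF z] by simp
  have "0 < side_form (cnj rot30 ^ k * (of_real t * z))" for k
  proof -
    let ?w = "cnj rot30 ^ k * z"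
    define R where "R = form_lin * Re (cnj (cis (pi / 30)) * ?w)"
    have n: "cmod ?w = cmod z" by (simp add: norm_mult norm_power)
    have "0 \<le> side_form ?w" using z by (simp add: polygon_def)
    then have R: "R \<le> form_quad * (1 + (cmod z)\<^sup>2)" unfolding side_form_eq n R_def by simp
    have "cnj rot30 ^ k * (of_real t * z) = of_real t * ?w" by simp
    then have "side_form (cnj rot30 ^ k * (of_real t * z)) = form_quad * (1 + (t * cmod z)\<^sup>2) - t * R"
      unfolding side_form_eq R_def using t by (simp add: norm_mult norm_power mult.left_commute)
    also have "\<dots> \<ge> form_quad * (1 + (t * cmod z)\<^sup>2) - t * (form_quad * (1 + (cmod z)\<^sup>2))"
      using R t by (simp add: mult_left_mono)
    moreover have "form_quad * (1 + (t * cmod z)\<^sup>2) - t * (form_quad * (1 + (cmod z)\<^sup>2)) =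
       form_quad * ((1 - t) * (1 - t * (cmod z)\<^sup>2))"
      by (simp add: power2_eq_square algebra_simps)
    moreover have "0 < form_quad * ((1 - t) * (1 - t * (cmod z)\<^sup>2))"
    proof -
      have "(cmod z)\<^sup>2 < 1" using zd by (simp add: abs_square_less_1)
      then have "t * (cmod z)\<^sup>2 < 1" using t mult_left_le_one_le[of "(cmod z)\<^sup>2" t] by simp
      then show ?thesis using t form_pos by simp
    qed
    ultimately show ?thesis by linarith
  qed
  moreover have "of_real t * z \<in> disc" using scaled_in_disc[OF polygon_disc(1)[OF z]] t by simp
  ultimately show ?thesis by (simp add: polygon_interior_def)
qed

lemma zero_in_polygon_interior: "0 \<in> polygon_interior"
  using form_pos by (simp add: polygon_interior_def side_form_eq)

lemma wedge_cases:
  assumes "z \<in> corner_wedge"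
  shows "z \<in> side_sector \<or> rot30 * z \<in> side_sector"
proof (cases "0 \<le> Im z")
  case True
  then have "z \<in> side_sector" using assms less_imp_le unfolding side_sector_def corner_wedge_def by blast
  then show ?thesis ..
next
  case False
  then have "Im (cnj rot30 * (rot30 * z)) \<le> 0" unfolding cnj_unit_cancel by linarith
  then have "rot30 * z \<in> side_sector" using assms less_imp_le unfolding side_sector_def corner_wedge_def by blast
  then show ?thesis ..
qed

lemma wedge_side_forms:
  assumes "z \<in> corner_wedge"
  shows "side_form z \<le> side_form (cnj rot30 ^ k * z) \<or> side_form (rot30 * z) \<le> side_form (cnj rot30 ^ k * z)"
proof -
  have "cnj rot30 ^ Suc k * (rot30 * z) = cnj rot30 ^ k * z"
    by (simp only: power_Suc2 mult.assoc cnj_unit_cancel)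
  then show ?thesis
    using wedge_cases[OF assms] side_form_le_rotated[of z k] side_form_le_rotated[of "rot30 * z" "Suc k"] by metis
qed

lemma polygon_in_wedge_forms:
  assumes z: "z \<in> corner_wedge" "z \<in> disc"
  shows "z \<in> polygon \<longleftrightarrow> 0 \<le> side_form z \<and> 0 \<le> side_form (rot30 * z)"
    and "z \<in> polygon_interior \<longleftrightarrow> 0 < side_form z \<and> 0 < side_form (rot30 * z)"
proof -
  have r: "rot30 * z = cnj rot30 ^ 29 * z" using rot30_pow_eq_cnj[of 1] by simp
  show "z \<in> polygon \<longleftrightarrow> 0 \<le> side_form z \<and> 0 \<le> side_form (rot30 * z)"
  proof
    assume "z \<in> polygon"
    then have *: "0 \<le> side_form (cnj rot30 ^ k * z)" for k by (simp add: polygon_def)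
    then show "0 \<le> side_form z \<and> 0 \<le> side_form (rot30 * z)" using *[of 0] *[of 29] unfolding r by simp
  next
    assume "0 \<le> side_form z \<and> 0 \<le> side_form (rot30 * z)"
    then have "0 \<le> side_form (cnj rot30 ^ k * z)" for k using wedge_side_forms[OF z(1), of k] by linarith
    then show "z \<in> polygon" using z(2) by (simp add: polygon_def)
  qed
  show "z \<in> polygon_interior \<longleftrightarrow> 0 < side_form z \<and> 0 < side_form (rot30 * z)"
  proof
    assume "z \<in> polygon_interior"
    then have *: "0 < side_form (cnj rot30 ^ k * z)" for k by (simp add: polygon_interior_def)
    then show "0 < side_form z \<and> 0 < side_form (rot30 * z)" using *[of 0] *[of 29] unfolding r by simp
  next
    assume "0 < side_form z \<and> 0 < side_form (rot30 * z)"
    then have "0 < side_form (cnj rot30 ^ k * z)" for k using wedge_side_forms[OF z(1), of k] by linarith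
    then show "z \<in> polygon_interior" using z(2) by (simp add: polygon_interior_def)
  qed
qed

definition open_vertex_sector :: "complex set" where
  "open_vertex_sector = {w. 0 < Im w \<and> Im (cnj rot3 * w) < 0}"

lemma open_open_vertex_sector: "open open_vertex_sector"
  unfolding open_vertex_sector_def by (intro open_Collect_conj open_Collect_less continuous_intros)

lemma open_vertex_sector_subset: "open_vertex_sector \<subseteq> vertex_sector"
  by (auto simp: open_vertex_sector_def vertex_sector_def)

lemma to_vertex_sector_iff:
  assumes z: "z \<in> disc"
  shows "to_vertex z \<in> vertex_sector \<longleftrightarrow> 0 \<le> side_form z \<and> 0 \<le> side_form (rot30 * z)"
    and "to_vertex z \<in> open_vertex_sector \<longleftrightarrow> 0 < side_form z \<and> 0 < side_form (rot30 * z)"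
proof -
  have rz: "rot30 * z \<in> disc" using z by (intro rotate_disc) simp_all
  have "to_vertex (cnj rot30 * (rot30 * z)) = rot3 * flip (to_vertex (rot30 * z))"
    by (rule triangle_group_relation[OF rz])
  then have "cnj rot3 * to_vertex z = flip (to_vertex (rot30 * z))" by (simp only: cnj_unit_cancel)
  then have 1: "0 < Im (cnj rot3 * to_vertex z) \<longleftrightarrow> Im (to_vertex (rot30 * z)) < 0"
    "Im (cnj rot3 * to_vertex z) < 0 \<longleftrightarrow> 0 < Im (to_vertex (rot30 * z))"
    unfolding flip_def by (simp_all only: sgn_Im_half_turn_real[OF side_disc to_vertex_disc[OF rz]])
  show "to_vertex z \<in> vertex_sector \<longleftrightarrow> 0 \<le> side_form z \<and> 0 \<le> side_form (rot30 * z)"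
    unfolding vertex_sector_def mem_Collect_eq
    using 1(1) sgn_Im_to_vertex(1)[OF z] sgn_Im_to_vertex(1)[OF rz] by linarith
  show "to_vertex z \<in> open_vertex_sector \<longleftrightarrow> 0 < side_form z \<and> 0 < side_form (rot30 * z)"
    unfolding open_vertex_sector_def mem_Collect_eq
    using 1(2) sgn_Im_to_vertex(2)[OF z] sgn_Im_to_vertex(2)[OF rz] by linarith
qed

lemma polygon_in_wedge:
  assumes "z \<in> corner_wedge" "z \<in> disc"
  shows "z \<in> polygon \<longleftrightarrow> to_vertex z \<in> vertex_sector"
    and "z \<in> polygon_interior \<longleftrightarrow> to_vertex z \<in> open_vertex_sector"
  using polygon_in_wedge_forms[OF assms] to_vertex_sector_iff[OF assms(2)] by simp_all

subsection \<open>Points on the sides\<close>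

lemma real_disc: "0 \<le> y \<Longrightarrow> y \<le> side \<Longrightarrow> complex_of_real y \<in> disc"
  using side_less_1 by simp

lemma flip_of_real: "flip (of_real y) = of_real (flip_real y)"
  by (simp add: flip_def half_turn_def flip_real_def)

lemma flip_real_bounds:
  assumes "0 \<le> y" "y \<le> side"
  shows "0 \<le> flip_real y" "flip_real y \<le> side" "y < side \<Longrightarrow> 0 < flip_real y" "0 < y \<Longrightarrow> flip_real y < side"
    "flip_real (flip_real y) = y"
proof -
  have "side * y \<le> side * side" using assms side_pos by (intro mult_left_mono) auto
  moreover have ss: "side * side < 1" using side_pos side_less_1 mult_strict_mono[of side 1 side 1] by simp
  ultimately have D: "0 < 1 - side * y" by linarith
  show "0 \<le> flip_real y" using assms D by (simp add: flip_real_def)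
  show "y < side \<Longrightarrow> 0 < flip_real y" using D by (simp add: flip_real_def)
  have le: "side - y \<le> side * (1 - side * y) \<longleftrightarrow> side * side * y \<le> y" by (simp add: algebra_simps)
  have "side * side * y \<le> 1 * y" using ss assms by (intro mult_right_mono) auto
  then show "flip_real y \<le> side" using D le by (simp add: flip_real_def pos_divide_le_eq)
  have less: "side - y < side * (1 - side * y) \<longleftrightarrow> side * side * y < y" by (simp add: algebra_simps)
  show "flip_real y < side" if "0 < y"
  proof -
    have "side * side * y < 1 * y" using ss that by (intro mult_strict_right_mono) auto
    then show ?thesis using D less by (simp add: flip_real_def pos_divide_less_eq)
  qed
  have "complex_of_real (flip_real (flip_real y)) = of_real y"
    using flip_flip[OF real_disc[OF assms]] by (simp only: flip_of_real)
  then show "flip_real (flip_real y) = y" by (simp only: of_real_eq_iff)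
qed

lemma flip_real_ends: "flip_real 0 = side" "flip_real side = 0"
  by (simp_all add: flip_real_def)

lemma sgn_Im_from_vertex:
  assumes "w \<in> disc"
  shows "0 < Im (from_vertex w) \<longleftrightarrow> Im (cnj rot6 * w) < 0" "Im (from_vertex w) < 0 \<longleftrightarrow> 0 < Im (cnj rot6 * w)"
proof -
  have "cnj rot6 * w \<in> disc" using assms by (intro rotate_disc) simp_all
  from sgn_Im_half_turn_real[OF corner_disc this]
  show "0 < Im (from_vertex w) \<longleftrightarrow> Im (cnj rot6 * w) < 0" "Im (from_vertex w) < 0 \<longleftrightarrow> 0 < Im (cnj rot6 * w)"
    by (simp_all only: from_vertex_def)
qed

lemma Im_rot6_real: "Im (cnj rot6 * of_real y) = - (sqrt 3 / 2 * y)" "Im (rot6 * of_real y) = sqrt 3 / 2 * y"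
  by (simp_all add: rot6_def sin_60)

lemma edge_point_disc: "0 \<le> y \<Longrightarrow> y \<le> side \<Longrightarrow> edge_point y \<in> disc"
  unfolding edge_point_def by (intro from_vertex_disc real_disc)

lemma edge_point_flip:
  assumes "0 \<le> y" "y \<le> side"
  shows "from_vertex (rot3 * of_real (flip_real y)) = cnj rot30 * edge_point y"
    and "from_vertex (rot3 * of_real y) = cnj rot30 * edge_point (flip_real y)"
proof -
  note fb = flip_real_bounds[OF assms]
  show "from_vertex (rot3 * of_real (flip_real y)) = cnj rot30 * edge_point y"
    using from_vertex_flip[OF real_disc[OF assms]] by (simp only: flip_of_real edge_point_def)
  show "from_vertex (rot3 * of_real y) = cnj rot30 * edge_point (flip_real y)"
    using from_vertex_flip[OF real_disc[OF fb(1,2)]] by (simp only: flip_of_real fb(5) edge_point_def)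
qed

lemma edge_point_sector:
  assumes "0 \<le> y" "y \<le> side"
  shows "0 \<le> Im (edge_point y)" "Im (cnj rot30 * edge_point y) \<le> 0"
    "0 < y \<Longrightarrow> 0 < Im (edge_point y)" "y < side \<Longrightarrow> Im (cnj rot30 * edge_point y) < 0"
proof -
  have 1: "0 < Im (edge_point y) \<longleftrightarrow> - (sqrt 3 / 2 * y) < 0" "Im (edge_point y) < 0 \<longleftrightarrow> 0 < - (sqrt 3 / 2 * y)"
    unfolding edge_point_def using sgn_Im_from_vertex[OF real_disc[OF assms]] by (simp_all only: Im_rot6_real)
  have "0 \<le> sqrt 3 / 2 * y" using assms by simp
  then show "0 \<le> Im (edge_point y)" using 1(2) by linarith
  show "0 < y \<Longrightarrow> 0 < Im (edge_point y)" using 1(1) by simp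
  let ?f = "flip_real y"
  note fb = flip_real_bounds[OF assms]
  have d: "rot3 * of_real ?f \<in> disc" using real_disc[OF fb(1,2)] by (intro rotate_disc) simp_all
  have "cnj rot6 * (rot3 * of_real ?f) = rot6 * of_real ?f" by (simp only: rot3_eq mult.assoc cnj_unit_cancel)
  then have 2: "0 < Im (cnj rot30 * edge_point y) \<longleftrightarrow> sqrt 3 / 2 * ?f < 0"
    "Im (cnj rot30 * edge_point y) < 0 \<longleftrightarrow> 0 < sqrt 3 / 2 * ?f"
    using sgn_Im_from_vertex[OF d] unfolding edge_point_flip(1)[OF assms] by (simp_all only: Im_rot6_real)
  have "0 \<le> sqrt 3 / 2 * ?f" using fb by simp
  then show "Im (cnj rot30 * edge_point y) \<le> 0" using 2(1) by linarith
  show "y < side \<Longrightarrow> Im (cnj rot30 * edge_point y) < 0" using 2(2) fb by simp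
qed

lemma edge_point_in_wedge:
  assumes "0 \<le> y" "y < side"
  shows "edge_point y \<in> corner_wedge" "from_vertex (rot3 * of_real y) \<in> corner_wedge"
proof -
  have le: "y \<le> side" using assms by simp
  note e = edge_point_sector[OF assms(1) le]
  have "0 < Im (rot30 * edge_point y)"
  proof -
    have "0 \<le> 2 * cos (pi / 15) * Im (edge_point y)" using e(1) cos_th_pos by simp
    then show ?thesis using e(4)[OF assms(2)] Im_rot30_mult[of "edge_point y"] by linarith
  qed
  then show "edge_point y \<in> corner_wedge" using e(4)[OF assms(2)] unfolding corner_wedge_def by blast
  let ?f = "flip_real y"
  note fb = flip_real_bounds[OF assms(1) le]
  note e' = edge_point_sector[OF fb(1,2)]
  have 1: "0 < Im (rot30 * (cnj rot30 * edge_point ?f))" using e'(3) fb(3)[OF assms(2)] by (simp only: cnj_unit_cancel)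
  have "Im (edge_point ?f) = 2 * cos (pi / 15) * Im (cnj rot30 * edge_point ?f) - Im (cnj rot30 * (cnj rot30 * edge_point ?f))"
    using Im_rot30_mult[of "cnj rot30 * edge_point ?f"] by (simp only: cnj_unit_cancel)
  moreover have "2 * cos (pi / 15) * Im (cnj rot30 * edge_point ?f) \<le> 0"
    using e'(2) cos_th_pos by (simp add: mult_nonneg_nonpos del: times_complex.sel)
  ultimately have "Im (cnj rot30 * (cnj rot30 * edge_point ?f)) < 0" using e'(3) fb(3)[OF assms(2)] by linarith
  with 1 show "from_vertex (rot3 * of_real y) \<in> corner_wedge"
    unfolding edge_point_flip(2)[OF assms(1) le] corner_wedge_def by blast
qed

lemma side_form_edge_point: "0 \<le> y \<Longrightarrow> y \<le> side \<Longrightarrow> side_form (edge_point y) = 0"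
  using sgn_Im_to_vertex(3)[OF edge_point_disc] to_from_vertex[OF real_disc] by (simp add: edge_point_def)

lemma edge_point_boundary:
  assumes "0 \<le> y" "y \<le> side"
  shows "rot30 ^ j * edge_point y \<in> polygon - polygon_interior"
proof -
  have "edge_point y \<in> side_sector" using edge_point_sector[OF assms] unfolding side_sector_def by blast
  then have "0 \<le> side_form (cnj rot30 ^ k * edge_point y)" for k
    using side_form_le_rotated[of "edge_point y" k] side_form_edge_point[OF assms] by simp
  then have "edge_point y \<in> polygon" using edge_point_disc[OF assms] by (simp add: polygon_def)
  moreover have "edge_point y \<notin> polygon_interior"
    using side_form_edge_point[OF assms] by (auto simp: polygon_interior_def intro!: exI[of _ 0])
  ultimately show ?thesis by (simp add: polygon_rotate_iff)
qed

lemma edge_point_side: "edge_point side = rot30 * edge_point 0"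
  by (simp add: edge_point_def from_vertex_side from_vertex_0)

lemma boundary_edge_point:
  assumes "z \<in> polygon - polygon_interior"
  obtains j y where "j < 30" "0 \<le> y" "y < side" "z = rot30 ^ j * edge_point y"
proof -
  have z: "z \<in> polygon" "z \<in> disc" using assms polygon_disc by auto
  obtain k where k: "side_form (cnj rot30 ^ k * z) \<le> 0"
    using assms z(2) by (auto simp: polygon_interior_def not_less)
  obtain i where i: "i < 30" "cnj rot30 ^ i * z \<in> side_sector" using ex_side_sector by blast
  let ?w = "cnj rot30 ^ i * z"
  have w: "?w \<in> disc" using z(2) by (intro rotate_disc) simp_all
  have "side_form ?w \<le> side_form (cnj rot30 ^ (k + 29 * i) * ?w)" by (rule side_form_le_rotated[OF i(2)])
  also have "cnj rot30 ^ (k + 29 * i) * ?w = cnj rot30 ^ k * z"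
    by (simp only: power_add rot30_pow_eq_cnj[symmetric] mult.assoc rot30_pow_cancel)
  finally have "side_form ?w = 0" using k z(1) by (intro antisym) (auto simp: polygon_def)
  then have "Im (to_vertex ?w) = 0" using sgn_Im_to_vertex(3)[OF w] by simp
  then obtain y where y: "to_vertex ?w = of_real y" by (metis complex_is_Real_iff Reals_cases)
  have wy: "?w = edge_point y" using from_to_vertex[OF w] unfolding y edge_point_def by simp
  have yd: "complex_of_real y \<in> disc" using to_vertex_disc[OF w] unfolding y .
  have "y \<ge> 0"
  proof -
    have "0 \<le> Im (edge_point y)" using i(2) unfolding wy side_sector_def by blast
    then have "\<not> 0 < - (sqrt 3 / 2 * y)"
      using sgn_Im_from_vertex(2)[OF yd] unfolding edge_point_def Im_rot6_real by linarith
    then show ?thesis by (simp add: mult_less_0_iff not_less)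
  qed
  moreover have "y \<le> side"
  proof -
    have fd: "complex_of_real (flip_real y) \<in> disc" using flip_disc[OF yd] by (simp only: flip_of_real)
    have d: "rot3 * of_real (flip_real y) \<in> disc" using fd by (intro rotate_disc) simp_all
    have e: "from_vertex (rot3 * of_real (flip_real y)) = cnj rot30 * edge_point y"
      using from_vertex_flip[OF yd] by (simp only: flip_of_real edge_point_def)
    have "cnj rot6 * (rot3 * of_real (flip_real y)) = rot6 * of_real (flip_real y)" by (simp only: rot3_eq mult.assoc cnj_unit_cancel)
    then have "0 < Im (cnj rot30 * edge_point y) \<longleftrightarrow> sqrt 3 / 2 * flip_real y < 0"
      using sgn_Im_from_vertex(1)[OF d] unfolding e by (simp only: Im_rot6_real)
    then have "0 \<le> flip_real y" using i(2) unfolding wy side_sector_def mem_Collect_eq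
      by (simp only: not_less[symmetric]) (simp add: mult_less_0_iff)
    moreover have "0 < 1 - side * y"
    proof -
      have "\<bar>side * y\<bar> < 1 * 1" unfolding abs_mult using side_pos side_less_1 yd
        by (intro mult_strict_mono') auto
      then show ?thesis by linarith
    qed
    ultimately show ?thesis by (simp add: flip_real_def zero_le_divide_iff)
  qed
  moreover have zy: "z = rot30 ^ i * edge_point y" using wy rot30_pow_cancel(1)[of i z] by simp
  show ?thesis
  proof (cases "y < side")
    case True
    then show ?thesis using that[of i y] i(1) \<open>y \<ge> 0\<close> zy by blast
  next
    case False
    then have "y = side" using \<open>y \<le> side\<close> by simp
    then have "z = rot30 ^ Suc i * edge_point 0" unfolding zy by (simp add: edge_point_side mult.commute mult.left_commute)
    then have "z = rot30 ^ (Suc i mod 30) * edge_point 0" by (simp only: rot30_pow_mod)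
    then show ?thesis using that[of "Suc i mod 30" 0] side_pos by simp
  qed
qed

lemma edge_point_inj:
  assumes "0 \<le> y" "y < side" "0 \<le> y'" "y' < side" "j < 30" "j' < 30"
    and eq: "rot30 ^ j * edge_point y = rot30 ^ j' * edge_point y'"
  shows "j = j' \<and> y = y'"
proof -
  have le: "y \<le> side" "y' \<le> side" using assms by auto
  have s: "edge_point y \<in> half_open_sector" "edge_point y' \<in> half_open_sector"
    using edge_point_sector[OF assms(1) le(1)] edge_point_sector[OF assms(3) le(2)] assms
    unfolding half_open_sector_def by blast+
  \<comment> \<open>Modulo 30, the exponent \<open>29 * j\<close> stands for \<open>- j\<close>.\<close>
  have "edge_point y' = cnj rot30 ^ j' * (rot30 ^ j * edge_point y)"
    unfolding eq by (simp only: rot30_pow_cancel)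
  also have "\<dots> = cnj rot30 ^ (j' + 29 * j) * edge_point y"
    by (simp only: power_add rot30_pow_eq_cnj mult.assoc)
  finally have "(j' + 29 * j) mod 30 = 0" using half_open_sector_rotated[OF s(1)] s(2) by metis
  then have "30 dvd j' + 29 * j" by (simp only: mod_eq_0_iff_dvd)
  then obtain m where m: "j' + 29 * j = 30 * m" by (rule dvdE)
  have "int m - int j = 0" using arg_cong[OF m, of int] assms(5,6) by linarith
  then have "j = j'" using m by linarith
  moreover from this eq have "edge_point y = edge_point y'" by simp
  then have "to_vertex (edge_point y) = to_vertex (edge_point y')" by simp
  then have "complex_of_real y = of_real y'"
    unfolding edge_point_def to_from_vertex[OF real_disc[OF assms(1) le(1)]] to_from_vertex[OF real_disc[OF assms(3) le(2)]] .
  then have "y = y'" by (simp only: of_real_eq_iff)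
  ultimately show ?thesis by simp
qed

section \<open>The combinatorial pattern of the gluing\<close>

text \<open>The corners of the polygon, in cyclic order, carry the vertices of a closed walk in the
  Petersen graph that runs through each edge once in each direction. Side \<open>j\<close> leads from
  corner \<open>j\<close> to the next corner.\<close>
definition corner_vertex :: "nat \<Rightarrow> nat" where
  "corner_vertex j = [0, 7, 3, 4, 2, 6, 1, 5, 3, 7, 6, 2, 8, 0, 9, 1, 6, 7, 0, 8, 5, 1, 9, 4, 3, 5, 8, 2, 4, 9] ! j"

text \<open>The side that belongs to the same edge with the opposite direction.\<close>
definition opposite_side :: "nat \<Rightarrow> nat" where
  "opposite_side j = [17, 8, 23, 27, 10, 15, 20, 24, 1, 16, 4, 26, 18, 29, 21, 5, 9, 0, 12, 25, 6, 14, 28, 2, 7, 19, 11, 3, 22, 13] ! j"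

text \<open>The position of a corner among the three corners at its vertex. The numbering follows the
  cyclic order in which the corners are arranged around the vertex after the gluing
  (\<open>next_slot\<close>).\<close>
definition corner_slot :: "nat \<Rightarrow> nat" where
  "corner_slot j = [0, 0, 0, 0, 0, 0, 0, 0, 1, 2, 1, 2, 0, 1, 0, 1, 2, 1, 2, 2, 1, 2, 2, 1, 2, 2, 1, 1, 2, 1] ! j"

definition corner_at :: "nat \<Rightarrow> nat \<Rightarrow> nat" where
  "corner_at v k = [[0, 13, 18], [6, 15, 21], [4, 27, 11], [2, 8, 24], [3, 23, 28], [7, 20, 25], [5, 10, 16], [1, 17, 9], [12, 26, 19], [14, 29, 22]] ! v ! k"

definition vertex_pair :: "nat \<Rightarrow> nat set" where
  "vertex_pair v = [{0, 1}, {0, 2}, {0, 3}, {0, 4}, {1, 2}, {1, 3}, {1, 4}, {2, 3}, {2, 4}, {3, 4}] ! v"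

text \<open>The finite statements about the pattern are decided by evaluation of the lists.\<close>
lemma all_less_upt: "(\<forall>j<n. P j) \<longleftrightarrow> list_all P [0..<n]"
  by (auto simp: list_all_iff)

lemma corner_range: "\<forall>j<30. corner_vertex j < 10 \<and> corner_slot j < 3 \<and> opposite_side j < 30"
  unfolding all_less_upt by code_simp

lemma opposite_involution: "\<forall>j<30. opposite_side (opposite_side j) = j \<and> opposite_side j \<noteq> j"
  unfolding all_less_upt by code_simp

lemma opposite_ends: "\<forall>j<30. corner_vertex (opposite_side j) = corner_vertex (Suc j mod 30) \<and>
    corner_vertex (Suc (opposite_side j) mod 30) = corner_vertex j"
  unfolding all_less_upt by code_simp

lemma corner_vertex_neq: "\<forall>j<30. corner_vertex (Suc j mod 30) \<noteq> corner_vertex j"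
  unfolding all_less_upt by code_simp

text \<open>Crossing side \<open>j\<close> near its start leads from corner \<open>j\<close> to the
  corner at the end of the opposite side, which precedes it around the vertex. That all three corners of
  a vertex are met in this way is what makes the quotient a surface at the vertex.\<close>
lemma next_slot: "\<forall>j<30. Suc (corner_slot (Suc (opposite_side j) mod 30)) mod 3 = corner_slot j"
  unfolding all_less_upt by code_simp

lemma corner_at_inverse: "\<forall>j<30. corner_at (corner_vertex j) (corner_slot j) = j"
  unfolding all_less_upt by code_simp

lemma corner_at_range: "\<forall>v<10. \<forall>k<3. corner_at v k < 30 \<and> corner_vertex (corner_at v k) = v \<and> corner_slot (corner_at v k) = k"
  unfolding all_less_upt by code_simp

lemma side_unique: "\<forall>j<30. \<forall>i<30. corner_vertex i = corner_vertex j \<and> corner_vertex (Suc i mod 30) = corner_vertex (Suc j mod 30) \<longrightarrow> i = j"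
  unfolding all_less_upt by code_simp

lemma petersen_vertices_eq: "petersen_vertices = vertex_pair ` {..<10}"
proof -
  have "petersen_vertices = {a \<in> Pow (set [0..<5]). card a = 2}"
    by (auto simp: petersen_vertices_def)
  also have "\<dots> = set (filter (\<lambda>a. card a = 2) (map set (subseqs [0..<5])))"
    unfolding subseqs_powset[symmetric] by auto
  also have "\<dots> = set (map vertex_pair [0..<10])" by code_simp
  finally show ?thesis by (simp add: atLeast_upt lessThan_atLeast0)
qed

lemma vertex_pair_inj: "inj_on vertex_pair {..<10}"
proof -
  have "\<forall>v<10. \<forall>w<10. vertex_pair v = vertex_pair w \<longrightarrow> v = w"
    unfolding all_less_upt by code_simp
  then show ?thesis by (auto simp: inj_on_def)
qed

lemma vertex_pairs_adjacent:
  "\<forall>v<10. \<forall>w<10. vertex_pair v \<inter> vertex_pair w = {} \<longleftrightarrow>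
     list_ex (\<lambda>j. corner_vertex j = v \<and> corner_vertex (Suc j mod 30) = w) [0..<30]"
  unfolding all_less_upt by code_simp

lemma petersen_edges_eq:
  "petersen_edges = (\<lambda>j. {vertex_pair (corner_vertex j), vertex_pair (corner_vertex (Suc j mod 30))}) ` {..<30}"
proof -
  have adj: "vertex_pair v \<inter> vertex_pair w = {} \<longleftrightarrow>
      (\<exists>j<30. corner_vertex j = v \<and> corner_vertex (Suc j mod 30) = w)" if "v < 10" "w < 10" for v w
    using vertex_pairs_adjacent that by (auto simp: list_ex_iff)
  have "Suc j mod 30 < 30" for j by simp
  then have lt: "corner_vertex j < 10" "corner_vertex (Suc j mod 30) < 10" if "j < 30" for j
    using corner_range that by blast+
  show ?thesis
  proof (intro equalityI subsetI)
    fix e assume "e \<in> petersen_edges"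
    then obtain v w where vw: "v < 10" "w < 10" "e = {vertex_pair v, vertex_pair w}" "vertex_pair v \<inter> vertex_pair w = {}"
      unfolding petersen_edges_def petersen_vertices_eq by auto
    then show "e \<in> (\<lambda>j. {vertex_pair (corner_vertex j), vertex_pair (corner_vertex (Suc j mod 30))}) ` {..<30}"
      using adj[OF vw(1,2)] by auto
  next
    fix e assume "e \<in> (\<lambda>j. {vertex_pair (corner_vertex j), vertex_pair (corner_vertex (Suc j mod 30))}) ` {..<30}"
    then obtain j where j: "j < 30" "e = {vertex_pair (corner_vertex j), vertex_pair (corner_vertex (Suc j mod 30))}" by auto
    then have "vertex_pair (corner_vertex j) \<inter> vertex_pair (corner_vertex (Suc j mod 30)) = {}"
      using adj[OF lt[OF j(1)]] by blast
    then show "e \<in> petersen_edges"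
      unfolding petersen_edges_def petersen_vertices_eq using lt[OF j(1)] j(2) by blast
  qed
qed

text \<open>The parametrizations are open maps, so points are separated by open sets as soon as the
  identified pairs form a closed set.\<close>
lemma (in isometric_atlas) hausdorff_if_closed_relation:
  assumes "\<And>i j. i \<in> I \<Longrightarrow> j \<in> I \<Longrightarrow> closedin (top_of_set (N i \<times> N j)) {x \<in> N i \<times> N j. \<psi> i (fst x) = \<psi> j (snd x)}"
  shows "Hausdorff_space glued_topology"
  unfolding Hausdorff_space_def
proof (intro allI impI)
  fix p q :: 'p assume "p \<in> topspace glued_topology \<and> q \<in> topspace glued_topology \<and> p \<noteq> q"
  then have pq: "p \<noteq> q" by simp
  obtain i z where i: "i \<in> I" "z \<in> N i" "\<psi> i z = p" using obtain_chart .
  obtain j w where j: "j \<in> I" "w \<in> N j" "\<psi> j w = q" using obtain_chart .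
  let ?R = "{x \<in> N i \<times> N j. \<psi> i (fst x) = \<psi> j (snd x)}"
  have "openin (top_of_set (N i \<times> N j)) (N i \<times> N j - ?R)"
    using assms[OF i(1) j(1)] by (simp add: openin_diff)
  moreover have "open (N i \<times> N j)" using open_Times open_N i(1) j(1) by blast
  ultimately have "open (N i \<times> N j - ?R)" by (rule openin_open_trans)
  moreover have "(z, w) \<in> N i \<times> N j - ?R" using i j pq by auto
  ultimately obtain A B where AB: "open A" "open B" "(z, w) \<in> A \<times> B" "A \<times> B \<subseteq> N i \<times> N j - ?R"
    by (rule open_prod_elim)
  have sub: "A \<subseteq> N i" "B \<subseteq> N j" using AB(3,4) by auto
  have "openin glued_topology (\<psi> i ` A)" "openin glued_topology (\<psi> j ` B)"
    using openin_\<psi>_image i(1) j(1) AB(1,2) sub by blast+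
  moreover have "p \<in> \<psi> i ` A" "q \<in> \<psi> j ` B" using AB(3) i(3) j(3) by auto
  moreover have "disjnt (\<psi> i ` A) (\<psi> j ` B)" using AB(4) by (fastforce simp: disjnt_def)
  ultimately show "\<exists>U V. openin glued_topology U \<and> openin glued_topology V \<and> p \<in> U \<and> q \<in> V \<and> disjnt U V" by blast
qed

section \<open>The gluing map\<close>

text \<open>Representatives for boundary points: a vertex is labelled by its number, an inner point of
  an edge by the smaller of its two sides and the parameter along that side. The real parts 2 and 3 or
  more keep the labels apart from each other and from the disc.\<close>
definition side_label :: "nat \<Rightarrow> real \<Rightarrow> complex" where
  "side_label j y =
     (if y = 0 then Complex 2 (real (corner_vertex j))
      else if j < opposite_side j then Complex (3 + real j) y
      else Complex (3 + real (opposite_side j)) (flip_real y))"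

definition point_label :: "complex \<Rightarrow> complex" where
  "point_label z =
     (if z \<in> polygon_interior then z
      else case (SOME (j, y). j < 30 \<and> 0 \<le> y \<and> y < side \<and> z = rot30 ^ j * edge_point y) of (j, y) \<Rightarrow> side_label j y)"

lemma point_label_interior: "z \<in> polygon_interior \<Longrightarrow> point_label z = z"
  by (simp add: point_label_def)

lemma point_label_edge:
  assumes "0 \<le> y" "y < side"
  shows "point_label (rot30 ^ j * edge_point y) = side_label (j mod 30) y"
proof -
  have b: "rot30 ^ j * edge_point y \<notin> polygon_interior" using edge_point_boundary[of y j] assms by auto
  have "(SOME (i, x). i < 30 \<and> 0 \<le> x \<and> x < side \<and> rot30 ^ j * edge_point y = rot30 ^ i * edge_point x) = (j mod 30, y)"
  proof (rule some_equality)
    show "case (j mod 30, y) of (i, x) \<Rightarrow> i < 30 \<and> 0 \<le> x \<and> x < side \<and> rot30 ^ j * edge_point y = rot30 ^ i * edge_point x"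
      using assms by (simp add: rot30_pow_mod)
    fix p assume "case p of (i, x) \<Rightarrow> i < 30 \<and> 0 \<le> x \<and> x < side \<and> rot30 ^ j * edge_point y = rot30 ^ i * edge_point x"
    then obtain i x where p: "p = (i, x)" "i < 30" "0 \<le> x" "x < side" "rot30 ^ (j mod 30) * edge_point y = rot30 ^ i * edge_point x"
      by (cases p) (auto simp: rot30_pow_mod)
    have "j mod 30 < 30" by simp
    from edge_point_inj[OF assms p(3,4) this p(2,5)] show "p = (j mod 30, y)" using p(1) by simp
  qed
  then show ?thesis using b by (simp add: point_label_def)
qed

lemma point_label_edge_end: "point_label (rot30 ^ j * edge_point side) = side_label (Suc j mod 30) 0"
proof -
  have eq: "rot30 ^ j * edge_point side = rot30 ^ Suc j * edge_point 0" by (simp add: edge_point_side mult_ac)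
  show ?thesis unfolding eq by (rule point_label_edge) (use side_pos in auto)
qed

lemma point_label_glue:
  assumes j: "j < 30" and y: "0 \<le> y" "y \<le> side"
  shows "point_label (rot30 ^ j * edge_point y) = point_label (rot30 ^ opposite_side j * edge_point (flip_real y))"
proof -
  have o: "opposite_side j < 30" "opposite_side (opposite_side j) = j" "opposite_side j \<noteq> j"
    using corner_range opposite_involution j by blast+
  have e: "corner_vertex (opposite_side j) = corner_vertex (Suc j mod 30)"
    "corner_vertex (Suc (opposite_side j) mod 30) = corner_vertex j" using opposite_ends j by blast+
  note fb = flip_real_bounds[OF y]
  consider "y = 0" | "y = side" | "0 < y" "y < side" using y by linarith
  then show ?thesis
  proof cases
    case 1
    then show ?thesis
      using point_label_edge[of 0 j] point_label_edge_end[of "opposite_side j"] side_pos j e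
      by (simp add: flip_real_ends side_label_def)
  next
    case 2
    then show ?thesis
      using point_label_edge[of 0 "opposite_side j"] point_label_edge_end[of j] side_pos o(1) e
      by (simp add: flip_real_ends side_label_def)
  next
    case 3
    then have f: "0 < flip_real y" "flip_real y < side" using fb by simp_all
    have "side_label j y = side_label (opposite_side j) (flip_real y)"
      unfolding side_label_def using 3 f o fb(5) by auto
    then show ?thesis
      using point_label_edge[of y j] point_label_edge[of "flip_real y" "opposite_side j"] 3 f j o(1) by simp
  qed
qed

lemma side_label_eq_iff:
  assumes j: "j < 30" "i < 30" and y: "0 \<le> y" "y < side" "0 \<le> x" "x < side"
  shows "side_label j y = side_label i x \<longleftrightarrow>
    (y = 0 \<and> x = 0 \<and> corner_vertex j = corner_vertex i) \<or>
    (0 < y \<and> 0 < x \<and> (j = i \<and> y = x \<or> i = opposite_side j \<and> x = flip_real y))"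
proof -
  have o: "opposite_side (opposite_side j) = j" "opposite_side j \<noteq> j"
    "opposite_side (opposite_side i) = i" "opposite_side i \<noteq> i"
    using opposite_involution j by blast+
  have f: "flip_real (flip_real y) = y" "flip_real (flip_real x) = x"
    using flip_real_bounds(5) y by simp_all
  show ?thesis
  proof (cases "y = 0 \<or> x = 0")
    case True
    then show ?thesis using y by (auto simp: side_label_def)
  next
    case False
    then have "side_label j y = side_label i x \<longleftrightarrow>
      (if j < opposite_side j then (if i < opposite_side i then j = i \<and> y = x else j = opposite_side i \<and> y = flip_real x)
       else (if i < opposite_side i then opposite_side j = i \<and> flip_real y = x
             else opposite_side j = opposite_side i \<and> flip_real y = flip_real x))"
      by (simp add: side_label_def)
    also have "\<dots> \<longleftrightarrow> j = i \<and> y = x \<or> i = opposite_side j \<and> x = flip_real y"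
      using o f by (smt (verit) linorder_neqE_nat order_less_asym)
    finally show ?thesis using False y by auto
  qed
qed

lemma side_label_not_disc: "side_label j y \<notin> disc"
proof -
  have "2 \<le> Re (side_label j y)" by (simp add: side_label_def)
  then show ?thesis using complex_Re_le_cmod[of "side_label j y"] by simp
qed

lemma point_label_eq_interior:
  assumes "z \<in> polygon_interior" "w \<in> polygon" "point_label z = point_label w"
  shows "w = z"
proof (cases "w \<in> polygon_interior")
  case True
  then show ?thesis using assms by (simp add: point_label_interior)
next
  case False
  then obtain j y where "0 \<le> y" "y < side" "w = rot30 ^ j * edge_point y"
    using boundary_edge_point[of w] assms(2) by blast
  then have "point_label w \<notin> disc" using point_label_edge side_label_not_disc by simp
  then show ?thesis using assms polygon_disc(2) by (simp add: point_label_interior)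
qed

text \<open>The set of labels contains a disc and therefore has the cardinality of the plane.\<close>
lemma ex_point_bijection: "\<exists>f :: complex \<Rightarrow> complex. bij_betw f (point_label ` polygon) UNIV"
proof -
  obtain e where e: "e > 0" "ball 0 e \<subseteq> polygon_interior"
    using open_polygon_interior zero_in_polygon_interior open_contains_ball by blast
  have "ball (0::complex) e homeomorphic (UNIV :: complex set)" using e(1) by (rule homeomorphic_ball_UNIV)
  then obtain f g where fg: "homeomorphism (ball (0::complex) e) (UNIV :: complex set) f g"
    unfolding homeomorphic_def by blast
  then have g: "inj g" "range g \<subseteq> ball 0 e" unfolding homeomorphism_def by (metis inj_on_inverseI UNIV_I, blast)
  have "range g \<subseteq> point_label ` polygon"
  proof
    fix z assume "z \<in> range g"
    then have "z \<in> polygon_interior" using g(2) e(2) by blast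
    then show "z \<in> point_label ` polygon" using point_label_interior[of z] polygon_interior_subset by force
  qed
  then show ?thesis by (intro Schroeder_Bernstein[of id _ _ g] g) auto
qed

text \<open>The labels are carried onto the whole plane by an arbitrary bijection. In this way every
  complex number is a point of the surface, and its distance is a metric on the whole type.\<close>
definition glue :: "complex \<Rightarrow> complex" where
  "glue z = (SOME f. bij_betw f (point_label ` polygon) UNIV) (point_label z)"

lemma glue_bij: "bij_betw (SOME f :: complex \<Rightarrow> complex. bij_betw f (point_label ` polygon) UNIV) (point_label ` polygon) UNIV"
  using ex_point_bijection by (rule someI_ex)

lemma glue_eq_iff: "z \<in> polygon \<Longrightarrow> w \<in> polygon \<Longrightarrow> glue z = glue w \<longleftrightarrow> point_label z = point_label w"
  unfolding glue_def using glue_bij by (intro inj_on_eq_iff[where A = "point_label ` polygon"]) (auto simp: bij_betw_def)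

lemma glue_surj: "glue ` polygon = UNIV"
  using glue_bij unfolding bij_betw_def glue_def image_image by simp

lemma glue_eq_interior: "z \<in> polygon_interior \<Longrightarrow> w \<in> polygon \<Longrightarrow> glue z = glue w \<Longrightarrow> w = z"
  using glue_eq_iff[of z w] polygon_interior_subset point_label_eq_interior by blast

lemma glue_opposite:
  assumes "j < 30" "0 \<le> y" "y \<le> side"
  shows "glue (rot30 ^ j * edge_point y) = glue (rot30 ^ opposite_side j * edge_point (flip_real y))"
  using point_label_glue[OF assms] by (simp add: glue_def)

lemma glue_edge_eq_iff:
  assumes "j < 30" "i < 30" "0 \<le> y" "y < side" "0 \<le> x" "x < side"
  shows "glue (rot30 ^ j * edge_point y) = glue (rot30 ^ i * edge_point x) \<longleftrightarrow>
    (y = 0 \<and> x = 0 \<and> corner_vertex j = corner_vertex i) \<or>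
    (0 < y \<and> 0 < x \<and> (j = i \<and> y = x \<or> i = opposite_side j \<and> x = flip_real y))"
proof -
  have "rot30 ^ j * edge_point y \<in> polygon" "rot30 ^ i * edge_point x \<in> polygon"
    using edge_point_boundary assms by auto
  then show ?thesis
    using glue_eq_iff point_label_edge[of y j] point_label_edge[of x i] side_label_eq_iff[OF assms] assms by simp
qed

section \<open>The star of a vertex\<close>

text \<open>The star of a vertex: three corners of the polygon put together around the origin. It is
  bounded by the condition that each of the three parts, moved back to the polygon, stays in the wedge
  of its corner.\<close>
definition vertex_nbhd :: "complex set" where
  "vertex_nbhd = {w \<in> disc. \<forall>k<3. cnj rot3 ^ k * w \<in> vertex_sector \<longrightarrow> from_vertex (cnj rot3 ^ k * w) \<in> corner_wedge}"

text \<open>The isometry that carries the sector \<open>k\<close> of the star to the corner of the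
  polygon in question.\<close>
definition sector_map :: "nat \<Rightarrow> nat \<Rightarrow> complex \<Rightarrow> complex" where
  "sector_map v k w = rot30 ^ corner_at v (k mod 3) * from_vertex (cnj rot3 ^ k * w)"

text \<open>On a ray between two sectors both sector maps apply; they agree there by
  \<open>vertex_map_eq\<close>, so the choice of the least index is harmless.\<close>
definition vertex_map :: "nat \<Rightarrow> complex \<Rightarrow> complex" where
  "vertex_map v w = glue (sector_map v (LEAST k. cnj rot3 ^ k * w \<in> vertex_sector) w)"

lemma cnj_rot3_pow_mod: "cnj rot3 ^ (k mod 3) = cnj rot3 ^ k"
proof -
  have "cnj rot3 ^ 3 = 1" using rot3_cubed by (metis complex_cnj_one complex_cnj_power)
  then have "cnj rot3 ^ (3 * (k div 3) + k mod 3) = cnj rot3 ^ (k mod 3)" unfolding power_add power_mult by simp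
  then show ?thesis by simp
qed

lemma norm_rot3_pow [simp]: "cmod (rot3 ^ k) = 1" "cmod (cnj rot3 ^ k) = 1"
  by (simp_all add: norm_power)

lemma rot3_pow_cancel: "rot3 ^ k * (cnj rot3 ^ k * z) = z" "cnj rot3 ^ k * (rot3 ^ k * z) = z"
  by (simp_all add: mult.assoc[symmetric] power_mult_distrib[symmetric] cnj_mult_unit)

lemma rot3_eq_cnj: "cnj rot3 * cnj rot3 = rot3"
proof -
  have "cnj rot3 ^ 3 = 1" using rot3_cubed by (metis complex_cnj_one complex_cnj_power)
  then have "rot3 * (cnj rot3 * (cnj rot3 * cnj rot3)) = rot3" by (simp add: power3_eq_cube mult.assoc)
  then show ?thesis by (simp only: cnj_unit_cancel)
qed

lemma sector_map_mod: "sector_map v (k mod 3) w = sector_map v k w"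
  by (simp add: sector_map_def cnj_rot3_pow_mod)

lemma hyp_isometry_to_vertex: "hyp_isometry to_vertex"
  unfolding to_vertex_def[abs_def]
  by (rule hyp_isometry_compose[OF hyp_isometry_rotation[OF norm_rots(2)] hyp_isometry_half_turn[OF corner_disc]])

lemma hyp_isometry_from_vertex: "hyp_isometry from_vertex"
  unfolding from_vertex_def[abs_def]
  by (rule hyp_isometry_compose[OF hyp_isometry_half_turn[OF corner_disc] hyp_isometry_rotation]) simp

lemma hyp_isometry_flip: "hyp_isometry flip"
  unfolding flip_def by (rule hyp_isometry_half_turn[OF side_disc])

lemma hyp_isometry_sector_map: "hyp_isometry (sector_map v k)"
  unfolding sector_map_def[abs_def]
  by (rule hyp_isometry_compose[OF hyp_isometry_rotation hyp_isometry_compose[OF hyp_isometry_from_vertex hyp_isometry_rotation]]) simp_all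

definition sector_inverse :: "nat \<Rightarrow> nat \<Rightarrow> complex \<Rightarrow> complex" where
  "sector_inverse v k z = rot3 ^ k * to_vertex (cnj rot30 ^ corner_at v (k mod 3) * z)"

lemma hyp_isometry_sector_inverse: "hyp_isometry (sector_inverse v k)"
  unfolding sector_inverse_def[abs_def]
  by (rule hyp_isometry_compose[OF hyp_isometry_rotation hyp_isometry_compose[OF hyp_isometry_to_vertex hyp_isometry_rotation]]) simp_all

lemma sector_inverse_map: "w \<in> disc \<Longrightarrow> sector_inverse v k (sector_map v k w) = w"
  unfolding sector_inverse_def sector_map_def rot30_pow_cancel
  by (subst to_from_vertex[OF rotate_disc]) (simp_all add: rot3_pow_cancel)

lemma sector_map_inverse: "z \<in> disc \<Longrightarrow> sector_map v k (sector_inverse v k z) = z"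
  unfolding sector_inverse_def sector_map_def rot3_pow_cancel
  by (subst from_to_vertex[OF rotate_disc]) (simp_all add: rot30_pow_cancel)

lemma ex_vertex_sector: "\<exists>k<3. cnj rot3 ^ k * w \<in> vertex_sector"
proof -
  define \<alpha> where "\<alpha> = Arg2pi w"
  have \<alpha>: "0 \<le> \<alpha>" "\<alpha> < 2 * pi" "w = of_real (cmod w) * cis \<alpha>"
    using Arg2pi[of w] by (simp_all add: \<alpha>_def cis_conv_exp is_Arg_def)
  define k where "k = nat \<lfloor>\<alpha> / (2 * pi / 3)\<rfloor>"
  have "0 \<le> \<alpha> / (2 * pi / 3)" using \<alpha> by simp
  then have k: "real k \<le> \<alpha> / (2 * pi / 3)" "\<alpha> / (2 * pi / 3) < real k + 1" unfolding k_def by linarith+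
  then have k': "real k * (2 * pi / 3) \<le> \<alpha>" "\<alpha> < real k * (2 * pi / 3) + 2 * pi / 3" by (simp_all add: field_simps)
  have "\<alpha> / (2 * pi / 3) < 3" using \<alpha>(2) by (simp add: field_simps)
  then have "k < 3" using k(1) by linarith
  have pw: "cnj rot3 ^ k = cis (- (real k * (2 * pi / 3)))"
    using Complex.DeMoivre[of "- (2 * pi / 3)" k] by (simp add: rot3_def cis_cnj)
  define \<beta> where "\<beta> = \<alpha> - real k * (2 * pi / 3)"
  have "cnj rot3 ^ k * w = of_real (cmod w) * cis \<beta>"
    by (subst \<alpha>(3)) (simp add: pw \<beta>_def mult.left_commute cis_mult)
  moreover have "cnj rot3 * (of_real (cmod w) * cis \<beta>) = of_real (cmod w) * cis (\<beta> - 2 * pi / 3)"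
    by (simp add: rot3_def cis_cnj mult.left_commute cis_mult)
  ultimately have "Im (cnj rot3 ^ k * w) = cmod w * sin \<beta>" "Im (cnj rot3 * (cnj rot3 ^ k * w)) = cmod w * sin (\<beta> - 2 * pi / 3)"
    by (simp_all only: Im_polar)
  moreover have "0 \<le> sin \<beta>" using k' by (intro sin_ge_zero) (auto simp: \<beta>_def)
  moreover have "sin (\<beta> - 2 * pi / 3) \<le> 0"
  proof -
    have "0 \<le> sin (- (\<beta> - 2 * pi / 3))"
      using k' pi_gt_zero unfolding \<beta>_def by (intro sin_ge_zero) linarith+
    then show ?thesis unfolding sin_minus by linarith
  qed
  ultimately have "cnj rot3 ^ k * w \<in> vertex_sector"
    unfolding vertex_sector_def mem_Collect_eq by (simp only: mult_nonneg_nonneg mult_nonneg_nonpos norm_ge_zero simp_thms)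
  then show ?thesis using \<open>k < 3\<close> by blast
qed

lemma Im_rot3_real: "Im (cnj rot3 * of_real y) = - (sqrt 3 / 2 * y)" "Im (rot3 * of_real y) = sqrt 3 / 2 * y"
proof -
  have "sin (2 * pi / 3) = sqrt 3 / 2" using sin_120 by simp
  then show "Im (cnj rot3 * of_real y) = - (sqrt 3 / 2 * y)" "Im (rot3 * of_real y) = sqrt 3 / 2 * y"
    by (simp_all add: rot3_def)
qed

lemma vertex_sector_ray:
  assumes "a \<in> vertex_sector"
  shows "Im a = 0 \<Longrightarrow> \<exists>y\<ge>0. a = of_real y"
    and "Im (cnj rot3 * a) = 0 \<Longrightarrow> \<exists>y\<ge>0. cnj rot3 * a = of_real y"
proof -
  assume "Im a = 0"
  then obtain y where y: "a = of_real y" by (metis complex_is_Real_iff Reals_cases)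
  have "- (sqrt 3 / 2 * y) \<le> 0" using assms unfolding y vertex_sector_def mem_Collect_eq Im_rot3_real by blast
  then have "0 \<le> y" by (simp add: zero_le_mult_iff)
  then show "\<exists>y\<ge>0. a = of_real y" using y by blast
next
  assume "Im (cnj rot3 * a) = 0"
  then obtain y where y: "cnj rot3 * a = of_real y" by (metis complex_is_Real_iff Reals_cases)
  then have "a = rot3 * of_real y" by (metis cnj_unit_cancel(6))
  then have "0 \<le> sqrt 3 / 2 * y" using assms unfolding vertex_sector_def mem_Collect_eq Im_rot3_real[symmetric] by blast
  then have "0 \<le> y" by (simp add: zero_le_mult_iff)
  then show "\<exists>y\<ge>0. cnj rot3 * a = of_real y" using y by blast
qed

lemma edge_wedge_less_side:
  assumes "0 \<le> y" "complex_of_real y \<in> disc" "edge_point y \<in> corner_wedge"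
  shows "y < side"
proof -
  have fd: "complex_of_real (flip_real y) \<in> disc" using flip_disc[OF assms(2)] by (simp only: flip_of_real)
  have d: "rot3 * of_real (flip_real y) \<in> disc" using fd by (intro rotate_disc) simp_all
  have e: "from_vertex (rot3 * of_real (flip_real y)) = cnj rot30 * edge_point y"
    using from_vertex_flip[OF assms(2)] by (simp only: flip_of_real edge_point_def)
  have "cnj rot6 * (rot3 * of_real (flip_real y)) = rot6 * of_real (flip_real y)" by (simp only: rot3_eq mult.assoc cnj_unit_cancel)
  then have "Im (cnj rot30 * edge_point y) < 0 \<longleftrightarrow> 0 < sqrt 3 / 2 * flip_real y"
    using sgn_Im_from_vertex(2)[OF d] unfolding e by (simp only: Im_rot6_real)
  then have f: "0 < flip_real y" using assms(3) unfolding corner_wedge_def mem_Collect_eq by (simp add: zero_less_mult_iff)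
  have "0 < 1 - side * y"
  proof -
    have "\<bar>side * y\<bar> < 1 * 1" unfolding abs_mult using side_pos side_less_1 assms(2)
      by (intro mult_strict_mono') auto
    then show ?thesis by linarith
  qed
  then show ?thesis using f by (simp add: flip_real_def zero_less_divide_iff)
qed

lemma vertex_nbhd_disc: "w \<in> vertex_nbhd \<Longrightarrow> w \<in> disc"
  by (simp add: vertex_nbhd_def)

lemma vertex_nbhd_wedge:
  assumes "w \<in> vertex_nbhd" "cnj rot3 ^ k * w \<in> vertex_sector"
  shows "from_vertex (cnj rot3 ^ k * w) \<in> corner_wedge"
proof -
  have "k mod 3 < 3" by simp
  then show ?thesis using assms unfolding vertex_nbhd_def mem_Collect_eq by (metis cnj_rot3_pow_mod)
qed

lemma from_vertex_polygon:
  assumes a: "a \<in> disc" "from_vertex a \<in> corner_wedge"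
  shows "from_vertex a \<in> polygon \<longleftrightarrow> a \<in> vertex_sector" "from_vertex a \<in> polygon_interior \<longleftrightarrow> a \<in> open_vertex_sector"
  using polygon_in_wedge[OF a(2) from_vertex_disc[OF a(1)]] to_from_vertex[OF a(1)] by simp_all

lemma sector_map_polygon:
  assumes "w \<in> vertex_nbhd" "cnj rot3 ^ k * w \<in> vertex_sector"
  shows "sector_map v k w \<in> polygon" "sector_map v k w \<in> polygon_interior \<longleftrightarrow> cnj rot3 ^ k * w \<in> open_vertex_sector"
proof -
  have d: "cnj rot3 ^ k * w \<in> disc" using vertex_nbhd_disc[OF assms(1)] by (intro rotate_disc) simp_all
  note fp = from_vertex_polygon[OF d vertex_nbhd_wedge[OF assms]]
  show "sector_map v k w \<in> polygon" "sector_map v k w \<in> polygon_interior \<longleftrightarrow> cnj rot3 ^ k * w \<in> open_vertex_sector"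
    unfolding sector_map_def polygon_rotate_iff using fp assms(2) by simp_all
qed

lemma nbhd_ray:
  assumes w: "w \<in> vertex_nbhd" and y: "0 \<le> y" "cnj rot3 ^ k * w = of_real y"
  shows "y < side"
proof -
  have "Im (cnj rot3 * of_real y) \<le> 0" unfolding Im_rot3_real using y(1) by simp
  then have s: "cnj rot3 ^ k * w \<in> vertex_sector" unfolding vertex_sector_def mem_Collect_eq y(2) by simp
  have d: "cnj rot3 ^ k * w \<in> disc" using vertex_nbhd_disc[OF w] by (intro rotate_disc) simp_all
  show ?thesis
    using edge_wedge_less_side[OF y(1)] vertex_nbhd_wedge[OF w s] d unfolding y(2) edge_point_def by blast
qed

lemma corner_at_next:
  assumes "v < 10"
  shows "corner_at v (k mod 3) = Suc (opposite_side (corner_at v (Suc k mod 3))) mod 30"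
proof -
  let ?j = "corner_at v (Suc k mod 3)"
  have "Suc k mod 3 < 3" "k mod 3 < 3" by simp_all
  then have j: "?j < 30" "corner_vertex ?j = v" "corner_slot ?j = Suc k mod 3" using corner_at_range assms by blast+
  let ?i = "Suc (opposite_side ?j) mod 30"
  have i: "?i < 30" by simp
  have "corner_vertex ?i = v" using opposite_ends j(1,2) by metis
  moreover have "Suc (corner_slot ?i) mod 3 = Suc k mod 3" using next_slot j(1,3) by metis
  moreover have "corner_slot ?i < 3" using corner_range i by blast
  moreover have "a = b mod 3" if "a < 3" "Suc a mod 3 = Suc b mod 3" for a b :: nat
    using that mod_Suc[of a 3] mod_Suc[of b 3] by (auto split: if_splits)
  ultimately have "corner_vertex ?i = v" "corner_slot ?i = k mod 3" by blast+
  then show ?thesis using corner_at_inverse i by metis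
qed

text \<open>On the ray common to two neighbouring sectors, the two maps land on opposite sides at points
  that are glued.\<close>
lemma glue_sector_map_Suc:
  assumes v: "v < 10" and w: "w \<in> vertex_nbhd"
    and s: "cnj rot3 ^ k * w \<in> vertex_sector" "cnj rot3 ^ Suc k * w \<in> vertex_sector"
  shows "glue (sector_map v k w) = glue (sector_map v (Suc k) w)"
proof -
  let ?a = "cnj rot3 ^ k * w"
  have b: "cnj rot3 ^ Suc k * w = cnj rot3 * ?a" by simp
  have "Im (cnj rot3 * ?a) = 0"
    using s unfolding b vertex_sector_def mem_Collect_eq by (intro antisym) blast+
  then obtain y where y: "0 \<le> y" "cnj rot3 * ?a = of_real y" using vertex_sector_ray(2)[OF s(1)] by blast
  have ylt: "y < side" using nbhd_ray[OF w y(1), of "Suc k"] y(2) b by simp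
  have a: "?a = rot3 * of_real y" using y(2) by (metis cnj_unit_cancel(6))
  let ?j = "corner_at v (Suc k mod 3)"
  have "Suc k mod 3 < 3" by simp
  then have j: "?j < 30" using corner_at_range v by blast
  have "sector_map v k w = rot30 ^ (Suc (opposite_side ?j) mod 30) * (cnj rot30 * edge_point (flip_real y))"
    unfolding sector_map_def a using edge_point_flip(2)[of y] y(1) ylt corner_at_next[OF v, of k] by simp
  also have "\<dots> = rot30 ^ opposite_side ?j * edge_point (flip_real y)"
    unfolding rot30_pow_mod power_Suc2 mult.assoc cnj_unit_cancel ..
  finally have "glue (sector_map v k w) = glue (rot30 ^ ?j * edge_point y)"
    using glue_opposite[OF j y(1)] ylt by simp
  also have "rot30 ^ ?j * edge_point y = sector_map v (Suc k) w"
    unfolding sector_map_def b y(2) edge_point_def ..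
  finally show ?thesis .
qed

lemma vertex_map_eq:
  assumes v: "v < 10" and w: "w \<in> vertex_nbhd" and s: "cnj rot3 ^ k * w \<in> vertex_sector"
  shows "vertex_map v w = glue (sector_map v k w)"
proof -
  define l where "l = (LEAST k. cnj rot3 ^ k * w \<in> vertex_sector)"
  obtain i where "i < 3" "cnj rot3 ^ i * w \<in> vertex_sector" using ex_vertex_sector by blast
  then have l: "l < 3" "cnj rot3 ^ l * w \<in> vertex_sector"
    unfolding l_def using LeastI Least_le by (metis le_less_trans, metis (mono_tags, lifting) LeastI)
  have m: "k mod 3 < 3" "cnj rot3 ^ (k mod 3) * w \<in> vertex_sector" using s by (simp_all add: cnj_rot3_pow_mod)
  have lt: "glue (sector_map v a w) = glue (sector_map v b w)"
    if ab: "a < b" "b < 3" "cnj rot3 ^ a * w \<in> vertex_sector" "cnj rot3 ^ b * w \<in> vertex_sector" for a b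
  proof -
    have "b = Suc a \<or> (a = 0 \<and> b = 2)" using ab(1,2) by linarith
    then show ?thesis
    proof
      assume "b = Suc a"
      then show ?thesis using glue_sector_map_Suc[OF v w] ab by blast
    next
      assume 02: "a = 0 \<and> b = 2"
      have "cnj rot3 ^ Suc 2 * w = w" "sector_map v (Suc 2) w = sector_map v 0 w"
        using cnj_rot3_pow_mod[of "Suc 2"] sector_map_mod[of v "Suc 2" w] by simp_all
      moreover have "w \<in> vertex_sector" "cnj rot3 ^ 2 * w \<in> vertex_sector" using ab(3,4) 02 by simp_all
      ultimately show ?thesis using glue_sector_map_Suc[OF v w, of 2] 02 by (simp only:)
    qed
  qed
  have "glue (sector_map v l w) = glue (sector_map v (k mod 3) w)"
  proof (cases l "k mod 3" rule: linorder_cases)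
    case less
    then show ?thesis using lt[OF _ m(1) l(2) m(2)] by blast
  next
    case greater
    then show ?thesis using lt[OF _ l(1) m(2) l(2)] by metis
  qed metis
  then show ?thesis unfolding vertex_map_def l_def[symmetric] sector_map_mod .
qed

lemma open_vertex_nbhd: "open vertex_nbhd"
proof (rule openI_eventually)
  fix w assume w: "w \<in> vertex_nbhd"
  have wd: "w \<in> disc" using vertex_nbhd_disc[OF w] .
  have "\<forall>\<^sub>F x in nhds w. cnj rot3 ^ k * x \<in> vertex_sector \<longrightarrow> from_vertex (cnj rot3 ^ k * x) \<in> corner_wedge" for k
  proof (cases "cnj rot3 ^ k * w \<in> vertex_sector")
    case True
    have iso: "hyp_isometry (\<lambda>x. from_vertex (cnj rot3 ^ k * x))"
      by (rule hyp_isometry_compose[OF hyp_isometry_from_vertex hyp_isometry_rotation]) simp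
    have "open (disc \<inter> (\<lambda>x. from_vertex (cnj rot3 ^ k * x)) -` corner_wedge)"
      by (rule continuous_open_preimage[OF hyp_isometry_continuous[OF iso] open_ball open_corner_wedge])
    moreover have "w \<in> disc \<inter> (\<lambda>x. from_vertex (cnj rot3 ^ k * x)) -` corner_wedge"
      using vertex_nbhd_wedge[OF w True] wd by simp
    ultimately have "\<forall>\<^sub>F x in nhds w. x \<in> disc \<inter> (\<lambda>x. from_vertex (cnj rot3 ^ k * x)) -` corner_wedge"
      by (rule eventually_nhds_in_open)
    then show ?thesis by eventually_elim simp
  next
    case False
    have "open ((\<lambda>x. cnj rot3 ^ k * x) -` (- vertex_sector))"
      by (intro open_vimage continuous_intros) (use closed_vertex_sector in auto)
    then have "\<forall>\<^sub>F x in nhds w. x \<in> (\<lambda>x. cnj rot3 ^ k * x) -` (- vertex_sector)"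
      using False by (intro eventually_nhds_in_open) auto
    then show ?thesis by eventually_elim simp
  qed
  then have "\<forall>\<^sub>F x in nhds w. \<forall>k\<in>{..<3::nat}. cnj rot3 ^ k * x \<in> vertex_sector \<longrightarrow> from_vertex (cnj rot3 ^ k * x) \<in> corner_wedge"
    by (intro eventually_ball_finite) auto
  moreover have "\<forall>\<^sub>F x in nhds w. x \<in> disc" using wd by (intro eventually_nhds_in_open) auto
  ultimately show "\<forall>\<^sub>F x in nhds w. x \<in> vertex_nbhd"
    by eventually_elim (simp add: vertex_nbhd_def)
qed

lemma real_in_vertex_sector: "0 \<le> y \<Longrightarrow> of_real y \<in> vertex_sector"
  unfolding vertex_sector_def mem_Collect_eq Im_rot3_real by simp

lemma ray_in_vertex_nbhd:
  assumes y: "0 \<le> y" "y < side"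
  shows "rot3 ^ k * of_real y \<in> vertex_nbhd"
proof -
  have "from_vertex (cnj rot3 ^ i * (rot3 ^ k * of_real y)) \<in> corner_wedge"
    if s: "cnj rot3 ^ i * (rot3 ^ k * of_real y) \<in> vertex_sector" for i
  proof -
    have r: "rot3 ^ k = cnj rot3 ^ (2 * k)" by (simp add: power_mult power2_eq_square rot3_eq_cnj)
    define m where "m = (i + 2 * k) mod 3"
    have e: "cnj rot3 ^ i * (rot3 ^ k * of_real y) = cnj rot3 ^ m * of_real y"
      unfolding r m_def cnj_rot3_pow_mod by (simp add: power_add)
    have "m < 3" by (simp add: m_def)
    then consider "m = 0" | "m = 1" | "m = 2" by linarith
    then show ?thesis
    proof cases
      case 1
      then show ?thesis using edge_point_in_wedge(1)[OF y] unfolding e edge_point_def by simp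
    next
      case 2
      have "0 \<le> - (sqrt 3 / 2 * y)" using s unfolding e 2 vertex_sector_def mem_Collect_eq power_one_right Im_rot3_real by blast
      then have "y = 0" using y(1) by (simp add: mult_le_0_iff)
      then show ?thesis using edge_point_in_wedge(1)[OF y] unfolding e edge_point_def by simp
    next
      case 3
      then show ?thesis using edge_point_in_wedge(2)[OF y] unfolding e by (simp add: power2_eq_square rot3_eq_cnj)
    qed
  qed
  moreover have "rot3 ^ k * of_real y \<in> disc" using real_disc[of y] y by (intro rotate_disc) simp_all
  ultimately show ?thesis unfolding vertex_nbhd_def by blast
qed

lemma vertex_map_ray:
  assumes v: "v < 10" and y: "0 \<le> y" "y < side"
  shows "vertex_map v (rot3 ^ k * of_real y) = glue (rot30 ^ corner_at v (k mod 3) * edge_point y)"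
proof -
  have "cnj rot3 ^ k * (rot3 ^ k * of_real y) \<in> vertex_sector"
    using real_in_vertex_sector[OF y(1)] by (simp only: rot3_pow_cancel)
  from vertex_map_eq[OF v ray_in_vertex_nbhd[OF y] this] show ?thesis
    unfolding sector_map_def rot3_pow_cancel edge_point_def .
qed

text \<open>A point of the star is either an inner point of the polygon or lies on one of the three sides that
  emanate from the vertex.\<close>
lemma vertex_nbhd_cases:
  assumes v: "v < 10" and w: "w \<in> vertex_nbhd"
  obtains (inner) k where "k < 3" "cnj rot3 ^ k * w \<in> open_vertex_sector" "sector_map v k w \<in> polygon_interior"
      "vertex_map v w = glue (sector_map v k w)"
  | (ray) k y where "k < 3" "0 \<le> y" "y < side" "w = rot3 ^ k * of_real y"
      "vertex_map v w = glue (rot30 ^ corner_at v k * edge_point y)"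
proof -
  obtain k where k: "k < 3" "cnj rot3 ^ k * w \<in> vertex_sector" using ex_vertex_sector by blast
  have ray': thesis if y: "0 \<le> y" "cnj rot3 ^ i * w = of_real y" for i y
  proof -
    have ylt: "y < side" using nbhd_ray[OF w y] .
    have m: "i mod 3 < 3" by simp
    have "w = rot3 ^ (i mod 3) * of_real y"
      using y(2) rot3_pow_cancel(1)[of "i mod 3" w] by (simp add: cnj_rot3_pow_mod)
    then show thesis using ray[OF m y(1) ylt] vertex_map_ray[OF v y(1) ylt, of "i mod 3"] by simp
  qed
  show thesis
  proof (cases "cnj rot3 ^ k * w \<in> open_vertex_sector")
    case True
    then show thesis using inner[OF k(1)] sector_map_polygon(2)[OF w k(2)] vertex_map_eq[OF v w k(2)] by blast
  next
    case False
    then have "Im (cnj rot3 ^ k * w) = 0 \<or> Im (cnj rot3 * (cnj rot3 ^ k * w)) = 0"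
      using k(2) unfolding open_vertex_sector_def vertex_sector_def mem_Collect_eq by linarith
    then show thesis
    proof
      assume "Im (cnj rot3 ^ k * w) = 0"
      then show thesis using vertex_sector_ray(1)[OF k(2)] ray' by blast
    next
      assume "Im (cnj rot3 * (cnj rot3 ^ k * w)) = 0"
      then obtain y where "0 \<le> y" "cnj rot3 ^ Suc k * w = of_real y"
        using vertex_sector_ray(2)[OF k(2)] by (auto simp: mult.assoc)
      then show thesis by (rule ray')
    qed
  qed
qed

section \<open>The surface glued from the polygon\<close>

text \<open>One parametrization for the interior of the polygon and one for the star of each of the ten
  vertices; the stars contain the inner points of the edges.\<close>
definition chart_index :: "nat option set" where
  "chart_index = insert None (Some ` {..<10})"

definition chart_dom :: "nat option \<Rightarrow> complex set" where
  "chart_dom i = (case i of None \<Rightarrow> polygon_interior | Some v \<Rightarrow> vertex_nbhd)"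

definition chart_map :: "nat option \<Rightarrow> complex \<Rightarrow> complex" where
  "chart_map i = (case i of None \<Rightarrow> glue | Some v \<Rightarrow> vertex_map v)"

definition side_length :: real where
  "side_length = hyp_norm (of_real side)"

lemma side_length_pos: "side_length > 0"
  using hyp_norm_less_iff[of 0 "of_real side"] side_pos side_less_1 by (simp add: side_length_def)

lemma hyp_isometry_eventually:
  assumes "hyp_isometry F" "z \<in> disc" "eventually P (nhds (F z))"
  shows "\<forall>\<^sub>F w in nhds z. P (F w)"
proof -
  have "isCont F z" using DERIV_isCont[OF hyp_isometry_DERIV[OF assms(1,2)]] .
  then have "filterlim F (nhds (F z)) (nhds z)" by (simp add: isCont_def tendsto_at_iff_tendsto_nhds)
  with assms(3) show ?thesis by (rule eventually_compose_filterlim)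
qed

lemma eventually_inner:
  assumes w: "w \<in> vertex_nbhd" and s: "cnj rot3 ^ k * w \<in> open_vertex_sector"
  shows "\<forall>\<^sub>F x in nhds w. x \<in> vertex_nbhd \<and> cnj rot3 ^ k * x \<in> open_vertex_sector"
proof -
  have "\<forall>\<^sub>F x in nhds w. x \<in> vertex_nbhd" using open_vertex_nbhd w by (rule eventually_nhds_in_open)
  moreover have "\<forall>\<^sub>F x in nhds w. cnj rot3 ^ k * x \<in> open_vertex_sector"
    using hyp_isometry_eventually[OF hyp_isometry_rotation vertex_nbhd_disc[OF w]
        eventually_nhds_in_open[OF open_open_vertex_sector s]] by simp
  ultimately show ?thesis by eventually_elim simp
qed

lemma sector_map_center:
  assumes v: "v < 10" and w: "w \<in> vertex_nbhd" and s: "cnj rot3 ^ k * w \<in> open_vertex_sector"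
  shows "sector_map v k w \<in> polygon_interior \<and> glue (sector_map v k w) = vertex_map v w"
proof -
  have s': "cnj rot3 ^ k * w \<in> vertex_sector" using s open_vertex_sector_subset by blast
  show ?thesis using sector_map_polygon(2)[OF w s'] vertex_map_eq[OF v w s'] s by simp
qed

lemma compatible_vertex_center:
  assumes v: "v < 10" and w: "w \<in> vertex_nbhd" and s: "cnj rot3 ^ k * w \<in> open_vertex_sector"
  shows "\<forall>\<^sub>F x in nhds w. sector_map v k x \<in> polygon_interior \<and> glue (sector_map v k x) = vertex_map v x"
  using eventually_inner[OF w s] by eventually_elim (use sector_map_center[OF v] in blast)

lemma compatible_center_vertex:
  assumes v: "v < 10" and w: "w \<in> vertex_nbhd" and s: "cnj rot3 ^ k * w \<in> open_vertex_sector"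
  shows "\<forall>\<^sub>F z in nhds (sector_map v k w). sector_inverse v k z \<in> vertex_nbhd \<and> vertex_map v (sector_inverse v k z) = glue z"
proof -
  have wd: "w \<in> disc" using vertex_nbhd_disc[OF w] .
  have zd: "sector_map v k w \<in> disc" using hyp_isometry_in_disc[OF hyp_isometry_sector_map wd] .
  have "\<forall>\<^sub>F x in nhds (sector_inverse v k (sector_map v k w)). x \<in> vertex_nbhd \<and> cnj rot3 ^ k * x \<in> open_vertex_sector"
    using eventually_inner[OF w s] by (simp only: sector_inverse_map[OF wd])
  note hyp_isometry_eventually[OF hyp_isometry_sector_inverse zd this]
  moreover have "\<forall>\<^sub>F z in nhds (sector_map v k w). z \<in> disc" using zd by (intro eventually_nhds_in_open) auto
  ultimately show ?thesis
  proof eventually_elim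
    case (elim z)
    then show ?case using sector_map_center[OF v, of "sector_inverse v k z" k] sector_map_inverse[of z v k] by simp
  qed
qed

lemma vertex_map_flip:
  assumes j: "j < 30" and g: "g \<in> disc" "0 \<le> Im g" "Im (cnj rot3 * g) \<le> 0" "0 \<le> Im (rot3 * flip g)"
    and n: "rot3 ^ corner_slot j * g \<in> vertex_nbhd" "rot3 ^ corner_slot (opposite_side j) * flip g \<in> vertex_nbhd"
  shows "vertex_map (corner_vertex (opposite_side j)) (rot3 ^ corner_slot (opposite_side j) * flip g) =
    vertex_map (corner_vertex j) (rot3 ^ corner_slot j * g)"
proof -
  let ?i = "opposite_side j"
  have i: "?i < 30" "opposite_side ?i = j" using corner_range opposite_involution j by blast+
  have r: "corner_vertex j < 10" "corner_slot j < 3" "corner_vertex ?i < 10" "corner_slot ?i < 3"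
    using corner_range j i(1) by blast+
  have ci: "corner_at (corner_vertex j) (corner_slot j) = j" "corner_at (corner_vertex ?i) (corner_slot ?i) = ?i"
    using corner_at_inverse j i(1) by blast+
  have e: "cnj rot3 ^ (corner_slot ?i + 2) * (rot3 ^ corner_slot ?i * flip g) = rot3 * flip g"
    unfolding add.commute[of _ 2] power_add mult.assoc rot3_pow_cancel
    by (simp add: power2_eq_square rot3_eq_cnj)
  have "Im (flip g) \<le> 0"
    using sgn_Im_half_turn_real(1)[OF side_disc g(1)] g(2) unfolding flip_def by linarith
  then have s: "cnj rot3 ^ (corner_slot ?i + 2) * (rot3 ^ corner_slot ?i * flip g) \<in> vertex_sector"
    unfolding e vertex_sector_def mem_Collect_eq cnj_unit_cancel using g(4) by blast
  have m: "Suc (corner_slot ?i + 2) mod 3 = corner_slot ?i" using r(4) by presburger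
  have "sector_map (corner_vertex ?i) (corner_slot ?i + 2) (rot3 ^ corner_slot ?i * flip g) =
      rot30 ^ (Suc j mod 30) * from_vertex (rot3 * flip g)"
    unfolding sector_map_def e corner_at_next[OF r(3)] m ci(2) i(2) ..
  also have "\<dots> = rot30 ^ j * from_vertex g"
    unfolding rot30_pow_mod from_vertex_flip[OF g(1)] power_Suc2 mult.assoc cnj_unit_cancel ..
  also have "\<dots> = sector_map (corner_vertex j) (corner_slot j) (rot3 ^ corner_slot j * g)"
    unfolding sector_map_def rot3_pow_cancel using r(2) ci(1) by simp
  finally have eq: "sector_map (corner_vertex ?i) (corner_slot ?i + 2) (rot3 ^ corner_slot ?i * flip g) =
    sector_map (corner_vertex j) (corner_slot j) (rot3 ^ corner_slot j * g)" .
  have s': "cnj rot3 ^ corner_slot j * (rot3 ^ corner_slot j * g) \<in> vertex_sector"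
    unfolding rot3_pow_cancel vertex_sector_def using g(2,3) by blast
  show ?thesis
    unfolding vertex_map_eq[OF r(3) n(2) s] vertex_map_eq[OF r(1) n(1) s'] eq ..
qed

text \<open>The stars of the two ends of an edge overlap along the edge, where the half turn about its
  midpoint carries one star to the other. This rests on the relation of the triangle group.\<close>
lemma compatible_along_side:
  assumes j: "j < 30" and y: "0 < y" "y < side"
  defines "F \<equiv> \<lambda>w. rot3 ^ corner_slot (opposite_side j) * flip (cnj rot3 ^ corner_slot j * w)"
  shows "hyp_isometry F" "F (rot3 ^ corner_slot j * of_real y) = rot3 ^ corner_slot (opposite_side j) * of_real (flip_real y)"
    "\<forall>\<^sub>F w in nhds (rot3 ^ corner_slot j * of_real y). F w \<in> vertex_nbhd \<and>
       vertex_map (corner_vertex (opposite_side j)) (F w) = vertex_map (corner_vertex j) w"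
proof -
  let ?i = "opposite_side j"
  let ?k = "corner_slot j" and ?l = "corner_slot ?i"
  let ?w = "rot3 ^ ?k * complex_of_real y"
  have i: "?i < 30" "opposite_side ?i = j" using corner_range opposite_involution j by blast+
  have yd: "complex_of_real y \<in> disc" using real_disc[of y] y by simp
  have wd: "?w \<in> disc" using yd by (intro rotate_disc) simp_all
  have isoh: "hyp_isometry (\<lambda>w. flip (cnj rot3 ^ ?k * w))"
    by (rule hyp_isometry_compose[OF hyp_isometry_flip hyp_isometry_rotation]) simp
  show isoF: "hyp_isometry F" unfolding F_def
    by (rule hyp_isometry_compose[OF hyp_isometry_rotation isoh]) simp
  show Fw: "F ?w = rot3 ^ ?l * of_real (flip_real y)"
    unfolding F_def rot3_pow_cancel flip_of_real ..
  have f: "0 < flip_real y" "flip_real y < side" using flip_real_bounds[of y] y by simp_all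
  define G where "G = {g. Im (cnj rot3 * g) < 0 \<and> 0 < Im (rot3 * g)}"
  have G: "open G" unfolding G_def by (intro open_Collect_conj open_Collect_less continuous_intros)
  have Gr: "complex_of_real x \<in> G" if "0 < x" for x unfolding G_def mem_Collect_eq Im_rot3_real using that by simp
  have 1: "\<forall>\<^sub>F w in nhds ?w. w \<in> vertex_nbhd"
    using open_vertex_nbhd ray_in_vertex_nbhd[of y ?k] y by (intro eventually_nhds_in_open) auto
  have 2: "\<forall>\<^sub>F w in nhds ?w. F w \<in> vertex_nbhd"
    using open_vertex_nbhd ray_in_vertex_nbhd[of "flip_real y" ?l] f
    by (intro hyp_isometry_eventually[OF isoF wd] eventually_nhds_in_open) (auto simp only: Fw less_imp_le)
  have 3: "\<forall>\<^sub>F w in nhds ?w. cnj rot3 ^ ?k * w \<in> G"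
    by (rule hyp_isometry_eventually[OF hyp_isometry_rotation wd eventually_nhds_in_open[OF G]])
      (simp_all only: norm_rot3_pow rot3_pow_cancel Gr[OF y(1)])
  have 4: "\<forall>\<^sub>F w in nhds ?w. flip (cnj rot3 ^ ?k * w) \<in> G"
    by (rule hyp_isometry_eventually[OF isoh wd eventually_nhds_in_open[OF G]])
      (simp only: rot3_pow_cancel flip_of_real Gr[OF f(1)])
  from 1 2 3 4 show "\<forall>\<^sub>F w in nhds ?w. F w \<in> vertex_nbhd \<and> vertex_map (corner_vertex ?i) (F w) = vertex_map (corner_vertex j) w"
  proof eventually_elim
    case (elim w)
    define g where "g = cnj rot3 ^ ?k * w"
    have gd: "g \<in> disc" unfolding g_def using vertex_nbhd_disc[OF elim(1)] by (intro rotate_disc) simp_all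
    have w: "w = rot3 ^ ?k * g" unfolding g_def rot3_pow_cancel ..
    have F: "F w = rot3 ^ ?l * flip g" unfolding F_def g_def ..
    have fd: "flip g \<in> disc" using flip_disc[OF gd] .
    have ff: "flip (flip g) = g" using flip_flip[OF gd] .
    have gG: "Im (cnj rot3 * g) \<le> 0" "0 \<le> Im (rot3 * g)" "Im (cnj rot3 * flip g) \<le> 0" "0 \<le> Im (rot3 * flip g)"
      using elim(3,4) unfolding g_def[symmetric] G_def mem_Collect_eq by linarith+
    have n: "rot3 ^ ?k * g \<in> vertex_nbhd" "rot3 ^ ?l * flip g \<in> vertex_nbhd"
      using elim(1,2) by (simp_all only: F[symmetric] w[symmetric])
    have "vertex_map (corner_vertex ?i) (rot3 ^ ?l * flip g) = vertex_map (corner_vertex j) (rot3 ^ ?k * g)"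
    proof (cases "0 \<le> Im g")
      case True
      then show ?thesis using vertex_map_flip[OF j gd True gG(1,4) n] by blast
    next
      case False
      then have "0 \<le> Im (flip g)"
        using sgn_Im_half_turn_real(1)[OF side_disc gd] unfolding flip_def by linarith
      then show ?thesis
        using vertex_map_flip[OF i(1) fd _ gG(3), unfolded i(2) ff] gG(2) n by simp
    qed
    then show ?case using elim(2) by (simp only: F[symmetric] w[symmetric])
  qed
qed

lemma vertex_map_interior:
  assumes v: "v < 10" and w: "w \<in> vertex_nbhd" and z: "z \<in> polygon_interior" "vertex_map v w = glue z"
  obtains k where "k < 3" "cnj rot3 ^ k * w \<in> open_vertex_sector" "sector_map v k w = z"
  using v w
proof (cases rule: vertex_nbhd_cases)
  case (inner k)
  then have "sector_map v k w = z" using glue_eq_interior[OF z(1)] z(2) polygon_interior_subset by (metis subsetD)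
  then show ?thesis using that inner by blast
next
  case (ray k y)
  have b: "rot30 ^ corner_at v k * edge_point y \<in> polygon - polygon_interior" using edge_point_boundary ray by simp
  then have "rot30 ^ corner_at v k * edge_point y = z" using glue_eq_interior[OF z(1)] z(2) ray by simp
  then show ?thesis using b z(1) by simp
qed

text \<open>The index is computed with 29 in place of -1 in order to stay within the natural
  numbers.\<close>
lemma cyclic_neighbours:
  fixes i j :: nat
  assumes "i < 30" "j < 30" and m: "(i + 29 * j) mod 30 \<in> {0, 1, 29}"
  shows "i = j \<or> i = Suc j mod 30 \<or> j = Suc i mod 30"
proof -
  define q r where "q = (i + 29 * j) div 30" and "r = (i + 29 * j) mod 30"
  have eq: "i + 29 * j = 30 * q + r" by (simp add: q_def r_def)
  have r: "r = 0 \<or> r = 1 \<or> r = 29" using m unfolding r_def[symmetric] by auto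
  have "r < 30" by (simp add: r_def)
  then have "q = j \<or> Suc q = j" using eq assms(1,2) by linarith
  then show ?thesis
  proof
    assume q: "q = j"
    then have i: "i = j + r" using eq by linarith
    from r show ?thesis
    proof (elim disjE)
      assume "r = 29"
      then have "j = 0" "i = 29" using i assms(1) by linarith+
      then show ?thesis by simp
    qed (use i assms(1) in simp_all)
  next
    assume q: "Suc q = j"
    then have j: "j + r = i + 30" using eq by linarith
    from r show ?thesis
    proof (elim disjE)
      assume "r = 1"
      then have "j = 29" "i = 0" using j assms(2) by linarith+
      then show ?thesis by simp
    next
      assume "r = 29"
      then have "j = Suc i" using j by linarith
      then show ?thesis using assms(2) by simp
    qed (use j assms(2) in linarith)
  qed
qed

lemma sector_map_same_vertex:
  assumes v: "v < 10" and k: "k < 3" "l < 3" and w: "w \<in> vertex_nbhd" "w' \<in> vertex_nbhd"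
    and s: "cnj rot3 ^ k * w \<in> open_vertex_sector" "cnj rot3 ^ l * w' \<in> open_vertex_sector"
    and eq: "sector_map v k w = sector_map v l w'"
  shows "w = w'"
proof -
  let ?j = "corner_at v k" and ?i = "corner_at v l"
  have j: "?j < 30" "corner_vertex ?j = v" "?i < 30" "corner_vertex ?i = v" using corner_at_range v k by blast+
  let ?a = "from_vertex (cnj rot3 ^ k * w)" and ?b = "from_vertex (cnj rot3 ^ l * w')"
  have ab: "?a \<in> corner_wedge" "?b \<in> corner_wedge"
    using vertex_nbhd_wedge w s open_vertex_sector_subset by blast+
  have e: "rot30 ^ ?j * ?a = rot30 ^ ?i * ?b" using eq k by (simp add: sector_map_def)
  have "?b = cnj rot30 ^ ?i * (rot30 ^ ?j * ?a)" unfolding e by (simp only: rot30_pow_cancel)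
  also have "\<dots> = cnj rot30 ^ (?i + 29 * ?j) * ?a" by (simp only: power_add rot30_pow_eq_cnj mult.assoc)
  finally have "(?i + 29 * ?j) mod 30 \<in> {0, 1, 29}" using corner_wedges_adjacent ab by metis
  then have "?i = ?j \<or> ?i = Suc ?j mod 30 \<or> ?j = Suc ?i mod 30" by (rule cyclic_neighbours[OF j(3,1)])
  moreover have "?i \<noteq> Suc ?j mod 30" "?j \<noteq> Suc ?i mod 30" using corner_vertex_neq j by force+
  ultimately have "?i = ?j" by blast
  moreover have "corner_slot ?j = k" "corner_slot ?i = l" using corner_at_range v k by blast+
  ultimately have "l = k" by simp
  then show ?thesis
    using eq sector_inverse_map vertex_nbhd_disc w by metis
qed

lemma vertex_map_eq_cases:
  assumes v: "v < 10" "v' < 10" and w: "w \<in> vertex_nbhd" "w' \<in> vertex_nbhd" and eq: "vertex_map v w = vertex_map v' w'"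
  obtains (same) "v = v'" "w = w'"
  | (inner) k l where "k < 3" "l < 3" "cnj rot3 ^ k * w \<in> open_vertex_sector" "cnj rot3 ^ l * w' \<in> open_vertex_sector"
      "sector_map v k w = sector_map v' l w'"
  | (side) j y where "j < 30" "0 < y" "y < side" "v = corner_vertex j" "v' = corner_vertex (opposite_side j)"
      "w = rot3 ^ corner_slot j * of_real y" "w' = rot3 ^ corner_slot (opposite_side j) * of_real (flip_real y)"
  using v(1) w(1)
proof (cases rule: vertex_nbhd_cases)
  case k: (inner k)
  have "vertex_map v' w' = glue (sector_map v k w)" using k(4) eq by simp
  then obtain l where "l < 3" "cnj rot3 ^ l * w' \<in> open_vertex_sector" "sector_map v' l w' = sector_map v k w"
    using vertex_map_interior[OF v(2) w(2) k(3)] by blast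
  then show ?thesis using k inner by metis
next
  case k: (ray k y)
  let ?j = "corner_at v k"
  have j: "?j < 30" "corner_vertex ?j = v" "corner_slot ?j = k" using corner_at_range v(1) k(1) by blast+
  have b: "rot30 ^ ?j * edge_point y \<in> polygon - polygon_interior" using edge_point_boundary k by simp
  from v(2) w(2) show ?thesis
  proof (cases rule: vertex_nbhd_cases)
    case (inner l)
    then have "rot30 ^ ?j * edge_point y = sector_map v' l w'" using glue_eq_interior b eq k(5) by (metis DiffD1)
    then show ?thesis using b inner by simp
  next
    case l: (ray l x)
    let ?i = "corner_at v' l"
    have i: "?i < 30" "corner_vertex ?i = v'" "corner_slot ?i = l" using corner_at_range v(2) l(1) by blast+
    have "glue (rot30 ^ ?j * edge_point y) = glue (rot30 ^ ?i * edge_point x)" using eq k(5) l(5) by simp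
    then consider "y = 0" "x = 0" "v = v'" | "?j = ?i" "y = x" | "0 < y" "?i = opposite_side ?j" "x = flip_real y"
      using glue_edge_eq_iff[OF j(1) i(1) k(2,3) l(2,3)] j(2) i(2) by auto
    then show ?thesis
    proof cases
      case 1
      then show ?thesis using same k(4) l(4) by simp
    next
      case 2
      then show ?thesis using same k(4) l(4) i j by metis
    next
      case 3
      then show ?thesis using side[of ?j y] i j k l by metis
    qed
  qed
qed

lemma inj_vertex_map:
  assumes "v < 10"
  shows "inj_on (vertex_map v) vertex_nbhd"
proof (rule inj_onI)
  fix w w' assume w: "w \<in> vertex_nbhd" "w' \<in> vertex_nbhd" and eq: "vertex_map v w = vertex_map v w'"
  from assms assms w eq show "w = w'"
  proof (cases rule: vertex_map_eq_cases)
    case (inner k l)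
    then show ?thesis using sector_map_same_vertex[OF assms _ _ w] by blast
  next
    case (side j y)
    then show ?thesis using opposite_ends corner_vertex_neq by metis
  qed
qed

lemma inj_glue_interior: "inj_on glue polygon_interior"
  by (rule inj_onI) (use glue_eq_interior polygon_interior_subset in blast)

lemma compatible_vertices:
  assumes v: "v < 10" "v' < 10" and w: "w \<in> vertex_nbhd" "w' \<in> vertex_nbhd" and eq: "vertex_map v w = vertex_map v' w'"
  shows "\<exists>F. hyp_isometry F \<and> F w = w' \<and> (\<forall>\<^sub>F x in nhds w. F x \<in> vertex_nbhd \<and> vertex_map v' (F x) = vertex_map v x)"
  using v w eq
proof (cases rule: vertex_map_eq_cases)
  case same
  have "\<forall>\<^sub>F x in nhds w. x \<in> vertex_nbhd" using open_vertex_nbhd w(1) by (rule eventually_nhds_in_open)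
  then show ?thesis using same hyp_isometry_ident by (intro exI[of _ "\<lambda>x. x"]) simp
next
  case (inner k l)
  have wd: "w \<in> disc" "w' \<in> disc" using vertex_nbhd_disc w by blast+
  let ?F = "\<lambda>x. sector_inverse v' l (sector_map v k x)"
  have "hyp_isometry ?F" by (rule hyp_isometry_compose[OF hyp_isometry_sector_inverse hyp_isometry_sector_map])
  moreover have "?F w = w'" using sector_inverse_map[OF wd(2)] inner(5) by simp
  moreover have "\<forall>\<^sub>F x in nhds w. ?F x \<in> vertex_nbhd \<and> vertex_map v' (?F x) = glue (sector_map v k x)"
    using hyp_isometry_eventually[OF hyp_isometry_sector_map wd(1)] compatible_center_vertex[OF v(2) w(2) inner(4)]
    by (simp only: inner(5)[symmetric])
  then have "\<forall>\<^sub>F x in nhds w. ?F x \<in> vertex_nbhd \<and> vertex_map v' (?F x) = vertex_map v x"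
    using compatible_vertex_center[OF v(1) w(1) inner(3)] by eventually_elim simp
  ultimately show ?thesis by blast
next
  case (side j y)
  show ?thesis using compatible_along_side[OF side(1-3)] unfolding side(4-7) by blast
qed

text \<open>The three kinds of overlaps: two points inside the polygon, a point of a star inside the
  polygon, and two stars.\<close>
lemma glued_compatible:
  assumes "i \<in> chart_index" "j \<in> chart_index" "z \<in> chart_dom i" "z' \<in> chart_dom j" "chart_map i z = chart_map j z'"
  shows "\<exists>F. hyp_isometry F \<and> F z = z' \<and> (\<forall>\<^sub>F w in nhds z. F w \<in> chart_dom j \<and> chart_map j (F w) = chart_map i w)"
proof (cases i; cases j)
  assume ij: "i = None" "j = None"
  then have z: "z \<in> polygon_interior" "z' = z"
    using assms glue_eq_interior[of z z'] polygon_interior_subset by (auto simp: chart_dom_def chart_map_def)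
  have "\<forall>\<^sub>F x in nhds z. x \<in> polygon_interior" using open_polygon_interior z(1) by (rule eventually_nhds_in_open)
  then show ?thesis using ij z hyp_isometry_ident by (intro exI[of _ "\<lambda>x. x"]) (simp add: chart_dom_def chart_map_def)
next
  fix v assume ij: "i = None" "j = Some v"
  then have h: "v < 10" "z \<in> polygon_interior" "z' \<in> vertex_nbhd" "vertex_map v z' = glue z"
    using assms by (auto simp: chart_dom_def chart_map_def chart_index_def)
  obtain k where k: "cnj rot3 ^ k * z' \<in> open_vertex_sector" "sector_map v k z' = z"
    using vertex_map_interior[OF h(1,3,2,4)] by blast
  show ?thesis
    using compatible_center_vertex[OF h(1,3) k(1)] sector_inverse_map[OF vertex_nbhd_disc[OF h(3)], of v k]
      hyp_isometry_sector_inverse[of v k] ij unfolding k(2)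
    by (intro exI[of _ "sector_inverse v k"]) (simp add: chart_dom_def chart_map_def)
next
  fix v assume ij: "i = Some v" "j = None"
  then have h: "v < 10" "z' \<in> polygon_interior" "z \<in> vertex_nbhd" "vertex_map v z = glue z'"
    using assms by (auto simp: chart_dom_def chart_map_def chart_index_def)
  obtain k where k: "cnj rot3 ^ k * z \<in> open_vertex_sector" "sector_map v k z = z'"
    using vertex_map_interior[OF h(1,3,2,4)] by blast
  show ?thesis
    using compatible_vertex_center[OF h(1,3) k(1)] hyp_isometry_sector_map[of v k] ij k(2)
    by (intro exI[of _ "sector_map v k"]) (simp add: chart_dom_def chart_map_def)
next
  fix v v' assume ij: "i = Some v" "j = Some v'"
  then have h: "v < 10" "v' < 10" "z \<in> vertex_nbhd" "z' \<in> vertex_nbhd" "vertex_map v z = vertex_map v' z'"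
    using assms by (auto simp: chart_dom_def chart_map_def chart_index_def)
  show ?thesis using compatible_vertices[OF h] ij by (simp add: chart_dom_def chart_map_def)
qed

lemma glue_boundary_vertex_map:
  assumes "j < 30" "0 \<le> y" "y < side"
  shows "glue (rot30 ^ j * edge_point y) = vertex_map (corner_vertex j) (rot3 ^ corner_slot j * of_real y)"
proof -
  have "corner_vertex j < 10" "corner_slot j < 3" "corner_at (corner_vertex j) (corner_slot j) = j"
    using corner_range corner_at_inverse assms(1) by blast+
  then show ?thesis using vertex_map_ray[OF _ assms(2,3)] by simp
qed

interpretation glued: isometric_atlas chart_index chart_dom chart_map "1 / side_length"
proof
  show "finite chart_index" by (simp add: chart_index_def)
  show "1 / side_length > 0" using side_length_pos by simp
  show "open (chart_dom i)" if "i \<in> chart_index" for i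
    using open_polygon_interior open_vertex_nbhd by (cases i) (simp_all add: chart_dom_def)
  show "chart_dom i \<subseteq> disc" if "i \<in> chart_index" for i
    using polygon_disc(2) vertex_nbhd_disc by (cases i) (auto simp: chart_dom_def simp del: mem_ball mem_ball_0)
  show "inj_on (chart_map i) (chart_dom i)" if "i \<in> chart_index" for i
    using inj_glue_interior inj_vertex_map that
    by (cases i) (auto simp: chart_dom_def chart_map_def chart_index_def)
  show "(\<Union>i\<in>chart_index. chart_map i ` chart_dom i) = UNIV"
  proof (intro equalityI subsetI)
    fix p :: complex
    obtain z where z: "z \<in> polygon" "glue z = p" using glue_surj by (metis UNIV_I imageE)
    show "p \<in> (\<Union>i\<in>chart_index. chart_map i ` chart_dom i)"
    proof (cases "z \<in> polygon_interior")
      case True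
      then show ?thesis using z by (auto simp: chart_index_def chart_dom_def chart_map_def)
    next
      case False
      then obtain j y where jy: "j < 30" "0 \<le> y" "y < side" "z = rot30 ^ j * edge_point y"
        using boundary_edge_point[of z] z(1) by blast
      then have "p = vertex_map (corner_vertex j) (rot3 ^ corner_slot j * of_real y)"
        using glue_boundary_vertex_map z(2) by blast
      moreover have "rot3 ^ corner_slot j * of_real y \<in> vertex_nbhd" using ray_in_vertex_nbhd jy by blast
      moreover have "Some (corner_vertex j) \<in> chart_index" using corner_range jy(1) by (simp add: chart_index_def)
      ultimately show ?thesis
        by (intro UN_I[of "Some (corner_vertex j)"]) (simp_all add: chart_dom_def chart_map_def)
    qed
  qed simp
  show "\<exists>F. hyp_isometry F \<and> F z = z' \<and> (\<forall>\<^sub>F w in nhds z. F w \<in> chart_dom j \<and> chart_map j (F w) = chart_map i w)"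
    if "i \<in> chart_index" "j \<in> chart_index" "z \<in> chart_dom i" "z' \<in> chart_dom j" "chart_map i z = chart_map j z'" for i j z z'
    by (rule glued_compatible[OF that])
qed

subsection \<open>Topology of the glued surface\<close>

lemma continuous_edge_point: "continuous_on {0..side} edge_point"
  unfolding edge_point_def
  by (rule continuous_on_compose2[OF hyp_isometry_continuous[OF hyp_isometry_from_vertex]])
    (use real_disc in \<open>auto intro!: continuous_intros\<close>)

text \<open>The relation is a finite union of compact sets: the diagonal, one arc for each pair of
  opposite sides, and the pairs of corners.\<close>
lemma closed_glue_relation: "closed {x \<in> polygon \<times> polygon. glue (fst x) = glue (snd x)}"
proof -
  let ?D = "(\<lambda>z. (z, z)) ` polygon"
  let ?E = "\<lambda>j. (\<lambda>y. (rot30 ^ j * edge_point y, rot30 ^ opposite_side j * edge_point (flip_real y))) ` {0..side}"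
  let ?C = "\<lambda>j i. if corner_vertex j = corner_vertex i then {(rot30 ^ j * edge_point 0, rot30 ^ i * edge_point 0)} else {}"
  let ?R = "?D \<union> (\<Union>j\<in>{..<30}. ?E j) \<union> (\<Union>j\<in>{..<30}. \<Union>i\<in>{..<30}. ?C j i)"
  have cf: "continuous_on {0..side} flip_real"
  proof -
    have "1 - side * y \<noteq> 0" if "y \<in> {0..side}" for y
    proof -
      have "side * y \<le> side * 1" using that side_pos side_less_1 by (intro mult_left_mono) auto
      then show ?thesis using side_less_1 by linarith
    qed
    then show ?thesis unfolding flip_real_def by (intro continuous_intros) auto
  qed
  have "continuous_on {0..side} (\<lambda>y. edge_point (flip_real y))"
    by (rule continuous_on_compose2[OF continuous_edge_point cf]) (use flip_real_bounds in auto)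
  then have "closed (?E j)" for j
    by (intro compact_imp_closed compact_continuous_image compact_Icc continuous_intros continuous_edge_point)
  moreover have "closed ?D"
    by (intro compact_imp_closed compact_continuous_image compact_polygon continuous_intros)
  moreover have "closed (?C j i)" for j i by simp
  ultimately have "closed ?R" by (intro closed_Un closed_UN) auto
  moreover have "{x \<in> polygon \<times> polygon. glue (fst x) = glue (snd x)} = ?R"
  proof (intro equalityI subsetI)
    fix x assume "x \<in> {x \<in> polygon \<times> polygon. glue (fst x) = glue (snd x)}"
    then obtain z w where x: "x = (z, w)" "z \<in> polygon" "w \<in> polygon" "glue z = glue w" by auto
    show "x \<in> ?R"
    proof (cases "z \<in> polygon_interior \<or> w \<in> polygon_interior")
      case True
      then have "z = w" using glue_eq_interior x by metis
      then show ?thesis using x by auto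
    next
      case False
      obtain j y where j: "j < 30" "0 \<le> y" "y < side" "z = rot30 ^ j * edge_point y"
        using boundary_edge_point[of z] x False by blast
      obtain i v where i: "i < 30" "0 \<le> v" "v < side" "w = rot30 ^ i * edge_point v"
        using boundary_edge_point[of w] x False by blast
      from glue_edge_eq_iff[OF j(1) i(1) j(2,3) i(2,3)] x(4)
      consider "y = 0" "v = 0" "corner_vertex j = corner_vertex i" | "j = i" "y = v" | "i = opposite_side j" "v = flip_real y"
        unfolding j(4) i(4) by blast
      then show ?thesis
      proof cases
        case 1
        then have "x \<in> ?C j i" using x(1) i(4) j(4) by simp
        then show ?thesis using i(1) j(1) by blast
      next
        case 2
        then show ?thesis using x i(4) j(4) by auto
      next
        case 3
        then have "x \<in> ?E j" using x(1) i(4) j by auto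
        then show ?thesis using j(1) by blast
      qed
    qed
  next
    fix x assume "x \<in> ?R"
    then consider z where "z \<in> polygon" "x = (z, z)"
      | j y where "j < 30" "0 \<le> y" "y \<le> side" "x = (rot30 ^ j * edge_point y, rot30 ^ opposite_side j * edge_point (flip_real y))"
      | j i where "j < 30" "i < 30" "corner_vertex j = corner_vertex i" "x = (rot30 ^ j * edge_point 0, rot30 ^ i * edge_point 0)"
      by (auto split: if_splits)
    then show "x \<in> {x \<in> polygon \<times> polygon. glue (fst x) = glue (snd x)}"
    proof cases
      case 1
      then show ?thesis by simp
    next
      case 2
      then show ?thesis using glue_opposite[OF 2(1-3)] edge_point_boundary flip_real_bounds by auto
    next
      case 3
      then show ?thesis using glue_edge_eq_iff[OF 3(1,2), of 0 0] edge_point_boundary[of 0] side_pos by auto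
    qed
  qed
  ultimately show ?thesis by simp
qed

text \<open>Pieces on which the parametrizations are continuous as maps into the polygon, before
  gluing.\<close>
definition piece :: "nat option \<Rightarrow> nat \<Rightarrow> complex set" where
  "piece i k = (case i of None \<Rightarrow> UNIV | Some v \<Rightarrow> {w. cnj rot3 ^ k * w \<in> vertex_sector})"

definition piece_map :: "nat option \<Rightarrow> nat \<Rightarrow> complex \<Rightarrow> complex" where
  "piece_map i k = (case i of None \<Rightarrow> (\<lambda>w. w) | Some v \<Rightarrow> sector_map v k)"

lemma closed_piece: "closed (piece i k)"
proof (cases i)
  case (Some v)
  have "piece i k = (\<lambda>w. cnj rot3 ^ k * w) -` vertex_sector" by (auto simp: piece_def Some)
  then show ?thesis by (simp only:) (intro closed_vimage closed_vertex_sector continuous_intros)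
qed (simp add: piece_def)

lemma continuous_piece_map: "continuous_on disc (piece_map i k)"
proof (cases i)
  case (Some v)
  then show ?thesis using hyp_isometry_continuous[OF hyp_isometry_sector_map] by (simp add: piece_map_def)
qed (simp add: piece_map_def)

lemma piece_cover: "\<exists>k<3. w \<in> piece i k"
  using ex_vertex_sector by (cases i) (auto simp: piece_def intro: exI[of _ "0::nat"])

lemma piece_glue:
  assumes "i \<in> chart_index" "w \<in> chart_dom i" "w \<in> piece i k"
  shows "piece_map i k w \<in> polygon" "chart_map i w = glue (piece_map i k w)"
  using assms polygon_interior_subset sector_map_polygon(1) vertex_map_eq
  by (cases i; auto simp: piece_def piece_map_def chart_dom_def chart_map_def chart_index_def)+

lemma hausdorff_glued: "Hausdorff_space glued.glued_topology"
proof (rule glued.hausdorff_if_closed_relation)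
  fix i j assume ij: "i \<in> chart_index" "j \<in> chart_index"
  let ?N = "chart_dom i \<times> chart_dom j"
  let ?G = "{x \<in> polygon \<times> polygon. glue (fst x) = glue (snd x)}"
  let ?f = "\<lambda>k l x. (piece_map i k (fst x), piece_map j l (snd x))"
  have d: "chart_dom i \<subseteq> disc" "chart_dom j \<subseteq> disc" using glued.N_subset_disc ij by blast+
  have "continuous_on ?N (?f k l)" for k l
    by (intro continuous_on_Pair continuous_on_compose2[OF continuous_piece_map] continuous_intros) (use d in auto)
  then have "closedin (top_of_set ?N) (?N \<inter> ?f k l -` ?G)" for k l
    using closed_glue_relation by (rule continuous_closedin_preimage)
  moreover have "closedin (top_of_set ?N) (?N \<inter> piece i k \<times> piece j l)" for k l
    by (intro closedin_closed_Int closed_Times closed_piece)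
  ultimately have "closedin (top_of_set ?N) ((?N \<inter> ?f k l -` ?G) \<inter> (?N \<inter> piece i k \<times> piece j l))" for k l
    by (rule closedin_Int)
  then have "closedin (top_of_set ?N) (\<Union>l\<in>{..<3::nat}. (?N \<inter> ?f k l -` ?G) \<inter> (?N \<inter> piece i k \<times> piece j l))" for k
    by (intro closedin_Union finite_imageI finite_lessThan) blast
  then have "closedin (top_of_set ?N) (\<Union>k\<in>{..<3::nat}. \<Union>l\<in>{..<3::nat}. (?N \<inter> ?f k l -` ?G) \<inter> (?N \<inter> piece i k \<times> piece j l))"
    by (intro closedin_Union finite_imageI finite_lessThan) blast
  moreover have "{x \<in> ?N. chart_map i (fst x) = chart_map j (snd x)} =
      (\<Union>k\<in>{..<3}. \<Union>l\<in>{..<3}. (?N \<inter> ?f k l -` ?G) \<inter> (?N \<inter> piece i k \<times> piece j l))"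
  proof (intro equalityI subsetI)
    fix x assume x: "x \<in> {x \<in> ?N. chart_map i (fst x) = chart_map j (snd x)}"
    obtain k where k: "k < 3" "fst x \<in> piece i k" using piece_cover by blast
    obtain l where l: "l < 3" "snd x \<in> piece j l" using piece_cover by blast
    have xd: "fst x \<in> chart_dom i" "snd x \<in> chart_dom j" using x by auto
    have "?f k l x \<in> ?G"
      using piece_glue[OF ij(1) xd(1) k(2)] piece_glue[OF ij(2) xd(2) l(2)] x by simp
    then show "x \<in> (\<Union>k\<in>{..<3}. \<Union>l\<in>{..<3}. (?N \<inter> ?f k l -` ?G) \<inter> (?N \<inter> piece i k \<times> piece j l))"
      using k l xd by (cases x) auto
  next
    fix x assume "x \<in> (\<Union>k\<in>{..<3}. \<Union>l\<in>{..<3}. (?N \<inter> ?f k l -` ?G) \<inter> (?N \<inter> piece i k \<times> piece j l))"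
    then obtain k l where kl: "x \<in> ?N" "?f k l x \<in> ?G" "fst x \<in> piece i k" "snd x \<in> piece j l" by auto
    have xd: "fst x \<in> chart_dom i" "snd x \<in> chart_dom j" using kl(1) by auto
    show "x \<in> {x \<in> ?N. chart_map i (fst x) = chart_map j (snd x)}"
      using piece_glue(2)[OF ij(1) xd(1) kl(3)] piece_glue(2)[OF ij(2) xd(2) kl(4)] kl(1,2) by simp
  qed
  ultimately show "closedin (top_of_set ?N) {x \<in> ?N. chart_map i (fst x) = chart_map j (snd x)}" by simp
qed

text \<open>Near a boundary point the polygon itself sits in the star as one of the three
  sectors.\<close>
lemma glue_near_boundary:
  assumes j: "j < 30" and z: "z \<in> polygon" "cnj rot30 ^ j * z \<in> corner_wedge"
    and n: "sector_inverse (corner_vertex j) (corner_slot j) z \<in> vertex_nbhd"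
  shows "glue z = vertex_map (corner_vertex j) (sector_inverse (corner_vertex j) (corner_slot j) z)"
proof -
  let ?v = "corner_vertex j" and ?k = "corner_slot j"
  have r: "?v < 10" "?k < 3" "corner_at ?v ?k = j" using corner_range corner_at_inverse j by blast+
  have zd: "z \<in> disc" using polygon_disc(1)[OF z(1)] .
  have d: "cnj rot30 ^ j * z \<in> disc" using zd by (intro rotate_disc) simp_all
  have "cnj rot30 ^ j * z \<in> polygon" using polygon_rotate(1)[OF z(1)] .
  then have "to_vertex (cnj rot30 ^ j * z) \<in> vertex_sector" using polygon_in_wedge(1)[OF z(2) d] by simp
  then have "cnj rot3 ^ ?k * sector_inverse ?v ?k z \<in> vertex_sector"
    unfolding sector_inverse_def rot3_pow_cancel using r by simp
  from vertex_map_eq[OF r(1) n this] show ?thesis unfolding sector_map_inverse[OF zd] by simp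
qed

lemma continuous_glue: "continuous_map (top_of_set polygon) glued.glued_topology glue"
  unfolding continuous_map
proof (intro conjI allI impI)
  fix U assume U: "openin glued.glued_topology U"
  have "\<exists>T. open T \<and> q \<in> T \<and> polygon \<inter> T \<subseteq> {z \<in> polygon. glue z \<in> U}" if q: "q \<in> polygon" "glue q \<in> U" for q
  proof (cases "q \<in> polygon_interior")
    case True
    have "open {z \<in> chart_dom None. chart_map None z \<in> U}"
      using U unfolding glued.openin_glued by (auto simp: chart_index_def)
    then show ?thesis using True q
      by (intro exI[of _ "{z \<in> chart_dom None. chart_map None z \<in> U}"]) (auto simp: chart_dom_def chart_map_def)
  next
    case False
    then obtain j y where jy: "j < 30" "0 \<le> y" "y < side" "q = rot30 ^ j * edge_point y"
      using boundary_edge_point[of q] q(1) by blast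
    let ?v = "corner_vertex j" and ?k = "corner_slot j"
    have r: "?v < 10" "?k < 3" "corner_at ?v ?k = j" using corner_range corner_at_inverse jy(1) by blast+
    let ?W = "{w \<in> chart_dom (Some ?v). chart_map (Some ?v) w \<in> U}"
    have W: "open ?W" using U r(1) unfolding glued.openin_glued by (auto simp: chart_index_def)
    let ?A = "disc \<inter> sector_inverse ?v ?k -` ?W"
    let ?B = "(\<lambda>z. cnj rot30 ^ j * z) -` corner_wedge"
    have "open ?A" by (rule continuous_open_preimage[OF hyp_isometry_continuous[OF hyp_isometry_sector_inverse] open_ball W])
    moreover have "open ?B" by (intro open_vimage open_corner_wedge continuous_intros)
    moreover have si: "sector_inverse ?v ?k q = rot3 ^ ?k * of_real y"
      unfolding sector_inverse_def jy(4) using r to_from_vertex[OF real_disc[of y]] jy(2,3)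
      by (simp add: rot30_pow_cancel edge_point_def)
    have nb: "rot3 ^ ?k * of_real y \<in> vertex_nbhd" using ray_in_vertex_nbhd jy by blast
    have gq: "glue q = vertex_map ?v (rot3 ^ ?k * of_real y)" using glue_boundary_vertex_map jy by blast
    have "q \<in> ?A \<inter> ?B"
      using si nb gq q polygon_disc(1)[OF q(1)] edge_point_in_wedge(1)[OF jy(2,3)]
      by (simp add: chart_dom_def chart_map_def) (simp add: jy(4) rot30_pow_cancel)
    moreover have "polygon \<inter> (?A \<inter> ?B) \<subseteq> {z \<in> polygon. glue z \<in> U}"
    proof
      fix z assume z: "z \<in> polygon \<inter> (?A \<inter> ?B)"
      then have n: "sector_inverse ?v ?k z \<in> vertex_nbhd" "vertex_map ?v (sector_inverse ?v ?k z) \<in> U"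
        by (auto simp: chart_dom_def chart_map_def)
      show "z \<in> {z \<in> polygon. glue z \<in> U}" using glue_near_boundary[OF jy(1) _ _ n(1)] n(2) z by auto
    qed
    ultimately show ?thesis by (intro exI[of _ "?A \<inter> ?B"]) auto
  qed
  then have nbhd: "\<exists>T. open T \<and> q \<in> T \<and> polygon \<inter> T \<subseteq> {z \<in> polygon. glue z \<in> U}"
    if "q \<in> polygon" "glue q \<in> U" for q using that by blast
  have "openin (top_of_set polygon) {z \<in> polygon. glue z \<in> U}"
  proof (subst openin_subopen, intro ballI)
    fix q assume "q \<in> {z \<in> polygon. glue z \<in> U}"
    then have q: "q \<in> polygon" "glue q \<in> U" by auto
    then obtain T where T: "open T" "q \<in> T" "polygon \<inter> T \<subseteq> {z \<in> polygon. glue z \<in> U}" using nbhd by blast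
    show "\<exists>T. openin (top_of_set polygon) T \<and> q \<in> T \<and> T \<subseteq> {z \<in> polygon. glue z \<in> U}"
      using openin_open_Int[OF T(1)] T(2,3) q(1) by (intro exI[of _ "polygon \<inter> T"] conjI IntI)
  qed
  then show "openin (top_of_set polygon) {z \<in> topspace (top_of_set polygon). glue z \<in> U}" by simp
qed simp

lemma connected_polygon: "connected polygon"
proof -
  have "starlike polygon"
    unfolding starlike_def
  proof (intro bexI ballI)
    show "0 \<in> polygon" using zero_in_polygon_interior polygon_interior_subset by blast
    fix z assume z: "z \<in> polygon"
    show "closed_segment 0 z \<subseteq> polygon"
    proof
      fix x assume "x \<in> closed_segment 0 z"
      then obtain t where t: "0 \<le> t" "t \<le> 1" "x = of_real t * z" by (auto simp: in_segment scaleR_conv_of_real)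
      then show "x \<in> polygon" using polygon_scale[OF z, of t] polygon_interior_subset z by (cases "t = 1") auto
    qed
  qed
  then show ?thesis by (rule starlike_imp_connected)
qed

interpretation glued: isometric_surface chart_index chart_dom chart_map "1 / side_length"
proof
  show "Hausdorff_space glued.glued_topology" by (rule hausdorff_glued)
  have "compactin glued.glued_topology (glue ` polygon)"
    by (rule image_compactin[OF _ continuous_glue]) (simp add: compactin_subtopology compact_polygon)
  then show "compact_space glued.glued_topology" unfolding glue_surj by (simp add: compact_space_def)
  have "connectedin glued.glued_topology (glue ` polygon)"
    by (rule connectedin_continuous_map_image[OF continuous_glue]) (simp add: connectedin_subtopology connected_polygon)
  then show "connected_space glued.glued_topology" unfolding glue_surj using connectedin_topspace by force
qed

section \<open>Extending shortest paths\<close>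

lemma continuous_on_dist_path:
  assumes M: "Metric_space M d" and \<delta>: "pathin (Metric_space.mtopology M d) \<delta>" and p: "p \<in> M"
  shows "continuous_on {0..1} (\<lambda>t. d p (\<delta> t))"
  unfolding continuous_on_iff
proof (intro ballI allI impI)
  interpret Metric_space M d by fact
  fix t e :: real assume t: "t \<in> {0..1}" and e: "e > 0"
  have in_M: "\<delta> s \<in> M" if "s \<in> {0..1}" for s using \<delta> that by (auto simp: pathin_def continuous_map_def)
  have "openin (top_of_set {0..1}) {s \<in> {0..1}. \<delta> s \<in> mball (\<delta> t) e}"
    using openin_continuous_map_preimage[OF \<delta>[unfolded pathin_def] openin_mball] by simp
  moreover have "t \<in> {s \<in> {0..1}. \<delta> s \<in> mball (\<delta> t) e}" using t e in_M by simp
  ultimately obtain r where r: "r > 0" "\<And>s. s \<in> {0..1} \<Longrightarrow> dist s t < r \<Longrightarrow> \<delta> s \<in> mball (\<delta> t) e"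
    unfolding openin_euclidean_subtopology_iff by blast
  show "\<exists>r>0. \<forall>s\<in>{0..1}. dist s t < r \<longrightarrow> dist (d p (\<delta> s)) (d p (\<delta> t)) < e"
  proof (intro exI[of _ r] conjI ballI impI r(1))
    fix s :: real assume s: "s \<in> {0..1}" "dist s t < r"
    have "d (\<delta> t) (\<delta> s) < e" using r(2)[OF s] by simp
    moreover have "d p (\<delta> s) \<le> d p (\<delta> t) + d (\<delta> t) (\<delta> s)" "d p (\<delta> t) \<le> d p (\<delta> s) + d (\<delta> s) (\<delta> t)"
      using p in_M s t by (auto intro: triangle)
    moreover have "d (\<delta> s) (\<delta> t) = d (\<delta> t) (\<delta> s)" by (rule commute)
    ultimately show "dist (d p (\<delta> s)) (d p (\<delta> t)) < e" unfolding dist_real_def by linarith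
  qed
qed

lemma shortest_path_in:
  assumes "Metric_space M d" "shortest_path M d \<gamma>" "u \<in> {0..1}"
  shows "\<gamma> u \<in> M"
proof -
  interpret Metric_space M d by fact
  show ?thesis using assms(2,3) by (auto simp: shortest_path_def pathin_def continuous_map_def)
qed

lemma shortest_path_level:
  assumes M: "Metric_space M d" and \<delta>: "shortest_path M d \<delta>" and st: "s \<in> {0..1}" "t \<in> {0..1}"
    and eq: "d (\<delta> 0) (\<delta> s) = d (\<delta> 0) (\<delta> t)"
  shows "\<delta> s = \<delta> t"
proof -
  interpret Metric_space M d by fact
  have in_M: "\<delta> u \<in> M" if "u \<in> {0..1}" for u
    by (rule shortest_path_in[OF M \<delta> that])
  have "d (\<delta> s) (\<delta> t) = 0 \<or> d (\<delta> t) (\<delta> s) = 0"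
  proof (cases "s \<le> t")
    case True
    then show ?thesis using shortest_path_additive[OF M \<delta>, of s t] eq st by simp
  next
    case False
    then show ?thesis using shortest_path_additive[OF M \<delta>, of t s] eq st by simp
  qed
  then show ?thesis using zero[OF in_M[OF st(1)] in_M[OF st(2)]] zero[OF in_M[OF st(2)] in_M[OF st(1)]] by metis
qed

text \<open>A longer path with the same start passes through \<open>p\<close> and, by continuity,
  through points close to \<open>p\<close> and farther from \<open>x\<close>; if it is shortest, these
  contradict the strict triangle inequality.\<close>
lemma cut_locus_if_not_extendable:
  assumes M: "Metric_space M d" and \<gamma>: "shortest_path M d \<gamma>" "\<gamma> 0 = x" "\<gamma> 1 = p" and px: "p \<noteq> x"
    and e: "e > 0" "\<And>q. q \<in> M \<Longrightarrow> 0 < d p q \<Longrightarrow> d p q < e \<Longrightarrow> d x q < d x p + d p q"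
  shows "p \<in> cut_locus M d x"
proof -
  interpret Metric_space M d by fact
  have False if \<delta>: "shortest_path M d \<delta>" "\<delta> 0 = x" "\<gamma> ` {0..1} \<subset> \<delta> ` {0..1}" for \<delta>
  proof -
    have in_M: "\<delta> u \<in> M" "\<gamma> u \<in> M" if "u \<in> {0..1}" for u
      by (rule shortest_path_in[OF M \<delta>(1) that], rule shortest_path_in[OF M \<gamma>(1) that])
    have xM: "x \<in> M" using in_M(1)[of 0] \<delta>(2) by simp
    define L where "L t = d x (\<delta> t)" for t
    have contL: "continuous_on {0..1} L" unfolding L_def
      using continuous_on_dist_path[OF M _ xM] \<delta>(1) by (simp add: shortest_path_def)
    have contG: "continuous_on {0..1} (\<lambda>t. d x (\<gamma> t))"
      using continuous_on_dist_path[OF M _ xM] \<gamma>(1) by (simp add: shortest_path_def)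
    have add: "L t = L s + d (\<delta> s) (\<delta> t)" if "0 \<le> s" "s \<le> t" "t \<le> 1" for s t
      using shortest_path_additive[OF M \<delta>(1) that] \<delta>(2) by (simp add: L_def)
    have mono: "L s \<le> L t" if "0 \<le> s" "s \<le> t" "t \<le> 1" for s t using add[OF that] by simp
    have same: "\<delta> s = \<delta> t" if "s \<in> {0..1}" "t \<in> {0..1}" "L s = L t" for s t
      using shortest_path_level[OF M \<delta>(1) that(1,2)] that(3) \<delta>(2) by (simp add: L_def)
    obtain t0 where t0: "t0 \<in> {0..1}" "\<delta> t0 = p"
    proof -
      have "p \<in> \<gamma> ` {0..1}" using \<gamma>(3) by force
      then have "p \<in> \<delta> ` {0..1}" using psubset_imp_subset[OF \<delta>(3)] by (rule subsetD[rotated])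
      then show ?thesis by (elim imageE) (rule that, simp_all)
    qed
    \<comment> \<open>A point of \<open>\<delta>\<close> outside \<open>\<gamma>\<close> has to lie beyond \<open>p\<close>: nearer to \<open>x\<close> there is a point of \<open>\<gamma>\<close>
      at every distance, and \<open>\<delta>\<close> has only one point at each distance.\<close>
    obtain t1 where t1: "t1 \<in> {0..1}" "L t1 > d x p"
    proof -
      obtain t where t: "t \<in> {0..1}" "\<delta> t \<notin> \<gamma> ` {0..1}" using \<delta>(3) by blast
      have "\<not> L t \<le> d x p"
      proof
        assume le: "L t \<le> d x p"
        have "d x (\<gamma> 0) \<le> L t" using \<gamma>(2) xM by (simp add: L_def)
        then obtain s where s: "0 \<le> s" "s \<le> 1" "d x (\<gamma> s) = L t"
          using IVT'[of "\<lambda>t. d x (\<gamma> t)" 0 "L t" 1] le \<gamma>(3) contG by auto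
        have "\<gamma> s \<in> \<gamma> ` {0..1}" using s by simp
        then have "\<gamma> s \<in> \<delta> ` {0..1}" using psubset_imp_subset[OF \<delta>(3)] by (rule subsetD[rotated])
        then obtain u where u: "u \<in> {0..1}" "\<gamma> s = \<delta> u" by blast
        then have "\<delta> u = \<delta> t" using same[OF u(1) t(1)] s(3) by (simp add: L_def)
        then show False using t(2) u(2) \<open>\<gamma> s \<in> \<gamma> ` {0..1}\<close> by simp
      qed
      then show ?thesis using that t(1) by force
    qed
    define h where "h = min e (L t1 - d x p) / 2"
    have h: "h > 0" "h < e" "d x p + h \<le> L t1" using e(1) t1(2) by (auto simp: h_def min_def field_simps)
    have t01: "t0 \<le> t1"
    proof (rule ccontr)
      assume "\<not> t0 \<le> t1"
      then show False using mono[of t1 t0] t0 t1 by (simp add: L_def)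
    qed
    have "continuous_on {t0..t1} L" using contL t0(1) t1(1) by (auto intro: continuous_on_subset)
    then obtain t2 where t2: "t0 \<le> t2" "t2 \<le> t1" "L t2 = d x p + h"
      using IVT'[of L t0 "d x p + h" t1] h t01 t0(2) by (auto simp: L_def)
    have "d p (\<delta> t2) = h" using add[of t0 t2] t0 t1 t2 by (simp add: L_def)
    moreover have "\<delta> t2 \<in> M" using in_M t0 t1 t2 by auto
    ultimately show False using e(2)[of "\<delta> t2"] h t2(3) by (simp add: L_def)
  qed
  then show ?thesis unfolding cut_locus_def using \<gamma> px by blast
qed

text \<open>Every shortest path from \<open>x\<close> to \<open>p\<close> can be followed by
  \<open>\<sigma>\<close>, since only the distance of the far end from \<open>x\<close> matters. As in
  \<open>shortest_pathI\<close>, the function \<open>g\<close> plays the role of arc length.\<close>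
lemma not_in_cut_locus_if_extendable:
  fixes \<sigma> :: "real \<Rightarrow> 'a" and g :: "real \<Rightarrow> real"
  assumes M: "Metric_space M d" and \<sigma>: "\<sigma> ` {0..1} \<subseteq> M" "\<sigma> 0 = p" and g: "continuous_on {0..1} g"
    and le: "\<And>s t. 0 \<le> s \<Longrightarrow> s \<le> t \<Longrightarrow> t \<le> 1 \<Longrightarrow> d (\<sigma> s) (\<sigma> t) \<le> g t - g s"
    and far: "d x (\<sigma> 1) = d x p + (g 1 - g 0)" "g 0 < g 1"
  shows "p \<notin> cut_locus M d x"
proof
  interpret Metric_space M d by fact
  assume "p \<in> cut_locus M d x"
  then obtain \<gamma> where \<gamma>: "shortest_path M d \<gamma>" "\<gamma> 0 = x" "\<gamma> 1 = p"
    "\<And>\<delta>. shortest_path M d \<delta> \<Longrightarrow> \<delta> 0 = x \<Longrightarrow> \<not> \<gamma> ` {0..1} \<subset> \<delta> ` {0..1}"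
    unfolding cut_locus_def by blast
  have in_M: "\<gamma> u \<in> M" "\<sigma> u \<in> M" if "u \<in> {0..1}" for u
    using shortest_path_in[OF M \<gamma>(1) that] \<sigma>(1) that by blast+
  have xM: "x \<in> M" using in_M(1)[of 0] \<gamma>(2) by simp
  have add: "d x (\<gamma> t) = d x (\<gamma> s) + d (\<gamma> s) (\<gamma> t)" if "0 \<le> s" "s \<le> t" "t \<le> 1" for s t
    using shortest_path_additive[OF M \<gamma>(1) that] \<gamma>(2) by simp
  define \<delta> where "\<delta> t = (if t \<le> 1/2 then \<gamma> (2 * t) else \<sigma> (2 * t - 1))" for t :: real
  define f where "f t = (if t \<le> 1/2 then d x (\<gamma> (2 * t)) else d x p + g (2 * t - 1) - g 0)" for t :: real
  have "shortest_path M d \<delta>"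
  proof (rule shortest_pathI[OF M, of _ f])
    show "\<delta> ` {0..1} \<subseteq> M" using in_M by (auto simp: \<delta>_def)
    have "continuous_on ({0..1/2} \<union> {1/2..1}) f"
      unfolding f_def
    proof (rule continuous_on_cases)
      show "continuous_on {0..1/2} (\<lambda>t. d x (\<gamma> (2 * t)))"
        by (rule continuous_on_compose2[OF continuous_on_dist_path[OF M _ xM]])
          (use \<gamma>(1) in \<open>auto simp: shortest_path_def intro!: continuous_intros\<close>)
      have "continuous_on {1/2..1} (\<lambda>t. g (2 * t - 1))"
        by (rule continuous_on_compose2[OF g]) (auto intro!: continuous_intros)
      then show "continuous_on {1/2..1} (\<lambda>t. d x p + g (2 * t - 1) - g 0)" by (intro continuous_intros)
      show "\<forall>t. t \<in> {0..1/2} \<and> \<not> t \<le> 1/2 \<or> t \<in> {1/2..1} \<and> t \<le> 1/2 \<longrightarrow> d x (\<gamma> (2 * t)) = d x p + g (2 * t - 1) - g 0"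
      proof (intro allI impI)
        fix t :: real assume "t \<in> {0..1/2} \<and> \<not> t \<le> 1/2 \<or> t \<in> {1/2..1} \<and> t \<le> 1/2"
        then have "2 * t = 1" by auto
        then show "d x (\<gamma> (2 * t)) = d x p + g (2 * t - 1) - g 0" using \<gamma>(3) by simp
      qed
    qed auto
    moreover have "{0..1/2} \<union> {1/2..1} = {0..1::real}" by auto
    ultimately show "continuous_on {0..1} f" by simp
    have f0: "f 0 = 0" using \<gamma>(2) xM by (simp add: f_def)
    have f1: "f 1 = d x p + g 1 - g 0" by (simp add: f_def)
    show "d (\<delta> 0) (\<delta> 1) = f 1 - f 0" unfolding f0 f1 using far(1) \<gamma>(2) by (simp add: \<delta>_def)
    fix s t :: real assume st: "0 \<le> s" "s \<le> t" "t \<le> 1"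
    consider "t \<le> 1/2" | "s \<le> 1/2" "1/2 < t" | "1/2 < s" using st by linarith
    then show "d (\<delta> s) (\<delta> t) \<le> f t - f s"
    proof cases
      case 1
      then show ?thesis using add[of "2 * s" "2 * t"] st by (simp add: \<delta>_def f_def)
    next
      case 2
      have "d (\<gamma> (2 * s)) p \<le> d x p - d x (\<gamma> (2 * s))" using add[of "2 * s" 1] st 2 \<gamma>(3) by simp
      moreover have "d p (\<sigma> (2 * t - 1)) \<le> g (2 * t - 1) - g 0" using le[of 0 "2 * t - 1"] st 2 \<sigma>(2) by simp
      moreover have "d (\<gamma> (2 * s)) (\<sigma> (2 * t - 1)) \<le> d (\<gamma> (2 * s)) p + d p (\<sigma> (2 * t - 1))"
        using in_M(1)[of "2 * s"] in_M(1)[of 1] in_M(2)[of "2 * t - 1"] \<gamma>(3) st 2 by (intro triangle) auto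
      ultimately show ?thesis using 2 by (simp add: \<delta>_def f_def)
    next
      case 3
      then show ?thesis using le[of "2 * s - 1" "2 * t - 1"] st by (simp add: \<delta>_def f_def)
    qed
  qed
  moreover have "\<delta> 0 = x" using \<gamma>(2) by (simp add: \<delta>_def)
  moreover have "\<gamma> ` {0..1} \<subset> \<delta> ` {0..1}"
  proof
    show "\<gamma> ` {0..1} \<subseteq> \<delta> ` {0..1}"
    proof
      fix q assume "q \<in> \<gamma> ` {0..1}"
      then obtain t where "t \<in> {0..1}" "q = \<gamma> t" by blast
      then have "q = \<delta> (t / 2)" "t / 2 \<in> {0..1}" by (auto simp: \<delta>_def)
      then show "q \<in> \<delta> ` {0..1}" by blast
    qed
    have "\<sigma> 1 \<notin> \<gamma> ` {0..1}"
    proof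
      assume "\<sigma> 1 \<in> \<gamma> ` {0..1}"
      then obtain t where t: "t \<in> {0..1}" "\<sigma> 1 = \<gamma> t" by blast
      have "d x (\<gamma> t) \<le> d x p" using add[of t 1] t(1) \<gamma>(3) by simp
      then show False using far t(2) by simp
    qed
    moreover have "\<sigma> 1 = \<delta> 1" by (simp add: \<delta>_def)
    then have "\<sigma> 1 \<in> \<delta> ` {0..1}" by force
    ultimately show "\<gamma> ` {0..1} \<noteq> \<delta> ` {0..1}" by blast
  qed
  ultimately show False using \<gamma>(4) by blast
qed

section \<open>The distance from the centre\<close>

lemma norm_edge_point_flip:
  assumes "0 \<le> y" "y \<le> side"
  shows "cmod (edge_point (flip_real y)) = cmod (edge_point y)"
proof -
  have "cmod (edge_point (flip_real y)) = cmod (from_vertex (rot3 * of_real y))"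
    unfolding edge_point_flip(2)[OF assms] by (simp add: norm_mult)
  also have "from_vertex (rot3 * of_real y) = cnj (edge_point y)"
    unfolding edge_point_def from_vertex_def rot3_eq mult.assoc cnj_unit_cancel by (simp add: half_turn_def)
  finally show ?thesis by simp
qed

lemma norm_eq_if_glued:
  assumes "z \<in> polygon" "w \<in> polygon" "glue z = glue w"
  shows "cmod z = cmod w"
proof (cases "z \<in> polygon_interior \<or> w \<in> polygon_interior")
  case True
  then show ?thesis using glue_eq_interior assms by metis
next
  case False
  obtain j y where j: "j < 30" "0 \<le> y" "y < side" "z = rot30 ^ j * edge_point y"
    using boundary_edge_point[of z] assms False by blast
  obtain i v where i: "i < 30" "0 \<le> v" "v < side" "w = rot30 ^ i * edge_point v"
    using boundary_edge_point[of w] assms False by blast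
  have "y = v \<or> v = flip_real y"
    using glue_edge_eq_iff[OF j(1) i(1) j(2,3) i(2,3)] assms(3) unfolding j(4) i(4) by blast
  then have "cmod (edge_point v) = cmod (edge_point y)" using norm_edge_point_flip[of y] j(2,3) by auto
  then show ?thesis unfolding j(4) i(4) by (simp add: norm_mult)
qed

text \<open>The distance of the centre within the polygon; glued boundary points have the same distance
  (\<open>norm_eq_if_glued\<close>), so the choice of \<open>z\<close> does not matter.\<close>
definition centre_dist :: "complex \<Rightarrow> real" where
  "centre_dist p = hyp_norm (SOME z. z \<in> polygon \<and> glue z = p)"

lemma centre_dist_glue:
  assumes "z \<in> polygon"
  shows "centre_dist (glue z) = hyp_norm z"
proof -
  have "\<exists>w. w \<in> polygon \<and> glue w = glue z" using assms by blast
  then have *: "(SOME w. w \<in> polygon \<and> glue w = glue z) \<in> polygon \<and> glue (SOME w. w \<in> polygon \<and> glue w = glue z) = glue z"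
    by (rule someI_ex)
  then show ?thesis using norm_eq_if_glued[OF _ assms] unfolding centre_dist_def hyp_norm_def by metis
qed

text \<open>The centres of the three copies of the polygon that surround a vertex, in the coordinates of the
  star of the vertex.\<close>
definition star_centre :: "nat \<Rightarrow> complex" where
  "star_centre k = rot3 ^ k * (rot6 * of_real corner_radius)"

definition star_dist :: "complex \<Rightarrow> real" where
  "star_dist w = min (hyp_dist (star_centre 0) w) (min (hyp_dist (star_centre 1) w) (hyp_dist (star_centre 2) w))"

lemma star_centre_disc [simp]: "star_centre k \<in> disc"
  unfolding star_centre_def by (intro rotate_disc corner_disc) simp_all

lemma star_centre_mod: "star_centre (k mod 3) = star_centre k"
proof -
  have "rot3 ^ (k mod 3) = rot3 ^ k" using arg_cong[OF cnj_rot3_pow_mod[of k], of cnj] by simp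
  then show ?thesis by (simp add: star_centre_def)
qed

lemma star_centre_neq: "star_centre k \<noteq> star_centre (k + 2)"
proof
  assume "star_centre k = star_centre (k + 2)"
  then have "rot3 ^ 2 = 1" using corner_radius_bounds(1) by (simp add: star_centre_def power_add power2_eq_square)
  then have "rot3 = 1" using rot3_cubed by (simp add: power3_eq_cube power2_eq_square)
  then show False using Im_rot3_real(2)[of 1] by simp
qed

lemma star_dist_le: "star_dist w \<le> hyp_dist (star_centre k) w"
proof -
  have "k mod 3 < 3" by simp
  then have "k mod 3 = 0 \<or> k mod 3 = 1 \<or> k mod 3 = 2" by linarith
  then show ?thesis unfolding star_dist_def star_centre_mod[of k, symmetric] by (elim disjE) simp_all
qed

text \<open>Among points of equal modulus, the distance to \<open>w\<close> decreases with the cosine of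
  the angle.\<close>
lemma hyp_dist_antimono_Re:
  assumes "c \<in> disc" "c' \<in> disc" "w \<in> disc" "cmod c = cmod c'" "Re (cnj c' * w) \<le> Re (cnj c * w)"
  shows "hyp_dist c w \<le> hyp_dist c' w"
proof -
  have "(cmod (1 - u))\<^sup>2 = 1 - 2 * Re u + (cmod u)\<^sup>2" for u
    unfolding cmod_power2 by (simp add: power2_eq_square algebra_simps)
  from this[of "cnj _ * w"]
  have sq: "(cmod (1 - cnj a * w))\<^sup>2 = 1 - 2 * Re (cnj a * w) + (cmod a * cmod w)\<^sup>2" for a
    by (simp only: norm_mult complex_mod_cnj)
  have "(cmod (1 - cnj c * w))\<^sup>2 \<le> (cmod (1 - cnj c' * w))\<^sup>2" unfolding sq using assms(4,5) by simp
  moreover have "(cmod (1 - cnj c * w))\<^sup>2 > 0" "(cmod (1 - cnj c' * w))\<^sup>2 > 0"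
    using one_minus_cnj_mult_nonzero assms(1-3) by auto
  moreover have "0 \<le> (1 - (cmod c)\<^sup>2) * (1 - (cmod w)\<^sup>2)"
    using assms(1,3) by (intro mult_nonneg_nonneg) (simp_all add: abs_square_le_1)
  ultimately have "(1 - (cmod c)\<^sup>2) * (1 - (cmod w)\<^sup>2) / (cmod (1 - cnj c' * w))\<^sup>2 \<le>
      (1 - (cmod c)\<^sup>2) * (1 - (cmod w)\<^sup>2) / (cmod (1 - cnj c * w))\<^sup>2"
    by (intro divide_left_mono mult_pos_pos)
  then have "1 - (cmod (half_turn c' w))\<^sup>2 \<le> 1 - (cmod (half_turn c w))\<^sup>2"
    unfolding one_minus_norm_half_turn[OF assms(1,3)] one_minus_norm_half_turn[OF assms(2,3)] assms(4) .
  then have "cmod (half_turn c w) \<le> cmod (half_turn c' w)" by (auto intro: power2_le_imp_le)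
  then show ?thesis
    unfolding hyp_dist_def hyp_norm_le_iff[OF half_turn_in_disc[OF assms(1,3)] half_turn_in_disc[OF assms(2,3)]] .
qed

text \<open>The three centres form an equilateral triangle around the vertex, and each sector is
  symmetric about the ray through its centre, so the sectors are the Voronoi cells of the
  centres.\<close>
lemma star_centre_nearest:
  assumes w: "w \<in> disc" and s: "cnj rot3 ^ k * w \<in> vertex_sector"
  shows "hyp_dist (star_centre k) w \<le> hyp_dist (star_centre l) w"
proof (rule hyp_dist_antimono_Re[OF star_centre_disc star_centre_disc w])
  show "cmod (star_centre k) = cmod (star_centre l)" by (simp add: star_centre_def norm_mult)
  define a where "a = cnj rot3 ^ k * w"
  have w_eq: "w = rot3 ^ k * a" unfolding a_def rot3_pow_cancel ..
  define m where "m = (l + 2 * k) mod 3"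
  have r: "rot3 ^ k = cnj rot3 ^ (2 * k)" by (simp add: power_mult power2_eq_square rot3_eq_cnj)
  have 1: "cnj rot3 ^ l * w = cnj rot3 ^ m * a"
    unfolding w_eq r m_def cnj_rot3_pow_mod by (simp add: power_add)
  have e: "Re (cnj (star_centre i) * w) = corner_radius * Re (cnj rot6 * (cnj rot3 ^ i * w))" for i
    by (simp add: star_centre_def mult_ac) (simp add: algebra_simps)
  have a: "0 \<le> Im a" "Im (cnj rot3 * a) \<le> 0" using s unfolding a_def vertex_sector_def by blast+
  have rr: "Re rot3 = - 1/2" "Im rot3 = sqrt 3 / 2" "Re rot6 = 1/2" "Im rot6 = sqrt 3 / 2"
    by (simp_all add: rot3_def rot6_def cos_120 sin_120 cos_60 sin_60)
  have "- Im a / 2 - sqrt 3 / 2 * Re a \<le> 0" using a(2) rr by simp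
  then have "sqrt 3 * (- Im a / 2 - sqrt 3 / 2 * Re a) \<le> 0" by (simp add: mult_nonneg_nonpos)
  then have 2: "0 \<le> sqrt 3 / 2 * Im a + 3 / 2 * Re a" by (simp add: algebra_simps)
  have 3: "0 \<le> sqrt 3 * Im a" using a(1) by simp
  have "m < 3" by (simp add: m_def)
  then consider "m = 0" | "m = 1" | "m = 2" by linarith
  then have "Re (cnj rot6 * (cnj rot3 ^ m * a)) \<le> Re (cnj rot6 * a)"
  proof cases
    case 2
    have "cnj rot6 * cnj rot3 = cnj (rot6 * rot3)" by simp
    also have "\<dots> = - 1" by (simp add: rot3_def rot6_def cis_mult)
    finally have "cnj rot6 * cnj rot3 = - 1" .
    then have "cnj rot6 * (cnj rot3 ^ m * a) = - a" unfolding 2 by (simp add: mult.assoc[symmetric])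
    then show ?thesis using \<open>0 \<le> sqrt 3 / 2 * Im a + 3 / 2 * Re a\<close> by (simp add: rr)
  next
    case 3
    have "cnj rot3 ^ m = rot3" unfolding 3 by (simp add: power2_eq_square rot3_eq_cnj)
    then have "cnj rot6 * (cnj rot3 ^ m * a) = rot6 * a" by (simp only: rot3_eq mult.assoc cnj_unit_cancel)
    moreover have "Re (rot6 * a) \<le> Re (cnj rot6 * a)" using \<open>0 \<le> sqrt 3 * Im a\<close> by (simp add: rr)
    ultimately show ?thesis by (simp only:)
  qed simp
  then show "Re (cnj (star_centre l) * w) \<le> Re (cnj (star_centre k) * w)"
    unfolding e 1 a_def[symmetric] using corner_radius_bounds(1) by (simp only: mult_left_mono less_imp_le)
qed

lemma hyp_norm_from_vertex: "hyp_norm (from_vertex (cnj rot3 ^ k * w)) = hyp_dist (star_centre k) w"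
proof -
  have "hyp_norm (from_vertex (cnj rot3 ^ k * w)) = hyp_dist (of_real corner_radius) (cnj rot6 * (cnj rot3 ^ k * w))"
    by (simp add: from_vertex_def hyp_dist_def)
  also have "\<dots> = hyp_dist (rot6 * of_real corner_radius) (cnj rot3 ^ k * w)"
    using hyp_dist_rotation[of rot6 "of_real corner_radius" "cnj rot6 * (cnj rot3 ^ k * w)"] by simp
  also have "\<dots> = hyp_dist (star_centre k) w"
    using hyp_dist_rotation[of "rot3 ^ k" "rot6 * of_real corner_radius" "cnj rot3 ^ k * w"]
    by (simp add: star_centre_def rot3_pow_cancel)
  finally show ?thesis .
qed

lemma star_dist_eq:
  assumes "w \<in> disc" "cnj rot3 ^ k * w \<in> vertex_sector"
  shows "star_dist w = hyp_dist (star_centre k) w"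
  using star_centre_nearest[OF assms] star_dist_le[of w k] unfolding star_dist_def by (intro antisym) simp_all

lemma centre_dist_vertex_map:
  assumes v: "v < 10" and w: "w \<in> vertex_nbhd"
  shows "centre_dist (vertex_map v w) = star_dist w"
proof -
  obtain k where k: "k < 3" "cnj rot3 ^ k * w \<in> vertex_sector" using ex_vertex_sector by blast
  have "centre_dist (vertex_map v w) = hyp_norm (sector_map v k w)"
    unfolding vertex_map_eq[OF v w k(2)] by (rule centre_dist_glue[OF sector_map_polygon(1)[OF w k(2)]])
  also have "\<dots> = hyp_dist (star_centre k) w"
    unfolding sector_map_def hyp_norm_mult_unit[OF norm_rot30_pow(1)] by (rule hyp_norm_from_vertex)
  finally show ?thesis using star_dist_eq[OF vertex_nbhd_disc[OF w] k(2)] by simp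
qed

lemma hyp_lipschitz_star_dist: "w \<in> disc \<Longrightarrow> hyp_lipschitz_at star_dist w"
  unfolding star_dist_def[abs_def]
  by (rule hyp_lipschitz_at_min[OF _ hyp_lipschitz_at_min]; rule hyp_lipschitz_at_hyp_dist[OF star_centre_disc])

abbreviation surface_dist :: "complex \<Rightarrow> complex \<Rightarrow> real" where
  "surface_dist \<equiv> riem_dist glued.glued_surface"

text \<open>In each star the function is a minimum of three distances in the disc, and inside the
  polygon it is a single distance.\<close>
lemma glued_lipschitz_centre_dist: "glued.glued_lipschitz centre_dist"
  unfolding glued.glued_lipschitz_def
proof
  fix p
  obtain i z where i: "i \<in> chart_index" "z \<in> chart_dom i" "chart_map i z = p" using glued.obtain_chart .
  have zd: "z \<in> disc" using glued.N_subset_disc[OF i(1)] i(2) by blast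
  have near: "\<forall>\<^sub>F w in nhds z. w \<in> chart_dom i" using glued.open_N[OF i(1)] i(2) by (rule eventually_nhds_in_open)
  have "hyp_lipschitz_at (\<lambda>w. centre_dist (chart_map i w)) z"
  proof (cases i)
    case None
    have "\<forall>\<^sub>F w in nhds z. hyp_norm w = centre_dist (chart_map i w)"
      using near by eventually_elim
        (use None centre_dist_glue polygon_interior_subset in \<open>auto simp: chart_dom_def chart_map_def\<close>)
    then show ?thesis by (rule hyp_lipschitz_at_cong) (rule hyp_lipschitz_at_hyp_norm[OF zd])
  next
    case (Some v)
    then have v: "v < 10" using i(1) by (auto simp: chart_index_def)
    have "\<forall>\<^sub>F w in nhds z. star_dist w = centre_dist (chart_map i w)"
      using near by eventually_elim
        (use Some centre_dist_vertex_map[OF v] in \<open>simp add: chart_dom_def chart_map_def\<close>)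
    then show ?thesis by (rule hyp_lipschitz_at_cong) (rule hyp_lipschitz_star_dist[OF zd])
  qed
  then show "\<exists>i\<in>chart_index. \<exists>z\<in>chart_dom i. chart_map i z = p \<and> hyp_lipschitz_at (\<lambda>w. centre_dist (chart_map i w)) z"
    using i by blast
qed

lemma centre_dist_0: "centre_dist (glue 0) = 0"
  using centre_dist_glue[of 0] zero_in_polygon_interior polygon_interior_subset by auto

lemma centre_dist_nonneg: "0 \<le> centre_dist p"
proof -
  obtain z where "z \<in> polygon" "glue z = p" using glue_surj by (metis UNIV_I imageE)
  then show ?thesis using centre_dist_glue hyp_norm_nonneg polygon_disc(1) by metis
qed

lemma centre_dist_le: "centre_dist p / side_length \<le> surface_dist (glue 0) p"
  using glued.lipschitz_le_riem_dist[OF glued_lipschitz_centre_dist, of p "glue 0"] centre_dist_nonneg[of p]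
  by (simp add: centre_dist_0)

lemma radial_derivative:
  assumes z: "z \<in> disc" and s: "0 \<le> s" "s \<le> t" "t \<le> 1"
  shows "((\<lambda>\<tau>. conformal_factor (of_real (s + \<tau> * (t - s)) * z) * cmod (of_real (t - s) * z)) has_integral
      hyp_norm (of_real t * z) - hyp_norm (of_real s * z)) {0..1}"
proof -
  let ?r = "cmod z"
  have r: "?r < 1" using z by simp
  have "((\<lambda>\<tau>. 2 * ((t - s) * ?r) / (1 - ((s + \<tau> * (t - s)) * ?r)\<^sup>2)) has_integral
      (2 * artanh ((s + 1 * (t - s)) * ?r) - 2 * artanh ((s + 0 * (t - s)) * ?r))) {0..1}"
  proof (rule fundamental_theorem_of_calculus)
    fix \<tau> :: real assume \<tau>: "\<tau> \<in> {0..1}"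
    have c: "0 \<le> s + \<tau> * (t - s)" "s + \<tau> * (t - s) \<le> 1"
      using s \<tau> mult_left_le_one_le[of "t - s" \<tau>] by auto
    have "\<bar>(s + \<tau> * (t - s)) * ?r\<bar> < 1"
      using mult_left_le_one_le[of ?r "s + \<tau> * (t - s)"] c r by (simp add: abs_mult)
    then show "((\<lambda>\<tau>. 2 * artanh ((s + \<tau> * (t - s)) * ?r)) has_vector_derivative
        2 * ((t - s) * ?r) / (1 - ((s + \<tau> * (t - s)) * ?r)\<^sup>2)) (at \<tau> within {0..1})"
      unfolding has_real_derivative_iff_has_vector_derivative[symmetric]
      by (auto intro!: derivative_eq_intros DERIV_chain2[where f = artanh])
  qed simp
  then have "((\<lambda>\<tau>. 2 * ((t - s) * ?r) / (1 - ((s + \<tau> * (t - s)) * ?r)\<^sup>2)) has_integral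
      hyp_norm (of_real t * z) - hyp_norm (of_real s * z)) {0..1}"
    using s by (simp add: hyp_norm_def norm_mult)
  moreover have "2 * ((t - s) * ?r) / (1 - ((s + \<tau> * (t - s)) * ?r)\<^sup>2) =
     conformal_factor (of_real (s + \<tau> * (t - s)) * z) * cmod (of_real (t - s) * z)" for \<tau>
    unfolding conformal_factor_def norm_mult norm_of_real using s by (simp add: power_mult_distrib)
  ultimately show ?thesis by simp
qed

lemma radial_dist_interior:
  assumes z: "z \<in> polygon" and s: "0 \<le> s" "s \<le> t" "t < 1"
  shows "surface_dist (glue (of_real s * z)) (glue (of_real t * z)) \<le> (hyp_norm (of_real t * z) - hyp_norm (of_real s * z)) / side_length"
proof -
  let ?\<zeta> = "\<lambda>\<tau>. of_real (s + \<tau> * (t - s)) * z"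
  have N: "None \<in> chart_index" by (simp add: chart_index_def)
  have "glued.joined (chart_map None (?\<zeta> 0)) (chart_map None (?\<zeta> 1))
      (1 / side_length * (hyp_norm (of_real t * z) - hyp_norm (of_real s * z)))"
  proof (rule glued.chart_curve_joined[OF N, where \<zeta>' = "\<lambda>_. of_real (t - s) * z"])
    show "?\<zeta> \<tau> \<in> chart_dom None" if "\<tau> \<in> {0..1}" for \<tau>
    proof -
      have "0 \<le> s + \<tau> * (t - s)" "s + \<tau> * (t - s) < 1"
        using s that mult_left_le_one_le[of "t - s" \<tau>] by auto
      then show ?thesis using polygon_scale[OF z] by (simp only: chart_dom_def option.case)
    qed
    show "(?\<zeta> has_vector_derivative of_real (t - s) * z) (at \<tau> within {0..1})" for \<tau>
      by (auto intro!: derivative_eq_intros)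
    show "((\<lambda>\<tau>. conformal_factor (?\<zeta> \<tau>) * cmod (of_real (t - s) * z)) has_integral
      hyp_norm (of_real t * z) - hyp_norm (of_real s * z)) {0..1}"
      using radial_derivative[OF polygon_disc(1)[OF z] s(1,2)] s(3) by simp
  qed simp
  then show ?thesis using glued.riem_dist_le by (fastforce simp: chart_map_def)
qed

lemma hyp_dist_to_vertex:
  assumes "z \<in> disc" "w \<in> disc"
  shows "hyp_dist (sector_inverse v k z) (sector_inverse v k w) = hyp_dist z w"
proof -
  have "cnj rot30 ^ i * z \<in> disc" "cnj rot30 ^ i * w \<in> disc" for i using assms rotate_disc[OF norm_rot30_pow(2)] by blast+
  then show ?thesis
    unfolding sector_inverse_def to_vertex_def
    by (simp only: hyp_dist_rotation norm_rot3_pow norm_rots norm_rot30_pow hyp_dist_half_turn[OF corner_disc])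
qed

lemma eventually_hyp_dist_less:
  assumes z: "z \<in> disc" and e: "e > 0"
  shows "\<forall>\<^sub>F w in nhds z. w \<in> disc \<and> hyp_dist z w < e"
proof -
  define K where "K = conformal_factor z + 1"
  have K: "K > 0" using conformal_factor_pos[OF z] by (simp add: K_def)
  have "\<forall>\<^sub>F w in nhds z. \<bar>hyp_dist z w - hyp_dist z z\<bar> \<le> K * cmod (w - z)"
    using hyp_lipschitz_at_hyp_dist[OF z z] unfolding hyp_lipschitz_at_def K_def by (elim allE[of _ 1] mp) simp
  moreover have "\<forall>\<^sub>F w in nhds z. cmod (w - z) < e / K"
    using e K unfolding eventually_nhds_metric dist_norm by (intro exI[of _ "e / K"]) auto
  moreover have "\<forall>\<^sub>F w in nhds z. w \<in> disc" using z by (intro eventually_nhds_in_open) auto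
  ultimately show ?thesis
  proof eventually_elim
    case (elim w)
    have "hyp_dist z w \<le> K * cmod (w - z)" using elim(1) by simp
    also have "\<dots> < e" using elim(2) K by (simp add: field_simps)
    finally show ?case using elim(3) by simp
  qed
qed

text \<open>Every boundary point of the polygon is the centre of a small disc in the star of a vertex.\<close>
lemma boundary_chart:
  assumes z: "z \<in> polygon - polygon_interior"
  obtains j y \<epsilon> where "j < 30" "0 \<le> y" "y < side" "z = rot30 ^ j * edge_point y" "\<epsilon> > 0"
    "glue z = vertex_map (corner_vertex j) (rot3 ^ corner_slot j * of_real y)"
    "\<And>w. w \<in> disc \<Longrightarrow> hyp_dist (rot3 ^ corner_slot j * of_real y) w < \<epsilon> \<Longrightarrow> w \<in> vertex_nbhd \<and>
       surface_dist (glue z) (vertex_map (corner_vertex j) w) = hyp_dist (rot3 ^ corner_slot j * of_real y) w / side_length"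
    "\<And>q. surface_dist (glue z) q < \<epsilon> / side_length \<Longrightarrow>
       \<exists>w\<in>disc. hyp_dist (rot3 ^ corner_slot j * of_real y) w < \<epsilon> \<and> q = vertex_map (corner_vertex j) w"
proof -
  obtain j y where jy: "j < 30" "0 \<le> y" "y < side" "z = rot30 ^ j * edge_point y"
    using boundary_edge_point[OF z] .
  let ?v = "corner_vertex j" and ?w = "rot3 ^ corner_slot j * complex_of_real y"
  have i: "Some ?v \<in> chart_index" using corner_range jy(1) by (simp add: chart_index_def)
  have w: "?w \<in> chart_dom (Some ?v)" using ray_in_vertex_nbhd[OF jy(2,3)] by (simp add: chart_dom_def)
  have g: "glue z = vertex_map ?v ?w" using glue_boundary_vertex_map[OF jy(1-3)] jy(4) by simp
  obtain \<epsilon> where \<epsilon>: "\<epsilon> > 0"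
    "\<And>x. x \<in> disc \<Longrightarrow> hyp_dist ?w x < \<epsilon> \<Longrightarrow> x \<in> chart_dom (Some ?v) \<and>
       surface_dist (chart_map (Some ?v) ?w) (chart_map (Some ?v) x) = 1 / side_length * hyp_dist ?w x"
    "\<And>q. surface_dist (chart_map (Some ?v) ?w) q < 1 / side_length * \<epsilon> \<Longrightarrow> \<exists>x\<in>disc. hyp_dist ?w x < \<epsilon> \<and> q = chart_map (Some ?v) x"
    using glued.chart_locally_isometric[OF i w] by blast
  show ?thesis
    by (rule that[OF jy \<epsilon>(1) g]) (use \<epsilon>(2,3) g in \<open>simp_all add: chart_dom_def chart_map_def\<close>)
qed

text \<open>Inside the polygon the radius is a curve in the chart around the centre. This chart does not
  reach the boundary, so an end point on the boundary is approached by inner points, and the distance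
  that remains is small in the star of a vertex.\<close>
lemma radial_dist_le:
  assumes z: "z \<in> polygon" and s: "0 \<le> s" "s \<le> t" "t \<le> 1"
  shows "surface_dist (glue (of_real s * z)) (glue (of_real t * z)) \<le> (hyp_norm (of_real t * z) - hyp_norm (of_real s * z)) / side_length"
proof -
  have zd: "z \<in> disc" using polygon_disc(1)[OF z] .
  have self: "surface_dist p p = 0" for p
    using Metric_space.zero[OF glued.Metric_space_riem_dist] by simp
  consider "t < 1" | "s = 1" "t = 1" | "s < 1" "t = 1" using s by linarith
  then show ?thesis
  proof cases
    case 1
    then show ?thesis using radial_dist_interior[OF z s(1,2)] by simp
  next
    case 2
    then show ?thesis using self by simp
  next
    case 3
    show ?thesis
    proof (rule field_le_epsilon)
      fix e :: real assume e: "e > 0"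
      have lim: "filterlim (\<lambda>\<tau>. of_real \<tau> * z) (nhds z) (at_left (1::real))"
      proof -
        have "((\<lambda>\<tau>. of_real \<tau> * z) \<longlongrightarrow> of_real 1 * z) (at_left (1::real))" by (intro tendsto_intros)
        then show ?thesis by simp
      qed
      have "\<forall>\<^sub>F w in nhds z. w \<in> polygon_interior \<longrightarrow> surface_dist (glue w) (glue z) < e"
      proof (cases "z \<in> polygon_interior")
        case True
        have N: "None \<in> chart_index" by (simp add: chart_index_def)
        have zN: "z \<in> chart_dom None" using True by (simp add: chart_dom_def)
        obtain \<epsilon> where \<epsilon>: "\<epsilon> > 0"
          "\<And>x. x \<in> disc \<Longrightarrow> hyp_dist z x < \<epsilon> \<Longrightarrow> x \<in> chart_dom None \<and>
             surface_dist (chart_map None z) (chart_map None x) = 1 / side_length * hyp_dist z x"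
          by (rule glued.chart_locally_isometric[OF N zN]) (rule that)
        have "\<forall>\<^sub>F w in nhds z. w \<in> disc \<and> hyp_dist z w < min \<epsilon> (e * side_length)"
          using \<epsilon>(1) e side_length_pos by (intro eventually_hyp_dist_less[OF zd]) simp
        then show ?thesis
        proof eventually_elim
          case (elim w)
          then have "surface_dist (glue z) (glue w) = hyp_dist z w / side_length" using \<epsilon>(2)[of w] by (simp add: chart_map_def)
          also have "\<dots> < e" using elim side_length_pos by (simp add: pos_divide_less_eq)
          finally show ?case by (simp add: glued.riem_dist_commute)
        qed
      next
        case False
        have zb: "z \<in> polygon - polygon_interior" using z False by simp
        obtain j y \<epsilon> where b: "j < 30" "0 \<le> y" "y < side" "z = rot30 ^ j * edge_point y" "\<epsilon> > 0"
          "glue z = vertex_map (corner_vertex j) (rot3 ^ corner_slot j * of_real y)"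
          "\<And>w. w \<in> disc \<Longrightarrow> hyp_dist (rot3 ^ corner_slot j * of_real y) w < \<epsilon> \<Longrightarrow> w \<in> vertex_nbhd \<and>
           surface_dist (glue z) (vertex_map (corner_vertex j) w) = hyp_dist (rot3 ^ corner_slot j * of_real y) w / side_length"
          by (rule boundary_chart[OF zb]) (rule that)
        let ?v = "corner_vertex j" and ?k = "corner_slot j"
        have r: "?v < 10" "?k < 3" "corner_at ?v ?k = j" using corner_range corner_at_inverse b(1) by blast+
        have si: "sector_inverse ?v ?k z = rot3 ^ ?k * of_real y"
          unfolding sector_inverse_def b(4) using r to_from_vertex[OF real_disc[of y]] b(2,3)
          by (simp add: rot30_pow_cancel edge_point_def)
        have "open ((\<lambda>w. cnj rot30 ^ j * w) -` corner_wedge)" by (intro open_vimage open_corner_wedge continuous_intros)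
        moreover have "cnj rot30 ^ j * z \<in> corner_wedge"
          using edge_point_in_wedge(1)[OF b(2,3)] unfolding b(4) rot30_pow_cancel .
        ultimately have "\<forall>\<^sub>F w in nhds z. w \<in> (\<lambda>w. cnj rot30 ^ j * w) -` corner_wedge"
          by (intro eventually_nhds_in_open) simp_all
        moreover have "\<forall>\<^sub>F w in nhds z. w \<in> disc \<and> hyp_dist z w < min \<epsilon> (e * side_length)"
          using b(5) e side_length_pos by (intro eventually_hyp_dist_less[OF zd]) simp
        ultimately show ?thesis
        proof eventually_elim
          case (elim w)
          show ?case
          proof
            assume wi: "w \<in> polygon_interior"
            let ?x = "sector_inverse ?v ?k w"
            have wd: "w \<in> disc" using elim by simp
            have xd: "?x \<in> disc" using hyp_isometry_in_disc[OF hyp_isometry_sector_inverse wd] .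
            have hd: "hyp_dist (rot3 ^ ?k * of_real y) ?x = hyp_dist z w"
              using hyp_dist_to_vertex[OF zd wd, of ?v ?k] unfolding si .
            have x: "?x \<in> vertex_nbhd" "surface_dist (glue z) (vertex_map ?v ?x) = hyp_dist z w / side_length"
              using b(7)[OF xd] elim(2) unfolding hd by simp_all
            have "glue w = vertex_map ?v ?x"
              using glue_near_boundary[OF b(1) _ _ x(1)] elim(1) wi polygon_interior_subset by auto
            then have "surface_dist (glue z) (glue w) = hyp_dist z w / side_length" using x(2) by simp
            also have "\<dots> < e" using elim(2) side_length_pos by (simp add: pos_divide_less_eq)
            finally show "surface_dist (glue w) (glue z) < e" by (simp add: glued.riem_dist_commute)
          qed
        qed
      qed
      then have "\<forall>\<^sub>F \<tau> in at_left 1. of_real \<tau> * z \<in> polygon_interior \<longrightarrow> surface_dist (glue (of_real \<tau> * z)) (glue z) < e"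
        using lim by (rule eventually_compose_filterlim)
      moreover have "\<forall>\<^sub>F \<tau> in at_left (1::real). \<tau> \<in> {s<..<1}" using 3 by (intro eventually_at_left_real)
      ultimately have "\<forall>\<^sub>F \<tau> in at_left (1::real). \<tau> \<in> {s<..<1} \<and> surface_dist (glue (of_real \<tau> * z)) (glue z) < e"
        by eventually_elim (use polygon_scale[OF z] s in auto)
      then obtain \<tau> where \<tau>: "s < \<tau>" "\<tau> < 1" "surface_dist (glue (of_real \<tau> * z)) (glue z) < e"
        using eventually_happens trivial_limit_at_left_real by (metis (no_types, lifting) greaterThanLessThan_iff)
      have "surface_dist (glue (of_real s * z)) (glue z) \<le>
          surface_dist (glue (of_real s * z)) (glue (of_real \<tau> * z)) + surface_dist (glue (of_real \<tau> * z)) (glue z)"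
        by (rule glued.riem_dist_triangle)
      also have "\<dots> \<le> (hyp_norm (of_real \<tau> * z) - hyp_norm (of_real s * z)) / side_length + e"
        using radial_dist_interior[OF z s(1), of \<tau>] \<tau> by simp
      also have "hyp_norm (of_real \<tau> * z) \<le> hyp_norm z"
      proof (subst hyp_norm_le_iff)
        show "of_real \<tau> * z \<in> disc" using scaled_in_disc[OF zd] \<tau> s by simp
        show "cmod (of_real \<tau> * z) \<le> cmod z" using \<tau> s mult_left_le_one_le[of "cmod z" \<tau>] by (simp add: norm_mult)
      qed (rule zd)
      finally show "surface_dist (glue (of_real s * z)) (glue (of_real t * z)) \<le>
          (hyp_norm (of_real t * z) - hyp_norm (of_real s * z)) / side_length + e"
        using 3 side_length_pos by (simp add: divide_right_mono)
    qed
  qed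
qed

lemma dist_from_centre:
  assumes "z \<in> polygon"
  shows "surface_dist (glue 0) (glue z) = hyp_norm z / side_length"
  using radial_dist_le[OF assms, of 0 1] centre_dist_le[of "glue z"] centre_dist_glue[OF assms] by simp

section \<open>The cut locus of the centre\<close>

lemma continuous_on_hyp_norm_ray:
  assumes "z \<in> disc"
  shows "continuous_on {0..1} (\<lambda>t. hyp_norm (of_real t * z))"
proof -
  have "- 1 < t * cmod z \<and> t * cmod z < 1" if "t \<in> {0..1}" for t
    using scaled_in_disc[OF assms, of t] that order_less_le_trans[of "-1" 0 "t * cmod z"] by (simp add: norm_mult)
  then have "continuous_on {0..1} (\<lambda>t. 2 * artanh (t * cmod z))"
    by (intro continuous_intros) auto
  then show ?thesis
    by (rule continuous_on_eq) (auto simp: hyp_norm_def norm_mult)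
qed

lemma hyp_norm_ray_strict_mono:
  assumes "z \<in> disc" "z \<noteq> 0" "0 \<le> s" "s < t" "t \<le> 1"
  shows "hyp_norm (of_real s * z) < hyp_norm (of_real t * z)"
  using assms scaled_in_disc[OF assms(1), of s] scaled_in_disc[OF assms(1), of t]
  by (subst hyp_norm_less_iff) (auto simp: norm_mult)

theorem cut_locus_of_centre:
  "cut_locus UNIV surface_dist (glue 0) = glue ` (polygon - polygon_interior)"
proof (intro equalityI subsetI)
  fix p assume "p \<in> glue ` (polygon - polygon_interior)"
  then obtain z where z: "z \<in> polygon - polygon_interior" "p = glue z" by blast
  then have zp: "z \<in> polygon" and zd: "z \<in> disc" using polygon_disc(1) by auto
  let ?\<gamma> = "\<lambda>t. glue (of_real t * z)"
  have sp: "shortest_path UNIV surface_dist ?\<gamma>"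
  proof (rule shortest_pathI[OF glued.Metric_space_riem_dist, of _ "\<lambda>t. hyp_norm (of_real t * z) / side_length"])
    show "continuous_on {0..1} (\<lambda>t. hyp_norm (of_real t * z) / side_length)"
      using continuous_on_hyp_norm_ray[OF zd] side_length_pos by (intro continuous_intros) auto
    show "surface_dist (?\<gamma> s) (?\<gamma> t) \<le> hyp_norm (of_real t * z) / side_length - hyp_norm (of_real s * z) / side_length"
      if "0 \<le> s" "s \<le> t" "t \<le> 1" for s t
      using radial_dist_le[OF zp that] by (simp add: diff_divide_distrib)
  qed (use dist_from_centre[OF zp] in simp_all)
  obtain j y \<epsilon> where b: "j < 30" "0 \<le> y" "y < side" "z = rot30 ^ j * edge_point y" "\<epsilon> > 0"
    "glue z = vertex_map (corner_vertex j) (rot3 ^ corner_slot j * of_real y)"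
    "\<And>w. w \<in> disc \<Longrightarrow> hyp_dist (rot3 ^ corner_slot j * of_real y) w < \<epsilon> \<Longrightarrow> w \<in> vertex_nbhd \<and>
       surface_dist (glue z) (vertex_map (corner_vertex j) w) = hyp_dist (rot3 ^ corner_slot j * of_real y) w / side_length"
    "\<And>q. surface_dist (glue z) q < \<epsilon> / side_length \<Longrightarrow>
       \<exists>w\<in>disc. hyp_dist (rot3 ^ corner_slot j * of_real y) w < \<epsilon> \<and> q = vertex_map (corner_vertex j) w"
    by (rule boundary_chart[OF z(1)]) (rule that)
  let ?v = "corner_vertex j" and ?k = "corner_slot j"
  let ?w = "rot3 ^ ?k * complex_of_real y"
  have v: "?v < 10" using corner_range b(1) by blast
  have wn: "?w \<in> vertex_nbhd" using ray_in_vertex_nbhd b by blast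
  have wd: "?w \<in> disc" using vertex_nbhd_disc[OF wn] .
  \<comment> \<open>The point lies between two of the three polygons around the vertex and has the same distance from
    their centres.\<close>
  have s1: "cnj rot3 ^ ?k * ?w \<in> vertex_sector" unfolding rot3_pow_cancel by (rule real_in_vertex_sector[OF b(2)])
  have s2: "cnj rot3 ^ (?k + 2) * ?w \<in> vertex_sector"
  proof -
    have e: "cnj rot3 ^ (?k + 2) * ?w = rot3 * of_real y"
      unfolding add.commute[of _ 2] power_add mult.assoc rot3_pow_cancel by (simp add: power2_eq_square rot3_eq_cnj)
    show ?thesis unfolding e vertex_sector_def mem_Collect_eq cnj_unit_cancel Im_rot3_real using b(2) by simp
  qed
  have c: "hyp_dist (star_centre ?k) ?w = star_dist ?w" "hyp_dist (star_centre (?k + 2)) ?w = star_dist ?w"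
    using star_dist_eq[OF wd s1] star_dist_eq[OF wd s2] by simp_all
  have dist_centre: "surface_dist (glue 0) (vertex_map ?v x) = star_dist x / side_length" if "x \<in> vertex_nbhd" for x
  proof -
    obtain u where "u \<in> polygon" "glue u = vertex_map ?v x" using glue_surj by (metis UNIV_I imageE)
    then show ?thesis using dist_from_centre centre_dist_glue centre_dist_vertex_map[OF v that] by metis
  qed
  show "p \<in> cut_locus UNIV surface_dist (glue 0)"
  proof (rule cut_locus_if_not_extendable[OF glued.Metric_space_riem_dist sp])
    show "p \<noteq> glue 0"
      using glue_eq_interior[OF zero_in_polygon_interior zp] z zero_in_polygon_interior by auto
    show "\<epsilon> / side_length > 0" using b(5) side_length_pos by simp
    fix q assume q: "0 < surface_dist p q" "surface_dist p q < \<epsilon> / side_length"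
    obtain x where x: "x \<in> disc" "hyp_dist ?w x < \<epsilon>" "q = vertex_map ?v x" using b(8) q(2) z(2) by blast
    have xn: "x \<in> vertex_nbhd" "surface_dist p q = hyp_dist ?w x / side_length" using b(7)[OF x(1,2)] z(2) x(3) by simp_all
    have xw: "x \<noteq> ?w" using q(1) xn(2) by auto
    have "star_dist x < star_dist ?w + hyp_dist ?w x"
    proof (rule ccontr)
      assume "\<not> star_dist x < star_dist ?w + hyp_dist ?w x"
      then have le: "star_dist ?w + hyp_dist ?w x \<le> hyp_dist (star_centre i) x" for i
        using star_dist_le[of x i] by linarith
      have "hyp_dist (star_centre ?k) x = hyp_dist (star_centre ?k) ?w + hyp_dist ?w x"
        using le[of ?k] hyp_dist_triangle[OF star_centre_disc[of ?k] wd x(1)] c(1) by linarith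
      moreover have "hyp_dist (star_centre (?k + 2)) x = hyp_dist (star_centre (?k + 2)) ?w + hyp_dist ?w x"
        using le[of "?k + 2"] hyp_dist_triangle[OF star_centre_disc[of "?k + 2"] wd x(1)] c(2) by linarith
      ultimately have "star_centre ?k = star_centre (?k + 2)"
        using hyp_dist_no_branching[OF wd x(1) star_centre_disc star_centre_disc xw] c by simp
      then show False using star_centre_neq by blast
    qed
    then show "surface_dist (glue 0) q < surface_dist (glue 0) p + surface_dist p q"
      unfolding xn(2) unfolding z(2) b(6) x(3) dist_centre[OF wn] dist_centre[OF xn(1)] add_divide_distrib[symmetric]
      using side_length_pos by (simp add: divide_strict_right_mono)
  qed (use z(2) in simp_all)
next
  fix p assume p: "p \<in> cut_locus UNIV surface_dist (glue 0)"
  obtain z where z: "z \<in> polygon" "glue z = p" using glue_surj by (metis UNIV_I imageE)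
  have "z \<notin> polygon_interior"
  proof
    assume zi: "z \<in> polygon_interior"
    have z0: "z \<noteq> 0" using p z(2) by (auto simp: cut_locus_def)
    obtain e where e: "e > 0" "ball z e \<subseteq> polygon_interior"
      using open_polygon_interior zi open_contains_ball by blast
    define c where "c = 1 + e / (2 * cmod z)"
    have c1: "c > 1" using e(1) z0 by (simp add: c_def)
    define w where "w = of_real c * z"
    have "cmod (w - z) = e / 2"
    proof -
      have "w - z = of_real (c - 1) * z" by (simp add: w_def algebra_simps)
      then have "cmod (w - z) = (c - 1) * cmod z" using c1 by (simp only: norm_mult norm_of_real)
      then show ?thesis using z0 by (simp add: c_def)
    qed
    then have "w \<in> ball z e" using e(1) by (simp add: dist_norm norm_minus_commute)
    then have w: "w \<in> polygon" using e(2) polygon_interior_subset by blast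
    have wd: "w \<in> disc" using polygon_disc(1)[OF w] .
    have w0: "w \<noteq> 0" using c1 z0 by (simp add: w_def)
    have zw: "z = of_real (1 / c) * w" using c1 by (simp add: w_def)
    let ?\<tau> = "\<lambda>t. 1 / c + t * (1 - 1 / c)"
    have \<tau>: "0 \<le> ?\<tau> t" "?\<tau> t \<le> 1" if "0 \<le> t" "t \<le> 1" for t
    proof -
      have "0 \<le> 1 - 1 / c" using c1 by simp
      then have "0 \<le> t * (1 - 1 / c)" "t * (1 - 1 / c) \<le> 1 - 1 / c"
        using that mult_left_le_one_le by (blast intro: mult_nonneg_nonneg)+
      moreover have "0 \<le> 1 / c" using c1 by simp
      ultimately show "0 \<le> ?\<tau> t" "?\<tau> t \<le> 1" by linarith+
    qed
    let ?\<sigma> = "\<lambda>t. glue (of_real (?\<tau> t) * w)"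
    let ?g = "\<lambda>t. hyp_norm (of_real (?\<tau> t) * w) / side_length"
    have "p \<notin> cut_locus UNIV surface_dist (glue 0)"
    proof (rule not_in_cut_locus_if_extendable[OF glued.Metric_space_riem_dist, of ?\<sigma> _ ?g])
      show "?\<sigma> 0 = p" using z(2) zw by simp
      have "continuous_on {0..1} (\<lambda>t. hyp_norm (of_real (?\<tau> t) * w))"
        by (rule continuous_on_compose2[OF continuous_on_hyp_norm_ray[OF wd]]) (use \<tau> in \<open>auto intro!: continuous_intros\<close>)
      then show "continuous_on {0..1} ?g" using side_length_pos by (intro continuous_intros) auto
      show "surface_dist (?\<sigma> s) (?\<sigma> t) \<le> ?g t - ?g s" if st: "0 \<le> s" "s \<le> t" "t \<le> 1" for s t
      proof -
        have "?\<tau> s \<le> ?\<tau> t" using st c1 by (intro add_left_mono mult_right_mono) auto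
        then show ?thesis using radial_dist_le[OF w, of "?\<tau> s" "?\<tau> t"] \<tau>[of s] \<tau>[of t] st by (simp add: diff_divide_distrib)
      qed
      have 1: "?\<sigma> 1 = glue w" "?g 1 = hyp_norm w / side_length" "?g 0 = hyp_norm z / side_length" using zw by simp_all
      show "surface_dist (glue 0) (?\<sigma> 1) = surface_dist (glue 0) p + (?g 1 - ?g 0)"
        unfolding 1 using dist_from_centre[OF w] dist_from_centre[OF z(1)] z(2) by simp
      have "hyp_norm (of_real (1 / c) * w) < hyp_norm (of_real 1 * w)"
        using c1 by (intro hyp_norm_ray_strict_mono[OF wd w0]) auto
      then show "?g 0 < ?g 1" unfolding 1 using zw side_length_pos by (simp add: divide_strict_right_mono)
    qed simp
    then show False using p by blast
  qed
  then show "p \<in> glue ` (polygon - polygon_interior)" using z by blast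
qed

section \<open>Spaces glued from unit intervals\<close>

text \<open>The map \<open>E\<close> parametrizes a space by \<open>n\<close> half-open unit intervals;
  gluing their ends is expressed by coincidences of values. Each point is at distance \<open>\<bar>t -
  s\<bar>\<close> from points of the same interval that are close enough, and all close points are of
  this kind, possibly after the interval has been replaced by another one through the same
  point.\<close>
definition unit_sides :: "nat \<Rightarrow> ('a \<Rightarrow> 'a \<Rightarrow> real) \<Rightarrow> (nat \<Rightarrow> real \<Rightarrow> 'a) \<Rightarrow> bool" where
  "unit_sides n d E \<longleftrightarrow>
     (\<forall>j<n. \<forall>t\<in>{0..<1}. \<exists>\<epsilon>>0.
        (\<forall>s\<in>{0..<1}. \<bar>t - s\<bar> < \<epsilon> \<longrightarrow> d (E j t) (E j s) = \<bar>t - s\<bar>) \<and>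
        (\<forall>i<n. \<forall>s\<in>{0..<1}. d (E j t) (E i s) < \<epsilon> \<longrightarrow>
           (\<exists>l<n. \<exists>r\<in>{0..<1}. E l t = E j t \<and> E l r = E i s \<and> d (E j t) (E i s) = \<bar>t - r\<bar>)))"

text \<open>Finitely many intervals pass through a point, so a common bound of closeness exists for all
  of them.\<close>
lemma unit_sides_transfer:
  fixes dA :: "'a \<Rightarrow> 'a \<Rightarrow> real" and dB :: "'b \<Rightarrow> 'b \<Rightarrow> real"
  assumes E: "unit_sides n dA E" and F: "unit_sides n dB F"
    and same: "\<And>j i t s. j < n \<Longrightarrow> i < n \<Longrightarrow> t \<in> {0..<1} \<Longrightarrow> s \<in> {0..<1} \<Longrightarrow> E j t = E i s \<Longrightarrow> F j t = F i s"
    and j: "j < n" and t: "t \<in> {0..<1}"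
  obtains \<epsilon> where "\<epsilon> > 0"
    "\<And>i s. i < n \<Longrightarrow> s \<in> {0..<1} \<Longrightarrow> dA (E j t) (E i s) < \<epsilon> \<Longrightarrow> dB (F j t) (F i s) = dA (E j t) (E i s)"
proof -
  from E j t have "\<exists>\<epsilon>>0. \<forall>i<n. \<forall>s\<in>{0..<1}. dA (E j t) (E i s) < \<epsilon> \<longrightarrow>
      (\<exists>l<n. \<exists>r\<in>{0..<1}. E l t = E j t \<and> E l r = E i s \<and> dA (E j t) (E i s) = \<bar>t - r\<bar>)"
    unfolding unit_sides_def by blast
  then obtain \<epsilon> where \<epsilon>: "\<epsilon> > 0"
    "\<And>i s. i < n \<Longrightarrow> s \<in> {0..<1} \<Longrightarrow> dA (E j t) (E i s) < \<epsilon> \<Longrightarrow>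
      \<exists>l<n. \<exists>r\<in>{0..<1}. E l t = E j t \<and> E l r = E i s \<and> dA (E j t) (E i s) = \<bar>t - r\<bar>"
    by (elim exE conjE) (rule that, assumption, blast)
  have "\<exists>\<delta>>0. \<forall>s\<in>{0..<1}. \<bar>t - s\<bar> < \<delta> \<longrightarrow> dB (F l t) (F l s) = \<bar>t - s\<bar>" if "l < n" for l
    using F t that unfolding unit_sides_def by blast
  then have "\<exists>\<delta>. l < n \<longrightarrow> 0 < \<delta> \<and> (\<forall>s\<in>{0..<1}. \<bar>t - s\<bar> < \<delta> \<longrightarrow> dB (F l t) (F l s) = \<bar>t - s\<bar>)" for l
    by (cases "l < n") blast+
  then obtain \<delta> where \<delta>': "\<And>l. l < n \<longrightarrow> 0 < \<delta> l \<and> (\<forall>s\<in>{0..<1}. \<bar>t - s\<bar> < \<delta> l \<longrightarrow> dB (F l t) (F l s) = \<bar>t - s\<bar>)"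
    using choice[of "\<lambda>l \<delta>. l < n \<longrightarrow> 0 < \<delta> \<and> (\<forall>s\<in>{0..<1}. \<bar>t - s\<bar> < \<delta> \<longrightarrow> dB (F l t) (F l s) = \<bar>t - s\<bar>)"] by blast
  then have \<delta>: "\<And>l. l < n \<Longrightarrow> \<delta> l > (0::real)"
    "\<And>l s. l < n \<Longrightarrow> s \<in> {0..<1} \<Longrightarrow> \<bar>t - s\<bar> < \<delta> l \<Longrightarrow> dB (F l t) (F l s) = \<bar>t - s\<bar>"
    by blast+
  have ne: "\<delta> ` {..<n} \<noteq> {}" using j by auto
  let ?e = "min \<epsilon> (Min (\<delta> ` {..<n}))"
  show ?thesis
  proof (rule that)
    show "?e > 0" using \<epsilon>(1) \<delta>(1) ne by (simp add: Min_gr_iff)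
    fix i s assume i: "i < n" and s: "s \<in> {0..<1}" and lt: "dA (E j t) (E i s) < ?e"
    then obtain l r where l: "l < n" "r \<in> {0..<1}" "E l t = E j t" "E l r = E i s" "dA (E j t) (E i s) = \<bar>t - r\<bar>"
      using \<epsilon>(2) by force
    have "Min (\<delta> ` {..<n}) \<le> \<delta> l" using l(1) by simp
    then have "dB (F l t) (F l r) = \<bar>t - r\<bar>" using \<delta>(2)[OF l(1,2)] lt l(5) by simp
    then show "dB (F j t) (F i s) = dA (E j t) (E i s)"
      using same[OF l(1) j t t l(3)] same[OF l(1) i l(2) s l(4)] l(5) by simp
  qed
qed

text \<open>The gluing pattern of the intervals determines the intrinsic distance.\<close>
lemma isometric_if_unit_sides:
  assumes A: "Metric_space A dA" "A = {E j t | j t. j < n \<and> t \<in> {0..<1}}" "unit_sides n dA E"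
    and B: "Metric_space B dB" "B = {F j t | j t. j < n \<and> t \<in> {0..<1}}" "unit_sides n dB F"
    and same: "\<And>j i t s. j < n \<Longrightarrow> i < n \<Longrightarrow> t \<in> {0..<1} \<Longrightarrow> s \<in> {0..<1} \<Longrightarrow> E j t = E i s \<longleftrightarrow> F j t = F i s"
  shows "isometric A (intrinsic_dist A dA) B (intrinsic_dist B dB)"
proof -
  define f where "f a = (SOME b. \<exists>j<n. \<exists>t\<in>{0..<1}. a = E j t \<and> b = F j t)" for a
  have f: "f (E j t) = F j t" if "j < n" "t \<in> {0..<1}" for j t
  proof -
    have "\<exists>b. \<exists>i<n. \<exists>s\<in>{0..<1}. E j t = E i s \<and> b = F i s" using that by blast
    then have "\<exists>i<n. \<exists>s\<in>{0..<1}. E j t = E i s \<and> f (E j t) = F i s" unfolding f_def by (rule someI_ex)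
    then show ?thesis using same that by metis
  qed
  show ?thesis
  proof (rule isometric_intrinsic_if_locally_isometric[OF A(1) B(1)])
    show "bij_betw f A B"
    proof (rule bij_betw_imageI)
      show "inj_on f A" unfolding A(2)
      proof (rule inj_onI)
        fix a b assume "a \<in> {E j t | j t. j < n \<and> t \<in> {0..<1}}" "b \<in> {E j t | j t. j < n \<and> t \<in> {0..<1}}" and eq: "f a = f b"
        then obtain j t i s where *: "j < n" "t \<in> {0..<1}" "a = E j t" "i < n" "s \<in> {0..<1}" "b = E i s" by blast
        then show "a = b" using same[of j i t s] f[of j t] f[of i s] eq by simp
      qed
      show "f ` A = B"
      proof (intro equalityI subsetI)
        fix b assume "b \<in> f ` A"
        then obtain j t where "j < n" "t \<in> {0..<1}" "b = f (E j t)" unfolding A(2) by blast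
        then show "b \<in> B" unfolding B(2) using f by blast
      next
        fix b assume "b \<in> B"
        then obtain j t where *: "j < n" "t \<in> {0..<1}" "b = F j t" unfolding B(2) by blast
        then have "b = f (E j t)" using f by simp
        moreover have "E j t \<in> A" unfolding A(2) using * by blast
        ultimately show "b \<in> f ` A" by blast
      qed
    qed
    fix a assume "a \<in> A"
    then obtain j t where a: "j < n" "t \<in> {0..<1}" "a = E j t" unfolding A(2) by blast
    obtain \<epsilon> where \<epsilon>: "\<epsilon> > 0"
      "\<And>i s. i < n \<Longrightarrow> s \<in> {0..<1} \<Longrightarrow> dA (E j t) (E i s) < \<epsilon> \<Longrightarrow> dB (F j t) (F i s) = dA (E j t) (E i s)"
      by (rule unit_sides_transfer[OF A(3) B(3) _ a(1,2)]) (simp_all add: same)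
    obtain \<delta> where \<delta>: "\<delta> > 0"
      "\<And>i s. i < n \<Longrightarrow> s \<in> {0..<1} \<Longrightarrow> dB (F j t) (F i s) < \<delta> \<Longrightarrow> dA (E j t) (E i s) = dB (F j t) (F i s)"
      by (rule unit_sides_transfer[OF B(3) A(3) _ a(1,2)]) (simp_all add: same)
    show "\<exists>\<epsilon>>0. \<forall>b\<in>A. dA a b < \<epsilon> \<or> dB (f a) (f b) < \<epsilon> \<longrightarrow> dB (f a) (f b) = dA a b"
    proof (intro exI[of _ "min \<epsilon> \<delta>"] conjI ballI impI)
      show "min \<epsilon> \<delta> > 0" using \<epsilon>(1) \<delta>(1) by simp
      fix b assume "b \<in> A" and lt: "dA a b < min \<epsilon> \<delta> \<or> dB (f a) (f b) < min \<epsilon> \<delta>"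
      then obtain i s where b: "i < n" "s \<in> {0..<1}" "b = E i s" unfolding A(2) by blast
      show "dB (f a) (f b) = dA a b"
        using lt \<epsilon>(2)[OF b(1,2)] \<delta>(2)[OF b(1,2)] f[OF a(1,2)] f[OF b(1,2)] unfolding a(3) b(3) by auto
    qed
  qed
qed

section \<open>The sides of the polygon\<close>

lemma tanh_artanh_real:
  assumes "\<bar>y\<bar> < 1"
  shows "tanh (artanh y) = (y::real)"
proof -
  let ?x = "tanh (artanh y)"
  have "\<bar>?x\<bar> < 1" using tanh_real_bounds[of "artanh y"] by (simp add: abs_less_iff)
  from artanh_less_iff[OF this assms] artanh_less_iff[OF assms this] show ?thesis
    unfolding artanh_tanh_real by simp
qed

text \<open>The hyperbolic distance of this real number from 0 is proportional to \<open>t\<close>.\<close>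
definition side_param :: "real \<Rightarrow> real" where
  "side_param t = tanh (t * (side_length / 2))"

lemma side_param_ends: "side_param 0 = 0" "side_param 1 = side"
proof -
  show "side_param 0 = 0" by (simp add: side_param_def)
  have "side_param 1 = tanh (artanh side)" using side_pos by (simp add: side_param_def side_length_def hyp_norm_def)
  then show "side_param 1 = side" using tanh_artanh_real[of side] side_pos side_less_1 by simp
qed

lemma side_param_less_iff: "side_param s < side_param t \<longleftrightarrow> s < t"
  using side_length_pos by (simp add: side_param_def)

lemma side_param_bounds:
  assumes "t \<in> {0..<1}"
  shows "0 \<le> side_param t" "side_param t < side" "0 < side_param t \<longleftrightarrow> 0 < t"
  using assms side_param_less_iff[of t 0] side_param_less_iff[of t 1] side_param_less_iff[of 0 t]
  unfolding side_param_ends by auto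

lemma side_param_eq_iff: "side_param s = side_param t \<longleftrightarrow> s = t"
  using side_param_less_iff by (metis less_irrefl linorder_less_linear)

lemma side_param_surj:
  assumes "0 \<le> y" "y < side"
  obtains t where "t \<in> {0..<1}" "y = side_param t"
proof -
  define t where "t = 2 * artanh y / side_length"
  have y: "side_param t = y"
    using tanh_artanh_real[of y] assms side_less_1 side_length_pos by (simp add: side_param_def t_def)
  have "t \<in> {0..<1}" using side_param_less_iff[of t 0] side_param_less_iff[of t 1] y assms unfolding side_param_ends by auto
  then show ?thesis using that y by blast
qed

lemma tanh_diff_real: "tanh (x - y) = (tanh x - tanh y) / (1 - tanh x * tanh (y::real))"
  using tanh_add[of x "- y"] by simp

lemma flip_side_param: "flip_real (side_param t) = side_param (1 - t)"
proof -
  have "side_param (1 - t) = tanh (1 * (side_length / 2) - t * (side_length / 2))"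
    unfolding side_param_def left_diff_distrib ..
  also have "\<dots> = (side_param 1 - side_param t) / (1 - side_param 1 * side_param t)"
    unfolding tanh_diff_real side_param_def ..
  finally show ?thesis unfolding side_param_ends flip_real_def ..
qed

lemma hyp_dist_side_param:
  "hyp_dist (of_real (side_param s)) (of_real (side_param t)) = \<bar>s - t\<bar> * side_length"
proof -
  have "half_turn (of_real (side_param s)) (of_real (side_param t)) =
      of_real ((side_param s - side_param t) / (1 - side_param s * side_param t))"
    by (simp add: half_turn_def)
  also have "(side_param s - side_param t) / (1 - side_param s * side_param t) = tanh ((s - t) * (side_length / 2))"
    unfolding side_param_def tanh_diff_real[symmetric] left_diff_distrib ..
  finally have "hyp_dist (of_real (side_param s)) (of_real (side_param t)) = 2 * artanh \<bar>tanh ((s - t) * (side_length / 2))\<bar>"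
    by (simp only: hyp_dist_def hyp_norm_def norm_of_real)
  also have "\<dots> = 2 * \<bar>(s - t) * (side_length / 2)\<bar>"
    unfolding tanh_real_abs[symmetric] artanh_tanh_real ..
  finally show ?thesis using side_length_pos by (simp add: abs_mult)
qed

text \<open>Side \<open>j\<close> of the polygon, parametrized proportionally to arc length. The other
  end of each side is left out, since it is the start of the next one.\<close>
definition locus_point :: "nat \<Rightarrow> real \<Rightarrow> complex" where
  "locus_point j t = glue (rot30 ^ j * edge_point (side_param t))"

lemma cut_locus_points:
  "glue ` (polygon - polygon_interior) = {locus_point j t | j t. j < 30 \<and> t \<in> {0..<1}}"
proof (intro equalityI subsetI)
  fix p assume "p \<in> glue ` (polygon - polygon_interior)"
  then obtain z where z: "z \<in> polygon - polygon_interior" "p = glue z" by blast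
  obtain j y where jy: "j < 30" "0 \<le> y" "y < side" "z = rot30 ^ j * edge_point y" using boundary_edge_point[OF z(1)] .
  obtain t where "t \<in> {0..<1}" "y = side_param t" using side_param_surj[OF jy(2,3)] .
  then have "p = locus_point j t" using jy(4) z(2) by (simp add: locus_point_def)
  then show "p \<in> {locus_point j t | j t. j < 30 \<and> t \<in> {0..<1}}" using jy(1) \<open>t \<in> {0..<1}\<close> by blast
next
  fix p assume "p \<in> {locus_point j t | j t. j < 30 \<and> t \<in> {0..<1}}"
  then obtain j t where "t \<in> {0..<1}" "p = locus_point j t" by blast
  then show "p \<in> glue ` (polygon - polygon_interior)"
    using edge_point_boundary[of "side_param t" j] side_param_bounds[of t] unfolding locus_point_def by auto
qed

text \<open>The gluing pattern that the sides of the polygon and the edges of the graph have in common: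
  each edge is met twice, in both directions, and each vertex three times.\<close>
definition same_point :: "nat \<Rightarrow> real \<Rightarrow> nat \<Rightarrow> real \<Rightarrow> bool" where
  "same_point j t i s \<longleftrightarrow>
     (t = 0 \<and> s = 0 \<and> corner_vertex j = corner_vertex i) \<or>
     (0 < t \<and> 0 < s \<and> (j = i \<and> t = s \<or> i = opposite_side j \<and> s = 1 - t))"

lemma locus_point_eq_iff:
  assumes "j < 30" "i < 30" "t \<in> {0..<1}" "s \<in> {0..<1}"
  shows "locus_point j t = locus_point i s \<longleftrightarrow> same_point j t i s"
  unfolding locus_point_def same_point_def
    glue_edge_eq_iff[OF assms(1,2) side_param_bounds(1,2)[OF assms(3)] side_param_bounds(1,2)[OF assms(4)]]
    flip_side_param side_param_eq_iff side_param_bounds(3)[OF assms(3)] side_param_bounds(3)[OF assms(4)]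
  using side_param_eq_iff[of t 0] side_param_eq_iff[of s 0] unfolding side_param_ends by simp

text \<open>The two inequalities describe the open sector of 120 degrees around one of the three rays,
  which contains neither of the others.\<close>
lemma rays_separated:
  assumes "k < 3" "k' < 3" and Im: "Im (cnj rot3 * (cnj rot3 ^ k * x)) < 0" "0 < Im (rot3 * (cnj rot3 ^ k * x))"
    and x: "x = rot3 ^ k' * of_real y"
  shows "k' = k"
proof (rule ccontr)
  assume "k' \<noteq> k"
  moreover have "k = 0 \<or> k = 1 \<or> k = 2" "k' = 0 \<or> k' = 1 \<or> k' = 2" using assms(1,2) by linarith+
  ultimately have "Suc k mod 3 = k' \<or> Suc (Suc k) mod 3 = k'" by auto
  then show False
  proof
    assume "Suc k mod 3 = k'"
    then have "cnj rot3 * cnj rot3 ^ k = cnj rot3 ^ k'" using cnj_rot3_pow_mod[of "Suc k"] by simp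
    then have "cnj rot3 * (cnj rot3 ^ k * x) = of_real y"
      unfolding x mult.assoc[symmetric, of "cnj rot3"] by (simp only: rot3_pow_cancel)
    then show False using Im(1) by simp
  next
    assume "Suc (Suc k) mod 3 = k'"
    then have "rot3 * cnj rot3 ^ k = cnj rot3 ^ k'"
      using cnj_rot3_pow_mod[of "Suc (Suc k)"] rot3_eq_cnj by (simp add: mult.assoc[symmetric])
    then have "rot3 * (cnj rot3 ^ k * x) = of_real y"
      unfolding x mult.assoc[symmetric, of "rot3"] by (simp only: rot3_pow_cancel)
    then show False using Im(2) by simp
  qed
qed

text \<open>Near a boundary point of the polygon the surface is the star of a vertex, where the cut
  locus consists of three rays from the origin. The ray through the point is unique unless the point is
  the vertex; then all three rays qualify.\<close>
lemma unit_sides_locus: "unit_sides 30 surface_dist locus_point"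
  unfolding unit_sides_def
proof (intro allI impI ballI)
  fix j t assume j: "j < (30::nat)" and t: "t \<in> {0..<1::real}"
  let ?v = "corner_vertex j" and ?k = "corner_slot j"
  let ?z = "rot30 ^ j * edge_point (side_param t)"
  let ?w = "rot3 ^ ?k * complex_of_real (side_param t)"
  note sb = side_param_bounds[OF t]
  have v: "?v < 10" and k: "?k < 3" using corner_range j by blast+
  have zb: "?z \<in> polygon - polygon_interior" using edge_point_boundary sb by simp
  obtain j' y \<epsilon> where b: "j' < 30" "0 \<le> y" "y < side" "?z = rot30 ^ j' * edge_point y" "\<epsilon> > 0"
    "glue ?z = vertex_map (corner_vertex j') (rot3 ^ corner_slot j' * of_real y)"
    "\<And>w. w \<in> disc \<Longrightarrow> hyp_dist (rot3 ^ corner_slot j' * of_real y) w < \<epsilon> \<Longrightarrow> w \<in> vertex_nbhd \<and>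
       surface_dist (glue ?z) (vertex_map (corner_vertex j') w) = hyp_dist (rot3 ^ corner_slot j' * of_real y) w / side_length"
    "\<And>q. surface_dist (glue ?z) q < \<epsilon> / side_length \<Longrightarrow>
       \<exists>w\<in>disc. hyp_dist (rot3 ^ corner_slot j' * of_real y) w < \<epsilon> \<and> q = vertex_map (corner_vertex j') w"
    by (rule boundary_chart[OF zb]) (rule that)
  have "j = j' \<and> side_param t = y" using edge_point_inj[OF sb(1,2) b(2,3) j b(1,4)] .
  then have jy: "j' = j" "y = side_param t" by simp_all
  have near: "w \<in> vertex_nbhd" "surface_dist (locus_point j t) (vertex_map ?v w) = hyp_dist ?w w / side_length"
    if "w \<in> disc" "hyp_dist ?w w < \<epsilon>" for w
    using b(7)[OF that(1)] that(2) unfolding jy locus_point_def by simp_all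
  have cover: "\<exists>w\<in>disc. hyp_dist ?w w < \<epsilon> \<and> q = vertex_map ?v w" if "surface_dist (locus_point j t) q < \<epsilon> / side_length" for q
    using b(8)[of q] that unfolding jy locus_point_def by simp
  have on_ray: "hyp_dist (rot3 ^ l * of_real (side_param t)) (rot3 ^ l * of_real (side_param s)) = \<bar>t - s\<bar> * side_length" for l s
    by (simp add: hyp_dist_rotation hyp_dist_side_param)
  have ray_disc: "rot3 ^ l * of_real (side_param s) \<in> disc" if "s \<in> {0..<1}" for l s
    using side_param_bounds[OF that] side_less_1 by (simp add: norm_mult)
  \<comment> \<open>Close to an inner point of a side the other two sides at its initial vertex are excluded.\<close>
  obtain \<delta> where \<delta>: "\<delta> > 0" "\<And>x l y'. x \<in> disc \<Longrightarrow> hyp_dist ?w x < \<delta> \<Longrightarrow> x = rot3 ^ l * of_real y' \<Longrightarrow> l < 3 \<Longrightarrow> t = 0 \<or> l = ?k"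
  proof (cases "t = 0")
    case True
    then show ?thesis using that[of 1] by simp
  next
    case False
    let ?U = "{x. Im (cnj rot3 * (cnj rot3 ^ ?k * x)) < 0 \<and> 0 < Im (rot3 * (cnj rot3 ^ ?k * x))}"
    have U: "open ?U" by (intro open_Collect_conj open_Collect_less continuous_intros)
    have wU: "?w \<in> ?U" unfolding mem_Collect_eq rot3_pow_cancel Im_rot3_real using sb(3) False t by simp
    obtain \<delta> where \<delta>: "\<delta> > 0" "{x \<in> disc. hyp_dist ?w x \<le> \<delta>} \<subseteq> ?U"
      by (rule hyp_ball_in_open[OF ray_disc[OF t] U wU]) (rule that)
    show ?thesis
    proof (rule that[OF \<delta>(1)])
      fix x l y' assume x: "x \<in> disc" "hyp_dist ?w x < \<delta>" "x = rot3 ^ l * complex_of_real y'" "l < 3"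
      then have "x \<in> {x \<in> disc. hyp_dist ?w x \<le> \<delta>}" by (simp only: mem_Collect_eq less_imp_le simp_thms)
      then have "x \<in> ?U" by (rule subsetD[OF \<delta>(2)])
      then show "t = 0 \<or> l = ?k" using rays_separated[OF k x(4) _ _ x(3)] unfolding mem_Collect_eq by blast
    qed
  qed
  define e where "e = min \<epsilon> \<delta> / side_length"
  have e: "e > 0" using b(5) \<delta>(1) side_length_pos by (simp add: e_def)
  have e_less: "x / side_length < e \<longleftrightarrow> x < \<epsilon> \<and> x < \<delta>" for x using side_length_pos by (simp add: e_def divide_less_cancel)
  show "\<exists>\<epsilon>>0. (\<forall>s\<in>{0..<1}. \<bar>t - s\<bar> < \<epsilon> \<longrightarrow> surface_dist (locus_point j t) (locus_point j s) = \<bar>t - s\<bar>) \<and>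
      (\<forall>i<30. \<forall>s\<in>{0..<1}. surface_dist (locus_point j t) (locus_point i s) < \<epsilon> \<longrightarrow>
         (\<exists>l<30. \<exists>r\<in>{0..<1}. locus_point l t = locus_point j t \<and> locus_point l r = locus_point i s \<and>
            surface_dist (locus_point j t) (locus_point i s) = \<bar>t - r\<bar>))"
  proof (intro exI[of _ e] conjI ballI allI impI e)
    fix s assume s: "s \<in> {0..<1::real}" and lt: "\<bar>t - s\<bar> < e"
    have "\<bar>t - s\<bar> * side_length / side_length < e" using lt side_length_pos by simp
    then have "hyp_dist ?w (rot3 ^ ?k * of_real (side_param s)) < \<epsilon>" unfolding on_ray e_less by blast
    from near(2)[OF ray_disc[OF s] this] show "surface_dist (locus_point j t) (locus_point j s) = \<bar>t - s\<bar>"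
      unfolding on_ray using glue_boundary_vertex_map[OF j side_param_bounds(1,2)[OF s]] side_length_pos
      by (simp add: locus_point_def)
  next
    fix i s assume i: "i < (30::nat)" and s: "s \<in> {0..<1::real}" and lt: "surface_dist (locus_point j t) (locus_point i s) < e"
    have "e \<le> \<epsilon> / side_length" using side_length_pos by (simp add: e_def divide_right_mono)
    then obtain x where x: "x \<in> disc" "hyp_dist ?w x < \<epsilon>" "locus_point i s = vertex_map ?v x"
      using cover[of "locus_point i s"] lt by auto
    note nx = near[OF x(1,2)]
    have x\<delta>: "hyp_dist ?w x < \<delta>" using lt unfolding x(3) nx(2) e_less by blast
    show "\<exists>l<30. \<exists>r\<in>{0..<1}. locus_point l t = locus_point j t \<and> locus_point l r = locus_point i s \<and>
            surface_dist (locus_point j t) (locus_point i s) = \<bar>t - r\<bar>"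
      using v nx(1)
    proof (cases rule: vertex_nbhd_cases)
      case (inner l)
      have "rot30 ^ i * edge_point (side_param s) \<in> polygon - polygon_interior"
        using edge_point_boundary side_param_bounds[OF s] by simp
      then have "sector_map ?v l x \<notin> polygon_interior"
        using glue_eq_interior[of "sector_map ?v l x" "rot30 ^ i * edge_point (side_param s)"] inner(4) x(3)
        unfolding locus_point_def by auto
      then show ?thesis using inner(3) by blast
    next
      case (ray l y)
      obtain r where r: "r \<in> {0..<1}" "y = side_param r" using side_param_surj[OF ray(2,3)] .
      have l: "t = 0 \<or> l = ?k" using \<delta>(2)[OF x(1) x\<delta> ray(4,1)] .
      then have w: "?w = rot3 ^ l * of_real (side_param t)" by (auto simp: side_param_ends)
      have c: "corner_at ?v l < 30" using corner_at_range v ray(1) by blast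
      have "vertex_map ?v ?w = locus_point j t"
        using glue_boundary_vertex_map[OF j sb(1,2)] by (simp add: locus_point_def)
      then have 1: "locus_point (corner_at ?v l) t = locus_point j t"
        unfolding w using vertex_map_ray[OF v sb(1,2), of l] ray(1) by (simp add: locus_point_def)
      have 2: "locus_point (corner_at ?v l) r = locus_point i s"
        using ray(5) x(3) r(2) by (simp add: locus_point_def)
      have "hyp_dist ?w x = \<bar>t - r\<bar> * side_length" unfolding w ray(4) r(2) on_ray ..
      then have 3: "surface_dist (locus_point j t) (locus_point i s) = \<bar>t - r\<bar>"
        using nx(2) side_length_pos unfolding x(3) by simp
      show ?thesis using c r(1) 1 2 3 by blast
    qed
  qed
qed

section \<open>The edges of the graph\<close>

definition source :: "nat \<Rightarrow> nat set" where
  "source j = vertex_pair (corner_vertex j)"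

definition target :: "nat \<Rightarrow> nat set" where
  "target j = vertex_pair (corner_vertex (Suc j mod 30))"

definition graph_point :: "nat \<Rightarrow> real \<Rightarrow> nat set \<Rightarrow> real" where
  "graph_point j t u = (if u = source j then 1 - t else if u = target j then t else 0)"

lemma vertex_pair_eq_iff: "v < 10 \<Longrightarrow> w < 10 \<Longrightarrow> vertex_pair v = vertex_pair w \<longleftrightarrow> v = w"
  using vertex_pair_inj by (auto simp: inj_on_def)

lemma source_target:
  assumes "j < 30"
  shows "source j \<in> petersen_vertices" "target j \<in> petersen_vertices" "source j \<noteq> target j"
    "source (opposite_side j) = target j" "target (opposite_side j) = source j"
    "opposite_side j < 30"
proof -
  have s: "Suc j mod 30 < 30" by simp
  have r: "corner_vertex j < 10" "corner_vertex (Suc j mod 30) < 10" "opposite_side j < 30" using corner_range assms s by blast+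
  show "source j \<in> petersen_vertices" "target j \<in> petersen_vertices" unfolding source_def target_def petersen_vertices_eq using r by auto
  show "source j \<noteq> target j" unfolding source_def target_def using vertex_pair_eq_iff r corner_vertex_neq assms by metis
  show "source (opposite_side j) = target j" "target (opposite_side j) = source j" unfolding source_def target_def
    using opposite_ends assms by metis+
  show "opposite_side j < 30" by fact
qed

lemma side_determined:
  assumes "j < 30" "i < 30" "source i = source j" "target i = target j"
  shows "i = j"
proof -
  have "Suc j mod 30 < 30" "Suc i mod 30 < 30" by simp_all
  then have "corner_vertex j < 10" "corner_vertex (Suc j mod 30) < 10" "corner_vertex i < 10" "corner_vertex (Suc i mod 30) < 10"
    using corner_range assms(1,2) by blast+
  then have "corner_vertex i = corner_vertex j" "corner_vertex (Suc i mod 30) = corner_vertex (Suc j mod 30)"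
    using assms(3,4) vertex_pair_eq_iff unfolding source_def target_def by blast+
  then show ?thesis using side_unique assms(1,2) by blast
qed

lemma finite_petersen_vertices: "finite petersen_vertices"
  unfolding petersen_vertices_eq by simp

lemma graph_point_opposite:
  assumes "j < 30"
  shows "graph_point (opposite_side j) (1 - t) = graph_point j t"
  using source_target[OF assms] by (auto simp: graph_point_def fun_eq_iff)

lemma graph_point_0: "j < 30 \<Longrightarrow> graph_point j 0 = (\<lambda>u. if u = source j then 1 else 0)"
  by (auto simp: graph_point_def fun_eq_iff)

text \<open>An edge is determined by its two ends, so a point with positive coordinates at both ends of
  an edge lies on that edge.\<close>
lemma graph_point_inside:
  assumes j: "j < 30" "i < 30" and s: "s \<in> {0..<1}"
    and pos: "graph_point i s (source j) > 0" "graph_point i s (target j) > 0"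
  shows "0 < s \<and> (i = j \<or> i = opposite_side j)"
proof -
  note st = source_target[OF j(1)] source_target[OF j(2)]
  consider "source i = source j" "target i = target j" "0 < s" | "source i = target j" "target i = source j" "0 < s"
    using pos st(3) s unfolding graph_point_def by (auto split: if_splits)
  then show ?thesis
  proof cases
    case 1
    then show ?thesis using side_determined[OF j] by blast
  next
    case 2
    then show ?thesis using side_determined[OF st(6) j(2)] st(4,5) by simp
  qed
qed

lemma graph_point_eq_iff:
  assumes j: "j < 30" "i < 30" and t: "t \<in> {0..<1}" and s: "s \<in> {0..<1}"
  shows "graph_point j t = graph_point i s \<longleftrightarrow> same_point j t i s"
proof
  note st = source_target[OF j(1)] source_target[OF j(2)]
  have lt: "corner_vertex j < 10" "corner_vertex i < 10" using corner_range j by blast+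
  have ends: "source j = source i \<longleftrightarrow> corner_vertex j = corner_vertex i"
    unfolding source_def by (rule vertex_pair_eq_iff[OF lt])
  {
    assume "same_point j t i s"
    then consider "t = 0" "s = 0" "corner_vertex j = corner_vertex i" | "j = i" "t = s" | "i = opposite_side j" "s = 1 - t"
      unfolding same_point_def by blast
    then show "graph_point j t = graph_point i s"
      by cases (use graph_point_opposite[OF j(1)] graph_point_0 j ends in simp_all)
  }
  assume eq: "graph_point j t = graph_point i s"
  have vals: "graph_point j t (source j) = 1 - t" "graph_point j t (target j) = t"
    "graph_point i s (source i) = 1 - s" "graph_point i s (target i) = s"
    using st by (auto simp: graph_point_def)
  show "same_point j t i s"
  proof (cases "t = 0 \<or> s = 0")
    case True
    have "t = 0 \<and> s = 0 \<and> source j = source i"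
    proof (cases "t = 0")
      case True
      then have "graph_point i s (source j) = 1" using vals(1) eq by simp
      then show ?thesis using s True by (auto simp: graph_point_def split: if_splits)
    next
      case False
      then have "s = 0" using True by blast
      then have "graph_point j t (source i) = 1" using vals(3) eq by simp
      then show ?thesis using t False by (auto simp: graph_point_def split: if_splits)
    qed
    then show ?thesis using ends by (simp add: same_point_def)
  next
    case False
    then have p: "0 < t" "0 < s" using t s by auto
    then have "i = j \<or> i = opposite_side j"
      using graph_point_inside[OF j s] vals t unfolding eq by auto
    then show ?thesis
    proof
      assume "i = j"
      then show ?thesis using p eq vals by (auto simp: same_point_def)
    next
      assume i: "i = opposite_side j"
      then have "s = 1 - t" using vals eq st by simp
      then show ?thesis using p i by (simp add: same_point_def)
    qed
  qed
qed

lemma sum_two_points: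
  assumes "finite V" "a \<in> V" "b \<in> V" "a \<noteq> b" "\<And>v. v \<noteq> a \<Longrightarrow> v \<noteq> b \<Longrightarrow> f v = (0::real)"
  shows "sum f V = f a + f b"
proof -
  have "sum f V = sum f {a, b}"
    using assms by (intro sum.mono_neutral_right) auto
  then show ?thesis using assms(4) by simp
qed

lemma bary_dist_same_side:
  assumes "j < 30"
  shows "bary_dist petersen_vertices (graph_point j t) (graph_point j s) = \<bar>t - s\<bar>"
proof -
  note st = source_target[OF assms]
  have "(\<Sum>v\<in>petersen_vertices. \<bar>graph_point j t v - graph_point j s v\<bar>) =
      \<bar>graph_point j t (source j) - graph_point j s (source j)\<bar> + \<bar>graph_point j t (target j) - graph_point j s (target j)\<bar>"
    by (rule sum_two_points[OF finite_petersen_vertices st(1-3)]) (simp add: graph_point_def)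
  then show ?thesis using st(3) by (simp add: bary_dist_def graph_point_def)
qed

text \<open>The differences of the coordinates add up to zero, so each of them is at most half the sum
  of their absolute values.\<close>
lemma coordinate_le_bary_dist:
  assumes "finite V" "v \<in> V" "(\<Sum>v\<in>V. f v) = (\<Sum>v\<in>V. g v)"
  shows "\<bar>f v - g v\<bar> \<le> bary_dist V f g"
proof -
  have "(\<Sum>u\<in>V. f u - g u) = 0" using assms(3) by (simp add: sum_subtractf)
  then have "f v - g v = - (\<Sum>u\<in>V - {v}. f u - g u)" using sum.remove[OF assms(1,2), of "\<lambda>u. f u - g u"] by simp
  then have "\<bar>f v - g v\<bar> \<le> (\<Sum>u\<in>V - {v}. \<bar>f u - g u\<bar>)" by simp
  moreover have "(\<Sum>u\<in>V. \<bar>f u - g u\<bar>) = \<bar>f v - g v\<bar> + (\<Sum>u\<in>V - {v}. \<bar>f u - g u\<bar>)"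
    by (rule sum.remove[OF assms(1,2)])
  ultimately show ?thesis by (simp add: bary_dist_def)
qed

lemma sum_graph_point: "j < 30 \<Longrightarrow> (\<Sum>v\<in>petersen_vertices. graph_point j t v) = 1"
  using source_target[of j] by (subst sum_two_points[of _ "source j" "target j"]) (auto simp: finite_petersen_vertices graph_point_def)

lemma petersen_graph_points:
  "graph_points petersen_vertices petersen_edges = {graph_point j t | j t. j < 30 \<and> t \<in> {0..<1}}"
proof (intro equalityI subsetI)
  fix f assume "f \<in> {graph_point j t | j t. j < 30 \<and> t \<in> {0..<1}}"
  then obtain j t where jt: "j < 30" "t \<in> {0..<1}" "f = graph_point j t" by blast
  have "{source j, target j} \<in> petersen_edges" unfolding petersen_edges_eq source_def target_def using jt(1) by blast
  moreover have "{v. f v \<noteq> 0} \<subseteq> {source j, target j}" using jt(3) by (auto simp: graph_point_def)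
  moreover have "\<forall>v. f v \<ge> 0" using jt by (auto simp: graph_point_def)
  ultimately show "f \<in> graph_points petersen_vertices petersen_edges"
    unfolding graph_points_def using sum_graph_point[OF jt(1)] jt(3) by auto
next
  fix f assume "f \<in> graph_points petersen_vertices petersen_edges"
  then have f: "\<And>v. f v \<ge> 0" "(\<Sum>v\<in>petersen_vertices. f v) = 1"
    and cases: "(\<exists>v\<in>petersen_vertices. {v. f v \<noteq> 0} = {v}) \<or> (\<exists>e\<in>petersen_edges. {v. f v \<noteq> 0} \<subseteq> e)"
    unfolding graph_points_def by blast+
  have "\<exists>j<30. {v. f v \<noteq> 0} \<subseteq> {source j, target j}"
    using cases
  proof
    assume "\<exists>v\<in>petersen_vertices. {v. f v \<noteq> 0} = {v}"
    then obtain a where a: "a < 10" "{v. f v \<noteq> 0} = {vertex_pair a}" unfolding petersen_vertices_eq by blast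
    have "(0::nat) < 3" by simp
    then have "corner_at a 0 < 30" "source (corner_at a 0) = vertex_pair a"
      using corner_at_range a(1) unfolding source_def by metis+
    then show ?thesis using a(2) by blast
  next
    assume "\<exists>e\<in>petersen_edges. {v. f v \<noteq> 0} \<subseteq> e"
    then show ?thesis unfolding petersen_edges_eq source_def target_def by blast
  qed
  then obtain j where j: "j < 30" "\<And>v. v \<noteq> source j \<Longrightarrow> v \<noteq> target j \<Longrightarrow> f v = 0" by blast
  note st = source_target[OF j(1)]
  have sum: "f (source j) + f (target j) = 1"
    using sum_two_points[OF finite_petersen_vertices st(1-3) j(2)] f(2) by simp
  have fj: "f = graph_point j (f (target j))"
  proof
    fix v show "f v = graph_point j (f (target j)) v"
      using sum j(2)[of v] by (auto simp: graph_point_def)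
  qed
  show "f \<in> {graph_point j t | j t. j < 30 \<and> t \<in> {0..<1}}"
  proof (cases "f (target j) < 1")
    case True
    then show ?thesis using fj j(1) f(1)[of "target j"] by auto
  next
    case False
    then have "f (target j) = 1" using sum f(1)[of "source j"] by simp
    then have "f = graph_point (opposite_side j) 0" using fj graph_point_opposite[OF j(1), of 1] by simp
    moreover have "0 \<in> {0..<1::real}" by simp
    ultimately show ?thesis using st(6) by blast
  qed
qed

text \<open>The bound of closeness keeps the coordinates of a point positive at both ends of its edge,
  or at the vertex.\<close>
lemma unit_sides_graph: "unit_sides 30 (bary_dist petersen_vertices) graph_point"
  unfolding unit_sides_def
proof (intro allI impI ballI)
  fix j t assume j: "j < (30::nat)" and t: "t \<in> {0..<1::real}"
  let ?d = "bary_dist petersen_vertices"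
  note st = source_target[OF j]
  define e where "e = (if t = 0 then 1 else min t (1 - t))"
  have gj: "graph_point j t (source j) = 1 - t" "graph_point j t (target j) = t" using st(3) by (simp_all add: graph_point_def)
  have e: "e > 0" using t by (auto simp: e_def)
  show "\<exists>\<epsilon>>0. (\<forall>s\<in>{0..<1}. \<bar>t - s\<bar> < \<epsilon> \<longrightarrow> ?d (graph_point j t) (graph_point j s) = \<bar>t - s\<bar>) \<and>
      (\<forall>i<30. \<forall>s\<in>{0..<1}. ?d (graph_point j t) (graph_point i s) < \<epsilon> \<longrightarrow>
         (\<exists>l<30. \<exists>r\<in>{0..<1}. graph_point l t = graph_point j t \<and> graph_point l r = graph_point i s \<and>
            ?d (graph_point j t) (graph_point i s) = \<bar>t - r\<bar>))"
  proof (intro exI[of _ e] conjI ballI allI impI e bary_dist_same_side j)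
    fix i s assume i: "i < (30::nat)" and s: "s \<in> {0..<1::real}" and lt: "?d (graph_point j t) (graph_point i s) < e"
    have coord: "\<bar>graph_point j t v - graph_point i s v\<bar> < e" if "v \<in> petersen_vertices" for v
      using coordinate_le_bary_dist[OF finite_petersen_vertices that, of "graph_point j t" "graph_point i s"]
        sum_graph_point j i lt by simp
    have "\<exists>l<30. \<exists>r\<in>{0..<1}. graph_point l t = graph_point j t \<and> graph_point l r = graph_point i s"
    proof (cases "t = 0")
      case True
      have "graph_point i s (source j) > 0"
        using coord[OF st(1)] True by (simp add: graph_point_def e_def)
      then consider "source j = source i" | "source j = target i" "0 < s" by (auto simp: graph_point_def split: if_splits)
      then show ?thesis
      proof cases
        case 1
        then have "graph_point i t = graph_point j t" using True graph_point_0 i j by simp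
        then show ?thesis using i s by blast
      next
        case 2
        note sti = source_target[OF i]
        have "graph_point (opposite_side i) t = graph_point j t" using True graph_point_0 sti j 2 by simp
        moreover have "graph_point (opposite_side i) (1 - s) = graph_point i s" by (rule graph_point_opposite[OF i])
        moreover have "1 - s \<in> {0..<1}" using 2 s by simp
        ultimately show ?thesis using sti(6) by blast
      qed
    next
      case False
      have "graph_point i s (source j) > 0" "graph_point i s (target j) > 0"
        using coord[OF st(1)] coord[OF st(2)] False unfolding gj e_def by auto
      then have i_s: "0 < s" "i = j \<or> i = opposite_side j" using graph_point_inside[OF j i s] by blast+
      show ?thesis
      proof (cases "i = j")
        case True
        then show ?thesis using j s by blast
      next
        case False
        then have "graph_point j (1 - s) = graph_point i s" using i_s graph_point_opposite[OF j, of "1 - s"] by simp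
        moreover have "1 - s \<in> {0..<1}" using i_s s by simp
        ultimately show ?thesis using j by blast
      qed
    qed
    then obtain l r where l: "l < 30" "r \<in> {0..<1}" "graph_point l t = graph_point j t" "graph_point l r = graph_point i s" by blast
    then have "?d (graph_point j t) (graph_point i s) = \<bar>t - r\<bar>" using bary_dist_same_side[OF l(1), of t r] by simp
    then show "\<exists>l<30. \<exists>r\<in>{0..<1}. graph_point l t = graph_point j t \<and> graph_point l r = graph_point i s \<and>
            ?d (graph_point j t) (graph_point i s) = \<bar>t - r\<bar>" using l by blast
  qed
qed

lemma Metric_space_graph_points:
  assumes V: "finite V" and E: "\<And>e. e \<in> E \<Longrightarrow> e \<subseteq> V"
  shows "Metric_space (graph_points V E) (bary_dist V)"
proof
  show "0 \<le> bary_dist V f g" for f g by (simp add: bary_dist_def sum_nonneg)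
  show "bary_dist V f g = bary_dist V g f" for f g by (simp add: bary_dist_def abs_minus_commute)
  show "bary_dist V f h \<le> bary_dist V f g + bary_dist V g h" for f g h
  proof -
    have "(\<Sum>v\<in>V. \<bar>f v - h v\<bar>) \<le> (\<Sum>v\<in>V. \<bar>f v - g v\<bar> + \<bar>g v - h v\<bar>)" by (intro sum_mono) linarith
    then show ?thesis by (simp add: bary_dist_def sum.distrib)
  qed
  show "bary_dist V f g = 0 \<longleftrightarrow> f = g" if "f \<in> graph_points V E" "g \<in> graph_points V E" for f g
  proof
    have outside: "h v = 0" if "h \<in> graph_points V E" "v \<notin> V" for h v
    proof -
      have "(\<exists>v\<in>V. {u. h u \<noteq> 0} = {v}) \<or> (\<exists>e\<in>E. {u. h u \<noteq> 0} \<subseteq> e)"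
        using that(1) unfolding graph_points_def by simp
      then have "{u. h u \<noteq> 0} \<subseteq> V" using E by (elim disjE bexE) (simp, meson order_trans)
      then show ?thesis using that(2) by blast
    qed
    assume "bary_dist V f g = 0"
    then have "f v = g v" if "v \<in> V" for v using V that by (simp add: bary_dist_def sum_nonneg_eq_0_iff)
    then show "f = g" using outside that by (metis ext)
  qed (simp add: bary_dist_def)
qed

theorem corollary5p8:
  shows "orientably_realizable petersen_vertices petersen_edges"
  unfolding orientably_realizable_def
proof (intro exI conjI)
  show "surface glued.glued_surface" by (rule glued.surface_glued)
  show "orientable glued.glued_surface" by (rule glued.orientable_glued)
  have top: "topspace (topo glued.glued_surface) = UNIV" by (simp add: glued.glued_surface_def)
  let ?C = "glue ` (polygon - polygon_interior)"
  have "isometric ?C (intrinsic_dist ?C surface_dist)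
      (graph_points petersen_vertices petersen_edges) (graph_dist petersen_vertices petersen_edges)"
    unfolding graph_dist_def
  proof (rule isometric_if_unit_sides[OF _ cut_locus_points unit_sides_locus _ petersen_graph_points unit_sides_graph])
    show "Metric_space ?C surface_dist"
      by (rule Metric_space.subspace[OF glued.Metric_space_riem_dist]) simp
    have "e \<subseteq> petersen_vertices" if "e \<in> petersen_edges" for e
      using that unfolding petersen_edges_def by blast
    then show "Metric_space (graph_points petersen_vertices petersen_edges) (bary_dist petersen_vertices)"
      by (rule Metric_space_graph_points[OF finite_petersen_vertices])
  qed (simp add: locus_point_eq_iff graph_point_eq_iff)
  then show "\<exists>x\<in>topspace (topo glued.glued_surface).
      let C = cut_locus (topspace (topo glued.glued_surface)) surface_dist x
      in isometric C (intrinsic_dist C surface_dist) (graph_points petersen_vertices petersen_edges)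
           (graph_dist petersen_vertices petersen_edges)"
    unfolding top Let_def by (intro bexI[of _ "glue 0"]) (simp_all add: cut_locus_of_centre)
qed

end
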